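(* If $\mathsf{ZFC}$ is consistent, then so is $\mathsf{ZFC}+\mathsf{CH}+(B)$, where $(B)$ is the following statement: there exists a sequence $\vec\pi=\langle \pi_\beta:\omega_1\le\beta<\omega_2\rangle$, where each $\pi_\beta:\beta\to\omega_1$ is a bijection, such that for any function $g:\omega_1\to\omega_1$ there exist an injective function $h:\omega_2\to\omega_2$ and a stationary set $I\subseteq S^2_1$ consisting of ordinals closed under $h$ such that for all $\beta\in I$ there exists a countable set $D_\beta\subseteq\beta$ such that: (1) for all $\alpha\in\beta\setminus D_\beta$, $g(\min\{\pi_\beta(\alpha),\pi_\beta(h(\alpha))\})<\max\{\pi_\beta(\alpha),\pi_\beta(h(\alpha))\}$; and (2) for all distinct $\alpha,\gamma\in\beta\setminus D_\beta$, $g(\min\{\pi_\beta(h(\alpha)),\pi_\beta(h(\gamma))\})<\max\{\pi_\beta(h(\alpha)),\pi_\beta(h(\gamma))\}$.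
   Context: $S^2_1=\{\alpha<\omega_2:\mathrm{cf}(\alpha)=\omega_1\}$. Stationary means stationary in $\omega_2$. An ordinal $\beta$ is closed under $h$ if $h(\alpha)<\beta$ for all $\alpha<\beta$. *)

theory Defs
  imports Main
begin

section \<open>First-order logic over the language of set theory\<close>

text \<open>Formulas over \<open>\<in>\<close> and \<open>=\<close>, with variables as de Bruijn indices.  The language has no
  terms other than variables, so lifting and substitution are both instances of renaming.\<close>

datatype fm = Mem nat nat | Eq nat nat | Falsum | Imp fm fm | Univ fm

primrec ren :: "(nat \<Rightarrow> nat) \<Rightarrow> fm \<Rightarrow> fm" where
  "ren r (Mem i j) = Mem (r i) (r j)"
| "ren r (Eq i j) = Eq (r i) (r j)"
| "ren r Falsum = Falsum"
| "ren r (Imp p q) = Imp (ren r p) (ren r q)"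
| "ren r (Univ p) = Univ (ren (case_nat 0 (\<lambda>i. Suc (r i))) p)"

text \<open>All free indices of the formula are less than the given bound.\<close>

primrec below :: "nat \<Rightarrow> fm \<Rightarrow> bool" where
  "below n (Mem i j) \<longleftrightarrow> i < n \<and> j < n"
| "below n (Eq i j) \<longleftrightarrow> i < n \<and> j < n"
| "below n Falsum \<longleftrightarrow> True"
| "below n (Imp p q) \<longleftrightarrow> below n p \<and> below n q"
| "below n (Univ p) \<longleftrightarrow> below (Suc n) p"

definition inst :: "nat \<Rightarrow> fm \<Rightarrow> fm" where
  "inst t p = ren (case_nat t (\<lambda>i. i)) p"

text \<open>Classical natural deduction with equality.  In \<open>UnivI\<close> the hypotheses are lifted, so that
  index 0 is an eigenvariable.\<close>

inductive deriv :: "fm set \<Rightarrow> fm \<Rightarrow> bool"  (infix "\<turnstile>" 50) where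
  Assm: "p \<in> H \<Longrightarrow> H \<turnstile> p"
| ImpI: "insert p H \<turnstile> q \<Longrightarrow> H \<turnstile> Imp p q"
| ImpE: "H \<turnstile> Imp p q \<Longrightarrow> H \<turnstile> p \<Longrightarrow> H \<turnstile> q"
| Class: "insert (Imp p Falsum) H \<turnstile> Falsum \<Longrightarrow> H \<turnstile> p"
| UnivI: "ren Suc ` H \<turnstile> p \<Longrightarrow> H \<turnstile> Univ p"
| UnivE: "H \<turnstile> Univ p \<Longrightarrow> H \<turnstile> inst t p"
| EqRefl: "H \<turnstile> Eq t t"
| EqSubst: "H \<turnstile> Eq s t \<Longrightarrow> H \<turnstile> inst s p \<Longrightarrow> H \<turnstile> inst t p"

definition consistent :: "fm set \<Rightarrow> bool" where
  "consistent T \<longleftrightarrow> \<not> T \<turnstile> Falsum"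


section \<open>Writing formulas with named variables\<close>

text \<open>A formula in context is a function of the number \<open>n\<close> of binders above it.  A variable
  is represented by the number of binders above the one that introduces it (its level), hence
  the variable of level \<open>x\<close> has index \<open>n - Suc x\<close> below \<open>n\<close> binders.  In this form the bound
  variables of the object language can be bound variables of HOL.\<close>

type_synonym var = nat
type_synonym cfm = "nat \<Rightarrow> fm"

definition cMem :: "var \<Rightarrow> var \<Rightarrow> cfm"  (infix "\<^bold>\<in>" 50) where
  "x \<^bold>\<in> y = (\<lambda>n. Mem (n - Suc x) (n - Suc y))"

definition cEq :: "var \<Rightarrow> var \<Rightarrow> cfm"  (infix "\<^bold>=" 50) where
  "x \<^bold>= y = (\<lambda>n. Eq (n - Suc x) (n - Suc y))"

definition cImp :: "cfm \<Rightarrow> cfm \<Rightarrow> cfm"  (infixr "\<^bold>\<longrightarrow>" 25) where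
  "(p \<^bold>\<longrightarrow> q) = (\<lambda>n. Imp (p n) (q n))"

definition cNot :: "cfm \<Rightarrow> cfm"  ("\<^bold>\<not> _" [40] 40) where
  "(\<^bold>\<not> p) = (p \<^bold>\<longrightarrow> (\<lambda>n. Falsum))"

definition cAnd :: "cfm \<Rightarrow> cfm \<Rightarrow> cfm"  (infixr "\<^bold>\<and>" 35) where
  "(p \<^bold>\<and> q) = (\<^bold>\<not> (p \<^bold>\<longrightarrow> \<^bold>\<not> q))"

definition cOr :: "cfm \<Rightarrow> cfm \<Rightarrow> cfm"  (infixr "\<^bold>\<or>" 30) where
  "(p \<^bold>\<or> q) = (\<^bold>\<not> p \<^bold>\<longrightarrow> q)"

definition cIff :: "cfm \<Rightarrow> cfm \<Rightarrow> cfm"  (infixr "\<^bold>\<longleftrightarrow>" 25) where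
  "(p \<^bold>\<longleftrightarrow> q) = ((p \<^bold>\<longrightarrow> q) \<^bold>\<and> (q \<^bold>\<longrightarrow> p))"

definition cAll :: "(var \<Rightarrow> cfm) \<Rightarrow> cfm"  (binder "\<^bold>\<forall>" 10) where
  "cAll P = (\<lambda>n. Univ (P n (Suc n)))"

definition cEx :: "(var \<Rightarrow> cfm) \<Rightarrow> cfm"  (binder "\<^bold>\<exists>" 10) where
  "cEx P = (\<^bold>\<not> (\<^bold>\<forall>x. \<^bold>\<not> P x))"

definition cBall :: "var \<Rightarrow> (var \<Rightarrow> cfm) \<Rightarrow> cfm" where
  "cBall a P = (\<^bold>\<forall>x. x \<^bold>\<in> a \<^bold>\<longrightarrow> P x)"

definition cBex :: "var \<Rightarrow> (var \<Rightarrow> cfm) \<Rightarrow> cfm" where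
  "cBex a P = (\<^bold>\<exists>x. x \<^bold>\<in> a \<^bold>\<and> P x)"

syntax
  "_cBall" :: "pttrn \<Rightarrow> var \<Rightarrow> cfm \<Rightarrow> cfm"  ("(3\<^bold>\<forall>_\<^bold>\<in>_./ _)" [0, 0, 10] 10)
  "_cBex" :: "pttrn \<Rightarrow> var \<Rightarrow> cfm \<Rightarrow> cfm"  ("(3\<^bold>\<exists>_\<^bold>\<in>_./ _)" [0, 0, 10] 10)
translations
  "\<^bold>\<forall>x\<^bold>\<in>a. p" \<rightleftharpoons> "CONST cBall a (\<lambda>x. p)"
  "\<^bold>\<exists>x\<^bold>\<in>a. p" \<rightleftharpoons> "CONST cBex a (\<lambda>x. p)"

definition sentence :: "cfm \<Rightarrow> fm" where
  "sentence p = p 0"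

text \<open>For the axiom schemata: universal quantification over parameters, which receive the levels
  \<open>0, \<dots>, k - 1\<close> when the context is empty; and a given formula with its free index \<open>i\<close> interpreted
  as the variable \<open>r i\<close>.\<close>

definition params :: "nat \<Rightarrow> cfm \<Rightarrow> cfm" where
  "params k p = (\<lambda>n. (Univ ^^ k) (p (n + k)))"

definition fm_at :: "fm \<Rightarrow> (nat \<Rightarrow> var) \<Rightarrow> cfm" where
  "fm_at p r = (\<lambda>n. ren (\<lambda>i. n - Suc (r i)) p)"


section \<open>Basic set-theoretic notions\<close>

definition is_empty :: "var \<Rightarrow> cfm" where
  "is_empty x = (\<^bold>\<forall>u. \<^bold>\<not> u \<^bold>\<in> x)"

definition subset :: "var \<Rightarrow> var \<Rightarrow> cfm"  (infix "\<^bold>\<subseteq>" 50) where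
  "x \<^bold>\<subseteq> y = (\<^bold>\<forall>u\<^bold>\<in>x. u \<^bold>\<in> y)"

definition is_upair :: "var \<Rightarrow> var \<Rightarrow> var \<Rightarrow> cfm" where
  "is_upair p x y = (\<^bold>\<forall>u. u \<^bold>\<in> p \<^bold>\<longleftrightarrow> u \<^bold>= x \<^bold>\<or> u \<^bold>= y)"

definition is_pair :: "var \<Rightarrow> var \<Rightarrow> var \<Rightarrow> cfm" where
  "is_pair p x y = (\<^bold>\<exists>a. \<^bold>\<exists>b. is_upair a x x \<^bold>\<and> is_upair b x y \<^bold>\<and> is_upair p a b)"

definition is_succ :: "var \<Rightarrow> var \<Rightarrow> cfm" where
  "is_succ y x = (\<^bold>\<forall>u. u \<^bold>\<in> y \<^bold>\<longleftrightarrow> u \<^bold>\<in> x \<^bold>\<or> u \<^bold>= x)"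

definition is_power :: "var \<Rightarrow> var \<Rightarrow> cfm" where
  "is_power y x = (\<^bold>\<forall>u. u \<^bold>\<in> y \<^bold>\<longleftrightarrow> u \<^bold>\<subseteq> x)"

definition is_diff :: "var \<Rightarrow> var \<Rightarrow> var \<Rightarrow> cfm" where
  "is_diff z x y = (\<^bold>\<forall>u. u \<^bold>\<in> z \<^bold>\<longleftrightarrow> u \<^bold>\<in> x \<^bold>\<and> \<^bold>\<not> u \<^bold>\<in> y)"

text \<open>\<open>maps f x y\<close> says \<open>(x, y) \<in> f\<close>, that is \<open>f(x) = y\<close> when \<open>f\<close> is a function with \<open>x\<close> in its
  domain.\<close>

definition maps :: "var \<Rightarrow> var \<Rightarrow> var \<Rightarrow> cfm" where
  "maps f x y = (\<^bold>\<exists>p\<^bold>\<in>f. is_pair p x y)"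

definition fun_on :: "var \<Rightarrow> var \<Rightarrow> cfm" where
  "fun_on f a = ((\<^bold>\<forall>p\<^bold>\<in>f. \<^bold>\<exists>x\<^bold>\<in>a. \<^bold>\<exists>y. is_pair p x y) \<^bold>\<and>
     (\<^bold>\<forall>x\<^bold>\<in>a. \<^bold>\<exists>y. maps f x y \<^bold>\<and> (\<^bold>\<forall>z. maps f x z \<^bold>\<longrightarrow> z \<^bold>= y)))"

definition fun_to :: "var \<Rightarrow> var \<Rightarrow> var \<Rightarrow> cfm" where
  "fun_to f a b = (fun_on f a \<^bold>\<and> (\<^bold>\<forall>x\<^bold>\<in>a. \<^bold>\<exists>y\<^bold>\<in>b. maps f x y))"

definition injection :: "var \<Rightarrow> var \<Rightarrow> var \<Rightarrow> cfm" where
  "injection f a b = (fun_to f a b \<^bold>\<and>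
     (\<^bold>\<forall>x\<^bold>\<in>a. \<^bold>\<forall>z\<^bold>\<in>a. \<^bold>\<forall>y. maps f x y \<^bold>\<and> maps f z y \<^bold>\<longrightarrow> x \<^bold>= z))"

definition bijection :: "var \<Rightarrow> var \<Rightarrow> var \<Rightarrow> cfm" where
  "bijection f a b = (injection f a b \<^bold>\<and> (\<^bold>\<forall>y\<^bold>\<in>b. \<^bold>\<exists>x\<^bold>\<in>a. maps f x y))"


section \<open>The axioms of ZFC\<close>

definition extensionality :: fm where
  "extensionality = sentence (\<^bold>\<forall>x. \<^bold>\<forall>y. (\<^bold>\<forall>u. u \<^bold>\<in> x \<^bold>\<longleftrightarrow> u \<^bold>\<in> y) \<^bold>\<longrightarrow> x \<^bold>= y)"

definition foundation :: fm where
  "foundation = sentence (\<^bold>\<forall>x. \<^bold>\<not> is_empty x \<^bold>\<longrightarrow> (\<^bold>\<exists>y\<^bold>\<in>x. \<^bold>\<forall>z\<^bold>\<in>x. \<^bold>\<not> z \<^bold>\<in> y))"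

definition pairing :: fm where
  "pairing = sentence (\<^bold>\<forall>x. \<^bold>\<forall>y. \<^bold>\<exists>p. is_upair p x y)"

definition union :: fm where
  "union = sentence (\<^bold>\<forall>x. \<^bold>\<exists>y. \<^bold>\<forall>u. u \<^bold>\<in> y \<^bold>\<longleftrightarrow> (\<^bold>\<exists>z\<^bold>\<in>x. u \<^bold>\<in> z))"

definition power_set :: fm where
  "power_set = sentence (\<^bold>\<forall>x. \<^bold>\<exists>y. is_power y x)"

definition infinity :: fm where
  "infinity = sentence (\<^bold>\<exists>s. (\<^bold>\<exists>x\<^bold>\<in>s. is_empty x) \<^bold>\<and> (\<^bold>\<forall>x\<^bold>\<in>s. \<^bold>\<exists>y\<^bold>\<in>s. is_succ y x))"

text \<open>In \<open>p\<close>, index 0 stands for the element \<open>u\<close> and the indices \<open>1, \<dots>, k\<close> for the parameters.\<close>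

definition separation :: "nat \<Rightarrow> fm \<Rightarrow> fm" where
  "separation k p = sentence (params k
     (\<^bold>\<forall>x. \<^bold>\<exists>y. \<^bold>\<forall>u. u \<^bold>\<in> y \<^bold>\<longleftrightarrow> u \<^bold>\<in> x \<^bold>\<and> fm_at p (case_nat u (\<lambda>i. i))))"

text \<open>In \<open>p\<close>, index 0 stands for the argument \<open>u\<close>, index 1 for the value \<open>v\<close>, and the indices
  \<open>2, \<dots>, k + 1\<close> for the parameters.\<close>

definition replacement :: "nat \<Rightarrow> fm \<Rightarrow> fm" where
  "replacement k p = sentence (params k
     (let P = (\<lambda>u v. fm_at p (case_nat u (case_nat v (\<lambda>i. i)))) in
       (\<^bold>\<forall>u. \<^bold>\<forall>v. \<^bold>\<forall>w. P u v \<^bold>\<and> P u w \<^bold>\<longrightarrow> v \<^bold>= w) \<^bold>\<longrightarrow>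
       (\<^bold>\<forall>x. \<^bold>\<exists>y. \<^bold>\<forall>v. v \<^bold>\<in> y \<^bold>\<longleftrightarrow> (\<^bold>\<exists>u\<^bold>\<in>x. P u v))))"

definition choice :: fm where
  "choice = sentence (\<^bold>\<forall>x. (\<^bold>\<forall>u\<^bold>\<in>x. \<^bold>\<not> is_empty u) \<^bold>\<longrightarrow>
     (\<^bold>\<exists>f. fun_on f x \<^bold>\<and> (\<^bold>\<forall>u\<^bold>\<in>x. \<^bold>\<exists>v\<^bold>\<in>u. maps f u v)))"

definition ZFC :: "fm set" where
  "ZFC = {extensionality, foundation, pairing, union, power_set, infinity, choice}
     \<union> {separation k p | k p. below (k + 1) p}
     \<union> {replacement k p | k p. below (k + 2) p}"


section \<open>Ordinals, cardinals and stationary sets\<close>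

definition is_transitive :: "var \<Rightarrow> cfm" where
  "is_transitive x = (\<^bold>\<forall>y\<^bold>\<in>x. y \<^bold>\<subseteq> x)"

text \<open>\<open>\<in>\<close> is a strict well-order of \<open>x\<close>.\<close>

definition mem_wellorders :: "var \<Rightarrow> cfm" where
  "mem_wellorders x =
     ((\<^bold>\<forall>a\<^bold>\<in>x. \<^bold>\<not> a \<^bold>\<in> a) \<^bold>\<and>
      (\<^bold>\<forall>a\<^bold>\<in>x. \<^bold>\<forall>b\<^bold>\<in>x. \<^bold>\<forall>c\<^bold>\<in>x. a \<^bold>\<in> b \<^bold>\<and> b \<^bold>\<in> c \<^bold>\<longrightarrow> a \<^bold>\<in> c) \<^bold>\<and>
      (\<^bold>\<forall>a\<^bold>\<in>x. \<^bold>\<forall>b\<^bold>\<in>x. a \<^bold>\<in> b \<^bold>\<or> a \<^bold>= b \<^bold>\<or> b \<^bold>\<in> a) \<^bold>\<and>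
      (\<^bold>\<forall>s. s \<^bold>\<subseteq> x \<^bold>\<and> \<^bold>\<not> is_empty s \<^bold>\<longrightarrow> (\<^bold>\<exists>a\<^bold>\<in>s. \<^bold>\<forall>b\<^bold>\<in>s. a \<^bold>= b \<^bold>\<or> a \<^bold>\<in> b)))"

definition ordinal :: "var \<Rightarrow> cfm" where
  "ordinal x = (is_transitive x \<^bold>\<and> mem_wellorders x)"

definition ord_le :: "var \<Rightarrow> var \<Rightarrow> cfm"  (infix "\<^bold>\<le>" 50) where
  "x \<^bold>\<le> y = (x \<^bold>\<in> y \<^bold>\<or> x \<^bold>= y)"

definition is_min :: "var \<Rightarrow> var \<Rightarrow> var \<Rightarrow> cfm" where
  "is_min m x y = ((m \<^bold>= x \<^bold>\<or> m \<^bold>= y) \<^bold>\<and> m \<^bold>\<le> x \<^bold>\<and> m \<^bold>\<le> y)"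

definition is_max :: "var \<Rightarrow> var \<Rightarrow> var \<Rightarrow> cfm" where
  "is_max m x y = ((m \<^bold>= x \<^bold>\<or> m \<^bold>= y) \<^bold>\<and> x \<^bold>\<le> m \<^bold>\<and> y \<^bold>\<le> m)"

definition limit_ordinal :: "var \<Rightarrow> cfm" where
  "limit_ordinal x = (ordinal x \<^bold>\<and> \<^bold>\<not> is_empty x \<^bold>\<and> (\<^bold>\<forall>y\<^bold>\<in>x. \<^bold>\<exists>z\<^bold>\<in>x. y \<^bold>\<in> z))"

definition is_omega :: "var \<Rightarrow> cfm" where
  "is_omega x = (limit_ordinal x \<^bold>\<and> (\<^bold>\<forall>y\<^bold>\<in>x. \<^bold>\<not> limit_ordinal y))"

definition cardinal :: "var \<Rightarrow> cfm" where
  "cardinal x = (ordinal x \<^bold>\<and> (\<^bold>\<forall>y\<^bold>\<in>x. \<^bold>\<not> (\<^bold>\<exists>f. bijection f y x)))"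

definition is_cardinal_succ :: "var \<Rightarrow> var \<Rightarrow> cfm" where
  "is_cardinal_succ y x = (cardinal y \<^bold>\<and> x \<^bold>\<in> y \<^bold>\<and> (\<^bold>\<forall>z\<^bold>\<in>y. x \<^bold>\<in> z \<^bold>\<longrightarrow> \<^bold>\<not> cardinal z))"

definition is_omega1 :: "var \<Rightarrow> cfm" where
  "is_omega1 x = (\<^bold>\<exists>w. is_omega w \<^bold>\<and> is_cardinal_succ x w)"

definition is_omega2 :: "var \<Rightarrow> cfm" where
  "is_omega2 x = (\<^bold>\<exists>w. is_omega1 w \<^bold>\<and> is_cardinal_succ x w)"

definition countable_set :: "var \<Rightarrow> cfm" where
  "countable_set x = (\<^bold>\<exists>w. is_omega w \<^bold>\<and> (\<^bold>\<exists>f. injection f x w))"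

definition cofinal_map :: "var \<Rightarrow> var \<Rightarrow> var \<Rightarrow> cfm" where
  "cofinal_map f b a = (fun_to f b a \<^bold>\<and> (\<^bold>\<forall>x\<^bold>\<in>a. \<^bold>\<exists>y\<^bold>\<in>b. \<^bold>\<exists>v. maps f y v \<^bold>\<and> x \<^bold>\<le> v))"

definition is_cofinality :: "var \<Rightarrow> var \<Rightarrow> cfm" where
  "is_cofinality c a = (ordinal c \<^bold>\<and> (\<^bold>\<exists>f. cofinal_map f c a) \<^bold>\<and>
     (\<^bold>\<forall>b\<^bold>\<in>c. \<^bold>\<not> (\<^bold>\<exists>f. cofinal_map f b a)))"

definition unbounded_in :: "var \<Rightarrow> var \<Rightarrow> cfm" where
  "unbounded_in c k = (\<^bold>\<forall>x\<^bold>\<in>k. \<^bold>\<exists>y\<^bold>\<in>c. y \<^bold>\<in> k \<^bold>\<and> x \<^bold>\<in> y)"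

definition club_in :: "var \<Rightarrow> var \<Rightarrow> cfm" where
  "club_in c k = (c \<^bold>\<subseteq> k \<^bold>\<and> unbounded_in c k \<^bold>\<and>
     (\<^bold>\<forall>d\<^bold>\<in>k. limit_ordinal d \<^bold>\<and> unbounded_in c d \<^bold>\<longrightarrow> d \<^bold>\<in> c))"

definition stationary_in :: "var \<Rightarrow> var \<Rightarrow> cfm" where
  "stationary_in s k = (s \<^bold>\<subseteq> k \<^bold>\<and> (\<^bold>\<forall>c. club_in c k \<^bold>\<longrightarrow> (\<^bold>\<exists>x\<^bold>\<in>s. x \<^bold>\<in> c)))"


section \<open>CH and (B)\<close>

text \<open>\<open>2\<^sup>\<aleph>\<^sup>0 = \<aleph>\<^sub>1\<close>\<close>

definition CH :: fm where
  "CH = sentence (\<^bold>\<exists>w. \<^bold>\<exists>w1. \<^bold>\<exists>p. \<^bold>\<exists>f.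
     is_omega w \<^bold>\<and> is_omega1 w1 \<^bold>\<and> is_power p w \<^bold>\<and> bijection f p w1)"

text \<open>\<open>g(min{u, v}) < max{u, v}\<close>\<close>

definition g_separated :: "var \<Rightarrow> var \<Rightarrow> var \<Rightarrow> cfm" where
  "g_separated g u v = (\<^bold>\<exists>m. \<^bold>\<exists>y. \<^bold>\<exists>M. is_min m u v \<^bold>\<and> maps g m y \<^bold>\<and> is_max M u v \<^bold>\<and> y \<^bold>\<in> M)"

definition closed_under :: "var \<Rightarrow> var \<Rightarrow> cfm" where
  "closed_under b h = (\<^bold>\<forall>a\<^bold>\<in>b. \<^bold>\<exists>v. maps h a v \<^bold>\<and> v \<^bold>\<in> b)"

text \<open>The two conditions on \<open>\<beta>\<close> and \<open>D\<^sub>\<beta>\<close>; here \<open>q\<close> is \<open>\<pi>\<^sub>\<beta>\<close>.\<close>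

definition cond1 :: "var \<Rightarrow> var \<Rightarrow> var \<Rightarrow> var \<Rightarrow> var \<Rightarrow> cfm" where
  "cond1 g h b q D = (\<^bold>\<forall>a\<^bold>\<in>b. \<^bold>\<not> a \<^bold>\<in> D \<^bold>\<longrightarrow>
     (\<^bold>\<exists>ha. \<^bold>\<exists>u. \<^bold>\<exists>v. maps h a ha \<^bold>\<and> maps q a u \<^bold>\<and> maps q ha v \<^bold>\<and> g_separated g u v))"

definition cond2 :: "var \<Rightarrow> var \<Rightarrow> var \<Rightarrow> var \<Rightarrow> var \<Rightarrow> cfm" where
  "cond2 g h b q D = (\<^bold>\<forall>a\<^bold>\<in>b. \<^bold>\<forall>c\<^bold>\<in>b. \<^bold>\<not> a \<^bold>\<in> D \<^bold>\<and> \<^bold>\<not> c \<^bold>\<in> D \<^bold>\<and> \<^bold>\<not> a \<^bold>= c \<^bold>\<longrightarrow>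
     (\<^bold>\<exists>ha. \<^bold>\<exists>hc. \<^bold>\<exists>u. \<^bold>\<exists>v. maps h a ha \<^bold>\<and> maps h c hc \<^bold>\<and> maps q ha u \<^bold>\<and> maps q hc v \<^bold>\<and>
        g_separated g u v))"

text \<open>The variable \<open>X\<close> is the index set \<open>{\<beta>. \<omega>\<^sub>1 \<le> \<beta> < \<omega>\<^sub>2} = \<omega>\<^sub>2 \ \<omega>\<^sub>1\<close> of the sequence \<open>\<pi>\<close>.\<close>

definition principle_B :: fm where
  "principle_B = sentence (\<^bold>\<exists>w1. \<^bold>\<exists>w2. \<^bold>\<exists>X. is_omega1 w1 \<^bold>\<and> is_omega2 w2 \<^bold>\<and> is_diff X w2 w1 \<^bold>\<and>
     (\<^bold>\<exists>\<pi>. fun_on \<pi> X \<^bold>\<and> (\<^bold>\<forall>b\<^bold>\<in>X. \<^bold>\<exists>q. maps \<pi> b q \<^bold>\<and> bijection q b w1) \<^bold>\<and>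
       (\<^bold>\<forall>g. fun_to g w1 w1 \<^bold>\<longrightarrow>
         (\<^bold>\<exists>h. \<^bold>\<exists>I. injection h w2 w2 \<^bold>\<and> stationary_in I w2 \<^bold>\<and>
           (\<^bold>\<forall>b\<^bold>\<in>I. is_cofinality w1 b \<^bold>\<and> closed_under b h) \<^bold>\<and>
           (\<^bold>\<forall>b\<^bold>\<in>I. \<^bold>\<exists>q. maps \<pi> b q \<^bold>\<and>
             (\<^bold>\<exists>D. D \<^bold>\<subseteq> b \<^bold>\<and> countable_set D \<^bold>\<and> cond1 g h b q D \<^bold>\<and> cond2 g h b q D))))))"

end

theory Submission
  imports Defs "HOL-Library.Countable" "HOL-Library.Infinite_Set"
begin

text \<open>The principle (B) follows from \<open>2\<^sup>\<aleph>\<^sup>1 = \<aleph>\<^sub>2\<close>, with \<open>D\<^sub>\<beta>\<close> empty and the successor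
  operation as \<open>h\<close>, for every \<open>g\<close>. For \<open>\<beta>\<close> of cofinality \<open>\<omega>\<^sub>1\<close>, the successor operation on \<open>\<beta>\<close> is conjugate,
  via a bijection \<open>q : \<beta> \<rightarrow> \<omega>\<^sub>1\<close>, to a function on \<open>\<omega>\<^sub>1\<close> that grows faster than a given \<open>g\<close>; then
  \<open>q\<close> and \<open>g\<close> satisfy (1) and (2) at \<open>\<beta>\<close>. As there are only \<open>\<omega>\<^sub>2\<close> functions \<open>g\<close>, an Ulam matrix
  provides pairwise disjoint stationary sets on which \<open>\<pi>\<^sub>\<beta>\<close> can be chosen in this way for the
  respective \<open>g\<close>. So it suffices to force \<open>2\<^sup>\<aleph>\<^sup>0 = \<aleph>\<^sub>1\<close> and \<open>2\<^sup>\<aleph>\<^sup>1 = \<aleph>\<^sub>2\<close>. Over a countable, not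
  necessarily well-founded model obtained from the completeness theorem there are generic filters,
  and the partial functions of size at most \<open>k\<close> from \<open>k\<^sup>+\<close> to the power set of \<open>k\<close> force
  \<open>2\<^sup>k = k\<^sup>+\<close> without adding sequences of length \<open>k\<close>; this is done for \<open>k = \<omega>\<close> and then for
  \<open>k = \<omega>\<^sub>1\<close>.\<close>

section \<open>Semantics, soundness and completeness\<close>

text \<open>Consistency of ZFC yields only a countable model, which may be ill-founded from outside.
  So nothing external can be iterated along its membership relation: names cannot be evaluated by
  recursion, and there is no collapse to a transitive model. Every induction and recursion is run
  inside the model, for properties that are first-order definable with parameters; the calculus of
  \<open>D\<close> and \<open>T\<close> serves to discharge these definability conditions from the
  shape of a term. The extension is the quotient of all names by the equality that the generic
  filter decides. All models live on the natural numbers, so that countability survives an extension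
  and the construction can be repeated. The order of the two extensions matters: the second one adds
  no subset of \<omega>_1, hence preserves what the first one has achieved for the power set of
  \<omega>. Cardinals above k^+ may collapse without harm. At \<beta> of cofinality \<omega>_1, the
  reason why the successor operation can be conjugated to a fast function on \<omega>_1 is that both
  have \<omega>_1 many starting points.\<close>

text \<open>Equality is interpreted by \<open>Q\<close>, which is genuine equality except in the Henkin model.\<close>

primrec sat :: "('a \<Rightarrow> 'a \<Rightarrow> bool) \<Rightarrow> ('a \<Rightarrow> 'a \<Rightarrow> bool) \<Rightarrow> fm \<Rightarrow> (nat \<Rightarrow> 'a) \<Rightarrow> bool" where
  "sat E Q (Mem i j) e \<longleftrightarrow> E (e i) (e j)"
| "sat E Q (Eq i j) e \<longleftrightarrow> Q (e i) (e j)"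
| "sat E Q Falsum e \<longleftrightarrow> False"
| "sat E Q (Imp p q) e \<longleftrightarrow> (sat E Q p e \<longrightarrow> sat E Q q e)"
| "sat E Q (Univ p) e \<longleftrightarrow> (\<forall>x. sat E Q p (case_nat x e))"

lemma sat_ren: "sat E Q (ren r p) e \<longleftrightarrow> sat E Q p (\<lambda>i. e (r i))"
proof (induction p arbitrary: r e)
  case (Univ p)
  have "(\<lambda>i. case_nat x e (case_nat 0 (\<lambda>i. Suc (r i)) i)) = case_nat x (\<lambda>i. e (r i))" for x
    by (auto simp: fun_eq_iff split: nat.split)
  then show ?case by (simp add: Univ)
qed auto

lemma sat_inst: "sat E Q (inst t p) e \<longleftrightarrow> sat E Q p (case_nat (e t) e)"
proof -
  have "(\<lambda>i. e (case_nat t (\<lambda>i. i) i)) = case_nat (e t) e"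
    by (auto simp: fun_eq_iff split: nat.split)
  then show ?thesis by (simp add: inst_def sat_ren)
qed

lemma soundness: "H \<turnstile> p \<Longrightarrow> (\<And>q. q \<in> H \<Longrightarrow> sat E (=) q e) \<Longrightarrow> sat E (=) p e"
proof (induction arbitrary: e rule: deriv.induct)
  case (UnivI H p)
  have "sat E (=) p (case_nat x e)" for x
    by (rule UnivI.IH) (use UnivI.prems in \<open>auto simp: sat_ren\<close>)
  then show ?case by simp
next
  case (ImpI p H q)
  then show ?case by auto
next
  case (Class p H)
  then show ?case by (metis insert_iff sat.simps(3,4))
next
  case (EqSubst H s t p)
  then have "e s = e t" "sat E (=) p (case_nat (e s) e)" by (auto simp: sat_inst)
  then show ?case by (simp add: sat_inst)
qed (auto simp: sat_inst)

lemma consistent_if_sat: "(\<And>q. q \<in> H \<Longrightarrow> sat E (=) q e) \<Longrightarrow> consistent H"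
  unfolding consistent_def using soundness by fastforce

section \<open>Renaming of variables in formulas and derivations\<close>

lemma ren_ren: "ren r (ren s p) = ren (\<lambda>i. r (s i)) p"
proof (induction p arbitrary: r s)
  case (Univ p)
  have "(\<lambda>i. case_nat 0 (\<lambda>i. Suc (r i)) (case_nat 0 (\<lambda>i. Suc (s i)) i))
      = case_nat 0 (\<lambda>i. Suc (r (s i)))"
    by (auto simp: fun_eq_iff split: nat.split)
  then show ?case by (simp add: Univ)
qed auto

primrec fv :: "fm \<Rightarrow> nat set" where
  "fv (Mem i j) = {i, j}"
| "fv (Eq i j) = {i, j}"
| "fv Falsum = {}"
| "fv (Imp p q) = fv p \<union> fv q"
| "fv (Univ p) = {i. Suc i \<in> fv p}"

lemma finite_fv: "finite (fv p)"
proof (induction p)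
  case (Univ p)
  have "fv (Univ p) = Suc -` fv p" by auto
  then show ?case using Univ by (metis finite_vimageI inj_Suc)
qed auto

lemma ren_cong: "(\<And>i. i \<in> fv p \<Longrightarrow> r i = s i) \<Longrightarrow> ren r p = ren s p"
proof (induction p arbitrary: r s)
  case (Univ p)
  have "ren (case_nat 0 (\<lambda>i. Suc (r i))) p = ren (case_nat 0 (\<lambda>i. Suc (s i))) p"
    by (rule Univ.IH) (use Univ.prems in \<open>auto split: nat.split\<close>)
  then show ?case by simp
next
  case (Imp p q)
  have "ren r p = ren s p" "ren r q = ren s q"
    by (rule Imp.IH; use Imp.prems in simp)+
  then show ?case by simp
qed simp_all

lemma ren_id: "ren (\<lambda>i. i) p = p"
proof (induction p)
  case (Univ p)
  have "case_nat 0 Suc = (\<lambda>i. i)" by (auto simp: fun_eq_iff split: nat.split)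
  then show ?case by (simp add: Univ)
qed auto

lemma fv_ren: "fv (ren r p) = r ` fv p"
proof (induction p arbitrary: r)
  case (Univ p)
  have "{i. Suc i \<in> case_nat 0 (\<lambda>i. Suc (r i)) ` fv p} = r ` {i. Suc i \<in> fv p}"
  proof (intro equalityI subsetI)
    fix i assume "i \<in> {i. Suc i \<in> case_nat 0 (\<lambda>i. Suc (r i)) ` fv p}"
    then obtain k where "k \<in> fv p" "Suc i = (case k of 0 \<Rightarrow> 0 | Suc i \<Rightarrow> Suc (r i))" by auto
    then show "i \<in> r ` {i. Suc i \<in> fv p}" by (cases k) auto
  next
    fix i assume "i \<in> r ` {i. Suc i \<in> fv p}"
    then obtain j where "Suc j \<in> fv p" "i = r j" by auto
    then show "i \<in> {i. Suc i \<in> case_nat 0 (\<lambda>i. Suc (r i)) ` fv p}"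
      by (auto intro!: image_eqI[of _ _ "Suc j"])
  qed
  then show ?case by (simp add: Univ)
qed auto

lemma ren_inst: "ren r (inst t p) = inst (r t) (ren (case_nat 0 (\<lambda>i. Suc (r i))) p)"
  unfolding inst_def ren_ren by (rule ren_cong) (auto split: nat.split)

lemma deriv_weaken: "H \<turnstile> p \<Longrightarrow> H \<subseteq> H' \<Longrightarrow> H' \<turnstile> p"
proof (induction arbitrary: H' rule: deriv.induct)
  case (ImpI p H q)
  then show ?case by (meson deriv.ImpI insert_mono)
next
  case (Class p H)
  then show ?case by (meson deriv.Class insert_mono)
next
  case (UnivI H p)
  then show ?case by (meson deriv.UnivI image_mono)
next
  case (EqSubst H s t p)
  then show ?case by (meson deriv.EqSubst)
next
  case (UnivE H p t)
  then show ?case by (meson deriv.UnivE)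
next
  case (ImpE H p q)
  then show ?case by (meson deriv.ImpE)
qed (auto intro: deriv.Assm deriv.EqRefl)

text \<open>Holds for arbitrary renamings, injective or not, because instantiation commutes with
  renaming. Non-injective ones occur: \<open>model_existence\<close> halves all indices.\<close>

lemma deriv_ren: "H \<turnstile> p \<Longrightarrow> ren r ` H \<turnstile> ren r p"
proof (induction arbitrary: r rule: deriv.induct)
  case (UnivI H p)
  have "ren (case_nat 0 (\<lambda>i. Suc (r i))) ` ren Suc ` H = ren Suc ` ren r ` H"
    by (simp add: image_image ren_ren)
  then show ?case using UnivI.IH[of "case_nat 0 (\<lambda>i. Suc (r i))"] by (simp add: deriv.UnivI)
next
  case (ImpI p H q)
  show ?case using ImpI.IH[of r] by (auto intro!: deriv.ImpI)
next
  case (Class p H)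
  show ?case using Class.IH[of r] by (auto intro!: deriv.Class)
next
  case (EqSubst H s t p)
  show ?case using EqSubst.IH[of r] by (simp add: ren_inst) (rule deriv.EqSubst)
next
  case (UnivE H p t)
  show ?case using UnivE.IH[of r] by (simp add: ren_inst) (rule deriv.UnivE)
next
  case (ImpE H p q)
  show ?case using ImpE.IH[of r] by simp (rule deriv.ImpE)
qed (auto intro: deriv.Assm deriv.EqRefl)

lemma deriv_finite: "H \<turnstile> p \<Longrightarrow> \<exists>F. finite F \<and> F \<subseteq> H \<and> F \<turnstile> p"
proof (induction rule: deriv.induct)
  case (Assm p H)
  then show ?case by (intro exI[of _ "{p}"]) (auto intro: deriv.Assm)
next
  case (ImpI p H q)
  then obtain F where F: "finite F" "F \<subseteq> insert p H" "F \<turnstile> q" by blast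
  have "insert p (F - {p}) \<turnstile> q" by (rule deriv_weaken[OF F(3)]) blast
  then have "F - {p} \<turnstile> Imp p q" by (rule deriv.ImpI)
  then show ?case using F by (intro exI[of _ "F - {p}"]) auto
next
  case (ImpE H p q)
  then obtain F F' where "finite F" "F \<subseteq> H" "F \<turnstile> Imp p q" "finite F'" "F' \<subseteq> H" "F' \<turnstile> p" by auto
  then show ?case
    by (intro exI[of _ "F \<union> F'"])
       (metis deriv.ImpE deriv_weaken finite_UnI sup_ge1 sup_ge2 Un_least)
next
  case (Class p H)
  then obtain F where F: "finite F" "F \<subseteq> insert (Imp p Falsum) H" "F \<turnstile> Falsum" by blast
  have "insert (Imp p Falsum) (F - {Imp p Falsum}) \<turnstile> Falsum"
    by (rule deriv_weaken[OF F(3)]) blast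
  then have "F - {Imp p Falsum} \<turnstile> p" by (rule deriv.Class)
  then show ?case using F by (intro exI[of _ "F - {Imp p Falsum}"]) auto
next
  case (UnivI H p)
  then obtain F where F: "finite F" "F \<subseteq> ren Suc ` H" "F \<turnstile> p" by auto
  then obtain F' where "finite F'" "F' \<subseteq> H" "F = ren Suc ` F'"
    by (meson finite_subset_image)
  then show ?case using F by (auto intro: deriv.UnivI)
next
  case (UnivE H p t)
  then show ?case by (meson deriv.UnivE)
next
  case (EqRefl H t)
  then show ?case by (intro exI[of _ "{}"]) (auto intro: deriv.EqRefl)
next
  case (EqSubst H s t p)
  then obtain F F' where "finite F" "F \<subseteq> H" "F \<turnstile> Eq s t" "finite F'" "F' \<subseteq> H" "F' \<turnstile> inst s p"
    by auto
  then show ?case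
    by (intro exI[of _ "F \<union> F'"])
       (metis deriv.EqSubst deriv_weaken finite_UnI sup_ge1 sup_ge2 Un_least)
qed

text \<open>\<open>UnivI\<close> has index 0 as its eigenvariable; this is the form with a fresh
  index \<open>k\<close>. The renaming that moves \<open>k\<close> to 0 and shifts all other indices
  turns the given derivation into the premise of \<open>UnivI\<close>.\<close>

lemma deriv_generalize:
  assumes "H \<turnstile> inst k p" and "k \<notin> (\<Union>q\<in>H. fv q)" and "k \<notin> fv (Univ p)"
  shows "H \<turnstile> Univ p"
proof -
  define r where "r = (\<lambda>i. if i = k then 0 else Suc i)"
  have "ren r (inst k p) = ren (\<lambda>i. i) p"
    unfolding inst_def ren_ren using assms(3) by (intro ren_cong) (auto simp: r_def split: nat.split)
  moreover have "ren r ` H = ren Suc ` H"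
    using assms(2) by (intro image_cong ren_cong) (auto simp: r_def)
  ultimately show ?thesis using deriv_ren[OF assms(1), of r] by (simp add: ren_id deriv.UnivI)
qed

section \<open>Complete Henkin extensions of consistent sets\<close>

instance fm :: countable
  by countable_datatype

definition fresh :: "fm set \<Rightarrow> fm \<Rightarrow> nat" where
  "fresh H p = (SOME k. k \<notin> (\<Union>q\<in>H. fv q) \<and> k \<notin> fv p)"

text \<open>\<open>Imp (Univ q) Falsum\<close> is the only shape that calls for a witness. The
  witness is added together with the formula itself, so that a single pass over all formulas makes
  the set both complete and Henkin.\<close>

definition extend :: "fm set \<Rightarrow> fm \<Rightarrow> fm set" where
  "extend H p = (if consistent (insert p H) then
     (case p of Imp (Univ q) Falsum \<Rightarrow> {Imp (inst (fresh H p) q) Falsum, p} \<union> H | _ \<Rightarrow> insert p H)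
     else H)"

primrec henkin :: "fm set \<Rightarrow> nat \<Rightarrow> fm set" where
  "henkin H 0 = H"
| "henkin H (Suc n) = extend (henkin H n) (from_nat n)"

lemma extend_cases:
  assumes "consistent (insert p H)"
  obtains "extend H p = insert p H" "\<And>q. p \<noteq> Imp (Univ q) Falsum"
  | q where "p = Imp (Univ q) Falsum" "extend H p = {Imp (inst (fresh H p) q) Falsum, p} \<union> H"
  using assms by (cases "\<exists>q. p = Imp (Univ q) Falsum") (auto simp: extend_def split: fm.split)

lemma extend_finite: "\<exists>F. finite F \<and> extend H p = F \<union> H"
proof (cases "consistent (insert p H)")
  case True
  then show ?thesis
  proof (cases rule: extend_cases)
    case 1
    then show ?thesis by (intro exI[of _ "{p}"]) auto
  next
    case (2 q)
    then show ?thesis by (metis finite.simps)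
  qed
qed (auto simp: extend_def intro: exI[of _ "{}"])

text \<open>Each stage adds only finitely many formulas, so infinitely many indices remain available
  as fresh witnesses.\<close>

lemma henkin_finite: "\<exists>F. finite F \<and> henkin H n = F \<union> H"
proof (induction n)
  case 0
  then show ?case by (intro exI[of _ "{}"]) auto
next
  case (Suc n)
  then obtain F where "finite F" "henkin H n = F \<union> H" by auto
  moreover obtain F' where "finite F'" "henkin H (Suc n) = F' \<union> henkin H n"
    using extend_finite by (metis henkin.simps(2))
  ultimately show ?case by (intro exI[of _ "F' \<union> F"]) auto
qed

text \<open>A contradiction from the witness would prove \<open>inst k q\<close> for a fresh
  \<open>k\<close>, hence \<open>Univ q\<close> by generalization, against the formula
  \<open>p\<close> that has just been added.\<close>

lemma consistent_extend:
  assumes "consistent H" and fresh: "infinite (- (\<Union>q\<in>H. fv q))"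
  shows "consistent (extend H p)"
proof (cases "consistent (insert p H)")
  case True
  then show ?thesis
  proof (cases rule: extend_cases)
    case 1
    then show ?thesis using True by simp
  next
    case (2 q)
    let ?k = "fresh H p" and ?H = "insert p H"
    have "infinite (- (\<Union>q\<in>H. fv q) - fv p)" using fresh finite_fv by simp
    then have "\<exists>k. k \<notin> (\<Union>q\<in>H. fv q) \<and> k \<notin> fv p"
      by (metis ComplD Diff_iff finite.emptyI ex_in_conv)
    then have k: "?k \<notin> (\<Union>q\<in>H. fv q)" "?k \<notin> fv p"
      unfolding fresh_def by (metis (mono_tags, lifting) someI_ex)+
    show ?thesis
    proof (rule ccontr)
      assume "\<not> ?thesis"
      then have "insert (Imp (inst ?k q) Falsum) ?H \<turnstile> Falsum" using 2 by (simp add: consistent_def)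
      then have "?H \<turnstile> inst ?k q" by (rule deriv.Class)
      then have "?H \<turnstile> Univ q"
        by (rule deriv_generalize) (use k 2 in auto)
      moreover have "?H \<turnstile> Imp (Univ q) Falsum" using 2 by (auto intro: deriv.Assm)
      ultimately show False using True by (meson consistent_def deriv.ImpE)
    qed
  qed
qed (use assms in \<open>simp add: extend_def\<close>)

lemma complete_henkin_extension:
  assumes "consistent H" and fresh: "infinite (- (\<Union>q\<in>H. fv q))"
  obtains G where "H \<subseteq> G" "consistent G" "\<And>p. p \<notin> G \<Longrightarrow> \<not> consistent (insert p G)"
    "\<And>q. Imp (Univ q) Falsum \<in> G \<Longrightarrow> \<exists>k. Imp (inst k q) Falsum \<in> G"
proof
  let ?G = "\<Union>n. henkin H n"
  have infn: "infinite (- (\<Union>q\<in>henkin H n. fv q))" for n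
  proof -
    obtain F where F: "finite F" "henkin H n = F \<union> H" using henkin_finite by blast
    have "- (\<Union>q\<in>henkin H n. fv q) = - (\<Union>q\<in>H. fv q) - (\<Union>q\<in>F. fv q)" using F by auto
    then show ?thesis using fresh F finite_fv by simp
  qed
  have con: "consistent (henkin H n)" for n
    by (induction n) (use assms infn consistent_extend in auto)
  have mono: "henkin H m \<subseteq> henkin H n" if "m \<le> n" for m n
    by (rule lift_Suc_mono_le[OF _ that]) (metis extend_finite henkin.simps(2) sup_ge2)
  show "H \<subseteq> ?G" by (metis UN_upper UNIV_I henkin.simps(1))
  have sub: "\<exists>n. F \<subseteq> henkin H n" if "finite F" "F \<subseteq> ?G" for F
    using that
  proof (induction F rule: finite_induct)
    case (insert p F)
    then obtain m n where "F \<subseteq> henkin H m" "p \<in> henkin H n" by auto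
    then have "insert p F \<subseteq> henkin H (max m n)"
      using mono[of m "max m n"] mono[of n "max m n"] by auto
    then show ?case by blast
  qed auto
  show "consistent ?G"
  proof (unfold consistent_def, rule notI)
    assume "?G \<turnstile> Falsum"
    then obtain F where "finite F" "F \<subseteq> ?G" "F \<turnstile> Falsum" using deriv_finite by blast
    then show False using sub con by (metis consistent_def deriv_weaken)
  qed
  \<comment> \<open>The formula \<open>p\<close> is treated at the stage numbered by its own code
    \<open>to_nat p\<close>.\<close>
  have step: "extend (henkin H (to_nat p)) p \<subseteq> ?G" for p
    by (metis UN_upper UNIV_I henkin.simps(2) from_nat_to_nat)
  have conp: "consistent (insert p (henkin H (to_nat p)))" if "consistent (insert p ?G)" for p
    using that unfolding consistent_def by (meson UN_upper UNIV_I deriv_weaken insert_mono)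
  show "\<not> consistent (insert p ?G)" if "p \<notin> ?G" for p
  proof
    assume "consistent (insert p ?G)"
    then have "p \<in> extend (henkin H (to_nat p)) p"
      using conp by (cases rule: extend_cases[OF conp]) auto
    then show False using step that by blast
  qed
  show "\<exists>k. Imp (inst k q) Falsum \<in> ?G" if "Imp (Univ q) Falsum \<in> ?G" for q
  proof -
    let ?p = "Imp (Univ q) Falsum"
    have "consistent (insert ?p ?G)" using that \<open>consistent ?G\<close> by (simp add: insert_absorb)
    then show ?thesis
      by (cases rule: extend_cases[OF conp[of ?p]]) (use step[of ?p] in auto)
  qed
qed

text \<open>Serves both the term model and the generic extension: each keeps the set of all natural
  numbers as its universe. Every class is represented by its least member, and the infinite set of
  representatives is enumerated in increasing order.\<close>

lemma equivalence_classes_enumerated: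
  fixes Q :: "nat \<Rightarrow> nat \<Rightarrow> bool"
  assumes "equivp Q" and inf: "\<And>F. finite F \<Longrightarrow> \<exists>x. \<forall>y\<in>F. \<not> Q x y"
  obtains h :: "nat \<Rightarrow> nat" where "surj h" "\<And>x y. h x = h y \<longleftrightarrow> Q x y"
proof -
  define c where "c x = (LEAST y. Q x y)" for x
  have refl: "Q x x" for x using assms(1) by (simp add: equivp_reflp)
  have c: "Q x (c x)" for x unfolding c_def using refl by (rule LeastI)
  have ceq: "c x = c y \<longleftrightarrow> Q x y" for x y
  proof
    assume "Q x y"
    then have "Q x = Q y" using assms(1) by (simp add: equivp_def)
    then show "c x = c y" by (simp add: c_def)
  qed (metis assms(1) c equivp_symp equivp_transp)
  have "infinite (range c)"
  proof
    assume "finite (range c)"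
    then show False using inf[of "range c"] c by blast
  qed
  then have b: "bij_betw (enumerate (range c)) UNIV (range c)" by (rule bij_enumerate)
  define h where "h x = the_inv (enumerate (range c)) (c x)" for x
  have i: "inj (enumerate (range c))" using b by (rule bij_betw_imp_inj_on)
  have "h x = h y \<longleftrightarrow> c x = c y" for x y
    unfolding h_def using b i by (metis bij_betw_imp_surj_on f_the_inv_into_f rangeI)
  moreover have "surj h"
    unfolding surj_def
  proof
    fix n
    obtain x where "c x = enumerate (range c) n" using b by (metis bij_betw_apply UNIV_I imageE)
    then show "\<exists>x. n = h x" unfolding h_def by (metis i the_inv_f_f)
  qed
  ultimately show ?thesis using that ceq by metis
qed

text \<open>The side condition says that the term model has infinitely many elements, so that its
  quotient can be placed on the natural numbers.\<close>

theorem model_existence: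
  assumes "consistent H"
    and inf: "\<And>E Q e F. equivp Q \<Longrightarrow> (\<And>x x' y y'. Q x x' \<Longrightarrow> Q y y' \<Longrightarrow> E x y \<Longrightarrow> E x' y') \<Longrightarrow>
      (\<And>p. p \<in> H \<Longrightarrow> sat E Q p e) \<Longrightarrow> finite F \<Longrightarrow> \<exists>x::nat. \<forall>y\<in>F. \<not> Q x y"
  obtains E :: "nat \<Rightarrow> nat \<Rightarrow> bool" and e where "\<And>p. p \<in> H \<Longrightarrow> sat E (=) p e"
proof -
  \<comment> \<open>Moving all variables to even indices leaves the odd ones free to be Henkin
    witnesses.\<close>
  let ?H = "ren (\<lambda>i. 2 * i) ` H"
  have "consistent ?H"
  proof (unfold consistent_def, rule notI)
    assume "?H \<turnstile> Falsum"
    then have "ren (\<lambda>i. i div 2) ` ?H \<turnstile> ren (\<lambda>i. i div 2) Falsum" by (rule deriv_ren)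
    then show False using assms(1) by (simp add: image_image ren_ren ren_id consistent_def)
  qed
  moreover have "infinite (- (\<Union>q\<in>?H. fv q))"
  proof (rule infinite_super)
    show "range (\<lambda>i. 2 * i + 1) \<subseteq> - (\<Union>q\<in>?H. fv q)" by (auto simp: fv_ren) presburger
    show "infinite (range (\<lambda>i::nat. 2 * i + 1))"
      by (rule range_inj_infinite) (auto intro: injI)
  qed
  ultimately obtain G where G: "?H \<subseteq> G" "consistent G" "\<And>p. p \<notin> G \<Longrightarrow> \<not> consistent (insert p G)"
    "\<And>q. Imp (Univ q) Falsum \<in> G \<Longrightarrow> \<exists>k. Imp (inst k q) Falsum \<in> G"
    using complete_henkin_extension by blast
  have closed: "p \<in> G" if "G \<turnstile> p" for p
    using G(2,3) that by (metis consistent_def deriv.ImpE deriv.ImpI)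
  have neg: "Imp p Falsum \<in> G" if "p \<notin> G" for p
    using G(3)[OF that] closed deriv.ImpI by (auto simp: consistent_def)
  have mp: "q \<in> G" if "Imp p q \<in> G" "p \<in> G" for p q
    using that by (metis closed deriv.Assm deriv.ImpE)
  have fal: "Falsum \<notin> G" using G(2) by (auto simp: consistent_def deriv.Assm)
  have imp: "Imp p q \<in> G \<longleftrightarrow> (p \<in> G \<longrightarrow> q \<in> G)" for p q
  proof -
    have "G \<turnstile> Imp p q" if "q \<in> G" using that by (auto intro: deriv.ImpI deriv.Assm)
    moreover have "G \<turnstile> Imp p q" if "Imp p Falsum \<in> G"
    proof (rule deriv.ImpI, rule deriv.Class)
      let ?K = "insert (Imp q Falsum) (insert p G)"
      have "?K \<turnstile> Imp p Falsum" "?K \<turnstile> p" using that by (auto intro: deriv.Assm)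
      then show "?K \<turnstile> Falsum" by (rule deriv.ImpE)
    qed
    ultimately show ?thesis using mp neg closed by blast
  qed
  have univ: "Univ p \<in> G \<longleftrightarrow> (\<forall>k. inst k p \<in> G)" for p
    by (metis G(4) closed deriv.Assm deriv.UnivE fal mp neg)
  define E where "E i j \<longleftrightarrow> Mem i j \<in> G" for i j
  define Q where "Q i j \<longleftrightarrow> Eq i j \<in> G" for i j
  \<comment> \<open>The only terms are variables, so the term model consists of the indices, and an
    assignment into it acts on formulas as a renaming.\<close>
  have truth: "sat E Q p e \<longleftrightarrow> ren e p \<in> G" for p e
  proof (induction p arbitrary: e)
    case (Univ p)
    have "inst k (ren (case_nat 0 (\<lambda>i. Suc (e i))) p) = ren (case_nat k e) p" for k
      unfolding inst_def ren_ren by (rule ren_cong) (auto split: nat.split)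
    then show ?case by (simp add: Univ univ)
  qed (auto simp: E_def Q_def fal imp)
  have subst: "inst t p \<in> G" if "Q s t" "inst s p \<in> G" for s t p
    using that unfolding Q_def by (metis closed deriv.Assm deriv.EqSubst)
  have refl: "Q x x" for x unfolding Q_def by (rule closed) (rule deriv.EqRefl)
  have sym: "Q y x" if "Q x y" for x y
    using subst[OF that, of "Eq 0 (Suc x)"] refl by (simp add: inst_def Q_def)
  have trans: "Q x z" if "Q x y" "Q y z" for x y z
    using subst[OF that(2), of "Eq (Suc x) 0"] that(1) by (simp add: inst_def Q_def)
  have eqv: "equivp Q"
    by (intro equivpI reflpI sympI transpI) (fact refl sym trans)+
  have cong: "E x' y'" if "Q x x'" "Q y y'" "E x y" for x x' y y'
    using subst[OF that(1), of "Mem 0 (Suc y)"] subst[OF that(2), of "Mem (Suc x') 0"] that(3)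
    by (simp add: inst_def E_def)
  have satH: "sat E Q p (\<lambda>i. 2 * i)" if "p \<in> H" for p
    using that G(1) truth by auto
  obtain h :: "nat \<Rightarrow> nat" where h: "surj h" "\<And>x y. h x = h y \<longleftrightarrow> Q x y"
  proof (rule equivalence_classes_enumerated[OF eqv])
    show "\<exists>x. \<forall>y\<in>F. \<not> Q x y" if "finite F" for F
      using eqv cong satH that by (rule inf)
  qed blast
  define E' where "E' x y \<longleftrightarrow> (\<exists>i j. x = h i \<and> y = h j \<and> E i j)" for x y
  have E': "E' (h i) (h j) \<longleftrightarrow> E i j" for i j
  proof
    assume "E' (h i) (h j)"
    then obtain i' j' where "h i = h i'" "h j = h j'" "E i' j'" unfolding E'_def by blast
    then show "E i j" using cong sym unfolding h(2) by blast
  qed (auto simp: E'_def)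
  have "sat E' (=) p (\<lambda>i. h (e i)) \<longleftrightarrow> sat E Q p e" for p e
  proof (induction p arbitrary: e)
    case (Univ p)
    have *: "case_nat (h x) (\<lambda>i. h (e i)) = (\<lambda>i. h (case_nat x e i))" for x
      by (auto simp: fun_eq_iff split: nat.split)
    have "(\<forall>y. sat E' (=) p (case_nat y (\<lambda>i. h (e i)))) \<longleftrightarrow>
        (\<forall>x. sat E' (=) p (case_nat (h x) (\<lambda>i. h (e i))))"
      using h(1) by (metis surj_def)
    also have "\<dots> \<longleftrightarrow> (\<forall>x. sat E Q p (case_nat x e))" by (simp only: * Univ)
    finally show ?case by simp
  qed (auto simp: E' h(2))
  then show ?thesis using that satH by blast
qed

section \<open>Definable predicates and operations\<close>

named_theorems D_intros

text \<open>A predicate on environments is definable if it is given by a formula, in which every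
  variable is either one of the environment or a parameter from the model.\<close>

locale mem =
  fixes E :: "'a \<Rightarrow> 'a \<Rightarrow> bool"  (infix "\<epsilon>" 50)
begin

definition D :: "((nat \<Rightarrow> 'a) \<Rightarrow> bool) \<Rightarrow> bool" where
  "D P \<longleftrightarrow> (\<exists>p r c. \<forall>e. P e = sat (\<epsilon>) (=) p (\<lambda>i. case r i of None \<Rightarrow> c i | Some j \<Rightarrow> e j))"

definition T :: "((nat \<Rightarrow> 'a) \<Rightarrow> 'a) \<Rightarrow> bool" where
  "T t \<longleftrightarrow> D (\<lambda>e. e 0 = t (\<lambda>n. e (Suc n)))"

lemma D_satI: "(\<And>e. P e = sat (\<epsilon>) (=) p (\<lambda>i. case r i of None \<Rightarrow> c i | Some j \<Rightarrow> e j)) \<Longrightarrow> D P"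
  unfolding D_def by blast

lemma D_env:
  assumes "D P"
  shows "D (\<lambda>e. P (\<lambda>i. case s i of None \<Rightarrow> d i | Some j \<Rightarrow> e j))"
proof -
  obtain p r c where P: "\<And>e. P e = sat (\<epsilon>) (=) p (\<lambda>i. case r i of None \<Rightarrow> c i | Some j \<Rightarrow> e j)"
    using assms unfolding D_def by blast
  let ?r = "\<lambda>i. case r i of None \<Rightarrow> None | Some j \<Rightarrow> s j"
  let ?c = "\<lambda>i. (case r i of None \<Rightarrow> c i | Some j \<Rightarrow> d j)"
  have "(case r i of None \<Rightarrow> c i | Some j \<Rightarrow> (case s j of None \<Rightarrow> d j | Some j \<Rightarrow> e j)) =
      (case ?r i of None \<Rightarrow> ?c i | Some j \<Rightarrow> e j)" for i e
    by (auto split: option.split)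
  then show ?thesis unfolding P by (intro D_satI[of _ p ?c ?r]) simp
qed

lemma D_ren: "D P \<Longrightarrow> D (\<lambda>e. P (\<lambda>i. e (r i)))"
  using D_env[where P = P and s = "\<lambda>i. Some (r i)"] by simp

lemma T_ren: "T t \<Longrightarrow> T (\<lambda>e. t (\<lambda>i. e (r i)))"
  unfolding T_def using D_ren[of _ "case_nat 0 (\<lambda>i. Suc (r i))"] by force

lemma D_const [D_intros]: "D (\<lambda>e. b)"
proof (cases b)
  case True
  then show ?thesis by (intro D_satI[of _ "Imp Falsum Falsum"]) simp
next
  case False
  then show ?thesis by (intro D_satI[of _ Falsum]) simp
qed

lemma D_imp [D_intros]:
  assumes "D P" "D Q"
  shows "D (\<lambda>e. P e \<longrightarrow> Q e)"
proof -
  obtain p r c where P: "\<And>e. P e = sat (\<epsilon>) (=) p (\<lambda>i. case r i of None \<Rightarrow> c i | Some j \<Rightarrow> e j)"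
    using assms unfolding D_def by blast
  obtain q s d where Q: "\<And>e. Q e = sat (\<epsilon>) (=) q (\<lambda>i. case s i of None \<Rightarrow> d i | Some j \<Rightarrow> e j)"
    using assms unfolding D_def by blast
  \<comment> \<open>Even indices serve the first formula and odd ones the second, so that their
    environments do not clash.\<close>
  show ?thesis unfolding P Q
    by (rule D_satI[of _ "Imp (ren (\<lambda>i. 2 * i) p) (ren (\<lambda>i. 2 * i + 1) q)"
          "\<lambda>i. if even i then c (i div 2) else d (i div 2)"
          "\<lambda>i. if even i then r (i div 2) else s (i div 2)"]) (simp add: sat_ren cong: option.case_cong)
qed

lemma D_all [D_intros]:
  assumes "D (\<lambda>e. P (e 0) (\<lambda>n. e (Suc n)))"
  shows "D (\<lambda>e. \<forall>x. P x e)"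
proof -
  obtain p r c where "\<And>e. P (e 0) (\<lambda>n. e (Suc n)) =
      sat (\<epsilon>) (=) p (\<lambda>i. case r i of None \<Rightarrow> c i | Some j \<Rightarrow> e j)"
    using assms unfolding D_def by blast
  from this[of "case_nat _ _"] have P: "P x e =
      sat (\<epsilon>) (=) p (\<lambda>i. case r i of None \<Rightarrow> c i | Some j \<Rightarrow> case_nat x e j)" for x e by simp
  \<comment> \<open>All variables that read slot 0 are merged into the bound index 0; the others
    skip it, and \<open>r'\<close> undoes the shift of their slots. Where \<open>r i\<close> is
    \<open>Some 0\<close>, the truncated value \<open>j - 1\<close> is never read.\<close>
  define f where "f i = (if r i = Some 0 then 0 else Suc i)" for i
  define r' where "r' i = (case r i of None \<Rightarrow> None | Some j \<Rightarrow> Some (j - 1))" for i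
  have "case_nat x (\<lambda>i. case r' i of None \<Rightarrow> c i | Some j \<Rightarrow> e j) (f i) =
      (case r i of None \<Rightarrow> c i | Some j \<Rightarrow> case_nat x e j)" for x e i
    unfolding f_def r'_def by (auto split: option.split nat.split)
  then show ?thesis
    by (intro D_satI[of _ "Univ (ren f p)" c r']) (simp add: sat_ren P)
qed

lemma D_not [D_intros]: "D P \<Longrightarrow> D (\<lambda>e. \<not> P e)"
  using D_imp[OF _ D_const[of False]] by simp

lemma D_or [D_intros]: "D P \<Longrightarrow> D Q \<Longrightarrow> D (\<lambda>e. P e \<or> Q e)"
  using D_imp[OF D_not] by (simp add: disj_imp)

lemma D_and [D_intros]: "D P \<Longrightarrow> D Q \<Longrightarrow> D (\<lambda>e. P e \<and> Q e)"
  using D_not[OF D_imp[OF _ D_not]] by simp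

lemma D_iff [D_intros]: "D P \<Longrightarrow> D Q \<Longrightarrow> D (\<lambda>e. P e \<longleftrightarrow> Q e)"
  unfolding iff_conv_conj_imp by (intro D_intros)

lemma D_if [D_intros]: "D P \<Longrightarrow> D Q \<Longrightarrow> D R \<Longrightarrow> D (\<lambda>e. if P e then Q e else R e)"
  unfolding if_bool_eq_conj by (intro D_intros)

lemma D_ex [D_intros]: "D (\<lambda>e. P (e 0) (\<lambda>n. e (Suc n))) \<Longrightarrow> D (\<lambda>e. \<exists>x. P x e)"
  using D_not[OF D_all[of "\<lambda>x e. \<not> P x e"]] D_not[of "\<lambda>e. P (e 0) (\<lambda>n. e (Suc n))"] by simp

lemma T_var [D_intros]: "T (\<lambda>e. e i)"
  unfolding T_def
  by (rule D_satI[of _ "Eq 0 1" _ "\<lambda>j. if j = 0 then Some 0 else Some (Suc i)"]) simp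

lemma T_const [D_intros]: "T (\<lambda>e. c)"
  unfolding T_def
  by (rule D_satI[of _ "Eq 0 1" "\<lambda>_. c" "\<lambda>j. if j = 0 then Some 0 else None"]) simp

text \<open>The object language has no terms, so substituting \<open>t\<close> means quantifying
  over a value \<open>x\<close> with \<open>x = t e\<close>, which the definable graph of
  \<open>t\<close> can express.\<close>

lemma D_subst:
  assumes "T t" "D (\<lambda>e. P (e 0) (\<lambda>n. e (Suc n)))"
  shows "D (\<lambda>e. P (t e) e)"
proof -
  have "D (\<lambda>e. \<exists>x. x = t e \<and> P x e)"
    using assms unfolding T_def by (intro D_intros)
  then show ?thesis by simp
qed

lemma D_subst1: "D (\<lambda>e. P (e 0)) \<Longrightarrow> T t \<Longrightarrow> D (\<lambda>e. P (t e))"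
  by (rule D_subst)

lemma D_subst2:
  assumes "D (\<lambda>e. P (e 0) (e 1))" "T s" "T t"
  shows "D (\<lambda>e. P (s e) (t e))"
proof (rule D_subst[OF assms(2)], rule D_subst[of "\<lambda>e. t (\<lambda>n. e (Suc n))" "\<lambda>x e. P (e 0) x"])
  show "T (\<lambda>e. t (\<lambda>n. e (Suc n)))" by (rule T_ren[OF assms(3)])
  show "D (\<lambda>e. P (e (Suc 0)) (e 0))"
    using D_ren[OF assms(1), of "\<lambda>i. if i = 0 then 1 else 0"] by simp
qed

lemma T_subst:
  assumes "T t" "T (\<lambda>e. F (e 0) (\<lambda>n. e (Suc n)))"
  shows "T (\<lambda>e. F (t e) e)"
  unfolding T_def
proof (rule D_subst[of "\<lambda>e. t (\<lambda>n. e (Suc n))" "\<lambda>x e. e 0 = F x (\<lambda>n. e (Suc n))"])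
  show "T (\<lambda>e. t (\<lambda>n. e (Suc n)))" by (rule T_ren[OF assms(1)])
  have "D (\<lambda>e. e 0 = F (e 1) (\<lambda>n. e (Suc (Suc n))))"
    using assms(2) unfolding T_def by simp
  from D_ren[OF this, of "\<lambda>i. if i = 0 then 1 else if i = 1 then 0 else i"]
  show "D (\<lambda>e. e (Suc 0) = F (e 0) (\<lambda>n. e (Suc (Suc n))))" by simp
qed

lemma T_subst1: "T (\<lambda>e. F (e 0)) \<Longrightarrow> T t \<Longrightarrow> T (\<lambda>e. F (t e))"
  by (rule T_subst)

lemma T_subst2:
  assumes "T (\<lambda>e. F (e 0) (e 1))" "T s" "T t"
  shows "T (\<lambda>e. F (s e) (t e))"
proof (rule T_subst[OF assms(2)], rule T_subst[of "\<lambda>e. t (\<lambda>n. e (Suc n))" "\<lambda>x e. F (e 0) x"])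
  show "T (\<lambda>e. t (\<lambda>n. e (Suc n)))" by (rule T_ren[OF assms(3)])
  show "T (\<lambda>e. F (e (Suc 0)) (e 0))"
    using T_ren[OF assms(1), of "\<lambda>i. if i = 0 then 1 else 0"] by simp
qed

lemma D_mem [D_intros]:
  assumes "T s" "T t"
  shows "D (\<lambda>e. s e \<epsilon> t e)"
proof (rule D_subst2[OF _ assms])
  show "D (\<lambda>e. e 0 \<epsilon> e 1)" by (rule D_satI[of _ "Mem 0 1" _ Some]) simp
qed

lemma D_eq [D_intros]:
  assumes "T s" "T t"
  shows "D (\<lambda>e. s e = t e)"
proof (rule D_subst2[OF _ assms])
  show "D (\<lambda>e. e 0 = e 1)" by (rule D_satI[of _ "Eq 0 1" _ Some]) simp
qed

lemma D_ex1 [D_intros]: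
  assumes "D (\<lambda>e. P (e 0) (\<lambda>n. e (Suc n)))"
  shows "D (\<lambda>e. \<exists>!x. P x e)"
proof -
  have "D (\<lambda>e. P (e 0) (\<lambda>n. e (Suc (Suc n))))"
    using D_ren[OF assms, of "case_nat 0 (\<lambda>n. Suc (Suc n))"] by simp
  then show ?thesis unfolding Ex1_def by (intro D_intros assms)
qed

lemma TI: "D (\<lambda>e. e 0 = t (\<lambda>n. e (Suc n))) \<Longrightarrow> T t"
  by (simp add: T_def)

lemma T_if [D_intros]:
  assumes "D P" "T s" "T t"
  shows "T (\<lambda>e. if P e then s e else t e)"
proof (rule TI)
  have "D (\<lambda>e. if P (\<lambda>n. e (Suc n)) then e 0 = s (\<lambda>n. e (Suc n)) else e 0 = t (\<lambda>n. e (Suc n)))"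
    by (intro D_intros D_ren[OF assms(1)] T_ren[OF assms(2)] T_ren[OF assms(3)])
  then show "D (\<lambda>e. e 0 = (if P (\<lambda>n. e (Suc n)) then s (\<lambda>n. e (Suc n)) else t (\<lambda>n. e (Suc n))))"
    by (simp add: if_distrib)
qed

text \<open>Makes the set notation of HOL available for the elements of the model.\<close>

definition elts :: "'a \<Rightarrow> 'a set" where
  "elts x = {u. u \<epsilon> x}"

lemma D_elts [D_intros]: "T s \<Longrightarrow> T t \<Longrightarrow> D (\<lambda>e. s e \<in> elts (t e))"
  unfolding elts_def by (simp add: D_mem)

lemma D_Collect [D_intros]: "D (\<lambda>e. P (s e) e) \<Longrightarrow> D (\<lambda>e. s e \<in> {x. P x e})"
  by simp

lemma D_Int [D_intros]: "D (\<lambda>e. s e \<in> A e) \<Longrightarrow> D (\<lambda>e. s e \<in> B e) \<Longrightarrow> D (\<lambda>e. s e \<in> A e \<inter> B e)"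
  by (simp add: D_and)

lemma D_Diff [D_intros]: "D (\<lambda>e. s e \<in> A e) \<Longrightarrow> D (\<lambda>e. s e \<in> B e) \<Longrightarrow> D (\<lambda>e. s e \<in> A e - B e)"
  by (simp add: D_and D_not)

lemma D_insert [D_intros]: "T s \<Longrightarrow> T a \<Longrightarrow> D (\<lambda>e. s e \<in> A e) \<Longrightarrow> D (\<lambda>e. s e \<in> insert (a e) (A e))"
  by (simp add: D_or D_eq)

lemma D_in_empty [D_intros]: "D (\<lambda>e. s e \<in> {})"
  by (simp add: D_const)

lemma D_Ball [D_intros]: "D (\<lambda>e. \<forall>x. x \<in> A e \<longrightarrow> P x e) \<Longrightarrow> D (\<lambda>e. \<forall>x\<in>A e. P x e)"
  by (simp add: Ball_def)

lemma D_Bex [D_intros]: "D (\<lambda>e. \<exists>x. x \<in> A e \<and> P x e) \<Longrightarrow> D (\<lambda>e. \<exists>x\<in>A e. P x e)"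
  by (simp add: Bex_def)

lemma D_image [D_intros]: "D (\<lambda>e. \<exists>x\<in>A e. s e = f x e) \<Longrightarrow> D (\<lambda>e. s e \<in> (\<lambda>x. f x e) ` A e)"
  by (simp add: image_iff)

lemma D_UN [D_intros]: "D (\<lambda>e. \<exists>x\<in>A e. s e \<in> B x e) \<Longrightarrow> D (\<lambda>e. s e \<in> (\<Union>x\<in>A e. B x e))"
  by simp

lemma D_subset [D_intros]: "D (\<lambda>e. \<forall>x\<in>A e. x \<in> B e) \<Longrightarrow> D (\<lambda>e. A e \<subseteq> B e)"
  by (simp add: subset_eq)

lemma D_set_eq [D_intros]:
  fixes A :: "(nat \<Rightarrow> 'a) \<Rightarrow> 'a set"
  shows "D (\<lambda>e. \<forall>x. x \<in> A e \<longleftrightarrow> x \<in> B e) \<Longrightarrow> D (\<lambda>e. A e = B e)"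
  by (simp add: set_eq_iff)

lemma D_inj_on [D_intros]:
  "D (\<lambda>e. \<forall>x\<in>A e. \<forall>y\<in>A e. f x e = f y e \<longrightarrow> x = y) \<Longrightarrow> D (\<lambda>e. inj_on (\<lambda>x. f x e) (A e))"
  by (simp add: inj_on_def)

section \<open>Sets of HOL that exist in the model, and definite descriptions\<close>

definition isset :: "'a set \<Rightarrow> bool" where
  "isset A \<longleftrightarrow> (\<exists>x. elts x = A)"

definition vempty :: 'a where
  "vempty = (SOME x. elts x = {})"

text \<open>The junk value \<open>vempty\<close> makes \<open>mk\<close> and \<open>the1\<close> definable without side conditions.\<close>

definition mk :: "'a set \<Rightarrow> 'a" where
  "mk A = (if isset A then SOME x. elts x = A else vempty)"

definition the1 :: "('a \<Rightarrow> bool) \<Rightarrow> 'a" where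
  "the1 P = (if \<exists>!x. P x then THE x. P x else vempty)"

lemma the1_eq: "P x \<Longrightarrow> (\<And>y. P y \<Longrightarrow> y = x) \<Longrightarrow> the1 P = x"
proof -
  assume *: "P x" "\<And>y. P y \<Longrightarrow> y = x"
  then have "\<exists>!x. P x" by blast
  moreover have "(THE x. P x) = x" using * by (rule the_equality)
  ultimately show ?thesis by (simp add: the1_def)
qed

lemma T_the1 [D_intros]:
  assumes "D (\<lambda>e. P (e 0) (\<lambda>n. e (Suc n)))"
  shows "T (\<lambda>e. the1 (\<lambda>x. P x e))"
proof (rule TI)
  have eq: "z = the1 Q \<longleftrightarrow> (if \<exists>!x. Q x then Q z else z = vempty)" for z Q
  proof (cases "\<exists>!x. Q x")
    case True
    then obtain a where "Q a" "\<And>x. Q x \<Longrightarrow> x = a" by blast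
    then have "the1 Q = a" "z = a \<longleftrightarrow> Q z" by (blast intro: the1_eq)+
    with True show ?thesis by simp
  qed (simp add: the1_def)
  have *: "D (\<lambda>e. P (e 0) (\<lambda>n. e (Suc (Suc n))))"
    using D_ren[OF assms, of "case_nat 0 (\<lambda>n. Suc (Suc n))"] by simp
  show "D (\<lambda>e. e 0 = the1 (\<lambda>x. P x (\<lambda>n. e (Suc n))))"
    unfolding eq by (intro D_intros * assms)
qed

end

section \<open>Set theory in a model\<close>

text \<open>The schemata range over \<open>D\<close>, that is, over first-order formulas with
  parameters from the model, and not over all predicates of HOL. This is exactly what a model of the
  first-order axioms provides.\<close>

locale zf = mem E for E :: "'a \<Rightarrow> 'a \<Rightarrow> bool" (infix "\<epsilon>" 50) +
  assumes ext: "(\<And>u. u \<epsilon> x \<longleftrightarrow> u \<epsilon> y) \<Longrightarrow> x = y"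
    and foundation: "u \<epsilon> x \<Longrightarrow> \<exists>y. y \<epsilon> x \<and> (\<forall>z. z \<epsilon> x \<longrightarrow> \<not> z \<epsilon> y)"
    and pairing: "\<exists>p. \<forall>u. u \<epsilon> p \<longleftrightarrow> u = x \<or> u = y"
    and union: "\<exists>y. \<forall>u. u \<epsilon> y \<longleftrightarrow> (\<exists>z. z \<epsilon> x \<and> u \<epsilon> z)"
    and power: "\<exists>y. \<forall>u. u \<epsilon> y \<longleftrightarrow> (\<forall>v. v \<epsilon> u \<longrightarrow> v \<epsilon> x)"
    and infinity: "\<exists>s. (\<exists>x. x \<epsilon> s \<and> (\<forall>u. \<not> u \<epsilon> x)) \<and>
      (\<forall>x. x \<epsilon> s \<longrightarrow> (\<exists>y. y \<epsilon> s \<and> (\<forall>u. u \<epsilon> y \<longleftrightarrow> u \<epsilon> x \<or> u = x)))"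
    and sep: "D (\<lambda>e. P (e 0)) \<Longrightarrow> \<exists>y. \<forall>u. u \<epsilon> y \<longleftrightarrow> u \<epsilon> x \<and> P u"
    and repl: "D (\<lambda>e. R (e 0) (e 1)) \<Longrightarrow> (\<And>u v w. R u v \<Longrightarrow> R u w \<Longrightarrow> v = w) \<Longrightarrow>
      \<exists>y. \<forall>v. v \<epsilon> y \<longleftrightarrow> (\<exists>u. u \<epsilon> x \<and> R u v)"
begin

lemma mem_elts: "u \<epsilon> x \<longleftrightarrow> u \<in> elts x"
  by (simp add: elts_def)

lemma elts_inject [simp]: "elts x = elts y \<longleftrightarrow> x = y"
  by (metis ext mem_elts)

lemma eltsI: "elts x = elts y \<Longrightarrow> x = y"
  by simp

lemma elts_mk: "isset A \<Longrightarrow> elts (mk A) = A"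
  by (auto simp: mk_def isset_def intro: someI_ex)

lemma isset_elts [simp, intro]: "isset (elts x)"
  by (auto simp: isset_def)

lemma issetI: "(\<And>u. u \<epsilon> y \<longleftrightarrow> u \<in> A) \<Longrightarrow> isset A"
  by (auto simp: isset_def elts_def intro!: exI[of _ y])

lemma isset_sub: "isset B \<Longrightarrow> A \<subseteq> B \<Longrightarrow> D (\<lambda>e. e 0 \<in> A) \<Longrightarrow> isset A"
proof -
  assume "isset B" "A \<subseteq> B" "D (\<lambda>e. e 0 \<in> A)"
  then obtain x where "B = elts x" by (auto simp: isset_def)
  moreover obtain y where "\<forall>u. u \<epsilon> y \<longleftrightarrow> u \<epsilon> x \<and> u \<in> A"
    using sep[OF \<open>D (\<lambda>e. e 0 \<in> A)\<close>] by blast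
  ultimately show ?thesis using \<open>A \<subseteq> B\<close> by (auto simp: isset_def mem_elts intro!: exI[of _ y])
qed

lemma isset_empty [simp, intro]: "isset {}"
  by (rule isset_sub[OF isset_elts empty_subsetI]) (intro D_intros)

lemma elts_vempty [simp]: "elts vempty = {}"
  using isset_empty unfolding isset_def vempty_def by (rule someI_ex)

lemma elts_eq_empty [simp]: "elts x = {} \<longleftrightarrow> x = vempty"
  by (metis elts_inject elts_vempty)

lemma isset_pair [simp, intro]: "isset {a, b}"
  using pairing[of a b] by (auto simp: isset_def mem_elts)

lemma isset_sing [simp, intro]: "isset {a}"
  using isset_pair[of a a] by simp

lemma isset_Union: "isset (\<Union>z\<in>elts x. elts z)"
proof -
  obtain y where "\<And>u. u \<epsilon> y \<longleftrightarrow> (\<exists>z. z \<epsilon> x \<and> u \<epsilon> z)" using union[of x] by blast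
  then show ?thesis by (intro issetI[of y]) (auto simp: mem_elts)
qed

lemma isset_Un [intro]:
  assumes "isset A" "isset B"
  shows "isset (A \<union> B)"
proof -
  obtain x y where xy: "A = elts x" "B = elts y" using assms by (auto simp: isset_def)
  obtain z where "elts z = {x, y}" using isset_pair unfolding isset_def by blast
  with isset_Union[of z] xy show ?thesis by simp
qed

lemma isset_insert [intro]: "isset A \<Longrightarrow> isset (insert a A)"
  using isset_Un[of "{a}" A] by simp

lemma isset_Pow [intro]: "isset A \<Longrightarrow> isset {y. elts y \<subseteq> A}"
proof -
  assume "isset A"
  then obtain x where "A = elts x" by (auto simp: isset_def)
  moreover obtain z where "\<And>u. u \<epsilon> z \<longleftrightarrow> (\<forall>v. v \<epsilon> u \<longrightarrow> v \<epsilon> x)" using power[of x] by blast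
  ultimately show ?thesis by (intro issetI[of z]) (auto simp: mem_elts)
qed

lemma isset_image [intro]:
  assumes "T (\<lambda>e. F (e 0))" "isset A"
  shows "isset (F ` A)"
proof -
  obtain x where "A = elts x" using assms by (auto simp: isset_def)
  moreover have "D (\<lambda>e. e 1 = F (e 0))"
    by (intro D_intros assms)
  then have "D (\<lambda>e. e 1 = F (e 0))" by simp
  from repl[OF this, of x] obtain y where "\<And>v. v \<epsilon> y \<longleftrightarrow> (\<exists>u. u \<epsilon> x \<and> v = F u)" by blast
  ultimately show ?thesis by (intro issetI[of y]) (auto simp: mem_elts)
qed

lemma T_mk [D_intros]:
  assumes "D (\<lambda>e. e 0 \<in> A (\<lambda>n. e (Suc n)))"
  shows "T (\<lambda>e. mk (A e))"
proof -
  have eq: "mk B = the1 (\<lambda>x. \<forall>u. u \<epsilon> x \<longleftrightarrow> u \<in> B)" for B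
  proof (cases "isset B")
    case True
    then have "\<forall>u. u \<epsilon> mk B \<longleftrightarrow> u \<in> B" by (simp add: mem_elts elts_mk)
    then show ?thesis by (intro the1_eq[symmetric]) (auto intro: ext)
  next
    case False
    then have "\<not> (\<exists>x. \<forall>u. u \<epsilon> x \<longleftrightarrow> u \<in> B)" by (auto simp: isset_def mem_elts)
    then show ?thesis unfolding the1_def mk_def using False by auto
  qed
  have "D (\<lambda>e. e 0 \<in> A (\<lambda>n. e (Suc (Suc n))))"
    using D_ren[OF assms, of "case_nat 0 (\<lambda>n. Suc (Suc n))"] by simp
  then show ?thesis unfolding eq by (intro D_intros)
qed

lemma isset_UN:
  assumes "isset A" "\<And>x. x \<in> A \<Longrightarrow> isset (B x)" "D (\<lambda>e. e 0 \<in> B (e 1))"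
  shows "isset (\<Union>x\<in>A. B x)"
proof -
  have "T (\<lambda>e. mk (B (e 0)))" using assms(3) by (intro D_intros) simp
  then have "isset ((\<lambda>x. mk (B x)) ` A)" using assms(1) by (rule isset_image)
  then obtain y where y: "elts y = (\<lambda>x. mk (B x)) ` A" by (auto simp: isset_def)
  have "(\<Union>z\<in>elts y. elts z) = (\<Union>x\<in>A. B x)" using assms(2) by (simp add: y elts_mk)
  then show ?thesis using isset_Union[of y] by simp
qed

definition upair where "upair a b = mk {a, b}"
definition vUnion where "vUnion x = mk (\<Union>z\<in>elts x. elts z)"
definition vpow where "vpow x = mk {y. elts y \<subseteq> elts x}"
definition vsucc where "vsucc x = mk (insert x (elts x))"
definition pair where "pair a b = upair (upair a a) (upair a b)"
definition times where "times a b = mk (\<Union>x\<in>elts a. (\<lambda>y. pair x y) ` elts b)"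
definition app where "app f x = the1 (\<lambda>y. pair x y \<in> elts f)"
definition lam where "lam a F = mk ((\<lambda>x. pair x (F x)) ` elts a)"

definition isfun where
  "isfun f a \<longleftrightarrow> (\<forall>p\<in>elts f. \<exists>x\<in>elts a. \<exists>y. p = pair x y) \<and> (\<forall>x\<in>elts a. \<exists>!y. pair x y \<in> elts f)"

lemma T_upair [D_intros]: "T s \<Longrightarrow> T t \<Longrightarrow> T (\<lambda>e. upair (s e) (t e))"
  by (rule T_subst2[of upair]) (unfold upair_def, intro D_intros)

lemma T_vUnion [D_intros]: "T s \<Longrightarrow> T (\<lambda>e. vUnion (s e))"
  by (rule T_subst1[of vUnion]) (unfold vUnion_def, intro D_intros)

lemma T_vpow [D_intros]: "T s \<Longrightarrow> T (\<lambda>e. vpow (s e))"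
  by (rule T_subst1[of vpow]) (unfold vpow_def, intro D_intros)

lemma T_vsucc [D_intros]: "T s \<Longrightarrow> T (\<lambda>e. vsucc (s e))"
  by (rule T_subst1[of vsucc]) (unfold vsucc_def, intro D_intros)

lemma T_pair [D_intros]: "T s \<Longrightarrow> T t \<Longrightarrow> T (\<lambda>e. pair (s e) (t e))"
  by (rule T_subst2[of pair]) (unfold pair_def, intro D_intros)

lemma T_app [D_intros]: "T s \<Longrightarrow> T t \<Longrightarrow> T (\<lambda>e. app (s e) (t e))"
  by (rule T_subst2[of app]) (unfold app_def, intro D_intros)

lemma T_lam [D_intros]:
  assumes "T a" "T (\<lambda>e. F (e 0) (\<lambda>n. e (Suc n)))"
  shows "T (\<lambda>e. lam (a e) (\<lambda>x. F x e))"
proof -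
  have "T (\<lambda>e. F (e 0) (\<lambda>n. e (Suc (Suc n))))"
    using T_ren[OF assms(2), of "case_nat 0 (\<lambda>n. Suc (Suc n))"] by simp
  then show ?thesis unfolding lam_def by (intro D_intros T_ren[OF assms(1)])
qed

lemma D_isfun [D_intros]: "T s \<Longrightarrow> T t \<Longrightarrow> D (\<lambda>e. isfun (s e) (t e))"
  by (rule D_subst2[of isfun]) (unfold isfun_def, intro D_intros)

lemma elts_upair [simp]: "elts (upair a b) = {a, b}"
  by (simp add: upair_def elts_mk)

lemma elts_vUnion [simp]: "elts (vUnion x) = (\<Union>z\<in>elts x. elts z)"
  by (simp add: vUnion_def elts_mk isset_Union)

lemma elts_vpow [simp]: "elts (vpow x) = {y. elts y \<subseteq> elts x}"
  by (simp add: vpow_def elts_mk isset_Pow)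

lemma elts_vsucc [simp]: "elts (vsucc x) = insert x (elts x)"
  by (simp add: vsucc_def elts_mk isset_insert)

lemma upair_eq: "p = upair a b \<longleftrightarrow> elts p = {a, b}"
  by (metis elts_inject elts_upair)

lemma pair_inject [simp]: "pair a b = pair c d \<longleftrightarrow> a = c \<and> b = d"
proof
  assume "pair a b = pair c d"
  then have "{upair a a, upair a b} = {upair c c, upair c d}"
    unfolding pair_def by (metis elts_upair)
  then show "a = c \<and> b = d"
    by (auto simp: doubleton_eq_iff upair_eq)
qed simp

lemma elts_times: "elts (times a b) = (\<Union>x\<in>elts a. (\<lambda>y. pair x y) ` elts b)"
  unfolding times_def
  by (rule elts_mk, rule isset_UN) (auto intro!: D_intros isset_image)

lemma pair_mem_times [simp]: "pair x y \<in> elts (times a b) \<longleftrightarrow> x \<in> elts a \<and> y \<in> elts b"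
  by (auto simp: elts_times)

lemma mem_timesE [elim!]:
  assumes "p \<in> elts (times a b)"
  obtains x y where "p = pair x y" "x \<in> elts a" "y \<in> elts b"
  using assms by (auto simp: elts_times)

lemma elts_lam: "T (\<lambda>e. F (e 0)) \<Longrightarrow> elts (lam a F) = (\<lambda>x. pair x (F x)) ` elts a"
  unfolding lam_def by (rule elts_mk, rule isset_image) (auto intro!: D_intros)

lemma app_lam: "T (\<lambda>e. F (e 0)) \<Longrightarrow> x \<in> elts a \<Longrightarrow> app (lam a F) x = F x"
  unfolding app_def by (rule the1_eq) (auto simp: mem_elts elts_lam)

lemma isfun_lam: "T (\<lambda>e. F (e 0)) \<Longrightarrow> isfun (lam a F) a"
  by (auto simp: isfun_def elts_lam mem_elts)

lemma isfun_app: "isfun f a \<Longrightarrow> x \<in> elts a \<Longrightarrow> pair x y \<in> elts f \<longleftrightarrow> y = app f x"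
proof -
  assume "isfun f a" "x \<in> elts a"
  then have ex: "\<exists>!y. pair x y \<in> elts f" by (auto simp: isfun_def)
  then have "pair x (app f x) \<in> elts f" using theI'[OF ex] ex by (simp add: app_def the1_def)
  with ex show ?thesis by auto
qed

lemma isfun_elts: "isfun f a \<Longrightarrow> elts f = (\<lambda>x. pair x (app f x)) ` elts a"
proof (intro equalityI subsetI)
  fix p assume f: "isfun f a" and p: "p \<in> elts f"
  then obtain x y where "x \<in> elts a" "p = pair x y" by (auto simp: isfun_def)
  then show "p \<in> (\<lambda>x. pair x (app f x)) ` elts a"
    using p isfun_app[OF f] by (auto simp: mem_elts)
next
  fix p assume f: "isfun f a" and p: "p \<in> (\<lambda>x. pair x (app f x)) ` elts a"
  then show "p \<in> elts f" using isfun_app[OF f] by (auto simp: mem_elts)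
qed

lemma not_self: "\<not> x \<epsilon> x"
  using foundation[of x "upair x x"] by (auto simp: mem_elts)

lemma not_self_elts [simp]: "x \<notin> elts x"
  using not_self by (simp add: mem_elts)

lemma not_cycle2: "x \<in> elts y \<Longrightarrow> y \<notin> elts x"
  using foundation[of x "upair x y"] by (auto simp: mem_elts)

end

context zf
begin

subsection \<open>Natural numbers, induction and recursion on membership\<close>

definition succ_closed where
  "succ_closed s \<longleftrightarrow> vempty \<in> elts s \<and> (\<forall>x\<in>elts s. vsucc x \<in> elts s)"

lemma D_succ_closed [D_intros]: "T s \<Longrightarrow> D (\<lambda>e. succ_closed (s e))"
  by (rule D_subst1[of succ_closed]) (unfold succ_closed_def, intro D_intros)

definition omega where
  "omega = mk {n. \<forall>s. succ_closed s \<longrightarrow> n \<in> elts s}"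

lemma elts_omega: "elts omega = {n. \<forall>s. succ_closed s \<longrightarrow> n \<in> elts s}"
proof -
  obtain s where s: "\<exists>x. x \<epsilon> s \<and> (\<forall>u. \<not> u \<epsilon> x)"
      "\<And>x. x \<epsilon> s \<Longrightarrow> \<exists>y. y \<epsilon> s \<and> (\<forall>u. u \<epsilon> y \<longleftrightarrow> u \<epsilon> x \<or> u = x)"
    using infinity by blast
  obtain x where "x \<in> elts s" "elts x = {}" using s(1) by (auto simp: elts_def)
  moreover have "vsucc x \<in> elts s" if "x \<in> elts s" for x
  proof -
    have "x \<epsilon> s" using that by (simp add: mem_elts)
    from s(2)[OF this] obtain y where y: "y \<epsilon> s" "\<forall>u. u \<epsilon> y \<longleftrightarrow> u \<epsilon> x \<or> u = x" by (elim exE conjE)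
    then have "elts y = insert x (elts x)" by (simp add: elts_def set_eq_iff disj_commute)
    with y(1) have "y \<in> elts s" "elts y = insert x (elts x)" by (simp_all add: mem_elts)
    then show ?thesis by (metis elts_inject elts_vsucc)
  qed
  ultimately have "succ_closed s" by (auto simp: succ_closed_def)
  then show ?thesis unfolding omega_def
    by (intro elts_mk isset_sub[OF isset_elts[of s]]) (auto intro!: D_intros)
qed

lemma zero_omega [simp]: "vempty \<in> elts omega"
  by (auto simp: elts_omega succ_closed_def)

lemma succ_omega [simp]: "n \<in> elts omega \<Longrightarrow> vsucc n \<in> elts omega"
  by (auto simp: elts_omega succ_closed_def)

text \<open>Restricted to definable \<open>P\<close>: in a nonstandard model \<open>omega\<close>
  has elements that no numeral reaches, and the argument needs the set of all \<open>n\<close> with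
  \<open>P n\<close> to exist in the model.\<close>

lemma omega_induct [consumes 1, case_names D zero succ]:
  assumes "n \<in> elts omega" "D (\<lambda>e. P (e 0))" "P vempty"
    "\<And>n. n \<in> elts omega \<Longrightarrow> P n \<Longrightarrow> P (vsucc n)"
  shows "P n"
proof -
  let ?A = "{n \<in> elts omega. P n}"
  have "D (\<lambda>e. e 0 \<in> ?A)" using assms(2) by (intro D_intros)
  then have "elts (mk ?A) = ?A" by (intro elts_mk isset_sub[OF isset_elts[of omega]]) auto
  then have "succ_closed (mk ?A)" using assms(3,4) by (auto simp: succ_closed_def)
  with assms(1) have "n \<in> elts (mk ?A)" unfolding elts_omega by blast
  with \<open>elts (mk ?A) = ?A\<close> show ?thesis by auto
qed

lemma omega_trans: "n \<in> elts omega \<Longrightarrow> elts n \<subseteq> elts omega"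
proof (induction n rule: omega_induct)
  show "D (\<lambda>e. elts (e 0) \<subseteq> elts omega)" by (intro D_intros)
qed auto

definition transitive where
  "transitive x \<longleftrightarrow> (\<forall>y\<in>elts x. elts y \<subseteq> elts x)"

lemma D_transitive [D_intros]: "T s \<Longrightarrow> D (\<lambda>e. transitive (s e))"
  by (rule D_subst1[of transitive]) (unfold transitive_def, intro D_intros)

lemma transitive_superset: "\<exists>t. transitive t \<and> elts x \<subseteq> elts t"
proof -
  define att where "att f n \<longleftrightarrow> app f vempty = x \<and>
    (\<forall>k\<in>elts n. app f (vsucc k) = vUnion (app f k))" for f n
  have D_att: "T s \<Longrightarrow> T t \<Longrightarrow> D (\<lambda>e. att (s e) (t e))" for s t
    by (rule D_subst2[of att]) (unfold att_def, intro D_intros)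
  have ex: "\<exists>f. att f n" if "n \<in> elts omega" for n
    using that
  proof (induction n rule: omega_induct)
    show "D (\<lambda>e. \<exists>f. att f (e 0))" by (intro D_intros D_att)
    have "T (\<lambda>e. x)" by (intro D_intros)
    then show "\<exists>f. att f vempty"
      by (intro exI[of _ "lam omega (\<lambda>_. x)"]) (simp add: att_def app_lam)
  next
    fix n assume n: "n \<in> elts omega" and "\<exists>f. att f n"
    then obtain f where f: "att f n" by blast
    define F where "F k = (if k = vsucc n then vUnion (app f n) else app f k)" for k
    have F: "T (\<lambda>e. F (e 0))" unfolding F_def by (intro D_intros)
    have a: "app (lam omega F) k = F k" if "k \<in> elts omega" for k
      using F that by (rule app_lam)
    have "vsucc n \<noteq> vempty" by (metis elts_vempty elts_vsucc insert_not_empty)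
    moreover have "k \<noteq> vsucc n" "vsucc k \<noteq> vsucc n" "k \<in> elts omega" if "k \<in> elts n" for k
    proof -
      show "k \<noteq> vsucc n" using not_cycle2[OF that] by auto
      have "n \<noteq> k" using that by auto
      moreover have "n \<notin> elts k" using not_cycle2[OF that] .
      ultimately show "vsucc k \<noteq> vsucc n" by (metis elts_vsucc insert_iff)
      show "k \<in> elts omega" using omega_trans[OF n] that by auto
    qed
    moreover have "n \<noteq> vsucc n" by (metis elts_vsucc insertI1 not_self_elts)
    ultimately have "att (lam omega F) (vsucc n)"
      using f n by (auto simp: att_def a) (auto simp: F_def)
    then show "\<exists>f. att f (vsucc n)" by blast
  qed
  have uniq: "\<forall>f g. att f n \<and> att g n \<longrightarrow> app f n = app g n" if "n \<in> elts omega" for n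
    using that
  proof (induction n rule: omega_induct)
    show "D (\<lambda>e. \<forall>f g. att f (e 0) \<and> att g (e 0) \<longrightarrow> app f (e 0) = app g (e 0))"
      by (intro D_intros D_att)
  next
    case (succ n)
    have "att f n" "app f (vsucc n) = vUnion (app f n)" if "att f (vsucc n)" for f
      using that by (simp_all add: att_def)
    with succ show ?case by metis
  qed (simp add: att_def)
  define G where "G n = the1 (\<lambda>y. \<exists>f. att f n \<and> y = app f n)" for n
  have T_G: "T (\<lambda>e. G (e 0))" unfolding G_def by (intro D_intros D_att)
  have G: "G n = app f n" if "n \<in> elts omega" "att f n" for n f
    unfolding G_def using that uniq by (intro the1_eq) blast+
  have G0: "G vempty = x" using ex[of vempty] G by (auto simp: att_def)
  have Gs: "G (vsucc n) = vUnion (G n)" if n: "n \<in> elts omega" for n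
  proof -
    obtain f where f: "att f (vsucc n)" using ex[of "vsucc n"] n by auto
    then have "att f n" "app f (vsucc n) = vUnion (app f n)" by (auto simp: att_def)
    then show ?thesis using G[OF n] G[OF succ_omega[OF n] f] by simp
  qed
  let ?A = "\<Union>n\<in>elts omega. elts (G n)"
  have "isset ?A"
    by (rule isset_UN) (auto intro!: D_intros T_subst1[OF T_G])
  then have t: "elts (mk ?A) = ?A" by (rule elts_mk)
  have "transitive (mk ?A)" unfolding transitive_def t
  proof
    fix y assume "y \<in> ?A"
    then obtain n where "n \<in> elts omega" "y \<in> elts (G n)" by blast
    then have "elts y \<subseteq> elts (G (vsucc n))" "vsucc n \<in> elts omega" by (auto simp: Gs)
    then show "elts y \<subseteq> ?A" by blast
  qed
  moreover have "elts x \<subseteq> ?A" using G0 by (intro UN_upper[THEN subset_trans[rotated]]) auto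
  ultimately show ?thesis using t by (intro exI[of _ "mk ?A"]) auto
qed

lemma transitive_superset_mem: "\<exists>t. transitive t \<and> x \<in> elts t"
proof -
  obtain t where t: "transitive t" "elts x \<subseteq> elts t" using transitive_superset by blast
  have "elts (mk (insert x (elts t))) = insert x (elts t)" by (intro elts_mk) auto
  then show ?thesis using t by (intro exI[of _ "mk (insert x (elts t))"]) (auto simp: transitive_def)
qed

text \<open>Foundation speaks about sets only, so it is applied to the counterexamples inside a
  transitive set around \<open>x\<close>.\<close>

lemma mem_induct [case_names D step]:
  assumes "D (\<lambda>e. P (e 0))" "\<And>x. (\<And>y. y \<in> elts x \<Longrightarrow> P y) \<Longrightarrow> P x"
  shows "P x"
proof (rule ccontr)
  assume "\<not> P x"
  obtain t where t: "transitive t" "x \<in> elts t" using transitive_superset_mem by blast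
  let ?A = "{y \<in> elts t. \<not> P y}"
  have "D (\<lambda>e. e 0 \<in> ?A)" using assms(1) by (intro D_intros)
  then have A: "elts (mk ?A) = ?A" by (intro elts_mk isset_sub[OF isset_elts[of t]]) auto
  then have "x \<epsilon> mk ?A" using t \<open>\<not> P x\<close> by (simp add: mem_elts)
  from foundation[OF this] obtain y where "y \<in> ?A" "\<And>z. z \<in> ?A \<Longrightarrow> z \<notin> elts y"
    by (auto simp: mem_elts A)
  then show False using assms(2)[of y] t by (auto simp: transitive_def)
qed

definition rec_att where
  "rec_att G f a \<longleftrightarrow> transitive a \<and> isfun f a \<and> (\<forall>z\<in>elts a. app f z = G z (lam z (app f)))"

definition rec where
  "rec G x = the1 (\<lambda>y. \<exists>f a. rec_att G f a \<and> x \<in> elts a \<and> y = app f x)"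

lemma D_rec_att:
  assumes "T (\<lambda>e. G (e 0) (e 1))" "T s" "T t"
  shows "D (\<lambda>e. rec_att G (s e) (t e))"
  by (rule D_subst2[of "rec_att G", OF _ assms(2,3)])
    (unfold rec_att_def, intro D_intros T_subst2[OF assms(1)])

lemma T_rec:
  assumes "T (\<lambda>e. G (e 0) (e 1))" "T s"
  shows "T (\<lambda>e. rec G (s e))"
  by (rule T_subst1[of "rec G", OF _ assms(2)]) (unfold rec_def, intro D_intros D_rec_att assms(1))

lemma lam_cong: "(\<And>x. x \<in> elts a \<Longrightarrow> F x = G x) \<Longrightarrow> lam a F = lam a G"
  unfolding lam_def by (intro arg_cong[of _ _ mk] image_cong) auto

lemma rec_att_unique:
  assumes G: "T (\<lambda>e. G (e 0) (e 1))" and "rec_att G f a" "rec_att G g b"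
  shows "x \<in> elts a \<Longrightarrow> x \<in> elts b \<Longrightarrow> app f x = app g x"
proof (induction x rule: mem_induct)
  show "D (\<lambda>e. e 0 \<in> elts a \<longrightarrow> e 0 \<in> elts b \<longrightarrow> app f (e 0) = app g (e 0))" by (intro D_intros)
next
  case (step x)
  then have "lam x (app f) = lam x (app g)"
    using assms(2,3) by (intro lam_cong step.IH) (auto simp: rec_att_def transitive_def)
  moreover have "app f x = G x (lam x (app f))" "app g x = G x (lam x (app g))"
    using step.prems assms(2,3) unfolding rec_att_def by blast+
  ultimately show ?case by simp
qed

text \<open>By induction on membership every \<open>x\<close> lies in the domain of an attempt: a
  function on a transitive set that obeys the recursion. Attempts agree where both are defined, so
  that \<open>rec G\<close> is well defined.\<close>

lemma rec_eq:
  assumes G: "T (\<lambda>e. G (e 0) (e 1))"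
  shows "rec G x = G x (lam x (rec G))"
proof -
  define F where "F = rec G"
  have F: "F x = app f x" if "rec_att G f a" "x \<in> elts a" for f a x
    unfolding F_def rec_def using that rec_att_unique[OF G] by (intro the1_eq) blast+
  have F_eq: "F x = G x (lam x F)" if "rec_att G f a" "x \<in> elts a" for f a x
  proof -
    have "lam x F = lam x (app f)"
      using that F by (intro lam_cong F[of f a]) (auto simp: rec_att_def transitive_def)
    then show ?thesis using that F[OF that] by (simp add: rec_att_def)
  qed
  have TF: "T s \<Longrightarrow> T (\<lambda>e. F (s e))" for s unfolding F_def using G by (rule T_rec)
  have "\<exists>f a. rec_att G f a \<and> x \<in> elts a" for x
  proof (induction x rule: mem_induct)
    show "D (\<lambda>e. \<exists>f a. rec_att G f a \<and> e 0 \<in> elts a)" by (intro D_intros D_rec_att G)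
  next
    case (step x)
    obtain t where t: "transitive t" "elts x \<subseteq> elts t" using transitive_superset by blast
    \<comment> \<open>\<open>B\<close> consists of the elements of \<open>t\<close> that some
      attempt covers. It is transitive and contains all elements of \<open>x\<close>, so that adding
      \<open>x\<close> to it yields the domain of an attempt that reaches \<open>x\<close>.\<close>
    define B where "B = {z \<in> elts t. \<exists>f a. rec_att G f a \<and> z \<in> elts a}"
    have "D (\<lambda>e. e 0 \<in> B)" unfolding B_def by (intro D_intros D_rec_att G)
    then have "isset B" by (intro isset_sub[OF isset_elts[of t]]) (auto simp: B_def)
    then have b: "elts (mk (insert x B)) = insert x B" by (intro elts_mk) auto
    let ?b = "mk (insert x B)"
    have xB: "elts x \<subseteq> B" using t step by (auto simp: B_def)
    have B: "elts z \<subseteq> B" if "z \<in> B" for z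
    proof
      fix y assume "y \<in> elts z"
      from that obtain f a where "z \<in> elts t" "rec_att G f a" "z \<in> elts a" by (auto simp: B_def)
      with \<open>y \<in> elts z\<close> have "y \<in> elts t" "y \<in> elts a"
        using t(1) unfolding transitive_def rec_att_def by blast+
      with \<open>rec_att G f a\<close> show "y \<in> B" by (auto simp: B_def)
    qed
    have trb: "transitive ?b" unfolding transitive_def b using xB B by auto
    have TG: "T (\<lambda>e. G (e 0) (lam (e 0) F))" by (intro T_subst2[OF G] D_intros TF)
    define f where "f = lam ?b (\<lambda>z. G z (lam z F))"
    have f: "app f z = G z (lam z F)" if "z \<in> insert x B" for z
      unfolding f_def using that b by (intro app_lam TG) auto
    have "app f z = G z (lam z (app f))" if "z \<in> insert x B" for z
    proof -
      have "lam z F = lam z (app f)"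
      proof (rule lam_cong)
        fix y assume "y \<in> elts z"
        then have "y \<in> B" using that xB B by auto
        then show "F y = app f y" using F_eq f by (auto simp: B_def)
      qed
      then show ?thesis using f that by simp
    qed
    then have "rec_att G f ?b"
      unfolding rec_att_def using trb b isfun_lam[OF TG] by (auto simp: f_def)
    then show ?case using b by blast
  qed
  then show ?thesis using F_eq F_def by metis
qed

subsection \<open>Ordinals\<close>

text \<open>Under foundation, hereditary transitivity already makes membership a well-order on
  \<open>x\<close>. This form is the convenient one for induction; \<open>S_ordinal\<close> shows
  that it agrees with the official formula.\<close>

definition Ord where
  "Ord x \<longleftrightarrow> transitive x \<and> (\<forall>y\<in>elts x. transitive y)"

lemma D_Ord [D_intros]: "T s \<Longrightarrow> D (\<lambda>e. Ord (s e))"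
  by (rule D_subst1[of Ord]) (unfold Ord_def, intro D_intros)

lemma Ord_mem: "Ord x \<Longrightarrow> y \<in> elts x \<Longrightarrow> Ord y"
  unfolding Ord_def transitive_def by blast

lemma Ord_trans: "Ord x \<Longrightarrow> y \<in> elts x \<Longrightarrow> elts y \<subseteq> elts x"
  unfolding Ord_def transitive_def by blast

lemma Ord_trans2: "Ord x \<Longrightarrow> z \<in> elts y \<Longrightarrow> y \<in> elts x \<Longrightarrow> z \<in> elts x"
  using Ord_trans by blast

lemma Ord_empty [simp]: "Ord vempty"
  by (simp add: Ord_def transitive_def)

lemma Ord_succ [simp]: "Ord x \<Longrightarrow> Ord (vsucc x)"
  by (auto simp: Ord_def transitive_def)

lemma Ord_Union: "(\<And>y. y \<in> elts x \<Longrightarrow> Ord y) \<Longrightarrow> Ord (vUnion x)"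
  by (fastforce simp: Ord_def transitive_def)

lemma omega_Ord: "n \<in> elts omega \<Longrightarrow> Ord n"
proof (induction n rule: omega_induct)
  show "D (\<lambda>e. Ord (e 0))" by (intro D_intros)
qed auto

lemma Ord_omega [simp]: "Ord omega"
  using omega_Ord omega_trans by (auto simp: Ord_def transitive_def)

lemma Ord_induct [consumes 1, case_names D step]:
  assumes "Ord x" "D (\<lambda>e. P (e 0))"
    "\<And>x. Ord x \<Longrightarrow> (\<And>y. y \<in> elts x \<Longrightarrow> P y) \<Longrightarrow> P x"
  shows "P x"
proof -
  have "Ord x \<longrightarrow> P x"
  proof (induction x rule: mem_induct)
    show "D (\<lambda>e. Ord (e 0) \<longrightarrow> P (e 0))" using assms(2) by (intro D_intros)
  qed (use assms(3) Ord_mem in blast)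
  with assms(1) show ?thesis by blast
qed

lemma Ord_least:
  assumes "D (\<lambda>e. P (e 0))" "Ord x" "P x"
  obtains y where "Ord y" "P y" "\<And>z. z \<in> elts y \<Longrightarrow> \<not> P z" "elts y \<subseteq> elts x"
proof -
  have "\<exists>y. Ord y \<and> P y \<and> (\<forall>z\<in>elts y. \<not> P z) \<and> elts y \<subseteq> elts x"
  proof (rule ccontr)
    assume *: "\<not> ?thesis"
    have "\<not> (elts y \<subseteq> elts x \<and> P y)" if "Ord y" for y
      using that
    proof (induction y rule: Ord_induct)
      show "D (\<lambda>e. \<not> (elts (e 0) \<subseteq> elts x \<and> P (e 0)))" using assms(1) by (intro D_intros)
    next
      case (step y)
      then have "\<forall>z\<in>elts y. \<not> P z" if "elts y \<subseteq> elts x" using that Ord_trans by blast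
      then show ?case using * step(1) by blast
    qed
    then show False using assms by blast
  qed
  then show ?thesis using that by blast
qed

lemma Ord_linear: "Ord x \<Longrightarrow> Ord y \<Longrightarrow> x \<in> elts y \<or> x = y \<or> y \<in> elts x"
proof -
  assume "Ord x" "Ord y"
  have "\<forall>y. Ord y \<longrightarrow> x \<in> elts y \<or> x = y \<or> y \<in> elts x"
    using \<open>Ord x\<close>
  proof (induction x rule: Ord_induct)
    show "D (\<lambda>e. \<forall>y. Ord y \<longrightarrow> e 0 \<in> elts y \<or> e 0 = y \<or> y \<in> elts (e 0))" by (intro D_intros)
  next
    case (step x)
    show ?case
    proof (intro allI impI)
      fix y assume "Ord y"
      then show "x \<in> elts y \<or> x = y \<or> y \<in> elts x"
      proof (induction y rule: Ord_induct)
        show "D (\<lambda>e. x \<in> elts (e 0) \<or> x = e 0 \<or> e 0 \<in> elts x)" by (intro D_intros)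
      next
        fix y assume y: "Ord y" "\<And>z. z \<in> elts y \<Longrightarrow> x \<in> elts z \<or> x = z \<or> z \<in> elts x"
        have "x = y" if "x \<notin> elts y" "y \<notin> elts x"
        proof (rule eltsI, intro equalityI subsetI)
          fix z assume "z \<in> elts x"
          then show "z \<in> elts y" using step y(1) that Ord_trans2[OF step(1)] by blast
        next
          fix z assume "z \<in> elts y"
          then show "z \<in> elts x" using y that Ord_trans2[OF y(1)] by blast
        qed
        then show "x \<in> elts y \<or> x = y \<or> y \<in> elts x" by blast
      qed
    qed
  qed
  then show ?thesis using \<open>Ord y\<close> by blast
qed

lemma Ord_subset_iff: "Ord x \<Longrightarrow> Ord y \<Longrightarrow> elts x \<subseteq> elts y \<longleftrightarrow> x \<in> elts y \<or> x = y"
  by (metis Ord_linear Ord_trans not_self_elts subset_iff)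

lemma Ord_not_mem: "Ord x \<Longrightarrow> Ord y \<Longrightarrow> x \<notin> elts y \<longleftrightarrow> elts y \<subseteq> elts x"
  by (metis Ord_linear Ord_subset_iff not_self_elts not_cycle2)

lemma succ_mem_succ: "Ord y \<Longrightarrow> x \<in> elts y \<Longrightarrow> vsucc x \<in> elts (vsucc y)"
proof -
  assume y: "Ord y" and "x \<in> elts y"
  then have "elts (vsucc x) \<subseteq> elts y" using Ord_trans by auto
  then show ?thesis using Ord_subset_iff[of "vsucc x" y] y \<open>x \<in> elts y\<close> Ord_mem by auto
qed

lemma vsucc_inject [simp]: "vsucc x = vsucc y \<longleftrightarrow> x = y"
  by (metis elts_vsucc insert_iff not_cycle2)

lemma vsucc_not_empty [simp]: "vsucc x \<noteq> vempty"
  by (metis elts_vempty elts_vsucc insert_not_empty)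

text \<open>Burali-Forti: a set of all ordinals would contain the successor of its own
  union.\<close>

lemma no_set_of_ordinals: "\<exists>x. Ord x \<and> x \<notin> elts a"
proof (rule ccontr)
  assume *: "\<not> ?thesis"
  let ?A = "{x \<in> elts a. Ord x}"
  have A: "elts (mk ?A) = ?A" by (intro elts_mk isset_sub[OF isset_elts[of a]]) (auto intro!: D_intros)
  then have "Ord (vsucc (vUnion (mk ?A)))" by (intro Ord_succ Ord_Union) auto
  then have "vsucc (vUnion (mk ?A)) \<in> elts (mk ?A)" using * A by auto
  then have "vUnion (mk ?A) \<in> elts (vUnion (mk ?A))"
    by (metis UN_I elts_vUnion elts_vsucc insertI1)
  then show False by (metis not_self_elts)
qed

end

section \<open>Choice and cardinals\<close>

context zf
begin

lemma D_bij_betw [D_intros]: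
  "D (\<lambda>e. inj_on (\<lambda>x. f x e) (A e) \<and> (\<lambda>x. f x e) ` A e = B e) \<Longrightarrow>
    D (\<lambda>e. bij_betw (\<lambda>x. f x e) (A e) (B e))"
  by (simp add: bij_betw_def)

text \<open>\<open>app\<close> is total, so \<open>f\<close> may be any set and only its values on
  \<open>a\<close> matter; \<open>lepollE\<close> restores a proper function with domain
  \<open>a\<close>.\<close>

definition lepoll where
  "lepoll a b \<longleftrightarrow> (\<exists>f. inj_on (app f) (elts a) \<and> app f ` elts a \<subseteq> elts b)"

definition eqpoll where
  "eqpoll a b \<longleftrightarrow> (\<exists>f. bij_betw (app f) (elts a) (elts b))"

lemma D_lepoll [D_intros]: "T s \<Longrightarrow> T t \<Longrightarrow> D (\<lambda>e. lepoll (s e) (t e))"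
  by (rule D_subst2[of lepoll]) (unfold lepoll_def, intro D_intros)

lemma lepollI:
  assumes "T (\<lambda>e. F (e 0))" "inj_on F (elts a)" "F ` elts a \<subseteq> elts b"
  shows "lepoll a b"
  unfolding lepoll_def
proof (intro exI conjI)
  have *: "app (lam a F) x = F x" if "x \<in> elts a" for x using assms(1) that by (rule app_lam)
  show "inj_on (app (lam a F)) (elts a)" using assms(2) * by (simp cong: inj_on_cong)
  show "app (lam a F) ` elts a \<subseteq> elts b" using assms(3) * by auto
qed

lemma eqpollI:
  assumes "T (\<lambda>e. F (e 0))" "bij_betw F (elts a) (elts b)"
  shows "eqpoll a b"
  unfolding eqpoll_def
proof (intro exI)
  have "app (lam a F) x = F x" if "x \<in> elts a" for x using assms(1) that by (rule app_lam)
  then show "bij_betw (app (lam a F)) (elts a) (elts b)"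
    using assms(2) by (simp cong: bij_betw_cong)
qed

lemma lepollE:
  assumes "lepoll a b"
  obtains f where "isfun f a" "inj_on (app f) (elts a)" "app f ` elts a \<subseteq> elts b"
proof -
  obtain f where f: "inj_on (app f) (elts a)" "app f ` elts a \<subseteq> elts b"
    using assms by (auto simp: lepoll_def)
  have T: "T (\<lambda>e. app f (e 0))" by (intro D_intros)
  have *: "app (lam a (app f)) x = app f x" if "x \<in> elts a" for x using T that by (rule app_lam)
  show ?thesis
  proof (rule that)
    show "isfun (lam a (app f)) a" using T by (rule isfun_lam)
    show "inj_on (app (lam a (app f))) (elts a)" using f(1) * by (simp cong: inj_on_cong)
    show "app (lam a (app f)) ` elts a \<subseteq> elts b" using f(2) * by auto
  qed
qed

text \<open>Places functions inside one fixed power set, from which \<open>bounded_choice\<close>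
  can then choose.\<close>

lemma isfun_subset_times:
  assumes "isfun h a" "elts a \<subseteq> elts u" "app h ` elts a \<subseteq> elts b"
  shows "elts h \<subseteq> elts (times u b)"
proof
  fix p assume "p \<in> elts h"
  then obtain x where "x \<in> elts a" "p = pair x (app h x)" using isfun_elts[OF assms(1)] by auto
  then show "p \<in> elts (times u b)" using assms(2,3) by (simp add: subset_eq)
qed

lemma lepoll_trans: "lepoll a b \<Longrightarrow> lepoll b c \<Longrightarrow> lepoll a c"
proof -
  assume "lepoll a b" "lepoll b c"
  then obtain f g where *: "inj_on (app f) (elts a)" "app f ` elts a \<subseteq> elts b"
      "inj_on (app g) (elts b)" "app g ` elts b \<subseteq> elts c"
    unfolding lepoll_def by blast
  have "inj_on (app g \<circ> app f) (elts a)"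
    using *(1) inj_on_subset[OF *(3,2)] by (rule comp_inj_on)
  then have "inj_on (\<lambda>x. app g (app f x)) (elts a)" by (simp add: comp_def)
  moreover have "(\<lambda>x. app g (app f x)) ` elts a \<subseteq> elts c" using * by auto
  moreover have "T (\<lambda>e. app g (app f (e 0)))" by (intro D_intros)
  ultimately show ?thesis by (intro lepollI)
qed

lemma subset_lepoll: "elts a \<subseteq> elts b \<Longrightarrow> lepoll a b"
  by (rule lepollI[of "\<lambda>x. x"]) (auto intro!: D_intros)

lemma lepoll_refl [simp]: "lepoll a a"
  by (simp add: subset_lepoll)

lemma eqpoll_lepoll: "eqpoll a b \<Longrightarrow> lepoll a b"
  by (auto simp: eqpoll_def lepoll_def bij_betw_def)

lemma bij_the1_inverse:
  assumes "inj_on G C"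
  shows "bij_betw (\<lambda>x. the1 (\<lambda>y. y \<in> C \<and> G y = x)) (G ` C) C"
proof -
  have "the1 (\<lambda>y. y \<in> C \<and> G y = G x) = x" if "x \<in> C" for x
    using that assms by (intro the1_eq) (auto simp: inj_on_def)
  then show ?thesis by (intro bij_betw_byWitness[of _ G]) auto
qed

lemma eqpoll_sym:
  assumes "eqpoll a b"
  shows "eqpoll b a"
proof -
  obtain f where f: "inj_on (app f) (elts a)" "app f ` elts a = elts b"
    using assms by (auto simp: eqpoll_def bij_betw_def)
  have "T (\<lambda>e. the1 (\<lambda>y. y \<in> elts a \<and> app f y = e 0))" by (intro D_intros)
  with bij_the1_inverse[OF f(1)] show ?thesis unfolding f(2) by (intro eqpollI)
qed

text \<open>Knaster and Tarski's argument: \<open>X\<close> is the greatest fixed point of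
  \<open>\<phi>\<close>, the union of all sets \<open>s\<close> with
  \<open>s \<subseteq> \<phi> s\<close>. The bijection is \<open>f\<close> on \<open>X\<close> and
  the inverse of \<open>g\<close> off \<open>X\<close>. No iteration over \<open>omega\<close> is
  involved.\<close>

lemma Schroeder_Bernstein:
  assumes "lepoll a b" "lepoll b a"
  shows "eqpoll a b"
proof -
  obtain f where f: "inj_on (app f) (elts a)" "app f ` elts a \<subseteq> elts b"
    using assms by (auto simp: lepoll_def)
  obtain g where g: "inj_on (app g) (elts b)" "app g ` elts b \<subseteq> elts a"
    using assms by (auto simp: lepoll_def)
  define \<phi> where "\<phi> S = elts a - app g ` (elts b - app f ` S)" for S
  have mono: "\<phi> S \<subseteq> \<phi> S'" if "S \<subseteq> S'" for S S' using that unfolding \<phi>_def by blast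
  define X where "X = {x \<in> elts a. \<exists>s. elts s \<subseteq> \<phi> (elts s) \<and> x \<in> elts s}"
  have DX: "D (\<lambda>e. s e \<in> X)" if "T s" for s
  proof (rule D_subst1[OF _ that])
    show "D (\<lambda>e. e 0 \<in> X)" unfolding X_def \<phi>_def by (intro D_intros)
  qed
  have le: "X \<subseteq> \<phi> X"
  proof
    fix x assume "x \<in> X"
    then obtain s where s: "elts s \<subseteq> \<phi> (elts s)" "x \<in> elts s" by (auto simp: X_def)
    then have "elts s \<subseteq> X" by (auto simp: X_def \<phi>_def)
    then show "x \<in> \<phi> X" using s mono by blast
  qed
  have "isset (\<phi> X)"
    by (rule isset_sub[OF isset_elts[of a]]) (auto simp: \<phi>_def intro!: D_intros DX)
  then obtain s where "elts s = \<phi> X" by (auto simp: isset_def)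
  then have "elts s \<subseteq> \<phi> (elts s)" using mono[OF le] by simp
  moreover have "\<phi> X \<subseteq> elts a" by (auto simp: \<phi>_def)
  ultimately have "\<phi> X \<subseteq> X" unfolding X_def \<open>elts s = \<phi> X\<close>[symmetric, unfolded X_def] by blast
  with le have X: "X = \<phi> X" by blast
  then have AX: "app g ` (elts b - app f ` X) = elts a - X" and "X \<subseteq> elts a"
    using g(2) by (auto simp: \<phi>_def)
  let ?I = "\<lambda>x. the1 (\<lambda>y. y \<in> elts b - app f ` X \<and> app g y = x)"
  have 1: "bij_betw (app f) X (app f ` X)"
    using f(1) \<open>X \<subseteq> elts a\<close> by (auto simp: bij_betw_def intro: inj_on_subset)
  have "inj_on (app g) (elts b - app f ` X)" using g(1) by (rule inj_on_subset) auto
  then have 2: "bij_betw ?I (elts a - X) (elts b - app f ` X)"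
    using bij_the1_inverse[of "app g" "elts b - app f ` X"] by (simp add: AX)
  let ?H = "\<lambda>x. if x \<in> X then app f x else ?I x"
  have "bij_betw ?H (X \<union> (elts a - X)) (app f ` X \<union> (elts b - app f ` X))"
    using 1 2 by (intro bij_betw_disjoint_Un) auto
  moreover have "X \<union> (elts a - X) = elts a" "app f ` X \<union> (elts b - app f ` X) = elts b"
    using \<open>X \<subseteq> elts a\<close> f(2) by blast+
  ultimately have "bij_betw ?H (elts a) (elts b)" by simp
  moreover have "T (\<lambda>e. ?H (e 0))" by (intro D_intros DX)
  ultimately show ?thesis by (intro eqpollI)
qed

definition vfst where "vfst p = the1 (\<lambda>x. \<exists>y. p = pair x y)"
definition vsnd where "vsnd p = the1 (\<lambda>y. \<exists>x. p = pair x y)"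

lemma T_vfst [D_intros]: "T s \<Longrightarrow> T (\<lambda>e. vfst (s e))"
  by (rule T_subst1[of vfst]) (unfold vfst_def, intro D_intros)

lemma T_vsnd [D_intros]: "T s \<Longrightarrow> T (\<lambda>e. vsnd (s e))"
  by (rule T_subst1[of vsnd]) (unfold vsnd_def, intro D_intros)

lemma vfst_pair [simp]: "vfst (pair x y) = x"
  unfolding vfst_def by (rule the1_eq) auto

lemma vsnd_pair [simp]: "vsnd (pair x y) = y"
  unfolding vsnd_def by (rule the1_eq) auto

lemma cantor: "\<not> lepoll (vpow a) a"
proof
  assume "lepoll (vpow a) a"
  then obtain f where f: "inj_on (app f) (elts (vpow a))" "app f ` elts (vpow a) \<subseteq> elts a"
    by (auto simp: lepoll_def)
  let ?D = "{x \<in> elts a. \<exists>y. elts y \<subseteq> elts a \<and> app f y = x \<and> x \<notin> elts y}"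
  have d: "elts (mk ?D) = ?D"
    by (intro elts_mk isset_sub[OF isset_elts[of a]]) (auto intro!: D_intros)
  have "app f (mk ?D) \<in> elts a" using f(2) d by auto
  moreover have "y = mk ?D" if "elts y \<subseteq> elts a" "app f y = app f (mk ?D)" for y
    using f(1) that d by (auto dest!: inj_onD)
  ultimately have "app f (mk ?D) \<in> ?D \<longleftrightarrow> app f (mk ?D) \<notin> elts (mk ?D)"
    using d by blast
  then show False using d by blast
qed

lemma omega_cases:
  assumes "n \<in> elts omega"
  obtains "n = vempty" | m where "m \<in> elts omega" "n = vsucc m"
proof -
  have "n = vempty \<or> (\<exists>m\<in>elts omega. n = vsucc m)"
    using assms
  proof (induction n rule: omega_induct)
    show "D (\<lambda>e. e 0 = vempty \<or> (\<exists>m\<in>elts omega. e 0 = vsucc m))" by (intro D_intros)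
  qed auto
  then show ?thesis using that by blast
qed

lemma empty_not_vsucc [simp]: "vempty \<noteq> vsucc x"
  by (metis vsucc_not_empty)

lemma vUnion_vsucc: "Ord n \<Longrightarrow> vUnion (vsucc n) = n"
  by (rule eltsI) (use Ord_trans in auto)

text \<open>The predecessor of a successor ordinal is its union, so this is an instance of recursion
  on membership.\<close>

lemma omega_recursion:
  assumes S: "T (\<lambda>e. S (e 0) (e 1))"
  obtains F where "T (\<lambda>e. F (e 0))" "F vempty = a" "\<And>n. n \<in> elts omega \<Longrightarrow> F (vsucc n) = S n (F n)"
proof
  define G where "G x f = (if x = vempty then a else S (vUnion x) (app f (vUnion x)))" for x f
  have G: "T (\<lambda>e. G (e 0) (e 1))" unfolding G_def by (intro D_intros T_subst2[OF S])
  show TF: "T (\<lambda>e. rec G (e 0))" by (intro D_intros T_rec G)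
  show "rec G vempty = a" by (subst rec_eq[OF G]) (simp add: G_def)
  fix n assume "n \<in> elts omega"
  then have "vUnion (vsucc n) = n" using omega_Ord vUnion_vsucc by simp
  moreover have "app (lam (vsucc n) (rec G)) n = rec G n" by (rule app_lam[OF TF]) simp
  ultimately show "rec G (vsucc n) = S n (rec G n)" by (subst rec_eq[OF G]) (simp add: G_def)
qed

text \<open>The one fact of cardinal arithmetic from which the bounds on unions and the regularity
  of k^+ follow. It holds for \<open>omega\<close> and passes from \<open>k\<close> to
  \<open>hart k\<close>, which reaches every cardinal that occurs here.\<close>

definition idem where
  "idem k \<longleftrightarrow> Ord k \<and> elts omega \<subseteq> elts k \<and> lepoll (times k k) k"

text \<open>The pairing function is 2^m (2 n + 1), with \<open>dbl\<close> for doubling and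
  \<open>app (K m) n\<close> for the value. Injectivity follows from doubling being injective and
  never hitting the successor of a double. \<open>K m\<close> is a set coding a function of
  \<open>n\<close>, so that recursion on \<open>m\<close> can produce it.\<close>

lemma idem_omega: "idem omega"
proof -
  have "T (\<lambda>e. vsucc (vsucc (e 1)))" by (intro D_intros)
  then obtain dbl where T_dbl: "T (\<lambda>e. dbl (e 0))" and dbl0: "dbl vempty = vempty"
      and dbl: "\<And>n. n \<in> elts omega \<Longrightarrow> dbl (vsucc n) = vsucc (vsucc (dbl n))"
    by (rule omega_recursion[where a = vempty and S = "\<lambda>_ y. vsucc (vsucc y)"]) blast
  note [D_intros] = T_subst1[OF T_dbl]
  have dbl_omega: "dbl n \<in> elts omega" if "n \<in> elts omega" for n
    using that
  proof (induction n rule: omega_induct)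
    show "D (\<lambda>e. dbl (e 0) \<in> elts omega)" by (intro D_intros)
  qed (simp_all add: dbl dbl0)
  have inj: "\<forall>m\<in>elts omega. dbl m = dbl n \<longrightarrow> m = n" if "n \<in> elts omega" for n
    using that
  proof (induction n rule: omega_induct)
    show "D (\<lambda>e. \<forall>m\<in>elts omega. dbl m = dbl (e 0) \<longrightarrow> m = e 0)" by (intro D_intros)
  next
    case zero
    show ?case by (auto simp: dbl dbl0 elim: omega_cases)
  next
    case (succ n)
    show ?case
    proof (intro ballI impI)
      fix m assume "m \<in> elts omega" "dbl m = dbl (vsucc n)"
      then show "m = vsucc n" using succ by (cases m rule: omega_cases) (auto simp: dbl dbl0)
    qed
  qed
  have odd: "\<forall>m\<in>elts omega. vsucc (dbl m) \<noteq> dbl n" if "n \<in> elts omega" for n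
    using that
  proof (induction n rule: omega_induct)
    show "D (\<lambda>e. \<forall>m\<in>elts omega. vsucc (dbl m) \<noteq> dbl (e 0))" by (intro D_intros)
  next
    case zero
    show ?case by (auto simp: dbl0)
  next
    case (succ n)
    show ?case
    proof (intro ballI notI)
      fix m assume m: "m \<in> elts omega" and "vsucc (dbl m) = dbl (vsucc n)"
      then have eq: "dbl m = vsucc (dbl n)" using succ by (simp add: dbl)
      then obtain l where l: "l \<in> elts omega" "m = vsucc l"
        using omega_cases[OF m] dbl0 empty_not_vsucc by metis
      then show False using eq succ by (auto simp: dbl)
    qed
  qed
  define K0 where "K0 = lam omega (\<lambda>n. vsucc (dbl n))"
  have "T (\<lambda>e. lam omega (\<lambda>n. dbl (app (e 1) n)))" by (intro D_intros)
  then obtain K where T_K: "T (\<lambda>e. K (e 0))" and K0: "K vempty = K0"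
      and K: "\<And>n. n \<in> elts omega \<Longrightarrow> K (vsucc n) = lam omega (\<lambda>k. dbl (app (K n) k))"
    by (rule omega_recursion[where a = K0 and S = "\<lambda>_ y. lam omega (\<lambda>n. dbl (app y n))"]) blast
  note [D_intros] = T_subst1[OF T_K]
  have Kz: "app (K vempty) n = vsucc (dbl n)" if "n \<in> elts omega" for n
    unfolding K0 K0_def using that by (intro app_lam D_intros)
  have Ks: "app (K (vsucc m)) n = dbl (app (K m) n)" if "n \<in> elts omega" "m \<in> elts omega" for m n
    unfolding K[OF that(2)] using that by (intro app_lam D_intros)
  have K_omega: "\<forall>n\<in>elts omega. app (K m) n \<in> elts omega" if "m \<in> elts omega" for m
    using that
  proof (induction m rule: omega_induct)
    show "D (\<lambda>e. \<forall>n\<in>elts omega. app (K (e 0)) n \<in> elts omega)" by (intro D_intros)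
  qed (simp_all add: Kz Ks dbl_omega)
  have K_inj: "\<forall>m'\<in>elts omega. \<forall>n\<in>elts omega. \<forall>n'\<in>elts omega.
      app (K m) n = app (K m') n' \<longrightarrow> m = m' \<and> n = n'" if "m \<in> elts omega" for m
    using that
  proof (induction m rule: omega_induct)
    show "D (\<lambda>e. \<forall>m'\<in>elts omega. \<forall>n\<in>elts omega. \<forall>n'\<in>elts omega.
      app (K (e 0)) n = app (K m') n' \<longrightarrow> e 0 = m' \<and> n = n')" by (intro D_intros)
  next
    case zero
    show ?case
    proof (intro ballI impI)
      fix m' n n' assume *: "m' \<in> elts omega" "n \<in> elts omega" "n' \<in> elts omega"
        "app (K vempty) n = app (K m') n'"
      from *(1) show "vempty = m' \<and> n = n'"
      proof (cases m' rule: omega_cases)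
        case 1
        then have "dbl n = dbl n'" using * by (simp add: Kz)
        then show ?thesis using inj * 1 by blast
      next
        case (2 m)
        then have "vsucc (dbl n) = dbl (app (K m) n')" using * by (simp add: Kz Ks)
        moreover have "app (K m) n' \<in> elts omega" using K_omega 2 * by blast
        ultimately show ?thesis using odd * by blast
      qed
    qed
  next
    case (succ m)
    show ?case
    proof (intro ballI impI)
      fix m' n n' assume *: "m' \<in> elts omega" "n \<in> elts omega" "n' \<in> elts omega"
        "app (K (vsucc m)) n = app (K m') n'"
      from *(1) show "vsucc m = m' \<and> n = n'"
      proof (cases m' rule: omega_cases)
        case 1
        then have "vsucc (dbl n') = dbl (app (K m) n)" using * succ.hyps by (simp add: Kz Ks)
        moreover have "app (K m) n \<in> elts omega" using K_omega succ.hyps * by blast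
        ultimately show ?thesis using odd * by blast
      next
        case (2 k)
        then have "dbl (app (K m) n) = dbl (app (K k) n')" using * succ.hyps by (simp add: Ks)
        moreover have "app (K m) n \<in> elts omega" "app (K k) n' \<in> elts omega"
          using K_omega succ.hyps * 2 by blast+
        ultimately have "app (K m) n = app (K k) n'" using inj by blast
        then show ?thesis using succ.IH * 2 by blast
      qed
    qed
  qed
  have "lepoll (times omega omega) omega"
  proof (rule lepollI)
    show "T (\<lambda>e. app (K (vfst (e 0))) (vsnd (e 0)))" by (intro D_intros)
    show "inj_on (\<lambda>p. app (K (vfst p)) (vsnd p)) (elts (times omega omega))"
      using K_inj by (auto intro!: inj_onI)
  qed (use K_omega in auto)
  then show ?thesis by (simp add: idem_def)
qed

end

locale zfc = zf +
  assumes choice: "(\<And>u. u \<in> elts x \<Longrightarrow> elts u \<noteq> {}) \<Longrightarrow>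
    \<exists>f. isfun f x \<and> (\<forall>u\<in>elts x. app f u \<in> elts u)"
begin

text \<open>Choice in the form used by the recursions below: a single function, fixed in advance as
  a parameter, selects from every nonempty subset of \<open>b\<close>.\<close>

lemma choice_function: "\<exists>c. \<forall>A. A \<subseteq> elts b \<longrightarrow> A \<noteq> {} \<longrightarrow> isset A \<longrightarrow> app c (mk A) \<in> A"
proof -
  let ?x = "mk (elts (vpow b) - {vempty})"
  have x: "elts ?x = elts (vpow b) - {vempty}"
    by (intro elts_mk isset_sub[OF isset_elts[of "vpow b"]] D_intros) auto
  have "elts u \<noteq> {}" if "u \<in> elts ?x" for u using that x by auto
  from choice[OF this] obtain c where c: "\<And>u. u \<in> elts ?x \<Longrightarrow> app c u \<in> elts u" by blast
  have "app c (mk A) \<in> A" if "A \<subseteq> elts b" "A \<noteq> {}" "isset A" for A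
  proof -
    have "elts (mk A) = A" using that by (simp add: elts_mk)
    then have "mk A \<in> elts ?x" unfolding x using that by auto
    then show ?thesis using c \<open>elts (mk A) = A\<close> by blast
  qed
  then show ?thesis by blast
qed

lemma bounded_choice:
  assumes "D (\<lambda>e. R (e 0) (e 1))" "\<And>x. x \<in> elts a \<Longrightarrow> \<exists>y\<in>elts b. R x y"
  obtains f where "isfun f a" "\<And>x. x \<in> elts a \<Longrightarrow> app f x \<in> elts b" "\<And>x. x \<in> elts a \<Longrightarrow> R x (app f x)"
proof -
  obtain c where c: "\<And>A. A \<subseteq> elts b \<Longrightarrow> A \<noteq> {} \<Longrightarrow> isset A \<Longrightarrow> app c (mk A) \<in> A"
    using choice_function[of b] by blast
  define F where "F x = app c (mk {y \<in> elts b. R x y})" for x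
  have DR: "D (\<lambda>e. R (s e) (t e))" if "T s" "T t" for s t
    using assms(1) that by (rule D_subst2)
  have TF: "T (\<lambda>e. F (e 0))" unfolding F_def by (intro D_intros DR)
  have F: "F x \<in> {y \<in> elts b. R x y}" if "x \<in> elts a" for x
    unfolding F_def
  proof (rule c)
    show "isset {y \<in> elts b. R x y}"
      by (rule isset_sub[OF isset_elts[of b]]) (auto intro!: D_intros DR)
  qed (use assms(2) that in auto)
  show ?thesis
  proof (rule that)
    show "isfun (lam a F) a" using TF by (rule isfun_lam)
  qed (use F app_lam[OF TF] in auto)
qed

text \<open>\<open>F\<close> enumerates \<open>a\<close> without repetition. If it never exhausted
  \<open>a\<close>, it would inject all ordinals into \<open>a\<close>, and by replacement its
  inverse \<open>H\<close> would make them a set.\<close>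

lemma zermelo:
  obtains \<alpha> f where "Ord \<alpha>" "bij_betw (app f) (elts \<alpha>) (elts a)"
proof -
  obtain c where c: "\<And>A. A \<subseteq> elts a \<Longrightarrow> A \<noteq> {} \<Longrightarrow> isset A \<Longrightarrow> app c (mk A) \<in> A"
    using choice_function[of a] by blast
  \<comment> \<open>Once \<open>a\<close> is exhausted the recursion returns the default value
    \<open>a\<close>, which lies outside of \<open>a\<close>.\<close>
  define G where "G x f = (if elts a \<subseteq> app f ` elts x then a else app c (mk (elts a - app f ` elts x)))" for x f
  have G: "T (\<lambda>e. G (e 0) (e 1))" unfolding G_def by (intro D_intros)
  define F where "F = rec G"
  have TF: "T (\<lambda>e. F (e 0))" unfolding F_def by (intro D_intros T_rec G)
  note [D_intros] = T_subst1[OF TF]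
  have F_eq: "F x = (if elts a \<subseteq> F ` elts x then a else app c (mk (elts a - F ` elts x)))" for x
  proof -
    have "app (lam x F) ` elts x = F ` elts x" using app_lam[OF TF] by auto
    then show ?thesis unfolding F_def by (subst rec_eq[OF G]) (simp add: G_def F_def)
  qed
  have F: "F x \<in> elts a - F ` elts x" if "\<not> elts a \<subseteq> F ` elts x" for x
  proof -
    have "isset (elts a - F ` elts x)" by (rule isset_sub[OF isset_elts[of a]]) (blast, intro D_intros)
    then have "app c (mk (elts a - F ` elts x)) \<in> elts a - F ` elts x"
      using that by (intro c) blast+
    then show ?thesis using F_eq[of x] that by (simp only: if_False)
  qed
  have "\<exists>\<alpha>. Ord \<alpha> \<and> elts a \<subseteq> F ` elts \<alpha>"
  proof (rule ccontr)
    assume *: "\<not> ?thesis"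
    have F': "F \<alpha> \<in> elts a" "\<And>\<beta>. \<beta> \<in> elts \<alpha> \<Longrightarrow> F \<alpha> \<noteq> F \<beta>" if "Ord \<alpha>" for \<alpha>
      using F[of \<alpha>] * that by auto
    define H where "H x = the1 (\<lambda>\<alpha>. Ord \<alpha> \<and> F \<alpha> = x)" for x
    have H: "H (F \<alpha>) = \<alpha>" if "Ord \<alpha>" for \<alpha>
      unfolding H_def
    proof (rule the1_eq)
      show "y = \<alpha>" if "Ord y \<and> F y = F \<alpha>" for y
        using that \<open>Ord \<alpha>\<close> Ord_linear[of y \<alpha>] F'(2)[of y \<alpha>] F'(2)[of \<alpha> y] by metis
    qed (simp add: that)
    have "T (\<lambda>e. H (e 0))" unfolding H_def by (intro D_intros)
    then have "elts (mk (H ` elts a)) = H ` elts a" by (intro elts_mk isset_image) auto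
    moreover obtain \<alpha> where "Ord \<alpha>" "\<alpha> \<notin> elts (mk (H ` elts a))" using no_set_of_ordinals by blast
    moreover have "\<alpha> \<in> H ` elts a"
      using H[OF \<open>Ord \<alpha>\<close>] F'(1)[OF \<open>Ord \<alpha>\<close>] by (metis imageI)
    ultimately show False by simp
  qed
  then obtain \<beta> where \<beta>: "Ord \<beta>" "elts a \<subseteq> F ` elts \<beta>" by blast
  have "D (\<lambda>e. elts a \<subseteq> F ` elts (e 0))" by (intro D_intros)
  then obtain \<alpha> where \<alpha>: "Ord \<alpha>" "elts a \<subseteq> F ` elts \<alpha>"
      "\<And>\<beta>. \<beta> \<in> elts \<alpha> \<Longrightarrow> \<not> elts a \<subseteq> F ` elts \<beta>" using \<beta> by (rule Ord_least) blast
  have "inj_on F (elts \<alpha>)"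
  proof (rule inj_onI)
    fix x y assume "x \<in> elts \<alpha>" "y \<in> elts \<alpha>" "F x = F y"
    then have "F x \<notin> F ` elts x" "F x \<notin> F ` elts y" using F[OF \<alpha>(3)] by (metis DiffE)+
    then have "y \<notin> elts x" "x \<notin> elts y" using \<open>F x = F y\<close> by (metis imageI)+
    then show "x = y" using Ord_linear \<alpha>(1) \<open>x \<in> elts \<alpha>\<close> \<open>y \<in> elts \<alpha>\<close> Ord_mem by blast
  qed
  moreover have "F ` elts \<alpha> = elts a" using \<alpha>(2) F[OF \<alpha>(3)] by auto
  ultimately have "eqpoll \<alpha> a" by (intro eqpollI[OF TF]) (simp add: bij_betw_def)
  then show ?thesis using that \<alpha>(1) unfolding eqpoll_def by blast
qed

lemma lepoll_linear: "lepoll a b \<or> lepoll b a"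
proof -
  obtain \<alpha> f where 1: "Ord \<alpha>" "bij_betw (app f) (elts \<alpha>) (elts a)" by (rule zermelo)
  obtain \<beta> g where 2: "Ord \<beta>" "bij_betw (app g) (elts \<beta>) (elts b)" by (rule zermelo)
  have "eqpoll \<alpha> a" "eqpoll \<beta> b" using 1 2 by (auto simp: eqpoll_def)
  moreover have "lepoll \<alpha> \<beta> \<or> lepoll \<beta> \<alpha>"
    using Ord_linear[OF 1(1) 2(1)] Ord_trans 1 2 by (auto intro!: subset_lepoll)
  ultimately have "lepoll a \<alpha>" "lepoll \<alpha> a" "lepoll b \<beta>" "lepoll \<beta> b" "lepoll \<alpha> \<beta> \<or> lepoll \<beta> \<alpha>"
    by (blast intro: eqpoll_lepoll eqpoll_sym)+
  then show ?thesis using lepoll_trans by blast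
qed

lemma lepoll_image:
  assumes "T (\<lambda>e. F (e 0))" "elts b \<subseteq> F ` elts a"
  shows "lepoll b a"
proof -
  have "D (\<lambda>e. F (e 1) = e 0)" by (intro D_intros T_subst1[OF assms(1)])
  moreover have "\<exists>x\<in>elts a. F x = y" if "y \<in> elts b" for y using assms(2) that by blast
  ultimately obtain f where f: "\<And>y. y \<in> elts b \<Longrightarrow> app f y \<in> elts a" "\<And>y. y \<in> elts b \<Longrightarrow> F (app f y) = y"
    by (rule bounded_choice[where R = "\<lambda>y x. F x = y" and a = b and b = a]) blast+
  then have "inj_on (app f) (elts b)" by (intro inj_on_inverseI[of _ F])
  then show ?thesis using f(1) unfolding lepoll_def by blast
qed

subsection \<open>Successor cardinals\<close>

text \<open>The Hartogs number of \<open>k\<close>; for an infinite cardinal this is the successor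
  cardinal k^+. Its description by \<open>lepoll\<close> is definable and can be checked in an
  extension without mentioning cardinals.\<close>

definition hart where
  "hart k = the1 (\<lambda>x. Ord x \<and> \<not> lepoll x k \<and> (\<forall>y\<in>elts x. lepoll y k))"

lemma hart_eqI:
  assumes "Ord x" "\<not> lepoll x k" "\<And>y. y \<in> elts x \<Longrightarrow> lepoll y k"
  shows "hart k = x"
  unfolding hart_def
proof (rule the1_eq)
  show "y = x" if "Ord y \<and> \<not> lepoll y k \<and> (\<forall>z\<in>elts y. lepoll z k)" for y
    using that assms Ord_linear[of x y] by auto
qed (use assms in auto)

lemma hart: "Ord (hart k)" "\<not> lepoll (hart k) k" "\<And>y. y \<in> elts (hart k) \<Longrightarrow> lepoll y k"
proof -
  obtain \<alpha> f where "Ord \<alpha>" "bij_betw (app f) (elts \<alpha>) (elts (vpow k))" by (rule zermelo)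
  then have "eqpoll \<alpha> (vpow k)" unfolding eqpoll_def by blast
  then have "\<not> lepoll \<alpha> k"
    using cantor lepoll_trans[OF eqpoll_lepoll[OF eqpoll_sym]] by blast
  have "D (\<lambda>e. \<not> lepoll (e 0) k)" by (intro D_intros)
  then obtain x where x: "Ord x" "\<not> lepoll x k" "\<And>y. y \<in> elts x \<Longrightarrow> lepoll y k"
    using \<open>Ord \<alpha>\<close> \<open>\<not> lepoll \<alpha> k\<close> by (rule Ord_least) blast
  moreover from this have "hart k = x" by (rule hart_eqI)
  ultimately show "Ord (hart k)" "\<not> lepoll (hart k) k" "\<And>y. y \<in> elts (hart k) \<Longrightarrow> lepoll y k"
    by simp_all
qed

lemma mem_hart_iff: "Ord x \<Longrightarrow> x \<in> elts (hart k) \<longleftrightarrow> lepoll x k"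
  by (metis Ord_linear Ord_trans hart lepoll_trans subset_lepoll)

lemma self_mem_hart: "Ord k \<Longrightarrow> k \<in> elts (hart k)"
  by (simp add: mem_hart_iff)

text \<open>Tagging the elements with 0 or 1 maps \<open>c\<close> into \<open>k\<close> times
  \<open>k\<close>.\<close>

lemma lepoll_Un:
  assumes "idem k" "lepoll a k" "lepoll b k" "elts c \<subseteq> elts a \<union> elts b"
  shows "lepoll c k"
proof -
  obtain f where f: "inj_on (app f) (elts a)" "app f ` elts a \<subseteq> elts k"
    using assms by (auto simp: lepoll_def)
  obtain g where g: "inj_on (app g) (elts b)" "app g ` elts b \<subseteq> elts k"
    using assms by (auto simp: lepoll_def)
  let ?F = "\<lambda>x. if x \<in> elts a then pair vempty (app f x) else pair (vsucc vempty) (app g x)"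
  have "lepoll c (times k k)"
  proof (rule lepollI[of ?F])
    show "T (\<lambda>e. ?F (e 0))" by (intro D_intros)
    show "inj_on ?F (elts c)"
    proof (rule inj_onI)
      fix x y assume xy: "x \<in> elts c" "y \<in> elts c" "?F x = ?F y"
      then show "x = y"
        using inj_onD[OF f(1), of x y] inj_onD[OF g(1), of x y] assms(4)
        by (cases "x \<in> elts a"; cases "y \<in> elts a") auto
    qed
    have "vempty \<in> elts k" "vsucc vempty \<in> elts k"
      using assms(1) zero_omega succ_omega by (auto simp: idem_def)
    moreover have "app f x \<in> elts k" if "x \<in> elts a" for x using f(2) that by blast
    moreover have "app g x \<in> elts k" if "x \<in> elts c" "x \<notin> elts a" for x
      using g(2) that assms(4) by blast
    ultimately show "?F ` elts c \<subseteq> elts (times k k)" by auto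
  qed
  then show ?thesis using assms(1) lepoll_trans by (auto simp: idem_def)
qed

text \<open>An element \<open>x\<close> of the union is coded by the position of an index \<iota>(x)
  with \<open>x \<in> elts (A (app \<iota> x))\<close> together with the position of
  \<open>x\<close> in that set, so that the union embeds into \<open>k\<close> times
  \<open>k\<close>.\<close>

lemma lepoll_Union:
  assumes k: "idem k" and I: "lepoll I k" and A: "\<And>i. i \<in> elts I \<Longrightarrow> lepoll (A i) k"
    and TA: "T (\<lambda>e. A (e 0))" and U: "elts U \<subseteq> (\<Union>i\<in>elts I. elts (A i))"
  shows "lepoll U k"
proof -
  note [D_intros] = T_subst1[OF TA]
  obtain g where g: "inj_on (app g) (elts I)" "app g ` elts I \<subseteq> elts k"
    using I by (auto simp: lepoll_def)
  let ?V = "mk (\<Union>i\<in>elts I. elts (A i))"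
  have V: "elts ?V = (\<Union>i\<in>elts I. elts (A i))"
    by (intro elts_mk isset_UN) (auto intro!: D_intros)
  obtain s where s: "\<And>i. i \<in> elts I \<Longrightarrow> inj_on (app (app s i)) (elts (A i)) \<and> app (app s i) ` elts (A i) \<subseteq> elts k"
  proof (rule bounded_choice[where a = I and b = "vpow (times ?V k)" and
        R = "\<lambda>i h. inj_on (app h) (elts (A i)) \<and> app h ` elts (A i) \<subseteq> elts k"])
    show "D (\<lambda>e. inj_on (app (e 1)) (elts (A (e 0))) \<and> app (e 1) ` elts (A (e 0)) \<subseteq> elts k)"
      by (intro D_intros)
    fix i assume i: "i \<in> elts I"
    from A[OF this] obtain h where h: "isfun h (A i)" "inj_on (app h) (elts (A i))" "app h ` elts (A i) \<subseteq> elts k"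
      by (rule lepollE)
    have "elts h \<subseteq> elts (times ?V k)"
      by (rule isfun_subset_times[OF h(1) _ h(3)]) (use i V in blast)
    then show "\<exists>h\<in>elts (vpow (times ?V k)). inj_on (app h) (elts (A i)) \<and> app h ` elts (A i) \<subseteq> elts k"
      using h by auto
  qed blast
  obtain \<iota> where \<iota>: "\<And>x. x \<in> elts U \<Longrightarrow> app \<iota> x \<in> elts I" "\<And>x. x \<in> elts U \<Longrightarrow> x \<in> elts (A (app \<iota> x))"
  proof (rule bounded_choice[where a = U and b = I and R = "\<lambda>x i. x \<in> elts (A i)"])
    show "D (\<lambda>e. e 0 \<in> elts (A (e 1)))" by (intro D_intros)
  qed (use U in auto)
  let ?F = "\<lambda>x. pair (app g (app \<iota> x)) (app (app s (app \<iota> x)) x)"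
  have "lepoll U (times k k)"
  proof (rule lepollI[of ?F])
    show "T (\<lambda>e. ?F (e 0))" by (intro D_intros)
    show "inj_on ?F (elts U)"
    proof (rule inj_onI)
      fix x y assume xy: "x \<in> elts U" "y \<in> elts U" "?F x = ?F y"
      then have "app \<iota> x = app \<iota> y" using g(1) \<iota>(1) by (auto dest: inj_onD)
      then have "x \<in> elts (A (app \<iota> x))" "y \<in> elts (A (app \<iota> x))" using xy \<iota>(2) by metis+
      moreover have "app (app s (app \<iota> x)) x = app (app s (app \<iota> x)) y"
        using xy(3) \<open>app \<iota> x = app \<iota> y\<close> by simp
      ultimately show "x = y" using s[OF \<iota>(1)[OF xy(1)]] by (blast dest: inj_onD)
    qed
    show "?F ` elts U \<subseteq> elts (times k k)"
    proof (rule image_subsetI)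
      fix x assume x: "x \<in> elts U"
      show "?F x \<in> elts (times k k)"
        using g(2) \<iota>[OF x] s[OF \<iota>(1)[OF x]] by (simp add: image_subset_iff)
    qed
  qed
  then show ?thesis using k lepoll_trans by (auto simp: idem_def)
qed

lemma hart_succ: "idem k \<Longrightarrow> x \<in> elts (hart k) \<Longrightarrow> vsucc x \<in> elts (hart k)"
proof -
  assume k: "idem k" and x: "x \<in> elts (hart k)"
  have "lepoll (upair x x) k"
    by (rule lepollI[of "\<lambda>_. vempty"]) (use k zero_omega in \<open>auto simp: idem_def intro!: D_intros\<close>)
  then have "lepoll (vsucc x) k" by (rule lepoll_Un[OF k hart(3)[OF x]]) auto
  then show ?thesis using x hart(1) Ord_mem mem_hart_iff by (metis Ord_succ)
qed

text \<open>Regularity of k^+: the union of at most \<open>k\<close> many ordinals of size at most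
  \<open>k\<close> again has size at most \<open>k\<close>. The successor of the union makes the
  bound strict.\<close>

lemma hart_regular:
  assumes k: "idem k" and I: "lepoll I k" and F: "\<And>i. i \<in> elts I \<Longrightarrow> F i \<in> elts (hart k)"
    and TF: "T (\<lambda>e. F (e 0))"
  obtains \<beta> where "\<beta> \<in> elts (hart k)" "\<And>i. i \<in> elts I \<Longrightarrow> F i \<in> elts \<beta>"
proof -
  let ?u = "vUnion (mk (F ` elts I))"
  have m: "elts (mk (F ` elts I)) = F ` elts I" by (intro elts_mk isset_image TF) auto
  have "Ord ?u" by (rule Ord_Union) (use m F Ord_mem[OF hart(1)] in auto)
  moreover have "lepoll ?u k"
    by (rule lepoll_Union[OF k I hart(3)[OF F] TF]) (auto simp: m)
  ultimately have u: "?u \<in> elts (hart k)" by (simp add: mem_hart_iff)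
  have "F i \<in> elts (vsucc ?u)" if "i \<in> elts I" for i
  proof -
    have "elts (F i) \<subseteq> elts ?u" using that by (auto simp: m)
    then show ?thesis
      using Ord_subset_iff[of "F i" ?u] \<open>Ord ?u\<close> F[OF that] Ord_mem[OF hart(1)] by auto
  qed
  then show ?thesis using that hart_succ[OF k u] by blast
qed

text \<open>\<open>J\<close> cuts out of k^+ pairwise disjoint copies of \<open>k\<close>, one for
  each index below k^+; there is always room for the next, since fewer than k^+ copies of
  \<open>k\<close> do not exhaust k^+. A pair of ordinals below \<open>g\<close> is coded by an
  element of \<open>k\<close>, as \<open>g\<close> injects into \<open>k\<close> and
  \<open>k\<close> absorbs pairs, and this code is then placed into the copy numbered
  \<open>g\<close>.\<close>

lemma idem_hart:
  assumes k: "idem k"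
  shows "idem (hart k)"
proof -
  let ?l = "hart k"
  have "Ord k" "elts omega \<subseteq> elts k" using k by (auto simp: idem_def)
  then have kl: "elts k \<subseteq> elts ?l" using self_mem_hart hart(1) Ord_trans by blast
  obtain c where c: "\<And>A. A \<subseteq> elts (vpow (times k ?l)) \<Longrightarrow> A \<noteq> {} \<Longrightarrow> isset A \<Longrightarrow> app c (mk A) \<in> A"
    using choice_function[of "vpow (times k ?l)"] by blast
  define A where "A x f = {h \<in> elts (vpow (times k ?l)). isfun h k \<and> inj_on (app h) (elts k) \<and>
    app h ` elts k \<subseteq> elts ?l - (\<Union>d\<in>elts x. app (app f d) ` elts k)}" for x f
  define G where "G x f = app c (mk (A x f))" for x f
  have G: "T (\<lambda>e. G (e 0) (e 1))" unfolding G_def A_def by (intro D_intros)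
  define J where "J = rec G"
  have TJ: "T (\<lambda>e. J (e 0))" unfolding J_def by (intro D_intros T_rec G)
  note [D_intros] = T_subst1[OF TJ]
  have J: "isfun (J x) k \<and> inj_on (app (J x)) (elts k) \<and>
      app (J x) ` elts k \<subseteq> elts ?l - (\<Union>d\<in>elts x. app (J d) ` elts k)"
    if x: "x \<in> elts ?l" for x
  proof -
    let ?f = "lam x J"
    let ?Y = "\<Union>d\<in>elts x. app (J d) ` elts k"
    have Y: "(\<Union>d\<in>elts x. app (app ?f d) ` elts k) = ?Y" using app_lam[OF TJ] by simp
    let ?B = "\<lambda>d. mk (app (J d) ` elts k)"
    have B: "elts (?B d) = app (J d) ` elts k" for d
      by (intro elts_mk isset_image D_intros) auto
    have isY: "isset ?Y" by (rule isset_UN) (auto intro!: D_intros isset_image)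
    have "lepoll (mk ?Y) k"
    proof (rule lepoll_Union[OF k hart(3)[OF x]])
      show "lepoll (?B d) k" for d
        by (rule lepoll_image[where F = "app (J d)"]) (auto simp: B intro!: D_intros)
      show "T (\<lambda>e. ?B (e 0))" by (intro D_intros)
      show "elts (mk ?Y) \<subseteq> (\<Union>d\<in>elts x. elts (?B d))" using elts_mk[OF isY] by (simp add: B)
    qed
    let ?R = "mk (elts ?l - ?Y)"
    have R: "elts ?R = elts ?l - ?Y"
      by (intro elts_mk isset_sub[OF isset_elts[of ?l]] D_intros) auto
    have "\<not> lepoll ?R k"
    proof
      assume "lepoll ?R k"
      then have "lepoll ?l k"
        using \<open>lepoll (mk ?Y) k\<close> by (rule lepoll_Un[OF k]) (auto simp: R elts_mk[OF isY])
      then show False using hart(2) by blast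
    qed
    then have "lepoll k ?R" using lepoll_linear by blast
    then obtain h where h: "isfun h k" "inj_on (app h) (elts k)" "app h ` elts k \<subseteq> elts ?R" by (rule lepollE)
    have "elts h \<subseteq> elts (times k ?l)"
      by (rule isfun_subset_times[OF h(1)]) (use h(3) R in blast)+
    then have "h \<in> A x ?f" using h by (simp add: A_def Y R)
    moreover have "isset (A x ?f)"
      by (rule isset_sub[OF isset_elts[of "vpow (times k ?l)"]])
        (auto simp: A_def intro!: D_intros)
    ultimately have "G x ?f \<in> A x ?f" unfolding G_def by (intro c) (auto simp: A_def)
    then have "J x \<in> A x ?f" unfolding J_def by (subst rec_eq[OF G])
    then show ?thesis by (simp add: A_def Y)
  qed
  have J_inj: "g = g' \<and> x = x'" if "g \<in> elts ?l" "g' \<in> elts ?l" "x \<in> elts k" "x' \<in> elts k"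
    "app (J g) x = app (J g') x'" for g g' x x'
  proof -
    have *: "g \<notin> elts g'" if "g' \<in> elts ?l" "x \<in> elts k" "x' \<in> elts k"
      "app (J g) x = app (J g') x'" for g g' x x'
    proof
      assume "g \<in> elts g'"
      then have "app (J g') x' \<notin> app (J g) ` elts k" using J[OF that(1)] that(3) by blast
      then show False using that(2,4) by (metis imageI)
    qed
    have "g \<notin> elts g'" using *[OF that(2,3,4,5)] .
    moreover have "g' \<notin> elts g" using *[OF that(1,4,3) that(5)[symmetric]] .
    ultimately have "g = g'" using Ord_linear that Ord_mem[OF hart(1)] by blast
    then show ?thesis using J[OF that(1)] that by (blast dest: inj_onD)
  qed
  obtain i where i: "\<And>g. g \<in> elts ?l \<Longrightarrow> inj_on (app (app i g)) (elts g) \<and> app (app i g) ` elts g \<subseteq> elts k"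
  proof (rule bounded_choice[where a = ?l and b = "vpow (times ?l k)" and
        R = "\<lambda>g h. inj_on (app h) (elts g) \<and> app h ` elts g \<subseteq> elts k"])
    show "D (\<lambda>e. inj_on (app (e 1)) (elts (e 0)) \<and> app (e 1) ` elts (e 0) \<subseteq> elts k)" by (intro D_intros)
    fix g assume g: "g \<in> elts ?l"
    from hart(3)[OF this] obtain h where h: "isfun h g" "inj_on (app h) (elts g)" "app h ` elts g \<subseteq> elts k"
      by (rule lepollE)
    have "elts g \<subseteq> elts ?l" using g hart(1) Ord_trans by blast
    then have "elts h \<subseteq> elts (times ?l k)"
      by (rule isfun_subset_times[OF h(1) _ h(3)])
    then show "\<exists>h\<in>elts (vpow (times ?l k)). inj_on (app h) (elts g) \<and> app h ` elts g \<subseteq> elts k"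
      using h by auto
  qed blast
  obtain p where p: "inj_on (app p) (elts (times k k))" "app p ` elts (times k k) \<subseteq> elts k"
    using k by (auto simp: idem_def lepoll_def)
  \<comment> \<open>The successor makes both \<open>a\<close> and \<open>b\<close> elements of
    \<open>mx a b\<close>, so that the injection of \<open>mx a b\<close> into \<open>k\<close>
    codes both of them.\<close>
  define mx where "mx a b = vsucc (if a \<in> elts b then b else a)" for a b
  have mx: "mx a b \<in> elts ?l" "a \<in> elts (mx a b)" "b \<in> elts (mx a b)"
    if "a \<in> elts ?l" "b \<in> elts ?l" for a b
    using that hart_succ[OF k] Ord_linear[of a b] Ord_mem[OF hart(1)] by (auto simp: mx_def)
  define q where "q a b = app p (pair (app (app i (mx a b)) a) (app (app i (mx a b)) b))" for a b
  have q: "q a b \<in> elts k" if "a \<in> elts ?l" "b \<in> elts ?l" for a b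
    unfolding q_def using that p(2) i[OF mx(1)[OF that]] mx[OF that] by (auto simp: image_subset_iff)
  let ?F = "\<lambda>z. app (J (mx (vfst z) (vsnd z))) (q (vfst z) (vsnd z))"
  have "lepoll (times ?l ?l) ?l"
  proof (rule lepollI[of ?F])
    show "T (\<lambda>e. ?F (e 0))" unfolding q_def mx_def by (intro D_intros)
    show "?F ` elts (times ?l ?l) \<subseteq> elts ?l"
      using J mx q by (auto simp: image_subset_iff)
    show "inj_on ?F (elts (times ?l ?l))"
    proof (rule inj_onI)
      fix z z' assume "z \<in> elts (times ?l ?l)" "z' \<in> elts (times ?l ?l)" and eq: "?F z = ?F z'"
      then obtain a b a' b' where z: "z = pair a b" "z' = pair a' b'" "a \<in> elts ?l" "b \<in> elts ?l"
        "a' \<in> elts ?l" "b' \<in> elts ?l" by auto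
      have m: "mx a b = mx a' b'" and "q a b = q a' b'"
        using eq z J_inj[of "mx a b" "mx a' b'" "q a b" "q a' b'"] mx q by auto
      let ?g = "mx a' b'"
      have ig: "inj_on (app (app i ?g)) (elts ?g)" "app (app i ?g) ` elts ?g \<subseteq> elts k"
        using i[OF mx(1)] z by auto
      have ab: "a \<in> elts ?g" "b \<in> elts ?g" "a' \<in> elts ?g" "b' \<in> elts ?g"
        using mx(2,3)[of a b] mx(2,3)[of a' b'] z m by auto
      then have "app (app i ?g) a \<in> elts k" "app (app i ?g) b \<in> elts k"
          "app (app i ?g) a' \<in> elts k" "app (app i ?g) b' \<in> elts k"
        using ig(2) by blast+
      then have "pair (app (app i ?g) a) (app (app i ?g) b) = pair (app (app i ?g) a') (app (app i ?g) b')"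
        using \<open>q a b = q a' b'\<close> unfolding q_def m by - (rule inj_onD[OF p(1)], simp_all)
      then have "a = a'" "b = b'" using inj_onD[OF ig(1)] ab by simp_all
      then show "z = z'" using z by simp
    qed
  qed
  then show ?thesis unfolding idem_def using hart(1) kl \<open>elts omega \<subseteq> elts k\<close> by blast
qed

end

section \<open>Forcing\<close>

context mem
begin

lemma D_subst3:
  assumes "D (\<lambda>e. R (e 0) (e 1) (e 2))" "T s" "T t" "T u"
  shows "D (\<lambda>e. R (s e) (t e) (u e))"
proof -
  have "D (\<lambda>e. R (e (Suc (Suc 0))) (e (Suc 0)) (e 0))"
    using D_ren[OF assms(1), of "\<lambda>i. 2 - i"] by (simp add: numeral_2_eq_2)
  moreover have "T (\<lambda>e. s (\<lambda>n. e (Suc n)))" "T (\<lambda>e. t (\<lambda>n. e (Suc (Suc n))))"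
    "T (\<lambda>e. u (\<lambda>n. e (Suc (Suc (Suc n)))))"
    using T_ren[OF assms(2)] T_ren[OF assms(3)] T_ren[OF assms(4)] by this+
  ultimately have "D (\<lambda>e. \<exists>x. x = s e \<and> (\<exists>y. y = t e \<and> (\<exists>z. z = u e \<and> R x y z)))"
    by (intro D_intros)
  then show ?thesis by simp
qed

end

context zf
begin

lemma mem_of_pair: "transitive t \<Longrightarrow> \<tau> \<in> elts t \<Longrightarrow> pair \<pi> s \<in> elts \<tau> \<Longrightarrow> \<pi> \<in> elts t"
proof -
  assume t: "transitive t" and "\<tau> \<in> elts t" "pair \<pi> s \<in> elts \<tau>"
  then have "pair \<pi> s \<in> elts t" by (auto simp: transitive_def)
  moreover have "upair \<pi> \<pi> \<in> elts (pair \<pi> s)" by (simp add: pair_def)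
  ultimately have "upair \<pi> \<pi> \<in> elts t" using t unfolding transitive_def by blast
  then show ?thesis using t unfolding transitive_def by auto
qed

lemma name_induct [case_names D step]:
  assumes "D (\<lambda>e. Q (e 0))" "\<And>\<sigma>. (\<And>\<pi> s. pair \<pi> s \<in> elts \<sigma> \<Longrightarrow> Q \<pi>) \<Longrightarrow> Q \<sigma>"
  shows "Q \<sigma>"
proof -
  note [D_intros] = D_subst1[OF assms(1)]
  \<comment> \<open>The name \<pi> lies three membership steps below \<sigma>, as an element of
    \<open>upair \<pi> \<pi>\<close> inside \<open>pair \<pi> s\<close>. So the claim is carried
    along for two further levels.\<close>
  have "Q \<sigma> \<and> (\<forall>y\<in>elts \<sigma>. Q y \<and> (\<forall>z\<in>elts y. Q z))"
  proof (induction \<sigma> rule: mem_induct)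
    show "D (\<lambda>e. Q (e 0) \<and> (\<forall>y\<in>elts (e 0). Q y \<and> (\<forall>z\<in>elts y. Q z)))" by (intro D_intros)
  next
    case (step x)
    have "Q \<pi>" if "pair \<pi> s \<in> elts x" for \<pi> s
    proof -
      have "upair \<pi> \<pi> \<in> elts (pair \<pi> s)" "\<pi> \<in> elts (upair \<pi> \<pi>)" by (simp_all add: pair_def)
      then show ?thesis using step[of "pair \<pi> s"] that by blast
    qed
    then have "Q x" by (rule assms(2))
    with step show ?case by blast
  qed
  then show ?thesis by blast
qed

subsection \<open>The cumulative hierarchy and collection\<close>

definition rank where "rank = rec (\<lambda>x f. mk (\<Union>y\<in>elts x. elts (vsucc (app f y))))"
text \<open>On ordinals this is the cumulative hierarchy; its recursion makes no distinction between
  zero, successors and limits.\<close>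

definition level where "level = rec (\<lambda>x f. mk (\<Union>y\<in>elts x. elts (vpow (app f y))))"

lemma T_rank [D_intros]: "T s \<Longrightarrow> T (\<lambda>e. rank (s e))"
  unfolding rank_def by (intro T_rec D_intros)

lemma T_level [D_intros]: "T s \<Longrightarrow> T (\<lambda>e. level (s e))"
  unfolding level_def by (intro T_rec D_intros)

lemma elts_rank: "elts (rank x) = (\<Union>y\<in>elts x. elts (vsucc (rank y)))"
proof -
  let ?G = "\<lambda>x f. mk (\<Union>y\<in>elts x. elts (vsucc (app f y)))"
  have G: "T (\<lambda>e. ?G (e 0) (e 1))" by (intro D_intros)
  have T: "T (\<lambda>e. rec ?G (e 0))" by (intro T_rec D_intros)
  have "(\<Union>y\<in>elts x. elts (vsucc (app (lam x (rec ?G)) y))) = (\<Union>y\<in>elts x. elts (vsucc (rank y)))"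
    using app_lam[OF T] by (simp add: rank_def)
  then have "rank x = mk (\<Union>y\<in>elts x. elts (vsucc (rank y)))"
    unfolding rank_def by (subst rec_eq[OF G]) simp
  moreover have "isset (\<Union>y\<in>elts x. elts (vsucc (rank y)))"
    by (rule isset_UN[OF isset_elts isset_elts]) (intro D_intros)
  ultimately show ?thesis by (metis elts_mk)
qed

lemma elts_level: "elts (level x) = (\<Union>y\<in>elts x. elts (vpow (level y)))"
proof -
  let ?G = "\<lambda>x f. mk (\<Union>y\<in>elts x. elts (vpow (app f y)))"
  have G: "T (\<lambda>e. ?G (e 0) (e 1))" by (intro D_intros)
  have T: "T (\<lambda>e. rec ?G (e 0))" by (intro T_rec D_intros)
  have "(\<Union>y\<in>elts x. elts (vpow (app (lam x (rec ?G)) y))) = (\<Union>y\<in>elts x. elts (vpow (level y)))"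
    using app_lam[OF T] by (simp add: level_def)
  then have "level x = mk (\<Union>y\<in>elts x. elts (vpow (level y)))"
    unfolding level_def by (subst rec_eq[OF G]) simp
  moreover have "isset (\<Union>y\<in>elts x. elts (vpow (level y)))"
    by (rule isset_UN[OF isset_elts isset_elts]) (intro D_intros)
  ultimately show ?thesis by (metis elts_mk)
qed

lemma Ord_rank: "Ord (rank x)"
proof (induction x rule: mem_induct)
  show "D (\<lambda>e. Ord (rank (e 0)))" by (intro D_intros)
next
  case (step x)
  have O: "Ord z" if "z \<in> elts (rank x)" for z
    using that step Ord_mem unfolding elts_rank[of x] by auto
  have "elts z \<subseteq> elts (rank x)" if "z \<in> elts (rank x)" for z
    using that step Ord_trans unfolding elts_rank[of x] by fastforce
  then show ?case unfolding Ord_def transitive_def using O by (auto simp: Ord_def transitive_def)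
qed

lemma mem_level_rank: "x \<in> elts (level (vsucc (rank x)))"
proof -
  have "elts x \<subseteq> elts (level (rank x))"
  proof (induction x rule: mem_induct)
    show "D (\<lambda>e. elts (e 0) \<subseteq> elts (level (rank (e 0))))" by (intro D_intros)
  next
    case (step x)
    show ?case
    proof
      fix y assume "y \<in> elts x"
      then have "rank y \<in> elts (rank x)" "y \<in> elts (vpow (level (rank y)))"
        using step by (auto simp: elts_rank[of x])
      then show "y \<in> elts (level (rank x))" unfolding elts_level[of "rank x"] by blast
    qed
  qed
  then have "x \<in> elts (vpow (level (rank x)))" by simp
  then show ?thesis unfolding elts_level[of "vsucc (rank x)"] elts_vsucc by blast
qed

text \<open>All witnesses for \<open>x\<close> may form a proper class; only those in the first
  level of the hierarchy that contains any are kept. This is used for replacement in the extension,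
  where values have many names.\<close>

lemma collection:
  assumes "D (\<lambda>e. R (e 0) (e 1))"
  shows "\<exists>b. \<forall>x\<in>elts a. (\<exists>y. R x y) \<longrightarrow> (\<exists>y\<in>elts b. R x y)"
proof -
  note [D_intros] = D_subst2[OF assms]
  define m where "m x = the1 (\<lambda>\<alpha>. Ord \<alpha> \<and> (\<exists>y\<in>elts (level \<alpha>). R x y) \<and>
    (\<forall>\<beta>\<in>elts \<alpha>. \<not> (\<exists>y\<in>elts (level \<beta>). R x y)))" for x
  have Tm: "T (\<lambda>e. m (e 0))" unfolding m_def by (intro D_intros)
  note [D_intros] = T_subst1[OF Tm]
  have m: "\<exists>y\<in>elts (level (m x)). R x y" if "R x y" for x y
  proof -
    have "D (\<lambda>e. \<exists>y\<in>elts (level (e 0)). R x y)" by (intro D_intros)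
    moreover have "Ord (vsucc (rank y))" by (simp add: Ord_rank)
    moreover have "\<exists>z\<in>elts (level (vsucc (rank y))). R x z" using that mem_level_rank by blast
    ultimately obtain \<alpha> where \<alpha>: "Ord \<alpha>" "\<exists>y\<in>elts (level \<alpha>). R x y"
        "\<And>\<beta>. \<beta> \<in> elts \<alpha> \<Longrightarrow> \<not> (\<exists>y\<in>elts (level \<beta>). R x y)"
      by (rule Ord_least) blast
    have "m x = \<alpha>"
      unfolding m_def
    proof (rule the1_eq)
      fix \<gamma> assume "Ord \<gamma> \<and> (\<exists>y\<in>elts (level \<gamma>). R x y) \<and> (\<forall>\<beta>\<in>elts \<gamma>. \<not> (\<exists>y\<in>elts (level \<beta>). R x y))"
      then show "\<gamma> = \<alpha>" using \<alpha> Ord_linear[of \<gamma> \<alpha>] by blast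
    qed (use \<alpha> in blast)
    then show ?thesis using \<alpha> by simp
  qed
  let ?B = "\<Union>x\<in>elts a. elts (level (m x))"
  have B: "elts (mk ?B) = ?B" by (intro elts_mk isset_UN D_intros) auto
  have "\<exists>y\<in>elts (mk ?B). R x y" if x: "x \<in> elts a" and R: "R x y" for x y
  proof -
    obtain z where "z \<in> elts (level (m x))" "R x z" using m[OF R] by blast
    with x show ?thesis unfolding B by blast
  qed
  then show ?thesis by blast
qed

end

section \<open>Forced equality and membership of names\<close>

locale forcing = zfc +
  fixes P :: 'a
  assumes bot: "vempty \<in> elts P"
begin

text \<open>Conditions are ordered by inclusion, larger sets being stronger. With \<open>R\<close>
  as forced equality this says that \<open>p\<close> forces \<sigma> \<subseteq> \<tau>. Keeping
  \<open>R\<close> abstract allows its arguments to be exchanged for the opposite inclusion.\<close>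

definition half where
  "half R p \<sigma> \<tau> \<longleftrightarrow> (\<forall>\<pi> s. pair \<pi> s \<in> elts \<sigma> \<and> s \<in> elts P \<longrightarrow>
    (\<forall>q\<in>elts P. elts p \<subseteq> elts q \<and> elts s \<subseteq> elts q \<longrightarrow>
      (\<exists>r\<in>elts P. elts q \<subseteq> elts r \<and>
        (\<exists>\<rho> t. pair \<rho> t \<in> elts \<tau> \<and> t \<in> elts P \<and> elts t \<subseteq> elts r \<and> R r \<pi> \<rho>))))"

text \<open>A set that is a post-fixed point of the two forced inclusions. Quantifying over such
  sets makes forced equality first-order definable.\<close>

definition bisim where
  "bisim w \<longleftrightarrow> (\<forall>p \<sigma> \<tau>. pair p (pair \<sigma> \<tau>) \<in> elts w \<longrightarrow> p \<in> elts P \<and>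
    half (\<lambda>r \<pi> \<rho>. pair r (pair \<pi> \<rho>) \<in> elts w) p \<sigma> \<tau> \<and> half (\<lambda>r \<pi> \<rho>. pair r (pair \<rho> \<pi>) \<in> elts w) p \<tau> \<sigma>)"

text \<open>\<open>p\<close> forces two names to be equal. Foundation makes the greatest fixed point the only one,
  so that recursion on pairs of names can be avoided.\<close>

definition feq where
  "feq p \<sigma> \<tau> \<longleftrightarrow> (\<exists>w. bisim w \<and> pair p (pair \<sigma> \<tau>) \<in> elts w)"

lemma D_feq [D_intros]: "T s \<Longrightarrow> T t \<Longrightarrow> T u \<Longrightarrow> D (\<lambda>e. feq (s e) (t e) (u e))"
  by (rule D_subst3[of feq]) (unfold feq_def bisim_def half_def, intro D_intros)

lemma half_mono: "half R p \<sigma> \<tau> \<Longrightarrow> (\<And>r \<pi> \<rho> s t. pair \<pi> s \<in> elts \<sigma> \<Longrightarrow> pair \<rho> t \<in> elts \<tau> \<Longrightarrow> R r \<pi> \<rho> \<Longrightarrow> S r \<pi> \<rho>) \<Longrightarrow> half S p \<sigma> \<tau>"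
  unfolding half_def by meson

text \<open>From right to left this is coinduction: the unfolded relation \<open>B\<close> contains
  \<open>feq\<close>, and cut down to a set it is itself a \<open>bisim\<close>.\<close>

lemma feq_iff: "feq p \<sigma> \<tau> \<longleftrightarrow> p \<in> elts P \<and> half feq p \<sigma> \<tau> \<and> half (\<lambda>r \<pi> \<rho>. feq r \<rho> \<pi>) p \<tau> \<sigma>"
proof
  assume "feq p \<sigma> \<tau>"
  then obtain w where w: "bisim w" "pair p (pair \<sigma> \<tau>) \<in> elts w" by (auto simp: feq_def)
  then have "half (\<lambda>r \<pi> \<rho>. pair r (pair \<pi> \<rho>) \<in> elts w) p \<sigma> \<tau>" "half (\<lambda>r \<pi> \<rho>. pair r (pair \<rho> \<pi>) \<in> elts w) p \<tau> \<sigma>"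
    "p \<in> elts P"
    unfolding bisim_def by blast+
  moreover have "feq r \<pi> \<rho>" if "pair r (pair \<pi> \<rho>) \<in> elts w" for r \<pi> \<rho>
    using w that unfolding feq_def by blast
  ultimately show "p \<in> elts P \<and> half feq p \<sigma> \<tau> \<and> half (\<lambda>r \<pi> \<rho>. feq r \<rho> \<pi>) p \<tau> \<sigma>"
    by (metis (no_types, lifting) half_mono)
next
  define B where "B p \<sigma> \<tau> \<longleftrightarrow> p \<in> elts P \<and> half feq p \<sigma> \<tau> \<and> half (\<lambda>r \<pi> \<rho>. feq r \<rho> \<pi>) p \<tau> \<sigma>" for p \<sigma> \<tau>
  assume "p \<in> elts P \<and> half feq p \<sigma> \<tau> \<and> half (\<lambda>r \<pi> \<rho>. feq r \<rho> \<pi>) p \<tau> \<sigma>"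
  then have B: "B p \<sigma> \<tau>" by (simp add: B_def)
  obtain t where t: "transitive t" "upair \<sigma> \<tau> \<in> elts t" using transitive_superset_mem by blast
  then have st: "\<sigma> \<in> elts t" "\<tau> \<in> elts t" unfolding transitive_def by auto
  \<comment> \<open>All names below \<sigma> and \<tau> lie in the transitive set \<open>t\<close>;
    hence \<open>B\<close> restricted to \<open>t\<close> is a set and remains closed under passing
    to members of the names.\<close>
  let ?W = "{z \<in> elts (times P (times t t)). \<exists>p \<sigma> \<tau>. z = pair p (pair \<sigma> \<tau>) \<and> B p \<sigma> \<tau>}"
  have "isset ?W"
    by (rule isset_sub[OF isset_elts[of "times P (times t t)"]])
      (blast, unfold B_def half_def, intro D_intros)
  then have W: "elts (mk ?W) = ?W" by (rule elts_mk)
  have W': "pair p (pair \<sigma> \<tau>) \<in> elts (mk ?W) \<longleftrightarrow> \<sigma> \<in> elts t \<and> \<tau> \<in> elts t \<and> B p \<sigma> \<tau>" for p \<sigma> \<tau>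
    unfolding W by (auto simp: B_def)
  have feq_B: "B p \<sigma> \<tau>" if "feq p \<sigma> \<tau>" for p \<sigma> \<tau>
  proof -
    obtain w where w: "bisim w" "pair p (pair \<sigma> \<tau>) \<in> elts w" using \<open>feq p \<sigma> \<tau>\<close> by (auto simp: feq_def)
    then have "half (\<lambda>r \<pi> \<rho>. pair r (pair \<pi> \<rho>) \<in> elts w) p \<sigma> \<tau>" "half (\<lambda>r \<pi> \<rho>. pair r (pair \<rho> \<pi>) \<in> elts w) p \<tau> \<sigma>"
      "p \<in> elts P"
      unfolding bisim_def by blast+
    moreover have "feq r \<pi> \<rho>" if "pair r (pair \<pi> \<rho>) \<in> elts w" for r \<pi> \<rho>
      using w that unfolding feq_def by blast
    ultimately show ?thesis unfolding B_def by (metis (no_types, lifting) half_mono)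
  qed
  have "bisim (mk ?W)"
    unfolding bisim_def
  proof (intro allI impI)
    fix p \<sigma> \<tau> assume "pair p (pair \<sigma> \<tau>) \<in> elts (mk ?W)"
    then have *: "\<sigma> \<in> elts t" "\<tau> \<in> elts t" "B p \<sigma> \<tau>" unfolding W' by auto
    have in_t: "\<pi> \<in> elts t" if "pair \<pi> s \<in> elts \<sigma> \<or> pair \<pi> s \<in> elts \<tau>" for \<pi> s
      using mem_of_pair[OF t(1)] * that by blast
    have "half feq p \<sigma> \<tau>" "half (\<lambda>r \<pi> \<rho>. feq r \<rho> \<pi>) p \<tau> \<sigma>" using *(3) by (auto simp: B_def)
    then have "half (\<lambda>r \<pi> \<rho>. pair r (pair \<pi> \<rho>) \<in> elts (mk ?W)) p \<sigma> \<tau>"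
      by - (rule half_mono[of feq], assumption, unfold W', use in_t feq_B in blast)
    moreover have "half (\<lambda>r \<pi> \<rho>. pair r (pair \<rho> \<pi>) \<in> elts (mk ?W)) p \<tau> \<sigma>"
      using \<open>half (\<lambda>r \<pi> \<rho>. feq r \<rho> \<pi>) p \<tau> \<sigma>\<close>
      by - (rule half_mono[of "\<lambda>r \<pi> \<rho>. feq r \<rho> \<pi>"], assumption, unfold W', use in_t feq_B in blast)
    ultimately show "p \<in> elts P \<and> half (\<lambda>r \<pi> \<rho>. pair r (pair \<pi> \<rho>) \<in> elts (mk ?W)) p \<sigma> \<tau> \<and>
        half (\<lambda>r \<pi> \<rho>. pair r (pair \<rho> \<pi>) \<in> elts (mk ?W)) p \<tau> \<sigma>"
      using *(3) by (simp add: B_def)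
  qed
  moreover have "pair p (pair \<sigma> \<tau>) \<in> elts (mk ?W)" unfolding W' using st B by blast
  ultimately show "feq p \<sigma> \<tau>" unfolding feq_def by blast
qed

lemma half_weaken: "half R p \<sigma> \<tau> \<Longrightarrow> elts p \<subseteq> elts q \<Longrightarrow> half R q \<sigma> \<tau>"
  unfolding half_def by blast

lemma feq_mono: "feq p \<sigma> \<tau> \<Longrightarrow> q \<in> elts P \<Longrightarrow> elts p \<subseteq> elts q \<Longrightarrow> feq q \<sigma> \<tau>"
  using half_weaken unfolding feq_iff[of p \<sigma> \<tau>] feq_iff[of q \<sigma> \<tau>] by blast

lemma half_dense:
  assumes "p \<in> elts P" "\<And>q. q \<in> elts P \<Longrightarrow> elts p \<subseteq> elts q \<Longrightarrow> \<exists>r\<in>elts P. elts q \<subseteq> elts r \<and> half R r \<sigma> \<tau>"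
  shows "half R p \<sigma> \<tau>"
  unfolding half_def
proof (intro allI ballI impI)
  fix \<pi> s q assume *: "pair \<pi> s \<in> elts \<sigma> \<and> s \<in> elts P" "q \<in> elts P" "elts p \<subseteq> elts q \<and> elts s \<subseteq> elts q"
  then obtain r where r: "r \<in> elts P" "elts q \<subseteq> elts r" "half R r \<sigma> \<tau>" using assms(2) by blast
  then have "elts s \<subseteq> elts r" using * by blast
  then obtain r' where "r' \<in> elts P" "elts r \<subseteq> elts r'"
      "\<exists>\<rho> t. pair \<rho> t \<in> elts \<tau> \<and> t \<in> elts P \<and> elts t \<subseteq> elts r' \<and> R r' \<pi> \<rho>"
    using r(1,3) * unfolding half_def by blast
  then show "\<exists>r\<in>elts P. elts q \<subseteq> elts r \<and> (\<exists>\<rho> t. pair \<rho> t \<in> elts \<tau> \<and> t \<in> elts P \<and> elts t \<subseteq> elts r \<and> R r \<pi> \<rho>)"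
    using r(2) by blast
qed

lemma feq_dense:
  assumes "p \<in> elts P" "\<And>q. q \<in> elts P \<Longrightarrow> elts p \<subseteq> elts q \<Longrightarrow> \<exists>r\<in>elts P. elts q \<subseteq> elts r \<and> feq r \<sigma> \<tau>"
  shows "feq p \<sigma> \<tau>"
  unfolding feq_iff[of p]
proof (intro conjI half_dense)
  fix q assume "q \<in> elts P" "elts p \<subseteq> elts q"
  then obtain r where "r \<in> elts P" "elts q \<subseteq> elts r" "feq r \<sigma> \<tau>" using assms(2) by blast
  then show "\<exists>r\<in>elts P. elts q \<subseteq> elts r \<and> half feq r \<sigma> \<tau>"
    "\<exists>r\<in>elts P. elts q \<subseteq> elts r \<and> half (\<lambda>r \<pi> \<rho>. feq r \<rho> \<pi>) r \<tau> \<sigma>"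
    unfolding feq_iff[of r] by blast+
qed (use assms(1) in auto)

lemma feq_refl: "p \<in> elts P \<Longrightarrow> feq p \<sigma> \<sigma>"
proof -
  have "\<forall>p\<in>elts P. feq p \<sigma> \<sigma>"
  proof (induction \<sigma> rule: name_induct)
    show "D (\<lambda>e. \<forall>p\<in>elts P. feq p (e 0) (e 0))" by (intro D_intros)
  next
    case (step \<sigma>)
    have "half feq p \<sigma> \<sigma>" "half (\<lambda>r \<pi> \<rho>. feq r \<rho> \<pi>) p \<sigma> \<sigma>" if "p \<in> elts P" for p
      unfolding half_def using step by blast+
    then show ?case unfolding feq_iff[of _ \<sigma> \<sigma>] by blast
  qed
  then show "p \<in> elts P \<Longrightarrow> feq p \<sigma> \<sigma>" by blast
qed

lemma feq_sym: "feq p \<sigma> \<tau> \<Longrightarrow> feq p \<tau> \<sigma>"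
proof -
  have "\<forall>p \<tau>. feq p \<sigma> \<tau> \<longrightarrow> feq p \<tau> \<sigma>"
  proof (induction \<sigma> rule: name_induct)
    show "D (\<lambda>e. \<forall>p \<tau>. feq p (e 0) \<tau> \<longrightarrow> feq p \<tau> (e 0))" by (intro D_intros)
  next
    case (step \<sigma>)
    show ?case
    proof (intro allI impI)
      fix p \<tau> assume "feq p \<sigma> \<tau>"
      then have p: "p \<in> elts P" "half feq p \<sigma> \<tau>" "half (\<lambda>r \<pi> \<rho>. feq r \<rho> \<pi>) p \<tau> \<sigma>"
        unfolding feq_iff[of p \<sigma>] by blast+
      have "half feq p \<tau> \<sigma>" by (rule half_mono[OF p(3)]) (use step in blast)
      moreover have "half (\<lambda>r \<pi> \<rho>. feq r \<rho> \<pi>) p \<sigma> \<tau>" by (rule half_mono[OF p(2)]) (use step in blast)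
      ultimately show "feq p \<tau> \<sigma>" unfolding feq_iff[of p \<tau>] using p(1) by blast
    qed
  qed
  then show "feq p \<sigma> \<tau> \<Longrightarrow> feq p \<tau> \<sigma>" by blast
qed

text \<open>Three separate relations are needed because in \<open>feq_trans\<close> the induction
  hypothesis is only available for members of \<sigma>, and both inclusions are composed by the same
  argument.\<close>

lemma half_trans:
  assumes "half R p \<sigma> \<tau>" "half S p \<tau> \<nu>"
    "\<And>r \<pi> \<rho> \<mu> s u. pair \<pi> s \<in> elts \<sigma> \<Longrightarrow> pair \<mu> u \<in> elts \<nu> \<Longrightarrow> R r \<pi> \<rho> \<Longrightarrow> S r \<rho> \<mu> \<Longrightarrow> U r \<pi> \<mu>"
    "\<And>r q \<pi> \<rho>. R r \<pi> \<rho> \<Longrightarrow> q \<in> elts P \<Longrightarrow> elts r \<subseteq> elts q \<Longrightarrow> R q \<pi> \<rho>"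
  shows "half U p \<sigma> \<nu>"
  unfolding half_def
proof (intro allI ballI impI)
  fix \<pi> s q assume *: "pair \<pi> s \<in> elts \<sigma> \<and> s \<in> elts P" "q \<in> elts P" "elts p \<subseteq> elts q \<and> elts s \<subseteq> elts q"
  then obtain r \<rho> t where r: "r \<in> elts P" "elts q \<subseteq> elts r" "pair \<rho> t \<in> elts \<tau>" "t \<in> elts P"
      "elts t \<subseteq> elts r" "R r \<pi> \<rho>"
    using assms(1) unfolding half_def by blast
  moreover have "elts p \<subseteq> elts r" using * r by blast
  ultimately obtain r' \<mu> u where r': "r' \<in> elts P" "elts r \<subseteq> elts r'" "pair \<mu> u \<in> elts \<nu>" "u \<in> elts P"
      "elts u \<subseteq> elts r'" "S r' \<rho> \<mu>"
    using assms(2) unfolding half_def by blast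
  then have "U r' \<pi> \<mu>" using assms(3,4) * r by blast
  then show "\<exists>r\<in>elts P. elts q \<subseteq> elts r \<and> (\<exists>\<rho> t. pair \<rho> t \<in> elts \<nu> \<and> t \<in> elts P \<and> elts t \<subseteq> elts r \<and> U r \<pi> \<rho>)"
    using r r' by blast
qed

lemma feq_trans: "feq p \<sigma> \<tau> \<Longrightarrow> feq p \<tau> \<nu> \<Longrightarrow> feq p \<sigma> \<nu>"
proof -
  have "\<forall>p \<tau> \<nu>. feq p \<sigma> \<tau> \<longrightarrow> feq p \<tau> \<nu> \<longrightarrow> feq p \<sigma> \<nu>"
  proof (induction \<sigma> rule: name_induct)
    show "D (\<lambda>e. \<forall>p \<tau> \<nu>. feq p (e 0) \<tau> \<longrightarrow> feq p \<tau> \<nu> \<longrightarrow> feq p (e 0) \<nu>)" by (intro D_intros)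
  next
    case (step \<sigma>)
    show ?case
    proof (intro allI impI)
      fix p \<tau> \<nu> assume "feq p \<sigma> \<tau>" "feq p \<tau> \<nu>"
      then have p: "p \<in> elts P" "half feq p \<sigma> \<tau>" "half (\<lambda>r \<pi> \<rho>. feq r \<rho> \<pi>) p \<tau> \<sigma>"
        "half feq p \<tau> \<nu>" "half (\<lambda>r \<pi> \<rho>. feq r \<rho> \<pi>) p \<nu> \<tau>"
        unfolding feq_iff[of p \<sigma>] feq_iff[of p \<tau>] by blast+
      have "half feq p \<sigma> \<nu>"
        by (rule half_trans[OF p(2,4)]) (use step feq_mono in blast)+
      moreover have "half (\<lambda>r \<pi> \<rho>. feq r \<rho> \<pi>) p \<nu> \<sigma>"
        by (rule half_trans[OF p(5,3)]) (use step feq_mono in blast)+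
      ultimately show "feq p \<sigma> \<nu>" unfolding feq_iff[of p \<sigma> \<nu>] using p(1) by blast
    qed
  qed
  then show "feq p \<sigma> \<tau> \<Longrightarrow> feq p \<tau> \<nu> \<Longrightarrow> feq p \<sigma> \<nu>" by blast
qed

definition fmem where
  "fmem p \<sigma> \<tau> \<longleftrightarrow> (\<forall>q\<in>elts P. elts p \<subseteq> elts q \<longrightarrow> (\<exists>r\<in>elts P. elts q \<subseteq> elts r \<and>
    (\<exists>\<rho> t. pair \<rho> t \<in> elts \<tau> \<and> t \<in> elts P \<and> elts t \<subseteq> elts r \<and> feq r \<sigma> \<rho>)))"

lemma D_fmem [D_intros]: "T s \<Longrightarrow> T t \<Longrightarrow> T u \<Longrightarrow> D (\<lambda>e. fmem (s e) (t e) (u e))"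
  by (rule D_subst3[of fmem]) (unfold fmem_def, intro D_intros)

lemma fmem_cong: "feq p \<sigma> \<sigma>' \<Longrightarrow> fmem p \<sigma> \<tau> \<Longrightarrow> fmem p \<sigma>' \<tau>"
  unfolding fmem_def
proof (intro ballI impI)
  fix q assume *: "feq p \<sigma> \<sigma>'" "q \<in> elts P" "elts p \<subseteq> elts q" "\<forall>q\<in>elts P. elts p \<subseteq> elts q \<longrightarrow> (\<exists>r\<in>elts P.
    elts q \<subseteq> elts r \<and> (\<exists>\<rho> t. pair \<rho> t \<in> elts \<tau> \<and> t \<in> elts P \<and> elts t \<subseteq> elts r \<and> feq r \<sigma> \<rho>))"
  then obtain r \<rho> t where r: "r \<in> elts P" "elts q \<subseteq> elts r" "pair \<rho> t \<in> elts \<tau>" "t \<in> elts P"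
    "elts t \<subseteq> elts r" "feq r \<sigma> \<rho>" by blast
  moreover from this have "feq r \<sigma> \<sigma>'" using * by (blast intro: feq_mono)
  ultimately have "feq r \<sigma>' \<rho>" using feq_sym feq_trans by blast
  then show "\<exists>r\<in>elts P. elts q \<subseteq> elts r \<and>
      (\<exists>\<rho> t. pair \<rho> t \<in> elts \<tau> \<and> t \<in> elts P \<and> elts t \<subseteq> elts r \<and> feq r \<sigma>' \<rho>)"
    using r by blast
qed

text \<open>The clauses are those of Kripke semantics. They give classical logic without double
  negations because forced membership and equality are closed under density, a property that all
  formulas inherit by \<open>forces_dense\<close>.\<close>

primrec forces :: "fm \<Rightarrow> 'a \<Rightarrow> (nat \<Rightarrow> 'a) \<Rightarrow> bool" where
  "forces (Mem i j) p e \<longleftrightarrow> fmem p (e i) (e j)"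
| "forces (Eq i j) p e \<longleftrightarrow> feq p (e i) (e j)"
| "forces Falsum p e \<longleftrightarrow> False"
| "forces (Imp \<phi> \<psi>) p e \<longleftrightarrow>
    (\<forall>q\<in>elts P. elts p \<subseteq> elts q \<longrightarrow> forces \<phi> q e \<longrightarrow> forces \<psi> q e)"
| "forces (Univ \<phi>) p e \<longleftrightarrow> (\<forall>x. forces \<phi> p (case_nat x e))"

text \<open>The definability theorem, for each formula separately: the recursion over \<phi> takes
  place in HOL, and every clause is definable in the model.\<close>

lemma D_forces: "D (\<lambda>e. forces \<phi> (e k) (\<lambda>i. e (f i)))"
proof (induction \<phi> arbitrary: k f)
  case (Imp \<phi> \<psi>)
  show ?case unfolding forces.simps by (intro D_intros Imp)
next
  case (Univ \<phi>)
  have eq: "case_nat (e 0) (\<lambda>i. e (Suc (f i))) = (\<lambda>i. e (case_nat 0 (\<lambda>i. Suc (f i)) i))" for e :: "nat \<Rightarrow> 'a"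
    by (auto simp: fun_eq_iff split: nat.split)
  have "D (\<lambda>e. forces \<phi> (e (Suc k)) (case_nat (e 0) (\<lambda>i. e (Suc (f i)))))"
    unfolding eq by (rule Univ)
  then show ?case unfolding forces.simps by (intro D_intros)
next
  case (Mem i j)
  show ?case unfolding forces.simps by (intro D_intros)
next
  case (Eq i j)
  show ?case unfolding forces.simps by (intro D_intros)
next
  case Falsum
  show ?case unfolding forces.simps by (intro D_intros)
qed

lemma forces_mono: "forces \<phi> p e \<Longrightarrow> q \<in> elts P \<Longrightarrow> elts p \<subseteq> elts q \<Longrightarrow> forces \<phi> q e"
proof (induction \<phi> arbitrary: e)
  case (Mem i j)
  then show ?case unfolding forces.simps fmem_def by blast
next
  case (Imp \<phi> \<psi>)
  then show ?case unfolding forces.simps by blast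
next
  case (Eq i j)
  then show ?case using feq_mono by simp
qed auto

lemma forces_dense:
  assumes "p \<in> elts P" "\<And>q. q \<in> elts P \<Longrightarrow> elts p \<subseteq> elts q \<Longrightarrow> \<exists>r\<in>elts P. elts q \<subseteq> elts r \<and> forces \<phi> r e"
  shows "forces \<phi> p e"
  using assms
proof (induction \<phi> arbitrary: e p)
  case (Mem i j)
  show ?case unfolding forces.simps fmem_def
  proof (intro ballI impI)
    fix q assume "q \<in> elts P" "elts p \<subseteq> elts q"
    then obtain r where r: "r \<in> elts P" "elts q \<subseteq> elts r" "fmem r (e i) (e j)" using Mem(2)[of q] by auto
    then obtain r' where "r' \<in> elts P" "elts r \<subseteq> elts r'"
        "\<exists>\<rho> t. pair \<rho> t \<in> elts (e j) \<and> t \<in> elts P \<and> elts t \<subseteq> elts r' \<and> feq r' (e i) \<rho>"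
      unfolding fmem_def by blast
    then show "\<exists>r\<in>elts P. elts q \<subseteq> elts r \<and>
        (\<exists>\<rho> t. pair \<rho> t \<in> elts (e j) \<and> t \<in> elts P \<and> elts t \<subseteq> elts r \<and> feq r (e i) \<rho>)"
      using r by blast
  qed
next
  case (Eq i j)
  then show ?case using feq_dense by simp
next
  case Falsum
  then show ?case by auto
next
  case (Imp \<phi> \<psi>)
  show ?case unfolding forces.simps
  proof (intro ballI impI)
    fix q assume q: "q \<in> elts P" "elts p \<subseteq> elts q" "forces \<phi> q e"
    show "forces \<psi> q e"
    proof (rule Imp.IH(2))
      fix q' assume q': "q' \<in> elts P" "elts q \<subseteq> elts q'"
      then have "elts p \<subseteq> elts q'" using q by blast
      with Imp.prems(2) q' obtain r where r: "r \<in> elts P" "elts q' \<subseteq> elts r" "forces (Imp \<phi> \<psi>) r e" by blast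
      moreover have "forces \<phi> r e" using forces_mono[OF q(3) r(1)] q' r(2) by blast
      ultimately have "forces \<psi> r e" by auto
      then show "\<exists>r\<in>elts P. elts q' \<subseteq> elts r \<and> forces \<psi> r e" using r by blast
    qed (rule q(1))
  qed
next
  case (Univ \<phi>)
  show ?case unfolding forces.simps
  proof
    fix x
    show "forces \<phi> p (case_nat x e)"
    proof (rule Univ.IH[OF Univ.prems(1)])
      fix q assume "q \<in> elts P" "elts p \<subseteq> elts q"
      then show "\<exists>r\<in>elts P. elts q \<subseteq> elts r \<and> forces \<phi> r (case_nat x e)"
        using Univ.prems(2)[of q] by auto
    qed
  qed
qed

end

section \<open>Canonical names for ground model sets\<close>

context zf
begin

definition chk where "chk = rec (\<lambda>x f. mk ((\<lambda>y. pair (app f y) vempty) ` elts x))"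

lemma T_chk [D_intros]: "T s \<Longrightarrow> T (\<lambda>e. chk (s e))"
  unfolding chk_def by (intro T_rec D_intros)

lemma elts_chk: "elts (chk x) = (\<lambda>y. pair (chk y) vempty) ` elts x"
proof -
  let ?G = "\<lambda>x f. mk ((\<lambda>y. pair (app f y) vempty) ` elts x)"
  have G: "T (\<lambda>e. ?G (e 0) (e 1))" by (intro D_intros)
  have T: "T (\<lambda>e. rec ?G (e 0))" by (intro T_rec D_intros)
  have "(\<lambda>y. pair (app (lam x (rec ?G)) y) vempty) ` elts x = (\<lambda>y. pair (chk y) vempty) ` elts x"
    using app_lam[OF T] by (simp add: chk_def)
  then have "chk x = mk ((\<lambda>y. pair (chk y) vempty) ` elts x)"
    unfolding chk_def by (subst rec_eq[OF G]) simp
  moreover have "isset ((\<lambda>y. pair (chk y) vempty) ` elts x)"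
    by (rule isset_image[OF _ isset_elts]) (intro D_intros)
  ultimately show ?thesis by (metis elts_mk)
qed

end

context forcing
begin

text \<open>No condition identifies canonical names of different sets. This embeds the ground model
  into the extension and also shows that names have infinitely many classes.\<close>

lemma chk_feq_inject: "feq p (chk x) (chk y) \<Longrightarrow> x = y"
proof -
  have "\<forall>p y. feq p (chk x) (chk y) \<longrightarrow> x = y"
  proof (induction x rule: mem_induct)
    show "D (\<lambda>e. \<forall>p y. feq p (chk (e 0)) (chk y) \<longrightarrow> e 0 = y)" by (intro D_intros)
  next
    case (step x)
    show ?case
    proof (intro allI impI eltsI)
      fix p y assume "feq p (chk x) (chk y)"
      then have p: "p \<in> elts P" "half feq p (chk x) (chk y)" "half (\<lambda>r \<pi> \<rho>. feq r \<rho> \<pi>) p (chk y) (chk x)"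
        unfolding feq_iff[of p] by blast+
      have "u \<in> elts y" if "u \<in> elts x" for u
      proof -
        have "pair (chk u) vempty \<in> elts (chk x)" using that by (simp add: elts_chk)
        then obtain r \<rho> t where "pair \<rho> t \<in> elts (chk y)" "feq r (chk u) \<rho>"
          using p(1,2) bot unfolding half_def by (metis elts_vempty empty_subsetI order_refl)
        moreover from this(1) obtain v where "\<rho> = chk v" "v \<in> elts y" by (auto simp: elts_chk)
        ultimately show ?thesis using step[OF that] by blast
      qed
      moreover have "u \<in> elts x" if "u \<in> elts y" for u
      proof -
        have "pair (chk u) vempty \<in> elts (chk y)" using that by (simp add: elts_chk)
        then obtain r \<rho> t where "pair \<rho> t \<in> elts (chk x)" "feq r \<rho> (chk u)"
          using p(1,3) bot unfolding half_def by (metis elts_vempty empty_subsetI order_refl)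
        moreover from this(1) obtain v where "\<rho> = chk v" "v \<in> elts x" by (auto simp: elts_chk)
        ultimately show ?thesis using step by blast
      qed
      ultimately show "elts x = elts y" by blast
    qed
  qed
  then show "feq p (chk x) (chk y) \<Longrightarrow> x = y" by blast
qed

lemma D_forces_param: "D (\<lambda>e'. forces \<phi> (e' k) (\<lambda>i. case s i of None \<Rightarrow> e i | Some j \<Rightarrow> e' j))"
proof -
  have "D (\<lambda>e. forces \<phi> (e 0) (\<lambda>i. e (Suc i)))" by (rule D_forces)
  from D_env[OF this, where s = "case_nat (Some k) s" and d = "case_nat vempty e"]
  show ?thesis by (simp cong: option.case_cong)
qed

lemma D_forces_const: "D (\<lambda>e'. forces \<phi> (e' k) e)"
  using D_forces_param[of \<phi> k e "\<lambda>_. None"] by simp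

lemma D_forces_case: "D (\<lambda>e'. forces \<phi> (e' k) (case_nat (e' l) e))"
proof -
  have "(\<lambda>i. case case_nat (Some l) (\<lambda>_. None) i of None \<Rightarrow> case_nat vempty e i | Some j \<Rightarrow> e' j) =
      case_nat (e' l) e" for e'
    by (auto simp: fun_eq_iff split: nat.split)
  then show ?thesis
    using D_forces_param[of \<phi> k "case_nat vempty e" "case_nat (Some l) (\<lambda>_. None)"] by (simp cong: option.case_cong)
qed

end

subsection \<open>Generic extensions\<close>

text \<open>Genericity is stated as a decision: for every definable \<open>A\<close> some condition
  in \<open>G\<close> lies in \<open>A\<close> or has no extension in \<open>A\<close>. For a dense
  \<open>A\<close> the second case is impossible, but the dichotomy applies without any preparation
  of \<open>A\<close>.\<close>

locale generic = forcing E P for E :: "nat \<Rightarrow> nat \<Rightarrow> bool" (infix "\<epsilon>" 50) and P +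
  fixes G :: "nat set"
  assumes G_P: "G \<subseteq> elts P" and G_bot: "vempty \<in> G"
    and G_down: "q \<in> G \<Longrightarrow> p \<in> elts P \<Longrightarrow> elts p \<subseteq> elts q \<Longrightarrow> p \<in> G"
    and G_dir: "p \<in> G \<Longrightarrow> q \<in> G \<Longrightarrow> \<exists>r\<in>G. elts p \<subseteq> elts r \<and> elts q \<subseteq> elts r"
    and G_generic: "D (\<lambda>e. e 0 \<in> A) \<Longrightarrow> \<exists>p\<in>G. p \<in> A \<or> (\<forall>q\<in>elts P. elts p \<subseteq> elts q \<longrightarrow> q \<notin> A)"

text \<open>Rasiowa and Sikorski: by separation the trace of a definable \<open>A\<close> on
  \<open>P\<close> is an element of the model, so the enumeration \<open>f\<close> of the model
  reaches it, and the \<open>n\<close>-th step of the chain \<open>p\<close> decides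
  \<open>f n\<close>.\<close>

lemma (in forcing) generic_exists:
  fixes f :: "nat \<Rightarrow> 'a"
  assumes "surj f"
  shows "\<exists>G. G \<subseteq> elts P \<and> vempty \<in> G \<and> (\<forall>p q. q \<in> G \<longrightarrow> p \<in> elts P \<longrightarrow> elts p \<subseteq> elts q \<longrightarrow> p \<in> G) \<and>
    (\<forall>p\<in>G. \<forall>q\<in>G. \<exists>r\<in>G. elts p \<subseteq> elts r \<and> elts q \<subseteq> elts r) \<and>
    (\<forall>A. D (\<lambda>e. e 0 \<in> A) \<longrightarrow> (\<exists>p\<in>G. p \<in> A \<or> (\<forall>q\<in>elts P. elts p \<subseteq> elts q \<longrightarrow> q \<notin> A)))"
proof -
  define nxt where "nxt p n = (if \<exists>q\<in>elts P. elts p \<subseteq> elts q \<and> q \<in> elts (f n)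
    then SOME q. q \<in> elts P \<and> elts p \<subseteq> elts q \<and> q \<in> elts (f n) else p)" for p n
  have nxt: "nxt p n \<in> elts P \<and> elts p \<subseteq> elts (nxt p n) \<and>
      (nxt p n \<in> elts (f n) \<or> (\<forall>q\<in>elts P. elts (nxt p n) \<subseteq> elts q \<longrightarrow> q \<notin> elts (f n)))"
    if "p \<in> elts P" for p n
  proof (cases "\<exists>q\<in>elts P. elts p \<subseteq> elts q \<and> q \<in> elts (f n)")
    case True
    then have "\<exists>q. q \<in> elts P \<and> elts p \<subseteq> elts q \<and> q \<in> elts (f n)" by blast
    from someI_ex[OF this] True show ?thesis by (simp add: nxt_def)
  qed (use that in \<open>auto simp: nxt_def\<close>)
  define p where "p = rec_nat vempty (\<lambda>n p. nxt p n)"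
  have pP: "p n \<in> elts P" for n by (induction n) (auto simp: p_def bot nxt)
  have ps: "p (Suc n) = nxt (p n) n" for n by (simp add: p_def)
  have mono: "elts (p m) \<subseteq> elts (p n)" if "m \<le> n" for m n
    using that by (rule lift_Suc_mono_le[of "\<lambda>n. elts (p n)", rotated]) (use nxt pP ps in auto)
  define H where "H = {q \<in> elts P. \<exists>n. elts q \<subseteq> elts (p n)}"
  have pH: "p n \<in> H" for n using pP by (auto simp: H_def)
  show ?thesis
  proof (intro exI[of _ H] conjI allI impI ballI)
    show "vempty \<in> H" using pH[of 0] by (simp add: p_def)
    fix q r assume "q \<in> H" "r \<in> H"
    then obtain m n where "elts q \<subseteq> elts (p m)" "elts r \<subseteq> elts (p n)" by (auto simp: H_def)
    then have "elts q \<subseteq> elts (p (max m n))" "elts r \<subseteq> elts (p (max m n))"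
      using mono[of m "max m n"] mono[of n "max m n"] by auto
    then show "\<exists>s\<in>H. elts q \<subseteq> elts s \<and> elts r \<subseteq> elts s" using pH by blast
  next
    fix A assume "D (\<lambda>e. e 0 \<in> A)"
    then have "D (\<lambda>e. e 0 \<in> A \<inter> elts P)" by (intro D_intros)
    then have "isset (A \<inter> elts P)" by (intro isset_sub[OF isset_elts[of P]]) auto
    then obtain n where n: "elts (f n) = A \<inter> elts P" using assms by (metis isset_def surjD)
    have "p (Suc n) \<in> A \<or> (\<forall>q\<in>elts P. elts (p (Suc n)) \<subseteq> elts q \<longrightarrow> q \<notin> A)"
      using nxt[OF pP[of n], of n] unfolding ps n by blast
    then show "\<exists>p\<in>H. p \<in> A \<or> (\<forall>q\<in>elts P. elts p \<subseteq> elts q \<longrightarrow> q \<notin> A)" using pH by blast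
  qed (auto simp: H_def)
qed

context generic
begin

text \<open>The conditions that exhibit a counterpart of \<pi> in \<tau> are dense above
  \<open>p\<close> and \<open>s\<close>, so \<open>G\<close> contains one of them.\<close>

lemma half_generic:
  assumes R: "D (\<lambda>e. R (e 0) (e 1) (e 2))" and "half R p \<sigma> \<tau>" "p \<in> G" "pair \<pi> s \<in> elts \<sigma>" "s \<in> G"
  shows "\<exists>r\<in>G. \<exists>\<rho>. \<exists>t\<in>G. pair \<rho> t \<in> elts \<tau> \<and> R r \<pi> \<rho>"
proof -
  let ?A = "{r. \<exists>\<rho> t. pair \<rho> t \<in> elts \<tau> \<and> t \<in> elts P \<and> elts t \<subseteq> elts r \<and> R r \<pi> \<rho>}"
  have "D (\<lambda>e. e 0 \<in> ?A)" by (intro D_intros D_subst3[OF R])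
  from G_generic[OF this] obtain r where r: "r \<in> G" "r \<in> ?A \<or> (\<forall>q\<in>elts P. elts r \<subseteq> elts q \<longrightarrow> q \<notin> ?A)"
    by blast
  obtain q0 where q0: "q0 \<in> G" "elts p \<subseteq> elts q0" "elts s \<subseteq> elts q0" using G_dir assms(3,5) by blast
  obtain q where q: "q \<in> G" "elts q0 \<subseteq> elts q" "elts r \<subseteq> elts q" using G_dir q0(1) r(1) by blast
  have "q \<in> elts P" "s \<in> elts P" "elts p \<subseteq> elts q" "elts s \<subseteq> elts q" using q q0 G_P assms(5) by blast+
  then obtain r' where "r' \<in> elts P" "elts q \<subseteq> elts r'" "r' \<in> ?A"
    using assms(2,4) unfolding half_def by blast
  then have "r \<in> ?A" using r(2) q(3) by blast
  then obtain \<rho> t where "pair \<rho> t \<in> elts \<tau>" "t \<in> elts P" "elts t \<subseteq> elts r" "R r \<pi> \<rho>" by blast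
  moreover from this have "t \<in> G" using G_down r(1) by blast
  ultimately show ?thesis using r(1) by blast
qed

definition geq where "geq \<sigma> \<tau> \<longleftrightarrow> (\<exists>p\<in>G. feq p \<sigma> \<tau>)"

lemma equivp_geq: "equivp geq"
proof (intro equivpI reflpI sympI transpI)
  show "geq \<sigma> \<sigma>" for \<sigma> unfolding geq_def using G_bot bot feq_refl by blast
  show "geq \<tau> \<sigma>" if "geq \<sigma> \<tau>" for \<sigma> \<tau> using that unfolding geq_def using feq_sym by blast
  show "geq \<sigma> \<nu>" if g: "geq \<sigma> \<tau>" "geq \<tau> \<nu>" for \<sigma> \<tau> \<nu>
  proof -
    obtain p q where pq: "p \<in> G" "q \<in> G" "feq p \<sigma> \<tau>" "feq q \<tau> \<nu>"
      using g unfolding geq_def by blast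
    then obtain r where r: "r \<in> G" "elts p \<subseteq> elts r" "elts q \<subseteq> elts r" using G_dir by blast
    then have "r \<in> elts P" using G_P by blast
    have "feq r \<sigma> \<nu>"
      using feq_mono[OF pq(3) \<open>r \<in> elts P\<close> r(2)] feq_mono[OF pq(4) \<open>r \<in> elts P\<close> r(3)] by (rule feq_trans)
    then show ?thesis using r(1) unfolding geq_def by blast
  qed
qed

text \<open>The quotient map by \<open>geq\<close>, with the classes numbered by all natural
  numbers. It replaces the usual evaluation of names by recursion, which would require the ground
  model to be well-founded from outside.\<close>

definition val :: "nat \<Rightarrow> nat" where
  "val = (SOME h. surj h \<and> (\<forall>\<sigma> \<tau>. h \<sigma> = h \<tau> \<longleftrightarrow> geq \<sigma> \<tau>))"

lemma val: "surj val" "val \<sigma> = val \<tau> \<longleftrightarrow> geq \<sigma> \<tau>"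
proof -
  \<comment> \<open>Canonical names of different elements are never identified, so a finite set of
    names cannot represent them all.\<close>
  have inf: "\<exists>\<sigma>. \<forall>\<tau>\<in>F. \<not> geq \<sigma> \<tau>" if F: "finite F" for F
  proof (rule ccontr)
    assume "\<not> ?thesis"
    then have "\<forall>x. \<exists>y. y \<in> F \<and> geq (chk x) y" by blast
    from Hilbert_Choice.choice[OF this] obtain g where g: "\<And>x. g x \<in> F" "\<And>x. geq (chk x) (g x)"
      by blast
    have "inj g"
    proof (rule injI)
      fix x y assume "g x = g y"
      then have "geq (chk x) (chk y)" using g equivp_geq by (metis equivp_symp equivp_transp)
      then show "x = y" using chk_feq_inject by (auto simp: geq_def)
    qed
    moreover have "range g \<subseteq> F" using g by blast
    ultimately show False using F by (metis finite_subset infinite_UNIV_nat finite_imageD)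
  qed
  obtain h :: "nat \<Rightarrow> nat" where "surj h" "\<And>\<sigma> \<tau>. h \<sigma> = h \<tau> \<longleftrightarrow> geq \<sigma> \<tau>"
  proof (rule equivalence_classes_enumerated[OF equivp_geq])
    show "\<exists>\<sigma>. \<forall>\<tau>\<in>F. \<not> geq \<sigma> \<tau>" if "finite F" for F using that by (rule inf)
  qed blast
  then have "\<exists>h :: nat \<Rightarrow> nat. surj h \<and> (\<forall>\<sigma> \<tau>. h \<sigma> = h \<tau> \<longleftrightarrow> geq \<sigma> \<tau>)" by blast
  from someI_ex[OF this] show "surj val" "val \<sigma> = val \<tau> \<longleftrightarrow> geq \<sigma> \<tau>" unfolding val_def by blast+
qed

lemma val_cases: obtains \<sigma> where "x = val \<sigma>"
  using val(1) by (metis surjD)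

lemma val_feq: "p \<in> G \<Longrightarrow> feq p \<sigma> \<tau> \<Longrightarrow> val \<sigma> = val \<tau>"
  unfolding val(2) geq_def by blast

definition EG :: "nat \<Rightarrow> nat \<Rightarrow> bool" where
  "EG x y \<longleftrightarrow> (\<exists>\<tau> \<pi>. \<exists>s\<in>G. y = val \<tau> \<and> x = val \<pi> \<and> pair \<pi> s \<in> elts \<tau>)"

sublocale N: mem EG .

text \<open>\<open>EG\<close> refers to some name of the larger set; by \<open>half_generic\<close>
  any other name of it yields the same elements.\<close>

lemma N_elts_val: "N.elts (val \<tau>) = {val \<pi> |\<pi> s. s \<in> G \<and> pair \<pi> s \<in> elts \<tau>}"
proof -
  have "\<exists>\<rho>. \<exists>t\<in>G. pair \<rho> t \<in> elts \<tau> \<and> val \<pi> = val \<rho>"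
    if "val \<tau> = val \<sigma>" "s \<in> G" "pair \<pi> s \<in> elts \<sigma>" for \<sigma> \<pi> s
  proof -
    obtain p where p: "p \<in> G" "feq p \<tau> \<sigma>" using \<open>val \<tau> = val \<sigma>\<close> unfolding val geq_def by blast
    then have "half feq p \<sigma> \<tau>" using feq_sym feq_iff by blast
    moreover have "D (\<lambda>e. feq (e 0) (e 1) (e 2))" by (intro D_intros)
    ultimately have "\<exists>r\<in>G. \<exists>\<rho>. \<exists>t\<in>G. pair \<rho> t \<in> elts \<tau> \<and> feq r \<pi> \<rho>"
      using half_generic[of feq] p(1) that by blast
    then show ?thesis using val_feq by blast
  qed
  then show ?thesis unfolding N.elts_def EG_def by blast
qed

lemma val_memI: "s \<in> G \<Longrightarrow> pair \<pi> s \<in> elts \<tau> \<Longrightarrow> val \<pi> \<in> N.elts (val \<tau>)"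
  unfolding N_elts_val by blast

lemma val_memE:
  assumes "x \<in> N.elts (val \<tau>)"
  obtains \<pi> s where "x = val \<pi>" "s \<in> G" "pair \<pi> s \<in> elts \<tau>"
  using assms unfolding N_elts_val by blast

lemma fmem_truth: "val \<sigma> \<in> N.elts (val \<tau>) \<longleftrightarrow> (\<exists>p\<in>G. fmem p \<sigma> \<tau>)"
proof
  assume "val \<sigma> \<in> N.elts (val \<tau>)"
  then obtain \<pi> s where *: "val \<sigma> = val \<pi>" "s \<in> G" "pair \<pi> s \<in> elts \<tau>" by (rule val_memE)
  then obtain p where "p \<in> G" "feq p \<sigma> \<pi>" unfolding val geq_def by blast
  with * obtain r where r: "r \<in> G" "elts p \<subseteq> elts r" "elts s \<subseteq> elts r" using G_dir by blast
  have "feq q \<sigma> \<pi>" if "q \<in> elts P" "elts r \<subseteq> elts q" for q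
    using that r \<open>feq p \<sigma> \<pi>\<close> feq_mono by blast
  then have "fmem r \<sigma> \<tau>" unfolding fmem_def using r * G_P by blast
  then show "\<exists>p\<in>G. fmem p \<sigma> \<tau>" using r by blast
next
  assume "\<exists>p\<in>G. fmem p \<sigma> \<tau>"
  then obtain p where p: "p \<in> G" "fmem p \<sigma> \<tau>" by blast
  let ?A = "{r. \<exists>\<rho> t. pair \<rho> t \<in> elts \<tau> \<and> t \<in> elts P \<and> elts t \<subseteq> elts r \<and> feq r \<sigma> \<rho>}"
  have "D (\<lambda>e. e 0 \<in> ?A)" by (intro D_intros)
  from G_generic[OF this] obtain r where r: "r \<in> G" "r \<in> ?A \<or> (\<forall>q\<in>elts P. elts r \<subseteq> elts q \<longrightarrow> q \<notin> ?A)"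
    by blast
  obtain q where q: "q \<in> G" "elts p \<subseteq> elts q" "elts r \<subseteq> elts q" using G_dir[OF p(1) r(1)] by blast
  then have "q \<in> elts P" using G_P by blast
  with p(2) q(2) obtain r' where r': "r' \<in> elts P" "elts q \<subseteq> elts r'" "r' \<in> ?A"
    unfolding fmem_def by blast
  then have "elts r \<subseteq> elts r'" using q(3) by blast
  then have "r \<in> ?A" using r(2) r'(1,3) by blast
  then obtain \<rho> t where *: "pair \<rho> t \<in> elts \<tau>" "t \<in> elts P" "elts t \<subseteq> elts r" "feq r \<sigma> \<rho>" by blast
  then have "val \<rho> \<in> N.elts (val \<tau>)" using G_down r(1) by (blast intro: val_memI)
  then show "val \<sigma> \<in> N.elts (val \<tau>)" using val_feq[OF r(1) *(4)] by simp
qed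

text \<open>In the cases of implication and quantification, \<open>G\<close> decides the set of
  conditions that either force the formula or rule out a suitable instance in all extensions. By
  \<open>forces_dense\<close> this set is dense, and the second alternative contradicts the
  hypothesis.\<close>

theorem truth: "sat EG (=) \<phi> (\<lambda>i. val (e i)) \<longleftrightarrow> (\<exists>p\<in>G. forces \<phi> p e)"
proof (induction \<phi> arbitrary: e)
  case (Mem i j)
  show ?case using fmem_truth by (simp add: N.elts_def)
next
  case (Eq i j)
  show ?case by (simp add: val geq_def)
next
  case Falsum
  show ?case by simp
next
  case (Imp \<phi> \<psi>)
  show ?case
  proof
    assume *: "sat EG (=) (Imp \<phi> \<psi>) (\<lambda>i. val (e i))"
    let ?A = "{p. forces (Imp \<phi> \<psi>) p e \<or> (forces \<phi> p e \<and> (\<forall>q\<in>elts P. elts p \<subseteq> elts q \<longrightarrow> \<not> forces \<psi> q e))}"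
    have "D (\<lambda>e. e 0 \<in> ?A)" by (intro D_intros D_forces_const)
    from G_generic[OF this] obtain r where r: "r \<in> G" "r \<in> ?A \<or> (\<forall>q\<in>elts P. elts r \<subseteq> elts q \<longrightarrow> q \<notin> ?A)"
      by blast
    then have "r \<in> elts P" using G_P by blast
    have "\<exists>q\<in>elts P. elts r \<subseteq> elts q \<and> q \<in> ?A"
    proof (rule ccontr)
      assume no: "\<not> ?thesis"
      have "forces (Imp \<phi> \<psi>) r e"
        unfolding forces.simps
      proof (intro ballI impI)
        fix q assume q: "q \<in> elts P" "elts r \<subseteq> elts q" "forces \<phi> q e"
        show "forces \<psi> q e"
        proof (rule forces_dense[OF q(1)])
          fix q' assume q': "q' \<in> elts P" "elts q \<subseteq> elts q'"
          then have "forces \<phi> q' e" "elts r \<subseteq> elts q'" using q forces_mono by blast+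
          then show "\<exists>r\<in>elts P. elts q' \<subseteq> elts r \<and> forces \<psi> r e" using no q' by blast
        qed
      qed
      then show False using no \<open>r \<in> elts P\<close> by blast
    qed
    then have "r \<in> ?A" using r by blast
    moreover have False if "forces \<phi> r e" "\<forall>q\<in>elts P. elts r \<subseteq> elts q \<longrightarrow> \<not> forces \<psi> q e"
    proof -
      have "sat EG (=) \<psi> (\<lambda>i. val (e i))" using * Imp.IH(1)[of e] that(1) r(1) by auto
      then obtain p where "p \<in> G" "forces \<psi> p e" using Imp.IH(2) by blast
      moreover obtain q where "q \<in> G" "elts p \<subseteq> elts q" "elts r \<subseteq> elts q"
        using G_dir[OF \<open>p \<in> G\<close> r(1)] by blast
      ultimately show False using that(2) forces_mono G_P by blast
    qed
    ultimately show "\<exists>p\<in>G. forces (Imp \<phi> \<psi>) p e" using r(1) by blast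
  next
    assume "\<exists>p\<in>G. forces (Imp \<phi> \<psi>) p e"
    then obtain p where p: "p \<in> G" "forces (Imp \<phi> \<psi>) p e" by blast
    have "sat EG (=) \<psi> (\<lambda>i. val (e i))" if \<phi>: "sat EG (=) \<phi> (\<lambda>i. val (e i))"
    proof -
      obtain p' where p': "p' \<in> G" "forces \<phi> p' e" using \<phi> Imp.IH(1) by blast
      obtain q where q: "q \<in> G" "elts p \<subseteq> elts q" "elts p' \<subseteq> elts q" using G_dir p(1) p'(1) by blast
      have "q \<in> elts P" using q(1) G_P by blast
      moreover have "forces \<phi> q e" using forces_mono[OF p'(2)] q(3) \<open>q \<in> elts P\<close> by blast
      ultimately have "forces \<psi> q e" using p(2) q(2) unfolding forces.simps by blast
      then show ?thesis using Imp.IH(2) q by blast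
    qed
    then show "sat EG (=) (Imp \<phi> \<psi>) (\<lambda>i. val (e i))" by simp
  qed
next
  case (Univ \<phi>)
  have case_val: "case_nat (val x) (\<lambda>i. val (e i)) = (\<lambda>i. val (case_nat x e i))" for x
    by (auto simp: fun_eq_iff split: nat.split)
  have IH: "sat EG (=) \<phi> (case_nat (val x) (\<lambda>i. val (e i))) \<longleftrightarrow> (\<exists>p\<in>G. forces \<phi> p (case_nat x e))" for x
    unfolding case_val by (rule Univ.IH)
  show ?case
  proof
    assume *: "sat EG (=) (Univ \<phi>) (\<lambda>i. val (e i))"
    let ?A = "{p. forces (Univ \<phi>) p e \<or> (\<exists>x. \<forall>q\<in>elts P. elts p \<subseteq> elts q \<longrightarrow> \<not> forces \<phi> q (case_nat x e))}"
    have "D (\<lambda>e. e 0 \<in> ?A)" by (intro D_intros D_forces_const D_forces_case)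
    from G_generic[OF this] obtain r where r: "r \<in> G" "r \<in> ?A \<or> (\<forall>q\<in>elts P. elts r \<subseteq> elts q \<longrightarrow> q \<notin> ?A)"
      by blast
    then have "r \<in> elts P" using G_P by blast
    have "\<exists>q\<in>elts P. elts r \<subseteq> elts q \<and> q \<in> ?A"
    proof (rule ccontr)
      assume no: "\<not> ?thesis"
      have "forces (Univ \<phi>) r e"
        unfolding forces.simps
      proof
        fix x
        show "forces \<phi> r (case_nat x e)"
          by (rule forces_dense[OF \<open>r \<in> elts P\<close>]) (use no in blast)
      qed
      then show False using no \<open>r \<in> elts P\<close> by blast
    qed
    then have "r \<in> ?A" using r by blast
    moreover have False if "\<forall>q\<in>elts P. elts r \<subseteq> elts q \<longrightarrow> \<not> forces \<phi> q (case_nat x e)" for x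
    proof -
      have "sat EG (=) \<phi> (case_nat (val x) (\<lambda>i. val (e i)))" using * by simp
      then obtain p where "p \<in> G" "forces \<phi> p (case_nat x e)" using IH by blast
      moreover obtain q where "q \<in> G" "elts p \<subseteq> elts q" "elts r \<subseteq> elts q"
        using G_dir[OF \<open>p \<in> G\<close> r(1)] by blast
      ultimately show False using that forces_mono G_P by blast
    qed
    ultimately show "\<exists>p\<in>G. forces (Univ \<phi>) p e" using r(1) by blast
  next
    assume "\<exists>p\<in>G. forces (Univ \<phi>) p e"
    then have "sat EG (=) \<phi> (case_nat (val x) (\<lambda>i. val (e i)))" for x using IH by auto
    then have "sat EG (=) \<phi> (case_nat y (\<lambda>i. val (e i)))" for y by (metis val_cases)
    then show "sat EG (=) (Univ \<phi>) (\<lambda>i. val (e i))" by simp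
  qed
qed

text \<open>Turns definability in the extension into definability in the ground model: the
  parameters are replaced by names for them and satisfaction by forcing.\<close>

lemma forcing_definable2:
  assumes "N.D (\<lambda>e. Q (e 0) (e 1))"
  obtains F where "D (\<lambda>e. F (e 0) (e 1) (e 2))" "\<And>x y. Q (val x) (val y) \<longleftrightarrow> (\<exists>p\<in>G. F p x y)"
    "\<And>p q x y. F p x y \<Longrightarrow> q \<in> elts P \<Longrightarrow> elts p \<subseteq> elts q \<Longrightarrow> F q x y"
proof -
  obtain \<phi> r c where Q: "\<And>e :: nat \<Rightarrow> nat. Q (e 0) (e 1) = sat EG (=) \<phi> (\<lambda>i. case r i of None \<Rightarrow> c i | Some j \<Rightarrow> e j)"
    using assms unfolding N.D_def by blast
  define c' where "c' i = inv val (c i)" for i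
  have c': "val (c' i) = c i" for i using val(1) by (simp add: c'_def surj_f_inv_f)
  define F where "F p x y = forces \<phi> p (\<lambda>i. case r i of None \<Rightarrow> c' i | Some j \<Rightarrow> if j = 0 then x else y)" for p x y
  show ?thesis
  proof (rule that[of F])
    let ?s = "\<lambda>i. case r i of None \<Rightarrow> None | Some j \<Rightarrow> Some (if j = 0 then 1 else 2::nat)"
    have "(case ?s i of None \<Rightarrow> c' i | Some j \<Rightarrow> e j) =
        (case r i of None \<Rightarrow> c' i | Some j \<Rightarrow> if j = 0 then e 1 else e 2)" for e :: "nat \<Rightarrow> nat" and i
      by (auto split: option.split)
    then show "D (\<lambda>e. F (e 0) (e 1) (e 2))"
      unfolding F_def using D_forces_param[of \<phi> 0 c' ?s] by simp
    show "Q (val x) (val y) \<longleftrightarrow> (\<exists>p\<in>G. F p x y)" for x y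
    proof -
      have "(\<lambda>i. case r i of None \<Rightarrow> c i | Some j \<Rightarrow> if j = 0 then val x else val y) =
          (\<lambda>i. val (case r i of None \<Rightarrow> c' i | Some j \<Rightarrow> if j = 0 then x else y))"
        by (auto simp: fun_eq_iff c' split: option.split)
      then show ?thesis
        using Q[of "\<lambda>j. if j = 0 then val x else val y"] by (simp add: F_def truth)
    qed
    show "F q x y" if "F p x y" "q \<in> elts P" "elts p \<subseteq> elts q" for p q x y
      using that unfolding F_def by (rule forces_mono)
  qed
qed

lemma forcing_definable:
  assumes "N.D (\<lambda>e. Q (e 0))"
  obtains F where "D (\<lambda>e. F (e 0) (e 1))" "\<And>x. Q (val x) \<longleftrightarrow> (\<exists>p\<in>G. F p x)"
    "\<And>p q x. F p x \<Longrightarrow> q \<in> elts P \<Longrightarrow> elts p \<subseteq> elts q \<Longrightarrow> F q x"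
proof -
  obtain F where F: "D (\<lambda>e. F (e 0) (e 1) (e 2))" "\<And>x y. Q (val x) \<longleftrightarrow> (\<exists>p\<in>G. F p x y)"
    "\<And>p q x y. F p x y \<Longrightarrow> q \<in> elts P \<Longrightarrow> elts p \<subseteq> elts q \<Longrightarrow> F q x y"
    using forcing_definable2[of "\<lambda>x y. Q x", OF assms] by blast
  show ?thesis
  proof (rule that[of "\<lambda>p x. F p x vempty"])
    show "D (\<lambda>e. F (e 0) (e 1) vempty)" by (intro D_subst3[OF F(1)] D_intros)
  qed (use F(2,3) in blast)+
qed

end

section \<open>The axioms of ZFC in the generic extension\<close>

context generic
begin

lemma common_ext: "p \<in> G \<Longrightarrow> q \<in> G \<Longrightarrow> \<exists>r. r \<in> G \<and> r \<in> elts P \<and> elts p \<subseteq> elts r \<and> elts q \<subseteq> elts r"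
  using G_dir[of p q] G_P by (meson subsetD)

lemma generic_meets:
  assumes "D (\<lambda>e. e 0 \<in> A)"
    and "\<And>p. p \<in> elts P \<Longrightarrow> p \<in> G \<Longrightarrow> elts p0 \<subseteq> elts p \<Longrightarrow> \<exists>q\<in>elts P. elts p \<subseteq> elts q \<and> q \<in> A"
    and "p0 \<in> G"
  shows "\<exists>p\<in>G. p \<in> A"
proof -
  obtain p where p: "p \<in> G" "p \<in> A \<or> (\<forall>q\<in>elts P. elts p \<subseteq> elts q \<longrightarrow> q \<notin> A)"
    using G_generic[OF assms(1)] by blast
  obtain r where r: "r \<in> G" "r \<in> elts P" "elts p \<subseteq> elts r" "elts p0 \<subseteq> elts r"
    using common_ext[OF p(1) assms(3)] by blast
  then obtain q where "q \<in> elts P" "elts r \<subseteq> elts q" "q \<in> A" using assms(2) by blast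
  moreover from this have "elts p \<subseteq> elts q" using r by blast
  ultimately show ?thesis using p by blast
qed

text \<open>Densely often a condition forces the names to be equal or forces one of them to have a
  member that the other lacks. The latter cannot occur in \<open>G\<close> if both values have the
  same elements.\<close>

lemma N_extensionality:
  assumes "N.elts x = N.elts y"
  shows "x = y"
proof -
  obtain \<sigma> \<tau> where xy: "x = val \<sigma>" "y = val \<tau>" using val_cases by metis
  \<comment> \<open>\<open>B R \<sigma> \<tau> p\<close> exhibits a member \<pi> of \<sigma> from
    which no extension of \<open>p\<close> can identify a member of \<tau>; densely this is the
    failure of \<open>half\<close>.\<close>
  define B where "B R \<sigma> \<tau> p \<longleftrightarrow> (\<exists>\<pi> s. pair \<pi> s \<in> elts \<sigma> \<and> s \<in> elts P \<and> elts s \<subseteq> elts p \<and>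
    (\<forall>r\<in>elts P. elts p \<subseteq> elts r \<longrightarrow> (\<forall>\<rho> t. pair \<rho> t \<in> elts \<tau> \<and> t \<in> elts P \<and> elts t \<subseteq> elts r \<longrightarrow> \<not> R r \<pi> \<rho>)))"
    for R \<sigma> \<tau> p
  have nhalf: "\<exists>q\<in>elts P. elts p \<subseteq> elts q \<and> B R \<sigma> \<tau> q" if "\<not> half R p \<sigma> \<tau>" for R \<sigma> \<tau> p
  proof -
    from that obtain \<pi> s q where "pair \<pi> s \<in> elts \<sigma>" "s \<in> elts P" "q \<in> elts P" "elts p \<subseteq> elts q" "elts s \<subseteq> elts q"
      "\<And>r \<rho> t. r \<in> elts P \<Longrightarrow> elts q \<subseteq> elts r \<Longrightarrow> pair \<rho> t \<in> elts \<tau> \<Longrightarrow> t \<in> elts P \<Longrightarrow> elts t \<subseteq> elts r \<Longrightarrow> \<not> R r \<pi> \<rho>"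
      unfolding half_def by metis
    then show ?thesis unfolding B_def by blast
  qed
  have notB: False if "B R \<sigma> \<tau> p" "p \<in> G" "N.elts (val \<sigma>) \<subseteq> N.elts (val \<tau>)"
    and R: "\<And>p \<pi> \<rho>. feq p \<pi> \<rho> \<Longrightarrow> R p \<pi> \<rho>" for R \<sigma> \<tau> p
  proof -
    from \<open>B R \<sigma> \<tau> p\<close> obtain \<pi> s where s: "pair \<pi> s \<in> elts \<sigma>" "s \<in> elts P" "elts s \<subseteq> elts p"
      and no: "\<And>r \<rho> t. r \<in> elts P \<Longrightarrow> elts p \<subseteq> elts r \<Longrightarrow> pair \<rho> t \<in> elts \<tau> \<Longrightarrow> t \<in> elts P \<Longrightarrow> elts t \<subseteq> elts r \<Longrightarrow> \<not> R r \<pi> \<rho>"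
      unfolding B_def by blast
    have "s \<in> G" using G_down[OF \<open>p \<in> G\<close> s(2,3)] .
    then have "val \<pi> \<in> N.elts (val \<tau>)" using val_memI[OF _ s(1)] \<open>N.elts (val \<sigma>) \<subseteq> N.elts (val \<tau>)\<close> by blast
    then obtain \<rho> t where t: "val \<pi> = val \<rho>" "t \<in> G" "pair \<rho> t \<in> elts \<tau>" by (rule val_memE)
    obtain q where q: "q \<in> G" "feq q \<pi> \<rho>" using t(1) unfolding val(2) geq_def by blast
    obtain r where r: "r \<in> G" "elts p \<subseteq> elts r" "elts q \<subseteq> elts r" using G_dir[OF \<open>p \<in> G\<close> q(1)] by blast
    obtain r' where r': "r' \<in> G" "r' \<in> elts P" "elts r \<subseteq> elts r'" "elts t \<subseteq> elts r'"
      using common_ext[OF r(1) t(2)] by blast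
    have "feq r' \<pi> \<rho>" by (rule feq_mono[OF q(2) r'(2)]) (use r(3) r'(3) in blast)
    moreover have "elts p \<subseteq> elts r'" "t \<in> elts P" using r(2) r'(3) t(2) G_P by blast+
    ultimately show False using no[OF r'(2) _ t(3) _ r'(4)] R by blast
  qed
  let ?R = "\<lambda>r \<pi> \<rho>. feq r \<rho> \<pi>"
  let ?A = "{p. feq p \<sigma> \<tau> \<or> B feq \<sigma> \<tau> p \<or> B ?R \<tau> \<sigma> p}"
  have "D (\<lambda>e. e 0 \<in> ?A)" unfolding B_def by (intro D_intros)
  then have "\<exists>p\<in>G. p \<in> ?A"
  proof (rule generic_meets)
    fix p assume p: "p \<in> elts P"
    show "\<exists>q\<in>elts P. elts p \<subseteq> elts q \<and> q \<in> ?A"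
    proof (cases "feq p \<sigma> \<tau>")
      case True
      then show ?thesis using p by blast
    next
      case False
      then have "\<not> half feq p \<sigma> \<tau> \<or> \<not> half ?R p \<tau> \<sigma>" unfolding feq_iff[of p \<sigma>] using p by blast
      then show ?thesis using nhalf[of feq p \<sigma> \<tau>] nhalf[of ?R p \<tau> \<sigma>] by blast
    qed
  qed (rule G_bot)
  then obtain p where p: "p \<in> G" "feq p \<sigma> \<tau> \<or> B feq \<sigma> \<tau> p \<or> B ?R \<tau> \<sigma> p" by blast
  have "\<not> B feq \<sigma> \<tau> p" using notB[of feq \<sigma> \<tau> p] p(1) assms xy by blast
  moreover have "\<not> B ?R \<tau> \<sigma> p" using notB[of ?R \<tau> \<sigma> p] p(1) assms xy feq_sym by blast
  ultimately show ?thesis using p val_feq xy by blast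
qed

lemma N_elts_mk: "isset W \<Longrightarrow> N.elts (val (mk W)) = {val \<pi> |\<pi> s. s \<in> G \<and> pair \<pi> s \<in> W}"
  by (simp add: N_elts_val elts_mk)

lemma val_setI: "s \<in> G \<Longrightarrow> pair \<pi> s \<in> W \<Longrightarrow> v = val \<pi> \<Longrightarrow> v \<in> {val \<pi> |\<pi> s. s \<in> G \<and> pair \<pi> s \<in> W}"
  by blast

lemma N_pair_exists: "\<exists>z. N.elts z = {x, y}"
proof -
  obtain \<sigma> \<tau> where xy: "x = val \<sigma>" "y = val \<tau>" using val_cases by metis
  have "N.elts (val (upair (pair \<sigma> vempty) (pair \<tau> vempty))) = {x, y}"
    unfolding N_elts_val xy using G_bot by auto
  then show ?thesis by blast
qed

lemma N_union_exists: "\<exists>z. N.elts z = (\<Union>y\<in>N.elts x. N.elts y)"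
proof -
  obtain \<tau> where x: "x = val \<tau>" by (rule val_cases)
  obtain t where t: "transitive t" "\<tau> \<in> elts t" using transitive_superset_mem by blast
  let ?W = "{z \<in> elts (times t P). \<exists>\<rho> r. z = pair \<rho> r \<and> (\<exists>\<pi> s q. pair \<pi> s \<in> elts \<tau> \<and> pair \<rho> q \<in> elts \<pi> \<and>
    s \<in> elts P \<and> q \<in> elts P \<and> elts s \<subseteq> elts r \<and> elts q \<subseteq> elts r)}"
  have W: "isset ?W" by (rule isset_sub[OF isset_elts[of "times t P"]]) (blast, intro D_intros)
  have "N.elts (val (mk ?W)) = (\<Union>y\<in>N.elts x. N.elts y)"
    unfolding N_elts_mk[OF W]
  proof (intro equalityI subsetI)
    fix v assume "v \<in> {val \<pi> |\<pi> s. s \<in> G \<and> pair \<pi> s \<in> ?W}"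
    then obtain \<rho> r \<pi> s q where *: "v = val \<rho>" "r \<in> G" "pair \<pi> s \<in> elts \<tau>" "pair \<rho> q \<in> elts \<pi>"
      "s \<in> elts P" "q \<in> elts P" "elts s \<subseteq> elts r" "elts q \<subseteq> elts r" by auto
    then have "s \<in> G" "q \<in> G" using G_down by blast+
    then have "val \<pi> \<in> N.elts x" "v \<in> N.elts (val \<pi>)" using * x val_memI by blast+
    then show "v \<in> (\<Union>y\<in>N.elts x. N.elts y)" by blast
  next
    fix v assume "v \<in> (\<Union>y\<in>N.elts x. N.elts y)"
    then obtain y where "y \<in> N.elts (val \<tau>)" "v \<in> N.elts y" using x by blast
    then obtain \<pi> s where \<pi>: "y = val \<pi>" "s \<in> G" "pair \<pi> s \<in> elts \<tau>" by (blast elim: val_memE)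
    with \<open>v \<in> N.elts y\<close> obtain \<rho> q where \<rho>: "v = val \<rho>" "q \<in> G" "pair \<rho> q \<in> elts \<pi>" by (blast elim: val_memE)
    obtain r where r: "r \<in> G" "r \<in> elts P" "elts s \<subseteq> elts r" "elts q \<subseteq> elts r"
      using common_ext[OF \<pi>(2) \<rho>(2)] by blast
    have "\<rho> \<in> elts t" using mem_of_pair[OF t(1) mem_of_pair[OF t \<pi>(3)] \<rho>(3)] .
    moreover have "s \<in> elts P" "q \<in> elts P" using \<pi>(2) \<rho>(2) G_P by blast+
    ultimately have "pair \<rho> r \<in> ?W" using r \<pi>(3) \<rho>(3) by simp blast
    then show "v \<in> {val \<pi> |\<pi> s. s \<in> G \<and> pair \<pi> s \<in> ?W}" by (rule val_setI[OF r(1) _ \<rho>(1)])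
  qed
  then show ?thesis by blast
qed

text \<open>The name pairs \<pi> with the conditions \<open>p\<close> that force \<open>Q\<close> of
  it and extend some \<open>s\<close> attached to \<pi> in \<tau>, hence also put \<pi> into the
  original set.\<close>

lemma N_sep:
  assumes "N.D (\<lambda>e. Q (e 0))"
  shows "\<exists>z. N.elts z = {u \<in> N.elts x. Q u}"
proof -
  obtain F where F: "D (\<lambda>e. F (e 0) (e 1))" "\<And>x. Q (val x) \<longleftrightarrow> (\<exists>p\<in>G. F p x)"
    "\<And>p q x. F p x \<Longrightarrow> q \<in> elts P \<Longrightarrow> elts p \<subseteq> elts q \<Longrightarrow> F q x"
    using forcing_definable[OF assms] by blast
  obtain \<tau> where x: "x = val \<tau>" by (rule val_cases)
  obtain t where t: "transitive t" "\<tau> \<in> elts t" using transitive_superset_mem by blast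
  let ?W = "{z \<in> elts (times t P). \<exists>\<pi> p. z = pair \<pi> p \<and> F p \<pi> \<and>
    (\<exists>s. pair \<pi> s \<in> elts \<tau> \<and> s \<in> elts P \<and> elts s \<subseteq> elts p)}"
  have W: "isset ?W"
    by (rule isset_sub[OF isset_elts[of "times t P"]]) (blast, intro D_intros D_subst2[OF F(1)])
  have "N.elts (val (mk ?W)) = {u \<in> N.elts x. Q u}"
    unfolding N_elts_mk[OF W]
  proof (intro equalityI subsetI)
    fix v assume "v \<in> {val \<pi> |\<pi> s. s \<in> G \<and> pair \<pi> s \<in> ?W}"
    then obtain \<pi> p s where *: "v = val \<pi>" "p \<in> G" "F p \<pi>" "pair \<pi> s \<in> elts \<tau>" "s \<in> elts P" "elts s \<subseteq> elts p"
      by auto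
    then have "s \<in> G" using G_down by blast
    then show "v \<in> {u \<in> N.elts x. Q u}" using * x F(2) val_memI by blast
  next
    fix v assume "v \<in> {u \<in> N.elts x. Q u}"
    then have "v \<in> N.elts (val \<tau>)" "Q v" using x by blast+
    then obtain \<pi> s where \<pi>: "v = val \<pi>" "s \<in> G" "pair \<pi> s \<in> elts \<tau>" by (blast elim: val_memE)
    then obtain p where p: "p \<in> G" "F p \<pi>" using \<open>Q v\<close> F(2) by blast
    obtain r where r: "r \<in> G" "r \<in> elts P" "elts s \<subseteq> elts r" "elts p \<subseteq> elts r"
      using common_ext[OF \<pi>(2) p(1)] by blast
    have "\<pi> \<in> elts t" using mem_of_pair[OF t \<pi>(3)] .
    moreover have "F r \<pi>" using F(3)[OF p(2) r(2,4)] .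
    moreover have "s \<in> elts P" using \<pi>(2) G_P by blast
    ultimately have "pair \<pi> r \<in> ?W" using r \<pi>(3) by simp blast
    then show "v \<in> {val \<pi> |\<pi> s. s \<in> G \<and> pair \<pi> s \<in> ?W}" by (rule val_setI[OF r(1) _ \<pi>(1)])
  qed
  then show ?thesis by blast
qed

text \<open>Every subset of \<open>val \<tau>\<close> has a name that is a subset of
  \<open>times t P\<close>, namely the conditions forcing membership in any given name of it. So a
  single set of names covers all subsets; in \<open>?B\<close> each of them is paired with the empty
  condition.\<close>

lemma N_power_exists: "\<exists>z. N.elts z = {y. N.elts y \<subseteq> N.elts x}"
proof -
  obtain \<tau> where x: "x = val \<tau>" by (rule val_cases)
  obtain t where t: "transitive t" "\<tau> \<in> elts t" using transitive_superset_mem by blast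
  let ?B = "times (vpow (times t P)) (upair vempty vempty)"
  have sup: "y \<in> N.elts (val ?B)" if y: "N.elts y \<subseteq> N.elts x" for y
  proof -
    obtain \<chi> where \<chi>: "y = val \<chi>" by (rule val_cases)
    let ?W = "{z \<in> elts (times t P). \<exists>\<pi> p. z = pair \<pi> p \<and> fmem p \<pi> \<chi> \<and>
      (\<exists>s. pair \<pi> s \<in> elts \<tau> \<and> s \<in> elts P \<and> elts s \<subseteq> elts p)}"
    have W: "isset ?W" by (rule isset_sub[OF isset_elts[of "times t P"]]) (blast, intro D_intros)
    have "N.elts (val (mk ?W)) = N.elts y"
      unfolding N_elts_mk[OF W]
    proof (intro equalityI subsetI)
      fix v assume "v \<in> {val \<pi> |\<pi> s. s \<in> G \<and> pair \<pi> s \<in> ?W}"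
      then obtain \<pi> p where "v = val \<pi>" "p \<in> G" "fmem p \<pi> \<chi>" by auto
      then show "v \<in> N.elts y" using \<chi> fmem_truth by blast
    next
      fix v assume v: "v \<in> N.elts y"
      then have "v \<in> N.elts (val \<tau>)" using y x by blast
      then obtain \<pi> s where \<pi>: "v = val \<pi>" "s \<in> G" "pair \<pi> s \<in> elts \<tau>" by (blast elim: val_memE)
      then obtain p where p: "p \<in> G" "fmem p \<pi> \<chi>" using v \<chi> fmem_truth by blast
      obtain r where r: "r \<in> G" "r \<in> elts P" "elts s \<subseteq> elts r" "elts p \<subseteq> elts r"
        using common_ext[OF \<pi>(2) p(1)] by blast
      have "\<pi> \<in> elts t" using mem_of_pair[OF t \<pi>(3)] .
      moreover have "fmem r \<pi> \<chi>" using p(2) r(4) unfolding fmem_def by blast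
      moreover have "s \<in> elts P" using \<pi>(2) G_P by blast
    ultimately have "pair \<pi> r \<in> ?W" using r \<pi>(3) by simp blast
      then show "v \<in> {val \<pi> |\<pi> s. s \<in> G \<and> pair \<pi> s \<in> ?W}" by (rule val_setI[OF r(1) _ \<pi>(1)])
    qed
    then have "y = val (mk ?W)" using N_extensionality by blast
    moreover have "mk ?W \<in> elts (vpow (times t P))" using elts_mk[OF W] by auto
    ultimately show ?thesis using val_memI[OF G_bot, of "mk ?W" ?B] by simp
  qed
  have "N.D (\<lambda>e. N.elts (e 0) \<subseteq> N.elts x)" by (intro D_intros)
  from N_sep[OF this] obtain z where "N.elts z = {u \<in> N.elts (val ?B). N.elts u \<subseteq> N.elts x}" by blast
  then have "N.elts z = {y. N.elts y \<subseteq> N.elts x}" using sup by blast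
  then show ?thesis by blast
qed

text \<open>Collection in the ground model is applied to pairs of a condition and a name of an
  argument. It selects only some of the possible names of values, which is why replacement is
  derived from collection and separation.\<close>

lemma N_collection:
  assumes "N.D (\<lambda>e. R (e 0) (e 1))"
  shows "\<exists>b. \<forall>u\<in>N.elts x. (\<exists>v. R u v) \<longrightarrow> (\<exists>v\<in>N.elts b. R u v)"
proof -
  obtain F where F: "D (\<lambda>e. F (e 0) (e 1) (e 2))" "\<And>x y. R (val x) (val y) \<longleftrightarrow> (\<exists>p\<in>G. F p x y)"
    "\<And>p q x y. F p x y \<Longrightarrow> q \<in> elts P \<Longrightarrow> elts p \<subseteq> elts q \<Longrightarrow> F q x y"
    using forcing_definable2[OF assms] by blast
  obtain \<tau> where x: "x = val \<tau>" by (rule val_cases)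
  obtain t where t: "transitive t" "\<tau> \<in> elts t" using transitive_superset_mem by blast
  have "D (\<lambda>e. F (vfst (e 0)) (vsnd (e 0)) (e 1))" by (intro D_subst3[OF F(1)] D_intros)
  from collection[of "\<lambda>z y. F (vfst z) (vsnd z) y" "times P t", OF this]
  obtain b where b: "\<forall>z\<in>elts (times P t). (\<exists>y. F (vfst z) (vsnd z) y) \<longrightarrow>
      (\<exists>y\<in>elts b. F (vfst z) (vsnd z) y)" by blast
  let ?b = "val (times b (upair vempty vempty))"
  have "\<exists>v\<in>N.elts ?b. R u v" if u: "u \<in> N.elts x" and v: "R u v" for u v
  proof -
    obtain \<pi> s where \<pi>: "u = val \<pi>" "s \<in> G" "pair \<pi> s \<in> elts \<tau>" using u x by (blast elim: val_memE)
    obtain \<nu> where \<nu>: "v = val \<nu>" by (rule val_cases)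
    obtain p where p: "p \<in> G" "F p \<pi> \<nu>" using v \<pi> \<nu> F(2) by blast
    have "pair p \<pi> \<in> elts (times P t)" using p(1) G_P mem_of_pair[OF t \<pi>(3)] by auto
    from bspec[OF b this] have "(\<exists>y. F p \<pi> y) \<longrightarrow> (\<exists>y\<in>elts b. F p \<pi> y)" by simp
    then obtain y where "y \<in> elts b" "F p \<pi> y" using p(2) by blast
    then have "R u (val y)" using F(2) p(1) \<pi>(1) by blast
    moreover have "val y \<in> N.elts ?b" using \<open>y \<in> elts b\<close> by (intro val_memI[OF G_bot]) simp
    ultimately show ?thesis by blast
  qed
  then show ?thesis by blast
qed

text \<open>External minimal elements need not exist. Instead, induction on names in the ground
  model shows that the conditions forcing some member of \<tau> to be disjoint from \<tau> are dense
  above \<open>p0\<close>: if \<sigma> does not work, a name inside \<sigma> is forced into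
  \<tau>.\<close>

lemma N_foundation:
  assumes "u \<in> N.elts x"
  shows "\<exists>y\<in>N.elts x. \<forall>z\<in>N.elts x. z \<notin> N.elts y"
proof -
  obtain \<tau> where x: "x = val \<tau>" by (rule val_cases)
  obtain \<sigma>0 p0 where p0: "p0 \<in> G" "fmem p0 \<sigma>0 \<tau>" using assms x fmem_truth val_cases by metis
  let ?B = "{p. \<exists>\<sigma>. fmem p \<sigma> \<tau> \<and> (\<forall>\<rho>. \<forall>q\<in>elts P. elts p \<subseteq> elts q \<longrightarrow> \<not> (fmem q \<rho> \<sigma> \<and> fmem q \<rho> \<tau>))}"
  have DB: "D (\<lambda>e. s e \<in> ?B)" if "T s" for s
    by (rule D_subst1[OF _ that]) (intro D_intros)
  have dense: "\<forall>q\<in>elts P. fmem q \<sigma> \<tau> \<longrightarrow> (\<exists>r\<in>elts P. elts q \<subseteq> elts r \<and> r \<in> ?B)" for \<sigma>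
  proof (induction \<sigma> rule: name_induct)
    show "D (\<lambda>e. \<forall>q\<in>elts P. fmem q (e 0) \<tau> \<longrightarrow> (\<exists>r\<in>elts P. elts q \<subseteq> elts r \<and> r \<in> ?B))"
      by (intro D_intros DB)
  next
    case (step \<sigma>)
    show ?case
    proof (intro ballI impI)
      fix q assume q: "q \<in> elts P" "fmem q \<sigma> \<tau>"
      show "\<exists>r\<in>elts P. elts q \<subseteq> elts r \<and> r \<in> ?B"
      proof (cases "\<exists>\<rho>. \<exists>r\<in>elts P. elts q \<subseteq> elts r \<and> fmem r \<rho> \<sigma> \<and> fmem r \<rho> \<tau>")
        case False
        then have "q \<in> ?B" using q(2) by blast
        then show ?thesis using q(1) by blast
      next
        case True
        then obtain \<rho> r where r: "r \<in> elts P" "elts q \<subseteq> elts r" "fmem r \<rho> \<sigma>" "fmem r \<rho> \<tau>" by blast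
        then obtain r' \<rho>' s where r': "r' \<in> elts P" "elts r \<subseteq> elts r'" "pair \<rho>' s \<in> elts \<sigma>" "feq r' \<rho> \<rho>'"
          unfolding fmem_def by blast
        have "fmem r' \<rho> \<tau>" using r(4) r'(2) unfolding fmem_def by blast
        then have "fmem r' \<rho>' \<tau>" by (rule fmem_cong[OF r'(4)])
        then obtain r'' where "r'' \<in> elts P" "elts r' \<subseteq> elts r''" "r'' \<in> ?B" using step[OF r'(3)] r'(1) by blast
        moreover from this have "elts q \<subseteq> elts r''" using r(2) r'(2) by blast
        ultimately show ?thesis by blast
      qed
    qed
  qed
  have "\<exists>p\<in>G. p \<in> ?B"
  proof (rule generic_meets[OF DB])
    show "\<exists>q\<in>elts P. elts p \<subseteq> elts q \<and> q \<in> ?B" if p: "p \<in> elts P" "elts p0 \<subseteq> elts p" for p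
    proof -
      have "fmem p \<sigma>0 \<tau>" using p0(2) p(2) unfolding fmem_def by blast
      then show ?thesis using dense p(1) by blast
    qed
  qed (intro D_intros p0)+
  then obtain p \<sigma> where p: "p \<in> G" "fmem p \<sigma> \<tau>"
    and no: "\<And>\<rho> q. q \<in> elts P \<Longrightarrow> elts p \<subseteq> elts q \<Longrightarrow> \<not> (fmem q \<rho> \<sigma> \<and> fmem q \<rho> \<tau>)" by blast
  have "z \<notin> N.elts (val \<sigma>)" if z: "z \<in> N.elts x" for z
  proof
    assume "z \<in> N.elts (val \<sigma>)"
    obtain \<rho> where \<rho>: "z = val \<rho>" by (rule val_cases)
    obtain q q' where q: "q \<in> G" "fmem q \<rho> \<sigma>" "q' \<in> G" "fmem q' \<rho> \<tau>"
      using z \<open>z \<in> N.elts (val \<sigma>)\<close> \<rho> x fmem_truth by blast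
    obtain r where r: "r \<in> G" "elts q \<subseteq> elts r" "elts q' \<subseteq> elts r" using G_dir[OF q(1,3)] by blast
    obtain r' where r': "r' \<in> elts P" "elts p \<subseteq> elts r'" "elts r \<subseteq> elts r'" using common_ext[OF p(1) r(1)] by blast
    have "fmem r' \<rho> \<sigma>" using q(2) r(2) r'(3) unfolding fmem_def by blast
    moreover have "fmem r' \<rho> \<tau>" using q(4) r(3) r'(3) unfolding fmem_def by blast
    ultimately show False using no[OF r'(1,2)] by blast
  qed
  moreover have "val \<sigma> \<in> N.elts x" using p x fmem_truth by blast
  ultimately show ?thesis by blast
qed

text \<open>The embedding of the ground model; it need not be definable in the extension, so facts
  about its range are transferred element by element.\<close>

definition j where "j x = val (chk x)"

lemma N_elts_j: "N.elts (j x) = j ` elts x"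
  unfolding j_def N_elts_val elts_chk using G_bot by auto

lemma j_inject [simp]: "j x = j y \<longleftrightarrow> x = y"
proof
  assume "j x = j y"
  then show "x = y" unfolding j_def val(2) geq_def using chk_feq_inject by blast
qed simp

lemma zf_EG: "zf EG"
proof unfold_locales
  show "x = y" if "\<And>u. EG u x = EG u y" for x y
    using that N_extensionality by (simp add: N.elts_def)
  show "\<exists>y. EG y x \<and> (\<forall>z. EG z x \<longrightarrow> \<not> EG z y)" if "EG u x" for u x
    using N_foundation[of u x] that unfolding N.elts_def by blast
  show "\<exists>p. \<forall>u. EG u p = (u = x \<or> u = y)" for x y
    using N_pair_exists[of x y] unfolding N.elts_def set_eq_iff by simp
  show "\<exists>y. \<forall>u. EG u y = (\<exists>z. EG z x \<and> EG u z)" for x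
    using N_union_exists[of x] unfolding N.elts_def set_eq_iff by simp
  show "\<exists>y. \<forall>u. EG u y = (\<forall>v. EG v u \<longrightarrow> EG v x)" for x
    using N_power_exists[of x] unfolding N.elts_def set_eq_iff subset_eq by simp
  show "\<exists>y. \<forall>u. EG u y = (EG u x \<and> Q u)" if "N.D (\<lambda>e. Q (e 0))" for Q x
    using N_sep[OF that, of x] unfolding N.elts_def set_eq_iff by simp
  show "\<exists>s. (\<exists>x. EG x s \<and> (\<forall>u. \<not> EG u x)) \<and>
      (\<forall>x. EG x s \<longrightarrow> (\<exists>y. EG y s \<and> (\<forall>u. EG u y = (EG u x \<or> u = x))))"
  proof (rule exI[of _ "j omega"], intro conjI allI impI)
    show "\<exists>x. EG x (j omega) \<and> (\<forall>u. \<not> EG u x)"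
      using N_elts_j[of vempty] N_elts_j[of omega] zero_omega
      by (intro exI[of _ "j vempty"]) (simp add: N.elts_def set_eq_iff)
    fix x assume "EG x (j omega)"
    then have "x \<in> N.elts (j omega)" by (simp add: N.elts_def)
    then obtain n where n: "n \<in> elts omega" "x = j n" unfolding N_elts_j by blast
    then have "j (vsucc n) \<in> N.elts (j omega)" "N.elts (j (vsucc n)) = insert x (N.elts x)"
      by (simp_all add: N_elts_j)
    then show "\<exists>y. EG y (j omega) \<and> (\<forall>u. EG u y = (EG u x \<or> u = x))"
      by (intro exI[of _ "j (vsucc n)"]) (auto simp: N.elts_def)
  qed
  show "\<exists>y. \<forall>v. EG v y = (\<exists>u. EG u x \<and> R u v)"
    if R: "N.D (\<lambda>e. R (e 0) (e 1))" "\<And>u v w. R u v \<Longrightarrow> R u w \<Longrightarrow> v = w" for R x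
  proof -
    obtain b where b: "\<And>u v. u \<in> N.elts x \<Longrightarrow> R u v \<Longrightarrow> \<exists>v\<in>N.elts b. R u v"
      using N_collection[OF R(1), of x] by blast
    have "N.D (\<lambda>e. \<exists>u\<in>N.elts x. R u (e 0))" by (intro D_intros N.D_subst2[OF R(1)])
    from N_sep[OF this] obtain z where "N.elts z = {v \<in> N.elts b. \<exists>u\<in>N.elts x. R u v}" by blast
    then have "v \<in> N.elts z \<longleftrightarrow> (\<exists>u. u \<in> N.elts x \<and> R u v)" for v using b R(2) by blast
    then show ?thesis by (intro exI[of _ z]) (simp add: N.elts_def)
  qed
qed

sublocale N: zf EG
  by (rule zf_EG)

lemma j_Ord: "Ord x \<Longrightarrow> N.Ord (j x)"
proof -
  have j_transitive: "transitive y \<Longrightarrow> N.transitive (j y)" for y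
    unfolding N.transitive_def transitive_def by (auto simp: N_elts_j intro!: imageI)
  assume "Ord x"
  then show ?thesis unfolding N.Ord_def Ord_def using j_transitive by (auto simp: N_elts_j)
qed

text \<open>A well-order of the names in \<open>t\<close> yields, in the extension, a function on an
  ordinal whose values include all members of members of \<open>x\<close>. Different names may have
  the same value, so \<open>H u\<close> takes the value at the least index that leads into
  \<open>u\<close>.\<close>

lemma N_choice:
  assumes "\<And>u. u \<in> N.elts x \<Longrightarrow> N.elts u \<noteq> {}"
  shows "\<exists>f. N.isfun f x \<and> (\<forall>u\<in>N.elts x. N.app f u \<in> N.elts u)"
proof -
  obtain \<tau> where x: "x = val \<tau>" by (rule val_cases)
  obtain t where t: "transitive t" "\<tau> \<in> elts t" using transitive_superset_mem by blast
  obtain \<alpha> h where h: "Ord \<alpha>" "bij_betw (app h) (elts \<alpha>) (elts t)" by (rule zermelo)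
  \<comment> \<open>\<open>un\<close> and \<open>pn\<close> are names for unordered and ordered
    pairs, with the empty condition attached throughout.\<close>
  define un where "un \<sigma> \<rho> = upair (pair \<sigma> vempty) (pair \<rho> vempty)" for \<sigma> \<rho>
  define pn where "pn \<sigma> \<rho> = un (un \<sigma> \<sigma>) (un \<sigma> \<rho>)" for \<sigma> \<rho>
  have un: "val (un \<sigma> \<rho>) = N.upair (val \<sigma>) (val \<rho>)" for \<sigma> \<rho>
  proof (rule N.eltsI)
    show "N.elts (val (un \<sigma> \<rho>)) = N.elts (N.upair (val \<sigma>) (val \<rho>))"
      unfolding N_elts_val un_def using G_bot by auto
  qed
  have pn: "val (pn \<sigma> \<rho>) = N.pair (val \<sigma>) (val \<rho>)" for \<sigma> \<rho>
    unfolding pn_def un N.pair_def ..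
  let ?F = "\<lambda>\<beta>. pair (pn (chk \<beta>) (app h \<beta>)) vempty"
  have "T (\<lambda>e. ?F (e 0))" unfolding pn_def un_def by (intro D_intros)
  then have W: "isset (?F ` elts \<alpha>)" by (rule isset_image) simp
  let ?\<Phi> = "val (mk (?F ` elts \<alpha>))"
  have \<Phi>: "N.elts ?\<Phi> = (\<lambda>\<beta>. N.pair (j \<beta>) (val (app h \<beta>))) ` elts \<alpha>"
    unfolding N_elts_mk[OF W]
  proof (intro equalityI subsetI)
    fix v assume "v \<in> {val \<pi> |\<pi> s. s \<in> G \<and> pair \<pi> s \<in> ?F ` elts \<alpha>}"
    then obtain \<beta> where "\<beta> \<in> elts \<alpha>" "v = val (pn (chk \<beta>) (app h \<beta>))" by auto
    then show "v \<in> (\<lambda>\<beta>. N.pair (j \<beta>) (val (app h \<beta>))) ` elts \<alpha>" by (auto simp: pn j_def)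
  next
    fix v assume "v \<in> (\<lambda>\<beta>. N.pair (j \<beta>) (val (app h \<beta>))) ` elts \<alpha>"
    then obtain \<beta> where \<beta>: "\<beta> \<in> elts \<alpha>" "v = N.pair (j \<beta>) (val (app h \<beta>))" by blast
    then have "?F \<beta> \<in> ?F ` elts \<alpha>" by blast
    then show "v \<in> {val \<pi> |\<pi> s. s \<in> G \<and> pair \<pi> s \<in> ?F ` elts \<alpha>}"
      by (rule val_setI[OF G_bot]) (simp add: \<beta> pn j_def)
  qed
  define C where "C u \<beta> \<longleftrightarrow> \<beta> \<in> N.elts (j \<alpha>) \<and> (\<exists>v. N.pair \<beta> v \<in> N.elts ?\<Phi> \<and> v \<in> N.elts u)" for u \<beta>
  define H where "H u = N.the1 (\<lambda>v. \<exists>\<beta>. C u \<beta> \<and> (\<forall>\<gamma>\<in>N.elts \<beta>. \<not> C u \<gamma>) \<and> N.pair \<beta> v \<in> N.elts ?\<Phi> \<and> v \<in> N.elts u)" for u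
  have TH: "N.T (\<lambda>e. H (e 0))" unfolding H_def C_def by (intro D_intros)
  have "H u \<in> N.elts u" if u: "u \<in> N.elts x" for u
  proof -
    obtain v where v: "v \<in> N.elts u" using assms[OF u] by blast
    obtain \<pi> s where \<pi>: "u = val \<pi>" "pair \<pi> s \<in> elts \<tau>" using u x by (blast elim: val_memE)
    obtain \<rho> q where \<rho>: "v = val \<rho>" "pair \<rho> q \<in> elts \<pi>" using v \<pi>(1) by (blast elim: val_memE)
    have "\<rho> \<in> elts t" using mem_of_pair[OF t(1) mem_of_pair[OF t \<pi>(2)] \<rho>(2)] .
    then obtain \<beta> where "\<beta> \<in> elts \<alpha>" "\<rho> = app h \<beta>" using h(2) unfolding bij_betw_def by blast
    then have "C u (j \<beta>)" unfolding C_def \<Phi> using v \<rho>(1) by (auto simp: N_elts_j)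
    have "N.D (\<lambda>e. C u (e 0))" unfolding C_def by (intro D_intros)
    moreover have "N.Ord (j \<beta>)" using j_Ord Ord_mem[OF h(1) \<open>\<beta> \<in> elts \<alpha>\<close>] .
    ultimately obtain \<gamma> where \<gamma>: "N.Ord \<gamma>" "C u \<gamma>" "\<And>\<delta>. \<delta> \<in> N.elts \<gamma> \<Longrightarrow> \<not> C u \<delta>"
      using \<open>C u (j \<beta>)\<close> by (rule N.Ord_least) blast
    then obtain w where w: "N.pair \<gamma> w \<in> N.elts ?\<Phi>" "w \<in> N.elts u" unfolding C_def by blast
    have "H u = w"
      unfolding H_def
    proof (rule N.the1_eq)
      fix w' assume "\<exists>\<beta>. C u \<beta> \<and> (\<forall>\<gamma>\<in>N.elts \<beta>. \<not> C u \<gamma>) \<and> N.pair \<beta> w' \<in> N.elts ?\<Phi> \<and> w' \<in> N.elts u"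
      then obtain \<beta>' where \<beta>': "C u \<beta>'" "\<And>\<gamma>. \<gamma> \<in> N.elts \<beta>' \<Longrightarrow> \<not> C u \<gamma>" "N.pair \<beta>' w' \<in> N.elts ?\<Phi>" by blast
      have "N.Ord \<beta>'" using \<beta>'(1) N.Ord_mem[OF j_Ord[OF h(1)]] unfolding C_def by blast
      then have "\<beta>' = \<gamma>" using N.Ord_linear[OF _ \<gamma>(1), of \<beta>'] \<gamma>(2,3) \<beta>'(1,2) by blast
      then show "w' = w" using w(1) \<beta>'(3) unfolding \<Phi> by auto
    qed (use \<gamma> w in blast)
    then show ?thesis using w(2) by simp
  qed
  then show ?thesis using N.isfun_lam[OF TH, of x] N.app_lam[OF TH] by (intro exI[of _ "N.lam x H"]) auto
qed

sublocale N: zfc EG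
  by unfold_locales (rule N_choice)

end

subsection \<open>The ground model inside the extension\<close>

context generic
begin

lemma j_upair: "j (upair x y) = N.upair (j x) (j y)"
  by (rule N.eltsI) (simp add: N_elts_j)

lemma j_pair: "j (pair x y) = N.pair (j x) (j y)"
  by (simp add: pair_def N.pair_def j_upair)

lemma j_vempty: "j vempty = N.vempty"
  by (rule N.eltsI) (simp add: N_elts_j)

lemma j_vsucc: "j (vsucc x) = N.vsucc (j x)"
  by (rule N.eltsI) (simp add: N_elts_j)

text \<open>An element of \<open>j omega\<close> outside of the new \<omega>, chosen minimal by
  foundation, would be \<open>j n\<close> for an old \<open>n\<close>. It is neither zero nor the
  successor of a smaller element.\<close>

lemma j_omega: "j omega = N.omega"
proof (rule N.eltsI, rule equalityI)
  have "N.succ_closed (j omega)"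
    unfolding N.succ_closed_def N_elts_j
    using j_vempty[symmetric] j_vsucc[symmetric] by auto
  then show "N.elts N.omega \<subseteq> N.elts (j omega)" unfolding N.elts_omega by blast
  show "N.elts (j omega) \<subseteq> N.elts N.omega"
  proof (rule ccontr)
    assume "\<not> ?thesis"
    then obtain u where u: "u \<in> N.elts (j omega) - N.elts N.omega" by blast
    let ?d = "N.mk (N.elts (j omega) - N.elts N.omega)"
    have d: "N.elts ?d = N.elts (j omega) - N.elts N.omega"
      by (intro N.elts_mk N.isset_sub[OF N.isset_elts[of "j omega"]] D_intros) auto
    from N_foundation[of u ?d] u d obtain y where y: "y \<in> N.elts (j omega)" "y \<notin> N.elts N.omega"
      "\<And>z. z \<in> N.elts (j omega) \<Longrightarrow> z \<notin> N.elts N.omega \<Longrightarrow> z \<notin> N.elts y" by blast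
    then obtain n where n: "n \<in> elts omega" "y = j n" unfolding N_elts_j by blast
    from n(1) show False
    proof (cases n rule: omega_cases)
      case 1
      then show False using y(2) n(2) j_vempty N.zero_omega by simp
    next
      case (2 m)
      then have "y = N.vsucc (j m)" using n(2) j_vsucc by simp
      moreover from this have "j m \<in> N.elts N.omega" using y(3)[of "j m"] 2 by (auto simp: N_elts_j)
      ultimately show False using y(2) N.succ_omega by simp
    qed
  qed
qed

lemma j_isfun:
  assumes "isfun f a"
  shows "N.isfun (j f) (j a)" "\<And>x. x \<in> elts a \<Longrightarrow> N.app (j f) (j x) = j (app f x)"
proof -
  have el: "N.elts (j f) = (\<lambda>x. N.pair (j x) (j (app f x))) ` elts a"
    by (simp add: N_elts_j isfun_elts[OF assms] image_image j_pair)
  then have mem: "N.pair (j x) y \<in> N.elts (j f) \<longleftrightarrow> y = j (app f x)" if "x \<in> elts a" for x y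
    using that by auto
  show "N.isfun (j f) (j a)"
    unfolding N.isfun_def
  proof (intro conjI ballI)
    fix p assume "p \<in> N.elts (j f)"
    then obtain u where "u \<in> elts a" "p = N.pair (j u) (j (app f u))" unfolding el by blast
    then show "\<exists>x\<in>N.elts (j a). \<exists>y. p = N.pair x y" by (auto simp: N_elts_j)
  next
    fix x assume "x \<in> N.elts (j a)"
    then obtain u where "u \<in> elts a" "x = j u" unfolding N_elts_j by blast
    then show "\<exists>!y. N.pair x y \<in> N.elts (j f)" using mem by auto
  qed
  then show "N.app (j f) (j x) = j (app f x)" if "x \<in> elts a" for x
    using N.isfun_app[of "j f" "j a" "j x" "j (app f x)"] mem[OF that] that by (simp add: N_elts_j)
qed

lemma j_lepoll:
  assumes "lepoll a b"
  shows "N.lepoll (j a) (j b)"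
proof -
  obtain f where f: "isfun f a" "inj_on (app f) (elts a)" "app f ` elts a \<subseteq> elts b"
    using assms by (rule lepollE)
  have "inj_on (N.app (j f)) (N.elts (j a))"
    using f(2) j_isfun(2)[OF f(1)] by (auto simp: N_elts_j inj_on_def)
  moreover have "N.app (j f) ` N.elts (j a) \<subseteq> N.elts (j b)"
    using f(3) j_isfun(2)[OF f(1)] by (auto simp: N_elts_j image_subset_iff)
  ultimately show ?thesis unfolding N.lepoll_def by blast
qed

end

subsection \<open>Closed forcing\<close>

locale closed_generic = generic E P G for E :: "nat \<Rightarrow> nat \<Rightarrow> bool" (infix "\<epsilon>" 50) and P G +
  fixes k :: nat
  assumes idem_k: "idem k"
    and closed: "elts C \<subseteq> elts P \<Longrightarrow> lepoll C k \<Longrightarrow>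
      (\<And>p q. p \<in> elts C \<Longrightarrow> q \<in> elts C \<Longrightarrow> elts p \<subseteq> elts q \<or> elts q \<subseteq> elts p) \<Longrightarrow> vUnion C \<in> elts P"
begin

lemma Ord_k: "Ord k"
  using idem_k by (simp add: idem_def)

lemma zero_one_k: "vempty \<in> elts k" "vsucc vempty \<in> elts k"
  using idem_k zero_omega succ_omega by (auto simp: idem_def)

text \<open>The \<open>k\<close> many decisions are strung along an increasing chain of conditions:
  \<open>S \<xi>\<close> pairs a condition above \<open>p\<close> and above all earlier ones with
  the value that it decides at \<xi>. Closure provides the upper bound at each stage and at the
  end.\<close>

lemma decide_dense:
  assumes D: "D (\<lambda>e. F (e 0) (e 1) (e 2))"
    and mono: "\<And>p q x y. F p x y \<Longrightarrow> q \<in> elts P \<Longrightarrow> elts p \<subseteq> elts q \<Longrightarrow> F q x y"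
    and step: "\<And>q \<xi>. q \<in> elts P \<Longrightarrow> elts p \<subseteq> elts q \<Longrightarrow> \<xi> \<in> elts k \<Longrightarrow>
      \<exists>r\<in>elts P. elts q \<subseteq> elts r \<and> (\<exists>x\<in>elts X. F r \<xi> x)"
    and p: "p \<in> elts P"
  shows "\<exists>q\<in>elts P. elts p \<subseteq> elts q \<and> (\<exists>f. \<forall>\<xi>\<in>elts k. app f \<xi> \<in> elts X \<and> F q \<xi> (app f \<xi>))"
proof -
  note [D_intros] = D_subst3[OF D]
  obtain c where c: "\<And>A. A \<subseteq> elts (times P X) \<Longrightarrow> A \<noteq> {} \<Longrightarrow> isset A \<Longrightarrow> app c (mk A) \<in> A"
    using choice_function[of "times P X"] by blast
  define W where "W S \<xi> = {z \<in> elts (times P X). elts p \<subseteq> elts (vfst z) \<and>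
    (\<forall>\<eta>\<in>elts \<xi>. elts (vfst (S \<eta>)) \<subseteq> elts (vfst z)) \<and> F (vfst z) \<xi> (vsnd z)}" for S \<xi>
  define H where "H \<xi> g = app c (mk (W (app g) \<xi>))" for \<xi> g
  have H: "T (\<lambda>e. H (e 0) (e 1))" unfolding H_def W_def by (intro D_intros)
  define S where "S = rec H"
  have TS: "T (\<lambda>e. S (e 0))" unfolding S_def by (intro T_rec H D_intros)
  note [D_intros] = T_subst1[OF TS]
  have S_eq: "S \<xi> = app c (mk (W S \<xi>))" for \<xi>
  proof -
    have "W (app (lam \<xi> S)) \<xi> = W S \<xi>" unfolding W_def using app_lam[OF TS] by simp
    then show ?thesis unfolding S_def by (subst rec_eq[OF H]) (simp add: H_def S_def)
  qed
  have S_mem: "S \<xi> \<in> W S \<xi>" if "W S \<xi> \<noteq> {}" for \<xi>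
    unfolding S_eq[of \<xi>]
  proof (rule c[OF _ that])
    show "W S \<xi> \<subseteq> elts (times P X)" unfolding W_def by blast
    show "isset (W S \<xi>)"
      by (rule isset_sub[OF isset_elts[of "times P X"]]) (unfold W_def, blast, intro D_intros)
  qed
  \<comment> \<open>Applies to each \<xi> in \<open>k\<close> and finally to \<open>k\<close>
    itself. Putting \<open>p\<close> into the chain makes the bound extend \<open>p\<close> also for
    \<xi> = 0.\<close>
  have union: "\<exists>q\<in>elts P. elts p \<subseteq> elts q \<and> (\<forall>\<eta>\<in>elts \<xi>. elts (vfst (S \<eta>)) \<subseteq> elts q)"
    if W: "\<And>\<eta>. \<eta> \<in> elts \<xi> \<Longrightarrow> S \<eta> \<in> W S \<eta>" and \<xi>: "Ord \<xi>" "elts \<xi> \<subseteq> elts k" for \<xi>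
  proof -
    let ?B = "mk ((\<lambda>\<eta>. vfst (S \<eta>)) ` elts \<xi>)" and ?C = "mk (insert p ((\<lambda>\<eta>. vfst (S \<eta>)) ` elts \<xi>))"
    have TB: "T (\<lambda>e. vfst (S (e 0)))" by (intro D_intros)
    have isB: "isset ((\<lambda>\<eta>. vfst (S \<eta>)) ` elts \<xi>)" by (rule isset_image[OF TB]) simp
    then have B: "elts ?B = (\<lambda>\<eta>. vfst (S \<eta>)) ` elts \<xi>"
      and C: "elts ?C = insert p ((\<lambda>\<eta>. vfst (S \<eta>)) ` elts \<xi>)"
      by (rule elts_mk, intro elts_mk isset_insert)
    have W': "vfst (S \<eta>) \<in> elts P" "elts p \<subseteq> elts (vfst (S \<eta>))"
        "\<And>\<zeta>. \<zeta> \<in> elts \<eta> \<Longrightarrow> elts (vfst (S \<zeta>)) \<subseteq> elts (vfst (S \<eta>))" if "\<eta> \<in> elts \<xi>" for \<eta>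
      using W[OF that] unfolding W_def by auto
    have "lepoll ?B k"
      using lepoll_trans[OF lepoll_image[OF TB] subset_lepoll[OF \<xi>(2)]] B by blast
    moreover have "lepoll (upair p p) k"
      by (rule lepollI[of "\<lambda>_. vempty"]) (use zero_one_k in \<open>auto intro!: D_intros\<close>)
    ultimately have "lepoll ?C k" by (rule lepoll_Un[OF idem_k]) (use B C in auto)
    moreover have "elts ?C \<subseteq> elts P" unfolding C using W'(1) p by blast
    moreover have "elts q \<subseteq> elts r \<or> elts r \<subseteq> elts q" if qr: "q \<in> elts ?C" "r \<in> elts ?C" for q r
    proof (cases "q = p \<or> r = p")
      case True
      then show ?thesis using qr W'(2) unfolding C by blast
    next
      case False
      then obtain \<eta> \<zeta> where *: "\<eta> \<in> elts \<xi>" "\<zeta> \<in> elts \<xi>" "q = vfst (S \<eta>)" "r = vfst (S \<zeta>)"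
        using qr unfolding C by blast
      then have "\<eta> \<in> elts \<zeta> \<or> \<eta> = \<zeta> \<or> \<zeta> \<in> elts \<eta>" using Ord_linear Ord_mem[OF \<xi>(1)] by blast
      then show ?thesis using W'(3) * by blast
    qed
    ultimately have "vUnion ?C \<in> elts P" by (intro closed)
    moreover have "elts q \<subseteq> elts (vUnion ?C)" if "q \<in> elts ?C" for q using that by auto
    ultimately show ?thesis unfolding C by blast
  qed
  have S: "S \<xi> \<in> W S \<xi>" if "\<xi> \<in> elts k" for \<xi>
  proof -
    have "Ord \<xi>" using Ord_mem[OF Ord_k that] .
    then have "\<xi> \<in> elts k \<longrightarrow> S \<xi> \<in> W S \<xi>"
    proof (induction \<xi> rule: Ord_induct)
      show "D (\<lambda>e. e 0 \<in> elts k \<longrightarrow> S (e 0) \<in> W S (e 0))" unfolding W_def by (intro D_intros)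
    next
      case (step \<xi>)
      show ?case
      proof
        assume \<xi>: "\<xi> \<in> elts k"
        then have sub: "elts \<xi> \<subseteq> elts k" using Ord_trans[OF Ord_k] by blast
        then obtain q where q: "q \<in> elts P" "elts p \<subseteq> elts q" "\<forall>\<eta>\<in>elts \<xi>. elts (vfst (S \<eta>)) \<subseteq> elts q"
          using union[of \<xi>] step by blast
        then obtain r x where r: "r \<in> elts P" "elts q \<subseteq> elts r" "x \<in> elts X" "F r \<xi> x"
          using assms(3)[OF q(1,2) \<xi>] by blast
        then have "pair r x \<in> W S \<xi>" unfolding W_def using q(2,3) by auto
        then show "S \<xi> \<in> W S \<xi>" using S_mem by blast
      qed
    qed
    then show ?thesis using that by blast
  qed
  then obtain q where q: "q \<in> elts P" "elts p \<subseteq> elts q" "\<forall>\<eta>\<in>elts k. elts (vfst (S \<eta>)) \<subseteq> elts q"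
    using union[OF _ Ord_k order_refl] by blast
  have "T (\<lambda>e. vsnd (S (e 0)))" by (intro D_intros)
  then have app: "app (lam k (\<lambda>\<xi>. vsnd (S \<xi>))) \<xi> = vsnd (S \<xi>)" if "\<xi> \<in> elts k" for \<xi>
    using that by (rule app_lam)
  have "vsnd (S \<xi>) \<in> elts X \<and> F q \<xi> (vsnd (S \<xi>))" if "\<xi> \<in> elts k" for \<xi>
    using S[OF that] mono[OF _ q(1)] q(3) that unfolding W_def by auto
  then have "\<forall>\<xi>\<in>elts k. app (lam k (\<lambda>\<xi>. vsnd (S \<xi>))) \<xi> \<in> elts X \<and>
      F q \<xi> (app (lam k (\<lambda>\<xi>. vsnd (S \<xi>))) \<xi>)"
    using app by simp
  then show ?thesis using q(1,2) by blast
qed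

text \<open>No new sequences of length \<open>k\<close>.\<close>

lemma decide:
  assumes DQ: "N.D (\<lambda>e. Q (e 0) (e 1))" and ex: "\<And>\<xi>. \<xi> \<in> elts k \<Longrightarrow> \<exists>x\<in>elts X. Q (j \<xi>) (j x)"
  obtains f where "\<And>\<xi>. \<xi> \<in> elts k \<Longrightarrow> app f \<xi> \<in> elts X" "\<And>\<xi>. \<xi> \<in> elts k \<Longrightarrow> Q (j \<xi>) (j (app f \<xi>))"
proof -
  obtain F where F: "D (\<lambda>e. F (e 0) (e 1) (e 2))" "\<And>x y. Q (val x) (val y) \<longleftrightarrow> (\<exists>p\<in>G. F p x y)"
    "\<And>p q x y. F p x y \<Longrightarrow> q \<in> elts P \<Longrightarrow> elts p \<subseteq> elts q \<Longrightarrow> F q x y"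
    using forcing_definable2[OF DQ] by blast
  define F' where "F' p \<xi> x \<longleftrightarrow> F p (chk \<xi>) (chk x)" for p \<xi> x
  have DF: "D (\<lambda>e. F' (e 0) (e 1) (e 2))" unfolding F'_def by (intro D_subst3[OF F(1)] D_intros)
  have QF: "Q (j \<xi>) (j x) \<longleftrightarrow> (\<exists>p\<in>G. F' p \<xi> x)" for \<xi> x unfolding F'_def j_def F(2) ..
  have F'_mono: "F' p \<xi> x \<Longrightarrow> q \<in> elts P \<Longrightarrow> elts p \<subseteq> elts q \<Longrightarrow> F' q \<xi> x" for p q \<xi> x
    unfolding F'_def by (rule F(3))
  \<comment> \<open>The conditions that exclude, for some \<xi>, every value in \<open>X\<close>.
    The assumption \<open>ex\<close> holds in the extension, so \<open>G\<close> contains none of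
    them, and a condition in \<open>G\<close> excludes them from there on.\<close>
  let ?A = "{q. \<exists>\<xi>\<in>elts k. \<forall>r\<in>elts P. elts q \<subseteq> elts r \<longrightarrow> (\<forall>x\<in>elts X. \<not> F' r \<xi> x)}"
  have "D (\<lambda>e. e 0 \<in> ?A)" by (intro D_intros D_subst3[OF DF])
  from G_generic[OF this] obtain p0 where p0: "p0 \<in> G"
    "p0 \<in> ?A \<or> (\<forall>q\<in>elts P. elts p0 \<subseteq> elts q \<longrightarrow> q \<notin> ?A)" by blast
  have "p0 \<notin> ?A"
  proof
    assume "p0 \<in> ?A"
    then obtain \<xi> where \<xi>: "\<xi> \<in> elts k" "\<And>r x. r \<in> elts P \<Longrightarrow> elts p0 \<subseteq> elts r \<Longrightarrow> x \<in> elts X \<Longrightarrow> \<not> F' r \<xi> x" by blast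
    then obtain x p where "x \<in> elts X" "p \<in> G" "F' p \<xi> x" using ex QF by blast
    moreover obtain r where "r \<in> elts P" "elts p0 \<subseteq> elts r" "elts p \<subseteq> elts r"
      using common_ext[OF p0(1) \<open>p \<in> G\<close>] by blast
    ultimately show False using \<xi>(2) F'_mono by blast
  qed
  then have step: "\<exists>r\<in>elts P. elts q \<subseteq> elts r \<and> (\<exists>x\<in>elts X. F' r \<xi> x)"
    if "q \<in> elts P" "elts p0 \<subseteq> elts q" "\<xi> \<in> elts k" for q \<xi>
    using p0(2) that by blast
  let ?B = "{q. \<exists>f. \<forall>\<xi>\<in>elts k. app f \<xi> \<in> elts X \<and> F' q \<xi> (app f \<xi>)}"
  have "D (\<lambda>e. e 0 \<in> ?B)" by (intro D_intros D_subst3[OF DF])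
  then have "\<exists>p\<in>G. p \<in> ?B"
  proof (rule generic_meets)
    fix p assume p: "p \<in> elts P" "elts p0 \<subseteq> elts p"
    have "\<exists>q\<in>elts P. elts p \<subseteq> elts q \<and> (\<exists>f. \<forall>\<xi>\<in>elts k. app f \<xi> \<in> elts X \<and> F' q \<xi> (app f \<xi>))"
    proof (rule decide_dense[OF DF F'_mono _ p(1)])
      fix q \<xi> assume "q \<in> elts P" "elts p \<subseteq> elts q" "\<xi> \<in> elts k"
      moreover from this have "elts p0 \<subseteq> elts q" using p(2) by blast
      ultimately show "\<exists>r\<in>elts P. elts q \<subseteq> elts r \<and> (\<exists>x\<in>elts X. F' r \<xi> x)" using step by blast
    qed
    then show "\<exists>q\<in>elts P. elts p \<subseteq> elts q \<and> q \<in> ?B" by blast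
  qed (rule p0(1))
  then obtain p f where "p \<in> G" "\<And>\<xi>. \<xi> \<in> elts k \<Longrightarrow> app f \<xi> \<in> elts X" "\<And>\<xi>. \<xi> \<in> elts k \<Longrightarrow> F' p \<xi> (app f \<xi>)"
    by blast
  then show ?thesis using that QF by blast
qed

text \<open>\<open>decide\<close> is applied to the characteristic function of \<open>y\<close>,
  with 1 and 0 as values, and the set is read off in the ground model.\<close>

lemma no_new_subsets:
  assumes "N.elts y \<subseteq> N.elts (j k)"
  obtains a where "elts a \<subseteq> elts k" "y = j a"
proof -
  let ?Q = "\<lambda>\<xi> x. if \<xi> \<in> N.elts y then x = j (vsucc vempty) else x = j vempty"
  have "N.D (\<lambda>e. ?Q (e 0) (e 1))" by (intro D_intros)
  moreover have "\<exists>x\<in>elts k. ?Q (j \<xi>) (j x)" for \<xi>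
    using zero_one_k by (cases "j \<xi> \<in> N.elts y") auto
  ultimately obtain f where f: "\<And>\<xi>. \<xi> \<in> elts k \<Longrightarrow> ?Q (j \<xi>) (j (app f \<xi>))"
    by (rule decide[where Q = ?Q]) blast
  let ?a = "mk {\<xi> \<in> elts k. app f \<xi> = vsucc vempty}"
  have a: "elts ?a = {\<xi> \<in> elts k. app f \<xi> = vsucc vempty}"
    by (intro elts_mk isset_sub[OF isset_elts[of k]]) (auto intro!: D_intros)
  have "j \<xi> \<in> N.elts y \<longleftrightarrow> \<xi> \<in> elts ?a" if "\<xi> \<in> elts k" for \<xi>
    using f[OF that] that by (auto simp: a split: if_splits)
  then have "N.elts y = N.elts (j ?a)" using assms a by (auto simp: N_elts_j)
  then have "y = j ?a" by (rule N.eltsI)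
  moreover have "elts ?a \<subseteq> elts k" using a by blast
  ultimately show ?thesis using that by blast
qed

text \<open>The domain \<open>a\<close> may be larger than \<open>k\<close>, so the injection
  \<open>g\<close> itself cannot be decided; its inverse has a domain inside \<open>k\<close> and
  can. Points outside the range of \<open>g\<close> are sent anywhere in \<open>a\<close>, which
  therefore has to be nonempty.\<close>

lemma lepoll_reflect:
  assumes b: "elts b \<subseteq> elts k" and "N.lepoll (j a) (j b)"
  shows "lepoll a b"
proof (cases "a = vempty")
  case True
  then show ?thesis by (intro subset_lepoll) simp
next
  case False
  then obtain x0 where x0: "x0 \<in> elts a" by (metis elts_eq_empty ex_in_conv)
  obtain g where g: "inj_on (N.app g) (N.elts (j a))" "N.app g ` N.elts (j a) \<subseteq> N.elts (j b)"
    using assms(2) unfolding N.lepoll_def by blast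
  let ?Q = "\<lambda>\<xi> x. N.app g x = \<xi> \<or> (\<forall>y\<in>N.elts (j a). N.app g y \<noteq> \<xi>)"
  have "N.D (\<lambda>e. ?Q (e 0) (e 1))" by (intro D_intros)
  moreover have "\<exists>x\<in>elts a. ?Q (j \<xi>) (j x)" for \<xi>
    using x0 unfolding N_elts_j by blast
  ultimately obtain f where f: "\<And>\<xi>. \<xi> \<in> elts k \<Longrightarrow> app f \<xi> \<in> elts a" "\<And>\<xi>. \<xi> \<in> elts k \<Longrightarrow> ?Q (j \<xi>) (j (app f \<xi>))"
    by (rule decide[where Q = ?Q]) blast
  have "x \<in> app f ` elts b" if x: "x \<in> elts a" for x
  proof -
    have jx: "j x \<in> N.elts (j a)" using x by (simp add: N_elts_j)
    then obtain \<xi> where \<xi>: "\<xi> \<in> elts b" "N.app g (j x) = j \<xi>" using g(2) unfolding N_elts_j by blast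
    then have "\<xi> \<in> elts k" using b by blast
    from f[OF this] \<xi> jx have "N.app g (j (app f \<xi>)) = N.app g (j x)" "j (app f \<xi>) \<in> N.elts (j a)"
      by (auto simp: N_elts_j)
    then have "j (app f \<xi>) = j x" using g(1) jx by (blast dest: inj_onD)
    then show ?thesis using \<xi>(1) by auto
  qed
  moreover have "T (\<lambda>e. app f (e 0))" by (intro D_intros)
  ultimately show ?thesis by (intro lepoll_image[where F = "app f"]) blast+
qed

text \<open>Successor cardinals up to k^+ are not collapsed, as a new injection into
  \<open>b\<close> would reflect to an old one.\<close>

lemma j_hart:
  assumes "elts b \<subseteq> elts k"
  shows "N.hart (j b) = j (hart b)"
proof (rule N.hart_eqI)
  show "N.Ord (j (hart b))" using hart(1) by (rule j_Ord)
  show "\<not> N.lepoll (j (hart b)) (j b)" using lepoll_reflect[OF assms] hart(2) by blast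
  show "N.lepoll y (j b)" if "y \<in> N.elts (j (hart b))" for y
    using that hart(3) j_lepoll unfolding N_elts_j by blast
qed

lemma j_vpow:
  assumes "elts b \<subseteq> elts k"
  shows "N.vpow (j b) = j (vpow b)"
proof (rule N.eltsI, rule equalityI)
  show "N.elts (N.vpow (j b)) \<subseteq> N.elts (j (vpow b))"
  proof
    fix y assume "y \<in> N.elts (N.vpow (j b))"
    then have y: "N.elts y \<subseteq> N.elts (j b)" by simp
    then have "N.elts y \<subseteq> N.elts (j k)" using assms unfolding N_elts_j by blast
    then obtain a where "elts a \<subseteq> elts k" "y = j a" by (rule no_new_subsets)
    moreover from this have "elts a \<subseteq> elts b" using y by (auto simp: N_elts_j)
    ultimately show "y \<in> N.elts (j (vpow b))" unfolding N_elts_j[of "vpow b"] by simp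
  qed
  show "N.elts (j (vpow b)) \<subseteq> N.elts (N.vpow (j b))" by (auto simp: N_elts_j intro!: imageI)
qed

end

subsection \<open>Collapsing a power set\<close>

context zfc
begin

definition gch where
  "gch k \<longleftrightarrow> lepoll (vpow k) (hart k)"

definition coll where
  "coll k = mk {s \<in> elts (vpow (times (hart k) (vpow k))).
    (\<forall>x y y'. pair x y \<in> elts s \<longrightarrow> pair x y' \<in> elts s \<longrightarrow> y = y') \<and> lepoll s k}"

lemma elts_coll: "elts (coll k) = {s. elts s \<subseteq> elts (times (hart k) (vpow k)) \<and>
    (\<forall>x y y'. pair x y \<in> elts s \<longrightarrow> pair x y' \<in> elts s \<longrightarrow> y = y') \<and> lepoll s k}"
proof -
  let ?S = "{s \<in> elts (vpow (times (hart k) (vpow k))).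
    (\<forall>x y y'. pair x y \<in> elts s \<longrightarrow> pair x y' \<in> elts s \<longrightarrow> y = y') \<and> lepoll s k}"
  have "isset ?S"
    by (rule isset_sub[OF isset_elts[of "vpow (times (hart k) (vpow k))"]]) (blast, intro D_intros)
  then show ?thesis unfolding coll_def by (simp add: elts_mk)
qed

lemma forcing_coll: "forcing E (coll k)"
proof unfold_locales
  show "vempty \<in> elts (coll k)" unfolding elts_coll by (auto intro!: subset_lepoll)
qed

lemma coll_closed:
  assumes k: "idem k" and C: "elts C \<subseteq> elts (coll k)" "lepoll C k"
    "\<And>p q. p \<in> elts C \<Longrightarrow> q \<in> elts C \<Longrightarrow> elts p \<subseteq> elts q \<or> elts q \<subseteq> elts p"
  shows "vUnion C \<in> elts (coll k)"
proof -
  have 1: "elts s \<subseteq> elts (times (hart k) (vpow k))" "lepoll s k"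
      "\<And>x y y'. pair x y \<in> elts s \<Longrightarrow> pair x y' \<in> elts s \<Longrightarrow> y = y'" if "s \<in> elts C" for s
    using C(1) that unfolding elts_coll by blast+
  have "y = y'" if "pair x y \<in> elts (vUnion C)" "pair x y' \<in> elts (vUnion C)" for x y y'
  proof -
    obtain s s' where "s \<in> elts C" "s' \<in> elts C" "pair x y \<in> elts s" "pair x y' \<in> elts s'"
      using \<open>pair x y \<in> elts (vUnion C)\<close> \<open>pair x y' \<in> elts (vUnion C)\<close> by auto
    then show ?thesis using C(3)[of s s'] 1(3) by blast
  qed
  moreover have "lepoll (vUnion C) k"
  proof (rule lepoll_Union[where A = "\<lambda>s. s", OF k C(2)])
    show "T (\<lambda>e. e 0)" by (intro D_intros)
  qed (use 1(2) in auto)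
  moreover have "elts (vUnion C) \<subseteq> elts (times (hart k) (vpow k))" using 1(1) by auto
  ultimately show ?thesis unfolding elts_coll by blast
qed

end

text \<open>The union of \<open>G\<close> is a function from part of k^+ onto the old power set of
  \<open>k\<close>. There are no new subsets of \<open>k\<close> and k^+ is preserved, so the
  extension sees a surjection of its own k^+ onto its own power set.\<close>

lemma (in closed_generic) collapse:
  assumes P: "P = coll k"
  shows "N.lepoll (N.vpow (j k)) (N.hart (j k))"
proof -
  \<comment> \<open>The name of the union of \<open>G\<close>: each pair \<open>u\<close> enters
    with exactly the conditions \<open>s\<close> that contain it.\<close>
  have "isset {z. \<exists>u s. z = pair (chk u) s \<and> u \<in> elts s \<and> s \<in> elts P}"
  proof -
    let ?V = "\<Union>s\<in>elts P. (\<lambda>u. pair (chk u) s) ` elts s"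
    have "isset ?V" by (rule isset_UN) (auto intro!: D_intros isset_image)
    moreover have "{z. \<exists>u s. z = pair (chk u) s \<and> u \<in> elts s \<and> s \<in> elts P} = ?V" by blast
    ultimately show ?thesis by simp
  qed
  from N_elts_mk[OF this] obtain R where R': "N.elts R = {val \<pi> |\<pi> s. s \<in> G \<and>
      pair \<pi> s \<in> {z. \<exists>u s. z = pair (chk u) s \<and> u \<in> elts s \<and> s \<in> elts P}}" by blast
  have R: "N.elts R = {j u |u s. s \<in> G \<and> u \<in> elts s}"
    unfolding R' j_def using G_P by auto
  have pairs: "\<exists>x y. u = pair x y \<and> x \<in> elts (hart k) \<and> elts y \<subseteq> elts k" if "s \<in> G" "u \<in> elts s" for s u
  proof -
    have "s \<in> elts (coll k)" using that(1) G_P P by blast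
    then have "u \<in> elts (times (hart k) (vpow k))" using that(2) unfolding elts_coll by blast
    then show ?thesis by auto
  qed
  have fn: "y = y'" if f: "s \<in> G" "pair x y \<in> elts s" "s' \<in> G" "pair x y' \<in> elts s'" for s s' x y y'
  proof -
    obtain r where "r \<in> elts P" "elts s \<subseteq> elts r" "elts s' \<subseteq> elts r" using common_ext[OF f(1,3)] by blast
    then show ?thesis using f(2,4) unfolding P elts_coll by blast
  qed
  have total: "\<exists>s\<in>G. \<exists>x. pair x a \<in> elts s" if a: "elts a \<subseteq> elts k" for a
  proof -
    let ?A = "{s. \<exists>x. pair x a \<in> elts s}"
    have "D (\<lambda>e. e 0 \<in> ?A)" by (intro D_intros)
    then have "\<exists>s\<in>G. s \<in> ?A"
    proof (rule generic_meets)
      fix p assume "p \<in> elts P"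
      then have p: "elts p \<subseteq> elts (times (hart k) (vpow k))" "lepoll p k"
        "\<And>x y y'. pair x y \<in> elts p \<Longrightarrow> pair x y' \<in> elts p \<Longrightarrow> y = y'"
        unfolding P elts_coll by blast+
      have Tf: "T (\<lambda>e. vfst (e 0))" by (intro D_intros)
      \<comment> \<open>A condition has size at most \<open>k\<close>, so some argument in k^+ is
        still free to receive the value \<open>a\<close>.\<close>
      have "\<not> elts (hart k) \<subseteq> vfst ` elts p"
        using lepoll_trans[OF lepoll_image[OF Tf] p(2)] hart(2) by blast
      then obtain x where x: "x \<in> elts (hart k)" "x \<notin> vfst ` elts p" by blast
      then have nx: "pair x y \<notin> elts p" for y by (metis imageI vfst_pair)
      let ?q = "mk (insert (pair x a) (elts p))"
      have q: "elts ?q = insert (pair x a) (elts p)" by (intro elts_mk) auto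
      have "lepoll (upair (pair x a) (pair x a)) k"
        by (rule lepollI[of "\<lambda>_. vempty"]) (use zero_one_k in \<open>auto intro!: D_intros\<close>)
      then have "lepoll ?q k" by (rule lepoll_Un[OF idem_k p(2)]) (use q in auto)
      moreover have "y = y'" if "pair x' y \<in> elts ?q" "pair x' y' \<in> elts ?q" for x' y y'
        using that p(3) nx unfolding q by auto
      moreover have "elts ?q \<subseteq> elts (times (hart k) (vpow k))" unfolding q using p(1) x(1) a by auto
      ultimately have "?q \<in> elts P" unfolding P elts_coll by blast
      moreover have "elts p \<subseteq> elts ?q" "pair x a \<in> elts ?q" unfolding q by blast+
      ultimately show "\<exists>q\<in>elts P. elts p \<subseteq> elts q \<and> q \<in> ?A" by blast
    qed (rule G_bot)
    then show ?thesis by blast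
  qed
  define F where "F x = N.the1 (\<lambda>y. N.pair x y \<in> N.elts R)" for x
  have TF: "N.T (\<lambda>e. F (e 0))" unfolding F_def by (intro D_intros)
  have "N.elts (N.vpow (j k)) \<subseteq> F ` N.elts (j (hart k))"
  proof
    fix y assume "y \<in> N.elts (N.vpow (j k))"
    then have "N.elts y \<subseteq> N.elts (j k)" by simp
    then obtain a where a: "elts a \<subseteq> elts k" "y = j a" by (rule no_new_subsets)
    then obtain s x where s: "s \<in> G" "pair x a \<in> elts s" using total by blast
    have "F (j x) = y"
      unfolding F_def
    proof (rule N.the1_eq)
      show "N.pair (j x) y \<in> N.elts R" unfolding R a(2) j_pair[symmetric] using s by blast
      fix y' assume "N.pair (j x) y' \<in> N.elts R"
      then obtain u s' where u: "s' \<in> G" "u \<in> elts s'" "N.pair (j x) y' = j u" unfolding R by blast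
      then obtain x' z where "u = pair x' z" using pairs by blast
      then have "u = pair x z" "y' = j z" using u(3) by (auto simp: j_pair)
      then show "y' = y" using fn[OF s] u a(2) by blast
    qed
    moreover have "x \<in> elts (hart k)" using pairs[OF s] by auto
    then have "j x \<in> N.elts (j (hart k))" by (simp add: N_elts_j)
    ultimately show "y \<in> F ` N.elts (j (hart k))" by blast
  qed
  then have "N.lepoll (N.vpow (j k)) (j (hart k))" by (rule N.lepoll_image[OF TF])
  then show ?thesis using j_hart[OF order_refl] by simp
qed

lemma closed_generic_exists:
  fixes E :: "nat \<Rightarrow> nat \<Rightarrow> bool"
  assumes "zfc E" "zf.idem E k"
  shows "\<exists>G. closed_generic E (zfc.coll E k) G k"
proof -
  interpret zfc E by fact
  interpret forcing E "coll k" by (rule forcing_coll)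
  \<comment> \<open>The universe is the set of natural numbers, so the identity enumerates the
    model.\<close>
  obtain G where G: "G \<subseteq> elts (coll k)" "vempty \<in> G"
    "\<forall>p q. q \<in> G \<longrightarrow> p \<in> elts (coll k) \<longrightarrow> elts p \<subseteq> elts q \<longrightarrow> p \<in> G"
    "\<forall>p\<in>G. \<forall>q\<in>G. \<exists>r\<in>G. elts p \<subseteq> elts r \<and> elts q \<subseteq> elts r"
    "\<forall>A. D (\<lambda>e. e 0 \<in> A) \<longrightarrow> (\<exists>p\<in>G. p \<in> A \<or> (\<forall>q\<in>elts (coll k). elts p \<subseteq> elts q \<longrightarrow> q \<notin> A))"
    using generic_exists[of "\<lambda>x. x"] by auto
  have "closed_generic E (coll k) G k"
  proof unfold_locales
    show "idem k" by fact
    show "p \<in> G" if "q \<in> G" "p \<in> elts (coll k)" "elts p \<subseteq> elts q" for p q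
      using G(3) that by blast
    show "\<exists>r\<in>G. elts p \<subseteq> elts r \<and> elts q \<subseteq> elts r" if "p \<in> G" "q \<in> G" for p q
      using G(4) that by blast
    show "\<exists>p\<in>G. p \<in> A \<or> (\<forall>q\<in>elts (coll k). elts p \<subseteq> elts q \<longrightarrow> q \<notin> A)" if "D (\<lambda>e. e 0 \<in> A)" for A
      using G(5) that by blast
    show "vUnion C \<in> elts (coll k)" if "elts C \<subseteq> elts (coll k)" "lepoll C k"
      "\<And>p q. p \<in> elts C \<Longrightarrow> q \<in> elts C \<Longrightarrow> elts p \<subseteq> elts q \<or> elts q \<subseteq> elts p" for C
      using coll_closed[OF \<open>idem k\<close>] that by blast
  qed (use G(1,2) in blast)+
  then show ?thesis by blast
qed

lemma gch_omega_extension: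
  fixes E :: "nat \<Rightarrow> nat \<Rightarrow> bool"
  assumes "zfc E"
  shows "\<exists>E' :: nat \<Rightarrow> nat \<Rightarrow> bool. zfc E' \<and> zfc.gch E' (zf.omega E')"
proof -
  interpret zfc E by fact
  obtain G where "closed_generic E (coll omega) G omega"
    using closed_generic_exists[OF assms idem_omega] by blast
  then interpret closed_generic E "coll omega" G omega .
  have "N.gch N.omega" unfolding N.gch_def using collapse[OF refl] by (simp add: j_omega)
  then show ?thesis using N.zfc_axioms by blast
qed

text \<open>Closure under chains of length \<omega>_1 leaves the power set of \<omega> and
  \<omega>_1 unchanged, so the injection that was obtained for \<omega> persists under
  \<open>j\<close>.\<close>

lemma gch_omega1_extension:
  fixes E :: "nat \<Rightarrow> nat \<Rightarrow> bool"
  assumes "zfc E" "zfc.gch E (zf.omega E)"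
  shows "\<exists>E' :: nat \<Rightarrow> nat \<Rightarrow> bool. zfc E' \<and> zfc.gch E' (zf.omega E') \<and>
    zfc.gch E' (zfc.hart E' (zf.omega E'))"
proof -
  interpret zfc E by fact
  let ?k = "hart omega"
  obtain G where "closed_generic E (coll ?k) G ?k"
    using closed_generic_exists[OF assms(1) idem_hart[OF idem_omega]] by blast
  then interpret closed_generic E "coll ?k" G ?k .
  have sub: "elts omega \<subseteq> elts ?k" using idem_k by (simp add: idem_def)
  have h: "N.hart N.omega = j ?k" using j_hart[OF sub] by (simp add: j_omega)
  have "N.lepoll (j (vpow omega)) (j ?k)" using assms(2) j_lepoll by (simp add: gch_def)
  then have "N.gch N.omega" unfolding N.gch_def h using j_vpow[OF sub] by (simp add: j_omega)
  moreover have "N.gch (N.hart N.omega)" unfolding N.gch_def h by (rule collapse[OF refl])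
  ultimately show ?thesis using N.zfc_axioms by blast
qed

section \<open>The principle (B) from \<open>2\<^sup>\<aleph>\<^sup>1 = \<aleph>\<^sub>2\<close>\<close>

context zfc
begin

definition w1 where "w1 = hart omega"
definition w2 where "w2 = hart w1"

lemma idem_w1: "idem w1"
  unfolding w1_def by (intro idem_hart idem_omega)

lemma Ord_w1: "Ord w1" and Ord_w2: "Ord w2"
  unfolding w1_def w2_def by (rule hart(1))+

lemma w1_countable: "i \<in> elts w1 \<Longrightarrow> lepoll i omega"
  unfolding w1_def by (rule hart(3))

lemma w2_lepoll: "\<beta> \<in> elts w2 \<Longrightarrow> lepoll \<beta> w1"
  unfolding w2_def by (rule hart(3))

lemma w1_succ: "i \<in> elts w1 \<Longrightarrow> vsucc i \<in> elts w1"
  unfolding w1_def by (rule hart_succ[OF idem_omega])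

lemma w2_succ: "i \<in> elts w2 \<Longrightarrow> vsucc i \<in> elts w2"
  unfolding w2_def by (rule hart_succ[OF idem_w1])

lemma w1_regular:
  assumes "lepoll I omega" "\<And>i. i \<in> elts I \<Longrightarrow> F i \<in> elts w1" "T (\<lambda>e. F (e 0))"
  shows "\<exists>\<beta>\<in>elts w1. \<forall>i\<in>elts I. F i \<in> elts \<beta>"
  using hart_regular[OF idem_omega, of I F] assms unfolding w1_def by metis

lemma w2_regular:
  assumes "lepoll I w1" "\<And>i. i \<in> elts I \<Longrightarrow> F i \<in> elts w2" "T (\<lambda>e. F (e 0))"
  shows "\<exists>\<beta>\<in>elts w2. \<forall>i\<in>elts I. F i \<in> elts \<beta>"
  using hart_regular[OF idem_w1, of I F] assms unfolding w2_def by metis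

lemma uncountable_w1:
  assumes "\<not> lepoll a omega"
  shows "lepoll w1 a"
proof -
  obtain \<alpha> f where \<alpha>: "Ord \<alpha>" "bij_betw (app f) (elts \<alpha>) (elts a)" by (rule zermelo)
  then have eq: "eqpoll \<alpha> a" unfolding eqpoll_def by blast
  have "\<alpha> \<notin> elts w1"
    using assms w1_countable lepoll_trans[OF eqpoll_lepoll[OF eqpoll_sym[OF eq]]] by blast
  then have "elts w1 \<subseteq> elts \<alpha>" using Ord_not_mem[OF \<alpha>(1) Ord_w1] by blast
  then show ?thesis using subset_lepoll lepoll_trans eqpoll_lepoll[OF eq] by blast
qed

text \<open>Cofinality \<omega>_1 in the form in which it is used: a strictly cofinal map from
  \<open>w1\<close>, and a bound inside \<beta> for each countable subset.
  \<open>S_is_cofinality\<close> links it to the official formula.\<close>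

definition S21 where
  "S21 \<beta> \<longleftrightarrow> \<beta> \<in> elts w2 \<and> (\<exists>f. isfun f w1 \<and> app f ` elts w1 \<subseteq> elts \<beta> \<and> (\<forall>x\<in>elts \<beta>. \<exists>y\<in>elts w1. x \<in> elts (app f y))) \<and>
    (\<forall>x. elts x \<subseteq> elts \<beta> \<and> lepoll x omega \<longrightarrow> (\<exists>\<delta>\<in>elts \<beta>. elts x \<subseteq> elts \<delta>))"

lemma D_S21 [D_intros]: "T s \<Longrightarrow> D (\<lambda>e. S21 (s e))"
  by (rule D_subst1[of S21]) (unfold S21_def, intro D_intros)

lemma S21_bound: "S21 \<beta> \<Longrightarrow> elts x \<subseteq> elts \<beta> \<Longrightarrow> lepoll x omega \<Longrightarrow> \<exists>\<delta>\<in>elts \<beta>. elts x \<subseteq> elts \<delta>"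
  unfolding S21_def by blast

lemma S21_Ord: "S21 \<beta> \<Longrightarrow> Ord \<beta>"
  unfolding S21_def using Ord_mem[OF Ord_w2] by blast

lemma S21_succ:
  assumes "S21 \<beta>" "x \<in> elts \<beta>"
  shows "vsucc x \<in> elts \<beta>"
proof -
  have "lepoll (upair x x) omega"
    by (rule lepollI[of "\<lambda>_. vempty"]) (auto intro!: D_intros)
  then obtain \<delta> where "\<delta> \<in> elts \<beta>" "x \<in> elts \<delta>" using S21_bound[OF assms(1), of "upair x x"] assms(2) by auto
  moreover have "Ord \<beta>" using S21_Ord[OF assms(1)] .
  ultimately show ?thesis using succ_mem_succ[of \<delta> x] Ord_mem Ord_trans2 by (metis elts_vsucc insertE)
qed

text \<open>A countable ordinal is a countable subset of itself, and none of its elements bounds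
  it.\<close>

lemma S21_not_w1: "S21 \<beta> \<Longrightarrow> \<beta> \<notin> elts w1"
proof
  assume "S21 \<beta>" "\<beta> \<in> elts w1"
  then obtain \<delta> where "\<delta> \<in> elts \<beta>" "elts \<beta> \<subseteq> elts \<delta>" using S21_bound[of \<beta> \<beta>] w1_countable by blast
  then show False using not_self_elts by blast
qed

text \<open>The non-successors below \<open>\<beta>\<close> are uncountable, as an upper bound \<open>\<delta>\<close> of countably many of them
  is followed by \<open>\<delta> + \<omega>\<close>.\<close>

lemma S21_limits:
  assumes \<beta>: "S21 \<beta>" and L: "elts L = {x \<in> elts \<beta>. \<forall>y. x \<noteq> vsucc y}"
  shows "\<not> lepoll L omega"
proof
  assume "lepoll L omega"
  then obtain \<delta> where \<delta>: "\<delta> \<in> elts \<beta>" "elts L \<subseteq> elts \<delta>" using S21_bound[OF \<beta>, of L] L by blast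
  have Ord\<beta>: "Ord \<beta>" using S21_Ord[OF \<beta>] .
  have "T (\<lambda>e. vsucc (e 1))" by (intro D_intros)
  then obtain s where s: "T (\<lambda>e. s (e 0))" "s vempty = \<delta>" "\<And>n. n \<in> elts omega \<Longrightarrow> s (vsucc n) = vsucc (s n)"
    by (rule omega_recursion[where a = \<delta> and S = "\<lambda>_ y. vsucc y"]) blast
  note [D_intros] = T_subst1[OF s(1)]
  have s\<beta>: "s n \<in> elts \<beta>" if "n \<in> elts omega" for n
    using that
  proof (induction n rule: omega_induct)
    show "D (\<lambda>e. s (e 0) \<in> elts \<beta>)" by (intro D_intros)
  qed (use s \<delta> S21_succ[OF \<beta>] in auto)
  let ?X = "mk (s ` elts omega)"
  have X: "elts ?X = s ` elts omega" by (intro elts_mk isset_image s(1)) auto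
  have "lepoll ?X omega" by (rule lepoll_image[OF s(1)]) (simp add: X)
  moreover have "elts ?X \<subseteq> elts \<beta>" unfolding X using s\<beta> by (rule image_subsetI)
  ultimately obtain \<epsilon>' where \<epsilon>': "\<epsilon>' \<in> elts \<beta>" "elts ?X \<subseteq> elts \<epsilon>'"
    using S21_bound[OF \<beta>, of ?X] by metis
  \<comment> \<open>The ordinal \<mu> = \<delta> + \<omega> is obtained as the least one that
    contains every \<delta> + n. By minimality it is no successor, hence an element of
    \<open>L\<close>, although it lies above \<delta>.\<close>
  have "D (\<lambda>e. \<forall>n\<in>elts omega. s n \<in> elts (e 0))" by (intro D_intros)
  moreover have "Ord \<epsilon>'" using Ord_mem[OF Ord\<beta> \<epsilon>'(1)] .
  moreover have "\<forall>n\<in>elts omega. s n \<in> elts \<epsilon>'" using \<epsilon>'(2) X by blast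
  ultimately obtain \<mu> where \<mu>: "Ord \<mu>" "\<forall>n\<in>elts omega. s n \<in> elts \<mu>"
      "\<And>z. z \<in> elts \<mu> \<Longrightarrow> \<not> (\<forall>n\<in>elts omega. s n \<in> elts z)" "elts \<mu> \<subseteq> elts \<epsilon>'"
    by (rule Ord_least) blast
  have "\<mu> \<in> elts \<beta>"
    using Ord_subset_iff[OF \<mu>(1) \<open>Ord \<epsilon>'\<close>] \<mu>(4) \<epsilon>'(1) Ord_trans2[OF Ord\<beta>] by blast
  moreover have "\<mu> \<noteq> vsucc \<nu>" for \<nu>
  proof
    assume \<nu>: "\<mu> = vsucc \<nu>"
    then have "\<nu> \<in> elts \<mu>" by simp
    from \<mu>(3)[OF this] obtain n where n: "n \<in> elts omega" "s n \<notin> elts \<nu>" by blast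
    then have "s n = \<nu>" using \<mu>(2) \<nu> by auto
    then have "s (vsucc n) = \<mu>" using s(3) n \<nu> by simp
    then show False using \<mu>(2) n(1) succ_omega by (metis not_self_elts)
  qed
  ultimately have "\<mu> \<in> elts \<delta>" using L \<delta>(2) by blast
  moreover have "\<delta> \<in> elts \<mu>" using \<mu>(2) s(2) zero_omega by metis
  ultimately show False using not_cycle2 by blast
qed

section \<open>A bijection that satisfies (1) and (2) at a single ordinal\<close>

definition gsep where
  "gsep g u v \<longleftrightarrow> u \<in> elts v \<and> app g u \<in> elts v \<or> v \<in> elts u \<and> app g v \<in> elts u"

text \<open>Conditions (1) and (2) at \<beta>, for the successor operation and without
  exceptions.\<close>

definition good where
  "good g \<beta> q \<longleftrightarrow> (\<forall>a\<in>elts \<beta>. gsep g (app q a) (app q (vsucc a))) \<and>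
    (\<forall>a\<in>elts \<beta>. \<forall>c\<in>elts \<beta>. a \<noteq> c \<longrightarrow> gsep g (app q (vsucc a)) (app q (vsucc c)))"

lemma D_gsep [D_intros]: "T s \<Longrightarrow> T t \<Longrightarrow> T u \<Longrightarrow> D (\<lambda>e. gsep (s e) (t e) (u e))"
  by (rule D_subst3[of gsep]) (unfold gsep_def, intro D_intros)

lemma D_good [D_intros]: "T s \<Longrightarrow> T t \<Longrightarrow> T u \<Longrightarrow> D (\<lambda>e. good (s e) (t e) (u e))"
  by (rule D_subst3[of good]) (unfold good_def, intro D_intros)

text \<open>\<open>w i\<close> is chosen above countably many ordinals, by regularity of
  \<open>w1\<close>. The bound \<open>app g i\<close> will give (1), and
  \<open>app g (app w j)\<close> will give (2). The bound \<open>vsucc (app w j)\<close> keeps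
  \<open>w j + 1\<close> out of the range and so provides \<open>w1\<close> many points that are not
  values of \<open>w\<close>; \<open>i < w i\<close> makes tracing back along \<open>w\<close>
  terminate.\<close>

lemma fast_function:
  assumes g: "app g ` elts w1 \<subseteq> elts w1"
  obtains w where "isfun w w1" "\<And>i. i \<in> elts w1 \<Longrightarrow> app w i \<in> elts w1"
    "\<And>i. i \<in> elts w1 \<Longrightarrow> i \<in> elts (app w i)" "\<And>i. i \<in> elts w1 \<Longrightarrow> app g i \<in> elts (app w i)"
    "\<And>i j. i \<in> elts w1 \<Longrightarrow> j \<in> elts i \<Longrightarrow> vsucc (app w j) \<in> elts (app w i)"
    "\<And>i j. i \<in> elts w1 \<Longrightarrow> j \<in> elts i \<Longrightarrow> app g (app w j) \<in> elts (app w i)"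
proof -
  obtain c where c: "\<And>A. A \<subseteq> elts w1 \<Longrightarrow> A \<noteq> {} \<Longrightarrow> isset A \<Longrightarrow> app c (mk A) \<in> A"
    using choice_function[of w1] by blast
  define A where "A i f = {x \<in> elts w1. i \<in> elts x \<and> app g i \<in> elts x \<and>
    (\<forall>j\<in>elts i. vsucc (f j) \<in> elts x \<and> app g (f j) \<in> elts x)}" for i f
  define H where "H i f = app c (mk (A i (app f)))" for i f
  have H: "T (\<lambda>e. H (e 0) (e 1))" unfolding H_def A_def by (intro D_intros)
  define w where "w = rec H"
  have Tw: "T (\<lambda>e. w (e 0))" unfolding w_def by (intro T_rec H D_intros)
  note [D_intros] = T_subst1[OF Tw]
  have w_eq: "w i = app c (mk (A i w))" for i
  proof -
    have "A i (app (lam i w)) = A i w" unfolding A_def using app_lam[OF Tw] by simp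
    then show ?thesis unfolding w_def by (subst rec_eq[OF H]) (simp add: H_def w_def)
  qed
  have w: "w i \<in> A i w" if "i \<in> elts w1" for i
  proof -
    have "Ord i" using Ord_mem[OF Ord_w1 that] .
    then have "i \<in> elts w1 \<longrightarrow> w i \<in> A i w"
    proof (induction i rule: Ord_induct)
      show "D (\<lambda>e. e 0 \<in> elts w1 \<longrightarrow> w (e 0) \<in> A (e 0) w)" unfolding A_def by (intro D_intros)
    next
      case (step i)
      show ?case
      proof
        assume i: "i \<in> elts w1"
        have wj: "w j \<in> elts w1" if "j \<in> elts i" for j
          using step(2)[OF that] Ord_trans2[OF Ord_w1 that i] unfolding A_def by blast
        have "T (\<lambda>e. vsucc (w (e 0)))" by (intro D_intros)
        then obtain b1 where b1: "b1 \<in> elts w1" "\<forall>j\<in>elts i. vsucc (w j) \<in> elts b1"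
          using w1_regular[OF w1_countable[OF i], of "\<lambda>j. vsucc (w j)"] wj w1_succ by blast
        have "T (\<lambda>e. app g (w (e 0)))" by (intro D_intros)
        then obtain b2 where b2: "b2 \<in> elts w1" "\<forall>j\<in>elts i. app g (w j) \<in> elts b2"
          using w1_regular[OF w1_countable[OF i], of "\<lambda>j. app g (w j)"] wj g by blast
        have gi: "app g i \<in> elts w1" using g i by blast
        define m where "m x y = (if x \<in> elts y then y else x)" for x y
        have m: "m x y \<in> elts w1" "elts x \<subseteq> elts (m x y)" "elts y \<subseteq> elts (m x y)"
          if "x \<in> elts w1" "y \<in> elts w1" for x y
        proof -
          have "Ord x" "Ord y" using that Ord_mem[OF Ord_w1] by blast+
          then show "m x y \<in> elts w1" "elts x \<subseteq> elts (m x y)" "elts y \<subseteq> elts (m x y)"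
            using that Ord_trans[of y x] Ord_not_mem[of x y] by (auto simp: m_def)
        qed
        let ?b = "m (m b1 b2) (m (vsucc i) (vsucc (app g i)))"
        have 1: "m b1 b2 \<in> elts w1" "m (vsucc i) (vsucc (app g i)) \<in> elts w1"
          using m(1) b1(1) b2(1) w1_succ i gi by blast+
        then have "?b \<in> elts w1" "elts (m b1 b2) \<subseteq> elts ?b" "elts (m (vsucc i) (vsucc (app g i))) \<subseteq> elts ?b"
          using m by blast+
        moreover have "elts b1 \<subseteq> elts (m b1 b2)" "elts b2 \<subseteq> elts (m b1 b2)"
          "i \<in> elts (m (vsucc i) (vsucc (app g i)))" "app g i \<in> elts (m (vsucc i) (vsucc (app g i)))"
          using m[OF b1(1) b2(1)] m[OF w1_succ[OF i] w1_succ[OF gi]] by auto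
        ultimately have "?b \<in> A i w" unfolding A_def using b1(2) b2(2) by blast
        moreover have "isset (A i w)"
          by (rule isset_sub[OF isset_elts[of w1]]) (unfold A_def, blast, intro D_intros)
        ultimately show "w i \<in> A i w" unfolding w_eq[of i] by (intro c) (auto simp: A_def)
      qed
    qed
    then show ?thesis using that by blast
  qed
  have app: "app (lam w1 w) i = w i" if "i \<in> elts w1" for i using Tw that by (rule app_lam)
  have sub: "j \<in> elts w1" if "i \<in> elts w1" "j \<in> elts i" for i j using Ord_trans2[OF Ord_w1 that(2,1)] .
  show ?thesis
  proof (rule that[of "lam w1 w"])
    show "isfun (lam w1 w) w1" by (rule isfun_lam[OF Tw])
  qed (use w app sub in \<open>auto simp: A_def\<close>)
qed

text \<open>\<open>q\<close> conjugates the successor operation on \<open>\<beta>\<close> to the fast growing \<open>w\<close>: both decompose their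
  domain into \<open>\<omega>\<close>-chains, and \<open>\<rho>\<close> matches the starting points.\<close>

lemma good_bijection:
  assumes \<beta>: "S21 \<beta>" and g: "app g ` elts w1 \<subseteq> elts w1"
  obtains q where "isfun q \<beta>" "bij_betw (app q) (elts \<beta>) (elts w1)" "good g \<beta> q"
proof -
  have Ord\<beta>: "Ord \<beta>" using S21_Ord[OF \<beta>] .
  obtain w where w: "isfun w w1" "\<And>i. i \<in> elts w1 \<Longrightarrow> app w i \<in> elts w1"
    "\<And>i. i \<in> elts w1 \<Longrightarrow> i \<in> elts (app w i)" "\<And>i. i \<in> elts w1 \<Longrightarrow> app g i \<in> elts (app w i)"
    "\<And>i j. i \<in> elts w1 \<Longrightarrow> j \<in> elts i \<Longrightarrow> vsucc (app w j) \<in> elts (app w i)"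
    "\<And>i j. i \<in> elts w1 \<Longrightarrow> j \<in> elts i \<Longrightarrow> app g (app w j) \<in> elts (app w i)"
    using fast_function[OF g] by blast
  have Ord1: "Ord i" if "i \<in> elts w1" for i using Ord_mem[OF Ord_w1 that] .
  have w_mono: "app w j \<in> elts (app w i)" if "i \<in> elts w1" "j \<in> elts i" for i j
    using w(5)[OF that] Ord1[OF w(2)[OF that(1)]] Ord_trans2[of "app w i" "app w j" "vsucc (app w j)"] by simp
  have lin: "i \<in> elts j \<or> i = j \<or> j \<in> elts i" if "i \<in> elts w1" "j \<in> elts w1" for i j
    using Ord_linear Ord1 that by blast
  have w_inj: "i = j" if "i \<in> elts w1" "j \<in> elts w1" "app w i = app w j" for i j
    using lin[OF that(1,2)] w_mono that not_self_elts by metis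
  let ?W = "mk (elts w1 - app w ` elts w1)"
  have W: "elts ?W = elts w1 - app w ` elts w1"
    by (intro elts_mk isset_sub[OF isset_elts[of w1]] D_intros) auto
  \<comment> \<open>The successors of the values of \<open>w\<close> are themselves no values, since
    \<open>w\<close> jumps over them.\<close>
  have "lepoll w1 ?W"
  proof (rule lepollI)
    show "T (\<lambda>e. vsucc (app w (e 0)))" by (intro D_intros)
    show "inj_on (\<lambda>i. vsucc (app w i)) (elts w1)" using w_inj by (auto intro: inj_onI)
    have "vsucc (app w i) \<noteq> app w j" if ij: "i \<in> elts w1" "j \<in> elts w1" for i j
    proof
      assume eq: "vsucc (app w i) = app w j"
      then have *: "app w i \<in> elts (app w j)" by (metis elts_vsucc insertI1)
      consider "i \<in> elts j" | "i = j" | "j \<in> elts i" using lin[OF ij] by blast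
      then show False
      proof cases
        case 1
        then show False using w(5)[OF ij(2) 1] eq not_self_elts by metis
      next
        case 2
        then show False using * by simp
      next
        case 3
        then show False using w_mono[OF ij(1) 3] * not_cycle2 by blast
      qed
    qed
    then have "vsucc (app w i) \<notin> app w ` elts w1" if "i \<in> elts w1" for i using that by (meson imageE)
    moreover have "vsucc (app w i) \<in> elts w1" if "i \<in> elts w1" for i by (intro w1_succ w(2) that)
    ultimately show "(\<lambda>i. vsucc (app w i)) ` elts w1 \<subseteq> elts ?W" unfolding W by (simp add: image_subset_iff)
  qed
  let ?L = "mk {x \<in> elts \<beta>. \<forall>y. x \<noteq> vsucc y}"
  have L: "elts ?L = {x \<in> elts \<beta>. \<forall>y. x \<noteq> vsucc y}"
    by (intro elts_mk isset_sub[OF isset_elts[of \<beta>]] D_intros) auto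
  have "lepoll w1 ?L" using uncountable_w1[OF S21_limits[OF \<beta> L]] .
  moreover have "lepoll ?L w1"
  proof (rule lepoll_trans)
    show "lepoll ?L \<beta>" by (rule subset_lepoll) (use L in blast)
    show "lepoll \<beta> w1" using \<beta> w2_lepoll unfolding S21_def by blast
  qed
  moreover have "lepoll ?W w1" by (rule subset_lepoll) (use W in blast)
  ultimately have "eqpoll ?L ?W"
    using \<open>lepoll w1 ?W\<close> by (intro Schroeder_Bernstein) (blast intro: lepoll_trans)+
  then obtain \<rho> where \<rho>: "bij_betw (app \<rho>) (elts ?L) (elts ?W)" unfolding eqpoll_def by blast
  \<comment> \<open>\<open>a = vsucc (vUnion a)\<close> is the test for successors. They continue
    the chain by \<open>w\<close>; all other ordinals start a chain where \<rho> says.\<close>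
  define H where "H a f = (if a = vsucc (vUnion a) then app w (app f (vUnion a)) else app \<rho> a)" for a f
  have H: "T (\<lambda>e. H (e 0) (e 1))" unfolding H_def by (intro D_intros)
  define q where "q = rec H"
  have Tq: "T (\<lambda>e. q (e 0))" unfolding q_def by (intro T_rec H D_intros)
  note [D_intros] = T_subst1[OF Tq]
  have q_succ: "q (vsucc a) = app w (q a)" if "Ord a" for a
  proof -
    have "app (lam (vsucc a) (rec H)) a = q a" unfolding q_def by (rule app_lam) (use Tq q_def in auto)
    then show ?thesis unfolding q_def using vUnion_vsucc[OF that]
      by (subst rec_eq[OF H]) (simp add: H_def q_def)
  qed
  have q_lim: "q a = app \<rho> a" if "\<forall>y. a \<noteq> vsucc y" for a
    unfolding q_def using that by (subst rec_eq[OF H]) (simp add: H_def)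
  have cases: "a \<in> elts ?L \<or> (\<exists>b. b \<in> elts \<beta> \<and> Ord b \<and> a = vsucc b)" if "a \<in> elts \<beta>" for a
  proof (cases "\<exists>b. a = vsucc b")
    case True
    then obtain b where "a = vsucc b" by blast
    moreover from this have "b \<in> elts \<beta>" using Ord_trans2[OF Ord\<beta> _ that, of b] by simp
    ultimately show ?thesis using Ord_mem[OF Ord\<beta>] by blast
  qed (use L that in blast)
  have q_L: "q a = app \<rho> a" "q a \<in> elts w1" "q a \<notin> app w ` elts w1" if "a \<in> elts ?L" for a
  proof -
    show "q a = app \<rho> a" using q_lim L that by blast
    moreover have "app \<rho> a \<in> elts ?W" using \<rho> that unfolding bij_betw_def by blast
    ultimately show "q a \<in> elts w1" "q a \<notin> app w ` elts w1" using W by auto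
  qed
  have q_w1: "q a \<in> elts w1" if a: "a \<in> elts \<beta>" for a
  proof -
    have "Ord a" using Ord_mem[OF Ord\<beta> a] .
    then have "a \<in> elts \<beta> \<longrightarrow> q a \<in> elts w1"
    proof (induction a rule: Ord_induct)
      show "D (\<lambda>e. e 0 \<in> elts \<beta> \<longrightarrow> q (e 0) \<in> elts w1)" by (intro D_intros)
    next
      case (step a)
      show ?case
      proof
        assume "a \<in> elts \<beta>"
        from cases[OF this] show "q a \<in> elts w1"
        proof
          assume "\<exists>b. b \<in> elts \<beta> \<and> Ord b \<and> a = vsucc b"
          then obtain b where b: "b \<in> elts \<beta>" "Ord b" "a = vsucc b" by blast
          then have "b \<in> elts a" by simp
          then show ?thesis using step(2) b q_succ w(2) by simp
        qed (rule q_L)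
      qed
    qed
    then show ?thesis using a by blast
  qed
  have q_inj: "a = c" if a: "a \<in> elts \<beta>" and c: "c \<in> elts \<beta>" and eq: "q a = q c" for a c
  proof -
    have "Ord a" using Ord_mem[OF Ord\<beta> a] .
    then have "\<forall>c. a \<in> elts \<beta> \<and> c \<in> elts \<beta> \<and> q a = q c \<longrightarrow> a = c"
    proof (induction a rule: Ord_induct)
      show "D (\<lambda>e. \<forall>c. e 0 \<in> elts \<beta> \<and> c \<in> elts \<beta> \<and> q (e 0) = q c \<longrightarrow> e 0 = c)" by (intro D_intros)
    next
      case (step a)
      show ?case
      proof (intro allI impI)
        fix c assume "a \<in> elts \<beta> \<and> c \<in> elts \<beta> \<and> q a = q c"
        then have *: "a \<in> elts \<beta>" "c \<in> elts \<beta>" "q a = q c" by auto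
        show "a = c"
        proof (cases "a \<in> elts ?L")
          case True
          have "c \<in> elts ?L"
          proof (rule ccontr)
            assume "c \<notin> elts ?L"
            then obtain b where "b \<in> elts \<beta>" "Ord b" "c = vsucc b" using cases *(2) by blast
            then have "q a \<in> app w ` elts w1" using *(3) q_succ q_w1 by auto
            then show False using q_L(3)[OF True] by blast
          qed
          then have "app \<rho> a = app \<rho> c" using q_L(1)[OF True] q_L(1)[of c] *(3) by simp
          then show ?thesis
            using inj_onD[OF bij_betw_imp_inj_on[OF \<rho>]] True \<open>c \<in> elts ?L\<close> by blast
        next
          case False
          then obtain b where b: "b \<in> elts \<beta>" "Ord b" "a = vsucc b" using cases *(1) by blast
          have "c \<notin> elts ?L"
          proof
            assume "c \<in> elts ?L"
            moreover have "q c \<in> app w ` elts w1" using b *(3)[symmetric] q_succ q_w1 by auto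
            ultimately show False using q_L(3) by blast
          qed
          then obtain d where d: "d \<in> elts \<beta>" "Ord d" "c = vsucc d" using cases *(2) by blast
          have "app w (q b) = app w (q d)" using *(3) b d q_succ by simp
          then have "q b = q d" using w_inj q_w1 b d by blast
          moreover have "b \<in> elts a" using b by simp
          ultimately have "b = d" using step(2) b(1) d(1) by blast
          then show ?thesis using b d by simp
        qed
      qed
    qed
    then show ?thesis using a c eq by blast
  qed
  have q_surj: "\<exists>a\<in>elts \<beta>. q a = i" if i: "i \<in> elts w1" for i
  proof -
    have "i \<in> elts w1 \<longrightarrow> (\<exists>a\<in>elts \<beta>. q a = i)"
      using Ord1[OF i]
    proof (induction i rule: Ord_induct)
      show "D (\<lambda>e. e 0 \<in> elts w1 \<longrightarrow> (\<exists>a\<in>elts \<beta>. q a = e 0))" by (intro D_intros)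
    next
      case (step i)
      show ?case
      proof
        assume i: "i \<in> elts w1"
        show "\<exists>a\<in>elts \<beta>. q a = i"
        proof (cases "i \<in> app w ` elts w1")
          case True
          then obtain k where k: "k \<in> elts w1" "i = app w k" by blast
          \<comment> \<open>\<open>k\<close> lies below \<open>w k = i\<close>, so the induction
            hypothesis applies to it.\<close>
          then obtain a where "a \<in> elts \<beta>" "q a = k" using step(2)[of k] w(3) by blast
          then show ?thesis using k q_succ Ord_mem[OF Ord\<beta>] S21_succ[OF \<beta>] by blast
        next
          case False
          then have "i \<in> elts ?W" using W i by blast
          then have "i \<in> app \<rho> ` elts ?L" unfolding bij_betw_imp_surj_on[OF \<rho>] .
          then obtain a where a: "a \<in> elts ?L" "i = app \<rho> a" by (rule imageE)
          then have "a \<in> elts \<beta>" "q a = i" using L q_L(1)[OF a(1)] by blast+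
          then show ?thesis by blast
        qed
      qed
    qed
    then show ?thesis using i by blast
  qed
  have app_q: "app (lam \<beta> q) a = q a" if "a \<in> elts \<beta>" for a using Tq that by (rule app_lam)
  have sep1: "gsep g i (app w i)" if "i \<in> elts w1" for i
    unfolding gsep_def using w(3,4)[OF that] by blast
  have sep2: "gsep g (app w i) (app w j)" if "i \<in> elts w1" "j \<in> elts w1" "i \<noteq> j" for i j
    unfolding gsep_def using lin[OF that(1,2)] w_mono w(6) that by blast
  have qs: "app (lam \<beta> q) (vsucc a) = app w (q a)" if "a \<in> elts \<beta>" for a
    using app_q[OF S21_succ[OF \<beta> that]] q_succ[OF Ord_mem[OF Ord\<beta> that]] by simp
  show ?thesis
  proof (rule that[of "lam \<beta> q"])
    show "isfun (lam \<beta> q) \<beta>" using Tq by (rule isfun_lam)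
    have "bij_betw q (elts \<beta>) (elts w1)"
      unfolding bij_betw_def
    proof
      show "inj_on q (elts \<beta>)" by (rule inj_onI) (rule q_inj)
      show "q ` elts \<beta> = elts w1" using q_w1 q_surj by (metis equalityI imageI image_subsetI subsetI)
    qed
    then show "bij_betw (app (lam \<beta> q)) (elts \<beta>) (elts w1)" using app_q by (simp cong: bij_betw_cong)
    show "good g \<beta> (lam \<beta> q)"
      unfolding good_def
    proof (intro conjI ballI impI)
      fix a assume a: "a \<in> elts \<beta>"
      show "gsep g (app (lam \<beta> q) a) (app (lam \<beta> q) (vsucc a))"
        unfolding qs[OF a] app_q[OF a] by (rule sep1[OF q_w1[OF a]])
      fix c assume c: "c \<in> elts \<beta>" "a \<noteq> c"
      show "gsep g (app (lam \<beta> q) (vsucc a)) (app (lam \<beta> q) (vsucc c))"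
        unfolding qs[OF a] qs[OF c(1)] using q_inj a c by (intro sep2 q_w1) blast+
    qed
  qed
qed

end

subsection \<open>Stationary sets\<close>

context zfc
begin

lemma bounded_choice_ex:
  assumes "D (\<lambda>e. R (e 0) (e 1))" "\<And>x. x \<in> elts a \<Longrightarrow> \<exists>y\<in>elts b. R x y"
  shows "\<exists>f. isfun f a \<and> (\<forall>x\<in>elts a. app f x \<in> elts b \<and> R x (app f x))"
proof (rule bounded_choice[OF assms])
  fix f assume "isfun f a" "\<And>x. x \<in> elts a \<Longrightarrow> app f x \<in> elts b" "\<And>x. x \<in> elts a \<Longrightarrow> R x (app f x)"
  then show ?thesis by blast
qed

definition limit where
  "limit d \<longleftrightarrow> Ord d \<and> d \<noteq> vempty \<and> (\<forall>y\<in>elts d. \<exists>z\<in>elts d. y \<in> elts z)"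

definition club where
  "club C \<longleftrightarrow> elts C \<subseteq> elts w2 \<and> (\<forall>x\<in>elts w2. \<exists>y\<in>elts C. x \<in> elts y) \<and>
    (\<forall>d\<in>elts w2. limit d \<and> (\<forall>x\<in>elts d. \<exists>y\<in>elts C. y \<in> elts d \<and> x \<in> elts y) \<longrightarrow> d \<in> elts C)"

definition stationary where
  "stationary S \<longleftrightarrow> elts S \<subseteq> elts w2 \<and> (\<forall>C. club C \<longrightarrow> (\<exists>x\<in>elts S. x \<in> elts C))"

lemma D_limit [D_intros]: "T s \<Longrightarrow> D (\<lambda>e. limit (s e))"
  by (rule D_subst1[of limit]) (unfold limit_def, intro D_intros)

lemma D_club [D_intros]: "T s \<Longrightarrow> D (\<lambda>e. club (s e))"
  by (rule D_subst1[of club]) (unfold club_def, intro D_intros)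

lemma D_stationary [D_intros]: "T s \<Longrightarrow> D (\<lambda>e. stationary (s e))"
  by (rule D_subst1[of stationary]) (unfold stationary_def, intro D_intros)

lemma clubs_above:
  assumes TC: "T (\<lambda>e. C (e 0))" and C: "\<And>\<xi>. \<xi> \<in> elts w1 \<Longrightarrow> club (C \<xi>)" and z: "z \<in> elts w2"
  shows "\<exists>x\<in>elts w2. \<forall>\<xi>\<in>elts w1. \<exists>y\<in>elts (C \<xi>). z \<in> elts y \<and> y \<in> elts x"
proof -
  note [D_intros] = T_subst1[OF TC]
  have "D (\<lambda>e. e 1 \<in> elts (C (e 0)) \<and> z \<in> elts (e 1))" by (intro D_intros)
  moreover have "\<exists>y\<in>elts w2. y \<in> elts (C \<xi>) \<and> z \<in> elts y" if "\<xi> \<in> elts w1" for \<xi>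
    using C[OF that] z unfolding club_def by blast
  ultimately have "\<exists>f. isfun f w1 \<and> (\<forall>x\<in>elts w1. app f x \<in> elts w2 \<and>
      app f x \<in> elts (C x) \<and> z \<in> elts (app f x))"
    by (rule bounded_choice_ex[where R = "\<lambda>\<xi> y. y \<in> elts (C \<xi>) \<and> z \<in> elts y"])
  then obtain f where f: "\<And>\<xi>. \<xi> \<in> elts w1 \<Longrightarrow> app f \<xi> \<in> elts w2"
    "\<And>\<xi>. \<xi> \<in> elts w1 \<Longrightarrow> app f \<xi> \<in> elts (C \<xi>) \<and> z \<in> elts (app f \<xi>)"
    by blast
  have "T (\<lambda>e. app f (e 0))" by (intro D_intros)
  then obtain x where "x \<in> elts w2" "\<forall>\<xi>\<in>elts w1. app f \<xi> \<in> elts x"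
    using w2_regular[OF lepoll_refl, of "app f"] f(1) by blast
  then show ?thesis using f(2) by blast
qed

text \<open>An increasing sequence \<open>F\<close> of length \<omega>_1 is built such that between
  \<open>F i\<close> and its successor term each of the \<omega>_1 many clubs has a point. Its
  supremum is a limit of every club, and regularity of \<open>w1\<close> bounds countable subsets,
  so the cofinality is \<omega>_1.\<close>

lemma club_intersection_meets_S21:
  assumes TC: "T (\<lambda>e. C (e 0))" and C: "\<And>\<xi>. \<xi> \<in> elts w1 \<Longrightarrow> club (C \<xi>)" and a: "a \<in> elts w2"
  obtains \<beta> where "S21 \<beta>" "a \<in> elts \<beta>" "\<And>\<xi>. \<xi> \<in> elts w1 \<Longrightarrow> \<beta> \<in> elts (C \<xi>)"
proof -
  note [D_intros] = T_subst1[OF TC]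
  have "D (\<lambda>e. \<forall>\<xi>\<in>elts w1. \<exists>y\<in>elts (C \<xi>). e 0 \<in> elts y \<and> y \<in> elts (e 1))" by (intro D_intros)
  then have "\<exists>f. isfun f w2 \<and> (\<forall>x\<in>elts w2. app f x \<in> elts w2 \<and>
      (\<forall>\<xi>\<in>elts w1. \<exists>y\<in>elts (C \<xi>). x \<in> elts y \<and> y \<in> elts (app f x)))"
    using clubs_above[OF TC C]
    by (rule bounded_choice_ex[where R = "\<lambda>z x. \<forall>\<xi>\<in>elts w1. \<exists>y\<in>elts (C \<xi>). z \<in> elts y \<and> y \<in> elts x"])
  then obtain u where u: "\<And>z. z \<in> elts w2 \<Longrightarrow> app u z \<in> elts w2"
    "\<And>z. z \<in> elts w2 \<Longrightarrow> \<forall>\<xi>\<in>elts w1. \<exists>y\<in>elts (C \<xi>). z \<in> elts y \<and> y \<in> elts (app u z)"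
    by blast
  have Ord2: "Ord x" if "x \<in> elts w2" for x using Ord_mem[OF Ord_w2 that] .
  have zero_w1: "vempty \<in> elts w1" using idem_w1 zero_omega unfolding idem_def by blast
  have z_u: "z \<in> elts (app u z)" if "z \<in> elts w2" for z
    using u(2)[OF that] zero_w1 Ord_trans2[OF Ord2[OF u(1)[OF that]]] by blast
  obtain c where c: "\<And>A. A \<subseteq> elts w2 \<Longrightarrow> A \<noteq> {} \<Longrightarrow> isset A \<Longrightarrow> app c (mk A) \<in> A"
    using choice_function[of w2] by blast
  \<comment> \<open>Admissible values at stage \<open>i\<close>: above \<open>a\<close>, and beyond
    \<open>app u\<close> of each earlier term, where \<open>app u z\<close> leaves room for a point
    of every club above \<open>z\<close>.\<close>
  define A where "A i f = {x \<in> elts w2. a \<in> elts x \<and> (\<forall>j\<in>elts i. app u (f j) \<in> elts x)}" for i f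
  define H where "H i f = app c (mk (A i (app f)))" for i f
  have H: "T (\<lambda>e. H (e 0) (e 1))" unfolding H_def A_def by (intro D_intros)
  define F where "F = rec H"
  have TF: "T (\<lambda>e. F (e 0))" unfolding F_def by (intro T_rec H D_intros)
  note [D_intros] = T_subst1[OF TF]
  have F_eq: "F i = app c (mk (A i F))" for i
  proof -
    have "A i (app (lam i F)) = A i F" unfolding A_def using app_lam[OF TF] by simp
    then show ?thesis unfolding F_def by (subst rec_eq[OF H]) (simp add: H_def F_def)
  qed
  have F: "F i \<in> A i F" if "i \<in> elts w1" for i
  proof -
    have "Ord i" using Ord_mem[OF Ord_w1 that] .
    then have "i \<in> elts w1 \<longrightarrow> F i \<in> A i F"
    proof (induction i rule: Ord_induct)
      show "D (\<lambda>e. e 0 \<in> elts w1 \<longrightarrow> F (e 0) \<in> A (e 0) F)" unfolding A_def by (intro D_intros)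
    next
      case (step i)
      show ?case
      proof
        assume i: "i \<in> elts w1"
        have Fj: "app u (F j) \<in> elts w2" if "j \<in> elts i" for j
          using step(2)[OF that] Ord_trans2[OF Ord_w1 that i] u(1) unfolding A_def by blast
        have "T (\<lambda>e. app u (F (e 0)))" by (intro D_intros)
        moreover have "lepoll i w1" using Ord_trans[OF Ord_w1 i] by (rule subset_lepoll)
        ultimately obtain b where b: "b \<in> elts w2" "\<forall>j\<in>elts i. app u (F j) \<in> elts b"
          using w2_regular[of i "\<lambda>j. app u (F j)"] Fj by blast
        let ?b = "if a \<in> elts b then b else vsucc a"
        have "?b \<in> elts w2" using b(1) w2_succ[OF a] by simp
        moreover have "a \<in> elts ?b" by simp
        moreover have "elts b \<subseteq> elts ?b" using Ord_not_mem[OF Ord2[OF a] Ord2[OF b(1)]] by auto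
        ultimately have "?b \<in> A i F" unfolding A_def using b(2) by blast
        moreover have "isset (A i F)"
          by (rule isset_sub[OF isset_elts[of w2]]) (unfold A_def, blast, intro D_intros)
        moreover have "A i F \<subseteq> elts w2" unfolding A_def by blast
        ultimately show "F i \<in> A i F" unfolding F_eq[of i] using c by blast
      qed
    qed
    then show ?thesis using that by blast
  qed
  have F_w2: "F i \<in> elts w2" and F_a: "a \<in> elts (F i)" if "i \<in> elts w1" for i
    using F[OF that] unfolding A_def by blast+
  have F_u: "app u (F j) \<in> elts (F i)" if "i \<in> elts w1" "j \<in> elts i" for i j
    using F[OF that(1)] that(2) unfolding A_def by blast
  have F_mono: "F j \<in> elts (F i)" if "i \<in> elts w1" "j \<in> elts i" for i j
  proof -
    have "j \<in> elts w1" using Ord_trans2[OF Ord_w1 that(2,1)] .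
    then show ?thesis using Ord_trans2[OF Ord2[OF F_w2[OF that(1)]] z_u[OF F_w2] F_u[OF that]] by blast
  qed
  let ?R = "mk (F ` elts w1)"
  let ?\<beta> = "vUnion ?R"
  have R: "elts ?R = F ` elts w1" by (intro elts_mk isset_image TF) auto
  have mem\<beta>: "x \<in> elts ?\<beta> \<longleftrightarrow> (\<exists>i\<in>elts w1. x \<in> elts (F i))" for x by (simp add: R)
  have Ord\<beta>: "Ord ?\<beta>"
  proof (rule Ord_Union)
    fix y assume "y \<in> elts ?R"
    then obtain i where "i \<in> elts w1" "y = F i" unfolding R by blast
    then show "Ord y" using Ord2[OF F_w2] by simp
  qed
  have F\<beta>: "F i \<in> elts ?\<beta>" if "i \<in> elts w1" for i
    unfolding mem\<beta> using F_mono[OF w1_succ[OF that], of i] w1_succ[OF that] by auto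
  have "lepoll ?\<beta> w1"
    by (rule lepoll_Union[OF idem_w1 lepoll_refl w2_lepoll[OF F_w2] TF]) (use mem\<beta> in blast)+
  then have \<beta>w2: "?\<beta> \<in> elts w2" using mem_hart_iff[OF Ord\<beta>] unfolding w2_def by blast
  have lim: "limit ?\<beta>"
    unfolding limit_def
  proof (intro conjI ballI)
    show "?\<beta> \<noteq> vempty" using F\<beta>[OF zero_w1] by (metis elts_vempty empty_iff)
    show "\<exists>z\<in>elts ?\<beta>. y \<in> elts z" if "y \<in> elts ?\<beta>" for y using that F\<beta> unfolding mem\<beta>[of y] by blast
  qed (rule Ord\<beta>)
  have inC: "?\<beta> \<in> elts (C \<xi>)" if \<xi>: "\<xi> \<in> elts w1" for \<xi>
  proof -
    have "\<exists>y\<in>elts (C \<xi>). y \<in> elts ?\<beta> \<and> x \<in> elts y" if x: "x \<in> elts ?\<beta>" for x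
    proof -
      obtain i where i: "i \<in> elts w1" "x \<in> elts (F i)" using x mem\<beta> by blast
      obtain y where y: "y \<in> elts (C \<xi>)" "F i \<in> elts y" "y \<in> elts (app u (F i))"
        using u(2)[OF F_w2[OF i(1)]] \<xi> by blast
      have i': "vsucc i \<in> elts w1" "i \<in> elts (vsucc i)" using w1_succ[OF i(1)] by auto
      have "y \<in> elts (F (vsucc i))" using Ord_trans2[OF Ord2[OF F_w2[OF i'(1)]] y(3) F_u[OF i']] .
      then have "y \<in> elts ?\<beta>" using i'(1) mem\<beta> by blast
      moreover have "x \<in> elts y"
      proof -
        have "Ord y" using Ord_mem[OF Ord\<beta> \<open>y \<in> elts ?\<beta>\<close>] .
        then show ?thesis using Ord_trans2 i(2) y(2) by blast
      qed
      ultimately show ?thesis using y(1) by blast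
    qed
    then show ?thesis using C[OF \<xi>] \<beta>w2 lim unfolding club_def by blast
  qed
  have app_F: "app (lam w1 F) i = F i" if "i \<in> elts w1" for i using TF that by (rule app_lam)
  have "S21 ?\<beta>"
    unfolding S21_def
  proof (intro conjI exI[of _ "lam w1 F"] allI impI)
    show "isfun (lam w1 F) w1" by (rule isfun_lam[OF TF])
    show "app (lam w1 F) ` elts w1 \<subseteq> elts ?\<beta>"
      using app_F F\<beta> by (intro image_subsetI) (simp del: elts_vUnion)
    show "\<forall>x\<in>elts ?\<beta>. \<exists>y\<in>elts w1. x \<in> elts (app (lam w1 F) y)"
      using app_F mem\<beta> by (simp del: elts_vUnion)
    fix x assume x: "elts x \<subseteq> elts ?\<beta> \<and> lepoll x omega"
    have "D (\<lambda>e. e 0 \<in> elts (F (e 1)))" by (intro D_intros)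
    moreover have "\<exists>i\<in>elts w1. y \<in> elts (F i)" if "y \<in> elts x" for y using x that mem\<beta> by blast
    ultimately have "\<exists>f. isfun f x \<and> (\<forall>x\<in>elts x. app f x \<in> elts w1 \<and> x \<in> elts (F (app f x)))"
      by (rule bounded_choice_ex[where R = "\<lambda>y i. y \<in> elts (F i)"])
    then obtain \<zeta> where \<zeta>: "\<And>y. y \<in> elts x \<Longrightarrow> app \<zeta> y \<in> elts w1" "\<And>y. y \<in> elts x \<Longrightarrow> y \<in> elts (F (app \<zeta> y))"
      by blast
    have "T (\<lambda>e. app \<zeta> (e 0))" by (intro D_intros)
    then obtain \<theta> where \<theta>: "\<theta> \<in> elts w1" "\<forall>y\<in>elts x. app \<zeta> y \<in> elts \<theta>"
      using w1_regular[of x "app \<zeta>"] \<zeta>(1) x by blast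
    have "y \<in> elts (F \<theta>)" if "y \<in> elts x" for y
      using Ord_trans2[OF Ord2[OF F_w2[OF \<theta>(1)]] \<zeta>(2)[OF that] F_mono[OF \<theta>(1)]] \<theta>(2) that by blast
    then show "\<exists>\<delta>\<in>elts ?\<beta>. elts x \<subseteq> elts \<delta>" using F\<beta>[OF \<theta>(1)] by blast
  qed (rule \<beta>w2)
  moreover have "a \<in> elts ?\<beta>" using mem\<beta> F_a[OF zero_w1] zero_w1 by blast
  ultimately show ?thesis using that inC by blast
qed

text \<open>An Ulam matrix: for every \<open>\<alpha>\<close> some column index \<open>\<xi>\<close> gives a stationary set, and the sets in a
  column are disjoint.\<close>

definition ulam where
  "ulam s \<alpha> \<xi> = mk {\<beta> \<in> elts w2. S21 \<beta> \<and> \<alpha> \<in> elts \<beta> \<and> app (app s \<beta>) \<alpha> = \<xi>}"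

lemma T_ulam [D_intros]: "T a \<Longrightarrow> T b \<Longrightarrow> T (\<lambda>e. ulam s (a e) (b e))"
  by (rule T_subst2[of "ulam s"]) (unfold ulam_def, intro D_intros)

lemma elts_ulam: "elts (ulam s \<alpha> \<xi>) = {\<beta> \<in> elts w2. S21 \<beta> \<and> \<alpha> \<in> elts \<beta> \<and> app (app s \<beta>) \<alpha> = \<xi>}"
  unfolding ulam_def by (intro elts_mk isset_sub[OF isset_elts[of w2]] D_intros) auto

text \<open>Otherwise each \<xi> has a club that misses its set. These \<omega>_1 many clubs share
  some \<beta> of cofinality \<omega>_1 above \<alpha>, and this \<beta> belongs to the set for
  \<xi> = s_\<beta>(\<alpha>).\<close>

lemma ulam_stationary:
  assumes s: "\<And>\<beta>. \<beta> \<in> elts w2 \<Longrightarrow> app (app s \<beta>) ` elts \<beta> \<subseteq> elts w1" and \<alpha>: "\<alpha> \<in> elts w2"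
  shows "\<exists>\<xi>\<in>elts w1. stationary (ulam s \<alpha> \<xi>)"
proof (rule ccontr)
  assume *: "\<not> ?thesis"
  let ?R = "\<lambda>\<xi> C. club C \<and> (\<forall>x\<in>elts (ulam s \<alpha> \<xi>). x \<notin> elts C)"
  have "D (\<lambda>e. ?R (e 0) (e 1))" by (intro D_intros)
  moreover have "\<exists>C\<in>elts (vpow w2). ?R \<xi> C" if \<xi>: "\<xi> \<in> elts w1" for \<xi>
  proof -
    have "elts (ulam s \<alpha> \<xi>) \<subseteq> elts w2" unfolding elts_ulam by blast
    then obtain C where "?R \<xi> C" using * \<xi> unfolding stationary_def by blast
    then show ?thesis unfolding club_def by auto
  qed
  ultimately have "\<exists>f. isfun f w1 \<and> (\<forall>x\<in>elts w1. app f x \<in> elts (vpow w2) \<and> (?R) x (app f x))"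
    by (rule bounded_choice_ex)
  then obtain C where C: "\<And>\<xi>. \<xi> \<in> elts w1 \<Longrightarrow> ?R \<xi> (app C \<xi>)"
    by blast
  have "T (\<lambda>e. app C (e 0))" by (intro D_intros)
  then obtain \<beta> where \<beta>: "S21 \<beta>" "\<alpha> \<in> elts \<beta>" "\<And>\<xi>. \<xi> \<in> elts w1 \<Longrightarrow> \<beta> \<in> elts (app C \<xi>)"
    using club_intersection_meets_S21[of "app C" \<alpha>] C \<alpha> by blast
  have "\<beta> \<in> elts w2" using \<beta>(1) unfolding S21_def by blast
  then have "app (app s \<beta>) \<alpha> \<in> elts w1" using s \<beta>(2) by blast
  moreover have "\<beta> \<in> elts (ulam s \<alpha> (app (app s \<beta>) \<alpha>))"
    unfolding elts_ulam using \<beta> \<open>\<beta> \<in> elts w2\<close> by blast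
  ultimately show False using C \<beta>(3) by blast
qed

section \<open>One column of the matrix for all functions\<close>

lemma lepoll_vpow: "lepoll a b \<Longrightarrow> lepoll (vpow a) (vpow b)"
proof -
  assume "lepoll a b"
  then obtain f where f: "inj_on (app f) (elts a)" "app f ` elts a \<subseteq> elts b" unfolding lepoll_def by blast
  let ?F = "\<lambda>y. mk (app f ` elts y)"
  have F: "elts (?F y) = app f ` elts y" for y by (intro elts_mk isset_image D_intros) auto
  show ?thesis
  proof (rule lepollI[of ?F])
    show "T (\<lambda>e. ?F (e 0))" by (intro D_intros)
    show "inj_on ?F (elts (vpow a))"
    proof (rule inj_onI)
      fix y z assume yz: "y \<in> elts (vpow a)" "z \<in> elts (vpow a)" "?F y = ?F z"
      then have "app f ` elts y = app f ` elts z" using F by metis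
      then have "elts y = elts z" using inj_on_image_eq_iff[OF f(1)] yz(1,2) by simp
      then show "y = z" by (rule eltsI)
    qed
    show "?F ` elts (vpow a) \<subseteq> elts (vpow b)"
    proof (rule image_subsetI)
      fix y assume "y \<in> elts (vpow a)"
      then have "app f ` elts y \<subseteq> elts b" using f(2) by auto
      then show "?F y \<in> elts (vpow b)" using F by simp
    qed
  qed
qed

lemma lepoll_times: "lepoll a a' \<Longrightarrow> lepoll b b' \<Longrightarrow> lepoll (times a b) (times a' b')"
proof -
  assume "lepoll a a'" "lepoll b b'"
  then obtain f g where f: "inj_on (app f) (elts a)" "app f ` elts a \<subseteq> elts a'"
    and g: "inj_on (app g) (elts b)" "app g ` elts b \<subseteq> elts b'"
    unfolding lepoll_def by blast
  show ?thesis
  proof (rule lepollI[of "\<lambda>p. pair (app f (vfst p)) (app g (vsnd p))"])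
    show "T (\<lambda>e. pair (app f (vfst (e 0))) (app g (vsnd (e 0))))" by (intro D_intros)
    show "inj_on (\<lambda>p. pair (app f (vfst p)) (app g (vsnd p))) (elts (times a b))"
    proof (rule inj_onI)
      fix p p' assume "p \<in> elts (times a b)" "p' \<in> elts (times a b)"
        "pair (app f (vfst p)) (app g (vsnd p)) = pair (app f (vfst p')) (app g (vsnd p'))"
      moreover from this obtain x y x' y' where "p = pair x y" "p' = pair x' y'" by blast
      ultimately show "p = p'" using inj_onD[OF f(1), of x x'] inj_onD[OF g(1), of y y'] by simp
    qed
    show "(\<lambda>p. pair (app f (vfst p)) (app g (vsnd p))) ` elts (times a b) \<subseteq> elts (times a' b')"
      using f(2) g(2) by (auto simp: image_subset_iff)
  qed
qed

text \<open>\<open>gn \<alpha> \<xi>\<close> is the \<open>\<xi>\<close>-th function of the \<open>\<alpha>\<close>-th sequence, in an enumeration of all \<open>\<omega>\<^sub>1\<close>-sequences of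
  functions. The diagonal argument avoids a pigeonhole principle: it finds one column \<open>\<xi>\<close> of the Ulam
  matrix that works for all functions.\<close>

lemma guessing_column:
  assumes gch: "gch w1"
    and s: "\<And>\<beta>. \<beta> \<in> elts w2 \<Longrightarrow> app (app s \<beta>) ` elts \<beta> \<subseteq> elts w1"
  shows "\<exists>gn. \<exists>\<xi>\<in>elts w1. T (\<lambda>e. gn (e 0)) \<and>
    (\<forall>g. elts g \<subseteq> elts (times w1 w1) \<longrightarrow> (\<exists>\<alpha>\<in>elts w2. gn \<alpha> = g \<and> stationary (ulam s \<alpha> \<xi>)))"
proof -
  let ?t = "times w1 (times w1 w1)"
  have w11: "lepoll (times w1 w1) w1" using idem_w1 unfolding idem_def by blast
  have "lepoll ?t w1" using lepoll_trans[OF lepoll_times[OF lepoll_refl w11] w11] .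
  then have "lepoll (vpow ?t) w2"
    using lepoll_trans[OF lepoll_vpow] gch unfolding gch_def w2_def by blast
  then obtain enc where enc: "inj_on (app enc) (elts (vpow ?t))" "app enc ` elts (vpow ?t) \<subseteq> elts w2"
    unfolding lepoll_def by blast
  \<comment> \<open>The section at \<xi> of the subset of \<open>?t\<close> that \<alpha> codes, and
    the empty set if \<alpha> codes nothing.\<close>
  define gm where "gm \<xi> \<alpha> = mk {p \<in> elts (times w1 w1). \<exists>z\<in>elts (vpow ?t). app enc z = \<alpha> \<and> pair \<xi> p \<in> elts z}" for \<xi> \<alpha>
  have Tgm: "T (\<lambda>e. gm (e 0) (e 1))" unfolding gm_def by (intro D_intros)
  have gm: "elts (gm \<xi> \<alpha>) = {p \<in> elts (times w1 w1). \<exists>z\<in>elts (vpow ?t). app enc z = \<alpha> \<and> pair \<xi> p \<in> elts z}" for \<xi> \<alpha>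
    unfolding gm_def by (intro elts_mk isset_sub[OF isset_elts[of "times w1 w1"]] D_intros) blast
  have "\<exists>\<xi>\<in>elts w1. \<forall>g\<in>elts (vpow (times w1 w1)). \<exists>\<alpha>\<in>elts w2. gm \<xi> \<alpha> = g \<and> stationary (ulam s \<alpha> \<xi>)"
  proof (rule ccontr)
    assume *: "\<not> ?thesis"
    let ?R = "\<lambda>\<xi> g. \<forall>\<alpha>\<in>elts w2. gm \<xi> \<alpha> = g \<longrightarrow> \<not> stationary (ulam s \<alpha> \<xi>)"
    have "D (\<lambda>e. ?R (e 0) (e 1))" by (intro D_intros T_subst2[OF Tgm])
    moreover have "\<exists>g\<in>elts (vpow (times w1 w1)). ?R \<xi> g" if "\<xi> \<in> elts w1" for \<xi> using * that by blast
    ultimately have "\<exists>f. isfun f w1 \<and> (\<forall>x\<in>elts w1. app f x \<in> elts (vpow (times w1 w1)) \<and> (?R) x (app f x))"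
      by (rule bounded_choice_ex)
    then obtain f where f: "\<And>\<xi>. \<xi> \<in> elts w1 \<Longrightarrow> app f \<xi> \<in> elts (vpow (times w1 w1))"
        "\<And>\<xi>. \<xi> \<in> elts w1 \<Longrightarrow> ?R \<xi> (app f \<xi>)"
      by blast
    \<comment> \<open>The counterexamples of all columns, combined into one sequence. Its code
      \<alpha> makes \<open>gm \<xi> \<alpha>\<close> the counterexample for each \<xi> at once,
      whereas some column is stationary at \<alpha>.\<close>
    let ?Z = "{z \<in> elts ?t. \<exists>\<xi> p. z = pair \<xi> p \<and> p \<in> elts (app f \<xi>)}"
    have Z: "elts (mk ?Z) = ?Z" by (intro elts_mk isset_sub[OF isset_elts[of ?t]] D_intros) blast
    then have Zt: "mk ?Z \<in> elts (vpow ?t)" by auto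
    let ?\<alpha> = "app enc (mk ?Z)"
    have \<alpha>: "?\<alpha> \<in> elts w2" using enc(2) Zt by blast
    have "gm \<xi> ?\<alpha> = app f \<xi>" if \<xi>: "\<xi> \<in> elts w1" for \<xi>
    proof (rule eltsI, intro equalityI subsetI)
      fix p assume "p \<in> elts (gm \<xi> ?\<alpha>)"
      then obtain z where z: "z \<in> elts (vpow ?t)" "app enc z = ?\<alpha>" "pair \<xi> p \<in> elts z" unfolding gm by blast
      then have "z = mk ?Z" using inj_onD[OF enc(1)] Zt by blast
      then have "pair \<xi> p \<in> ?Z" using z(3) Z by blast
      then show "p \<in> elts (app f \<xi>)" by auto
    next
      fix p assume p: "p \<in> elts (app f \<xi>)"
      then have pw: "p \<in> elts (times w1 w1)" using f(1)[OF \<xi>] by auto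
      then have "pair \<xi> p \<in> ?Z" using p \<xi> by simp
      then have "pair \<xi> p \<in> elts (mk ?Z)" unfolding Z .
      then show "p \<in> elts (gm \<xi> ?\<alpha>)" unfolding gm using pw Zt by blast
    qed
    moreover obtain \<xi> where "\<xi> \<in> elts w1" "stationary (ulam s ?\<alpha> \<xi>)" using ulam_stationary[OF s \<alpha>] by blast
    ultimately show False using f(2) \<alpha> by blast
  qed
  then obtain \<xi> where \<xi>: "\<xi> \<in> elts w1"
    "\<And>g. g \<in> elts (vpow (times w1 w1)) \<Longrightarrow> \<exists>\<alpha>\<in>elts w2. gm \<xi> \<alpha> = g \<and> stationary (ulam s \<alpha> \<xi>)" by blast
  have "T (\<lambda>e. gm \<xi> (e 0))" by (intro T_subst2[OF Tgm] D_intros)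
  moreover have "\<exists>\<alpha>\<in>elts w2. gm \<xi> \<alpha> = g \<and> stationary (ulam s \<alpha> \<xi>)" if "elts g \<subseteq> elts (times w1 w1)" for g
    using \<xi>(2)[of g] that by simp
  ultimately show ?thesis using \<xi>(1) by (intro exI[of _ "gm \<xi>"] bexI[of _ \<xi>]) blast+
qed

text \<open>The stationary set for \<open>g\<close> is the entry of the Ulam matrix in column \<xi>
  at an index \<alpha> of \<open>g\<close>. Since each \<open>app s \<beta>\<close> is injective,
  \<beta> lies in at most one entry of the column, so \<pi>_\<beta> has to serve a single function;
  where there is nothing to serve, any bijection is taken.\<close>

theorem principle_B:
  assumes gch: "gch w1"
  obtains \<pi> where "isfun \<pi> (mk (elts w2 - elts w1))"
    "\<And>b. b \<in> elts w2 - elts w1 \<Longrightarrow> isfun (app \<pi> b) b \<and> bij_betw (app (app \<pi> b)) (elts b) (elts w1)"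
    "\<And>g. isfun g w1 \<Longrightarrow> app g ` elts w1 \<subseteq> elts w1 \<Longrightarrow> \<exists>I. stationary I \<and> (\<forall>b\<in>elts I. S21 b \<and> good g b (app \<pi> b))"
proof -
  let ?Rs = "\<lambda>\<beta> h. inj_on (app h) (elts \<beta>) \<and> app h ` elts \<beta> \<subseteq> elts w1"
  have "D (\<lambda>e. ?Rs (e 0) (e 1))" by (intro D_intros)
  moreover have "\<exists>h\<in>elts (vpow (times w2 w1)). ?Rs \<beta> h" if \<beta>: "\<beta> \<in> elts w2" for \<beta>
  proof -
    obtain h where h: "isfun h \<beta>" "?Rs \<beta> h" using lepollE[OF w2_lepoll[OF \<beta>]] by blast
    then have "elts h \<subseteq> elts (times w2 w1)"
      by (intro isfun_subset_times[OF h(1) Ord_trans[OF Ord_w2 \<beta>]]) blast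
    then show ?thesis using h(2) by auto
  qed
  ultimately have "\<exists>f. isfun f w2 \<and> (\<forall>x\<in>elts w2. app f x \<in> elts (vpow (times w2 w1)) \<and> ?Rs x (app f x))"
    by (rule bounded_choice_ex)
  then obtain s where s: "\<And>\<beta>. \<beta> \<in> elts w2 \<Longrightarrow> ?Rs \<beta> (app s \<beta>)"
    by blast
  obtain gn \<xi> where gn: "T (\<lambda>e. gn (e 0))" "\<xi> \<in> elts w1"
    "\<And>g. elts g \<subseteq> elts (times w1 w1) \<Longrightarrow> \<exists>\<alpha>\<in>elts w2. gn \<alpha> = g \<and> stationary (ulam s \<alpha> \<xi>)"
    using guessing_column[OF gch, of s] s by metis
  note [D_intros] = T_subst1[OF gn(1)]
  let ?X = "mk (elts w2 - elts w1)"
  have X: "elts ?X = elts w2 - elts w1" by (intro elts_mk isset_sub[OF isset_elts[of w2]] D_intros) blast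
  let ?R = "\<lambda>\<beta> q. isfun q \<beta> \<and> bij_betw (app q) (elts \<beta>) (elts w1) \<and>
    (\<forall>\<alpha>\<in>elts \<beta>. S21 \<beta> \<and> app (app s \<beta>) \<alpha> = \<xi> \<and> app (gn \<alpha>) ` elts w1 \<subseteq> elts w1 \<longrightarrow> good (gn \<alpha>) \<beta> q)"
  have "D (\<lambda>e. ?R (e 0) (e 1))" by (intro D_intros)
  moreover have "\<exists>q\<in>elts (vpow (times w2 w1)). ?R \<beta> q" if "\<beta> \<in> elts ?X" for \<beta>
  proof -
    have \<beta>: "\<beta> \<in> elts w2" "\<beta> \<notin> elts w1" using that X by blast+
    have "\<exists>q. ?R \<beta> q"
    proof (cases "\<exists>\<alpha>\<in>elts \<beta>. S21 \<beta> \<and> app (app s \<beta>) \<alpha> = \<xi> \<and> app (gn \<alpha>) ` elts w1 \<subseteq> elts w1")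
      case True
      then obtain \<alpha> where \<alpha>: "\<alpha> \<in> elts \<beta>" "S21 \<beta>" "app (app s \<beta>) \<alpha> = \<xi>" "app (gn \<alpha>) ` elts w1 \<subseteq> elts w1" by blast
      obtain q where q: "isfun q \<beta>" "bij_betw (app q) (elts \<beta>) (elts w1)" "good (gn \<alpha>) \<beta> q"
        using good_bijection[OF \<alpha>(2,4)] by blast
      have "\<alpha>' = \<alpha>" if "\<alpha>' \<in> elts \<beta>" "app (app s \<beta>) \<alpha>' = \<xi>" for \<alpha>'
        using s[OF \<beta>(1)] that \<alpha>(1,3) by (blast dest: inj_onD)
      then have "?R \<beta> q" using q by blast
      then show ?thesis by blast
    next
      case False
      have "elts w1 \<subseteq> elts \<beta>" using Ord_not_mem[OF Ord_mem[OF Ord_w2 \<beta>(1)] Ord_w1] \<beta>(2) by blast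
      then have "eqpoll \<beta> w1" by (intro Schroeder_Bernstein w2_lepoll[OF \<beta>(1)] subset_lepoll)
      then obtain f where f: "bij_betw (app f) (elts \<beta>) (elts w1)" unfolding eqpoll_def by blast
      have Tf: "T (\<lambda>e. app f (e 0))" by (intro D_intros)
      have "bij_betw (app (lam \<beta> (app f))) (elts \<beta>) (elts w1)"
        using f app_lam[OF Tf] by (simp cong: bij_betw_cong)
      moreover have "isfun (lam \<beta> (app f)) \<beta>" by (rule isfun_lam[OF Tf])
      ultimately show ?thesis using False by blast
    qed
    then obtain q where q: "?R \<beta> q" by blast
    have "elts q \<subseteq> elts (times w2 w1)"
      by (rule isfun_subset_times[OF conjunct1[OF q] Ord_trans[OF Ord_w2 \<beta>(1)]])
        (use q in \<open>simp add: bij_betw_def\<close>)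
    then show ?thesis using q by auto
  qed
  ultimately have "\<exists>f. isfun f (?X) \<and> (\<forall>x\<in>elts (?X). app f x \<in> elts (vpow (times w2 w1)) \<and> (?R) x (app f x))"
    by (rule bounded_choice_ex)
  then obtain \<pi> where \<pi>: "isfun \<pi> ?X" "\<And>\<beta>. \<beta> \<in> elts ?X \<Longrightarrow> ?R \<beta> (app \<pi> \<beta>)"
    by blast
  show ?thesis
  proof (rule that[OF \<pi>(1)])
    show "isfun (app \<pi> b) b \<and> bij_betw (app (app \<pi> b)) (elts b) (elts w1)" if "b \<in> elts w2 - elts w1" for b
      using \<pi>(2)[of b] that X by blast
    fix g assume g: "isfun g w1" "app g ` elts w1 \<subseteq> elts w1"
    have "elts g \<subseteq> elts (times w1 w1)" by (rule isfun_subset_times[OF g(1) order_refl g(2)])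
    then obtain \<alpha> where \<alpha>: "\<alpha> \<in> elts w2" "gn \<alpha> = g" "stationary (ulam s \<alpha> \<xi>)" using gn(3) by blast
    have "S21 b \<and> good g b (app \<pi> b)" if "b \<in> elts (ulam s \<alpha> \<xi>)" for b
    proof -
      have b: "b \<in> elts w2" "S21 b" "\<alpha> \<in> elts b" "app (app s b) \<alpha> = \<xi>" using that unfolding elts_ulam by blast+
      then have "b \<in> elts ?X" using X S21_not_w1 by blast
      then show ?thesis using \<pi>(2) b g(2) \<alpha>(2) by blast
    qed
    then show "\<exists>I. stationary I \<and> (\<forall>b\<in>elts I. S21 b \<and> good g b (app \<pi> b))" using \<alpha>(3) by blast
  qed
qed

end

section \<open>The meaning of the formulas\<close>

text \<open>Levels below \<open>n\<close> are interpreted by \<open>\<rho>\<close>, and the indices that point outside of the \<open>n\<close> binders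
  by \<open>u\<close>.\<close>

definition lenv :: "nat \<Rightarrow> (nat \<Rightarrow> 'a) \<Rightarrow> (nat \<Rightarrow> 'a) \<Rightarrow> nat \<Rightarrow> 'a" where
  "lenv n \<rho> u i = (if i < n then \<rho> (n - Suc i) else u (i - n))"

definition csat :: "('a \<Rightarrow> 'a \<Rightarrow> bool) \<Rightarrow> ('a \<Rightarrow> 'a \<Rightarrow> bool) \<Rightarrow> (nat \<Rightarrow> 'a) \<Rightarrow> cfm \<Rightarrow> nat \<Rightarrow> (nat \<Rightarrow> 'a) \<Rightarrow> bool" where
  "csat E Q u p n \<rho> \<longleftrightarrow> sat E Q (p n) (lenv n \<rho> u)"

lemma lenv_level: "x < n \<Longrightarrow> lenv n \<rho> u (n - Suc x) = \<rho> x"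
  by (simp add: lenv_def Suc_diff_Suc)

lemma lenv_Suc: "case_nat a (lenv n \<rho> u) = lenv (Suc n) (\<rho>(n := a)) u"
  by (auto simp: lenv_def fun_eq_iff split: nat.split)

lemma sat_sentence: "sat E Q (sentence p) u \<longleftrightarrow> csat E Q u p 0 \<rho>"
proof -
  have "lenv 0 \<rho> u = u" by (simp add: lenv_def fun_eq_iff)
  then show ?thesis by (simp add: sentence_def csat_def)
qed

lemma csat_Mem: "x < n \<Longrightarrow> y < n \<Longrightarrow> csat E Q u (x \<^bold>\<in> y) n \<rho> \<longleftrightarrow> E (\<rho> x) (\<rho> y)"
  by (simp add: csat_def cMem_def lenv_level)

lemma csat_Eq: "x < n \<Longrightarrow> y < n \<Longrightarrow> csat E Q u (x \<^bold>= y) n \<rho> \<longleftrightarrow> Q (\<rho> x) (\<rho> y)"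
  by (simp add: csat_def cEq_def lenv_level)

lemma csat_Imp: "csat E Q u (p \<^bold>\<longrightarrow> q) n \<rho> \<longleftrightarrow> (csat E Q u p n \<rho> \<longrightarrow> csat E Q u q n \<rho>)"
  by (simp add: csat_def cImp_def)

lemma csat_Not: "csat E Q u (\<^bold>\<not> p) n \<rho> \<longleftrightarrow> \<not> csat E Q u p n \<rho>"
  by (simp add: csat_def cNot_def cImp_def)

lemma csat_And: "csat E Q u (p \<^bold>\<and> q) n \<rho> \<longleftrightarrow> csat E Q u p n \<rho> \<and> csat E Q u q n \<rho>"
  by (simp add: cAnd_def csat_Not csat_Imp)

lemma csat_Or: "csat E Q u (p \<^bold>\<or> q) n \<rho> \<longleftrightarrow> csat E Q u p n \<rho> \<or> csat E Q u q n \<rho>"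
  by (auto simp: cOr_def csat_Not csat_Imp)

lemma csat_Iff: "csat E Q u (p \<^bold>\<longleftrightarrow> q) n \<rho> \<longleftrightarrow> (csat E Q u p n \<rho> \<longleftrightarrow> csat E Q u q n \<rho>)"
  by (auto simp: cIff_def csat_And csat_Imp)

lemma csat_All: "csat E Q u (cAll p) n \<rho> \<longleftrightarrow> (\<forall>a. csat E Q u (p n) (Suc n) (\<rho>(n := a)))"
  by (simp add: csat_def cAll_def lenv_Suc)

lemma csat_Ex: "csat E Q u (cEx p) n \<rho> \<longleftrightarrow> (\<exists>a. csat E Q u (p n) (Suc n) (\<rho>(n := a)))"
  by (simp add: cEx_def csat_All csat_Not)

lemma csat_Ball: "x < n \<Longrightarrow>
    csat E Q u (cBall x p) n \<rho> \<longleftrightarrow> (\<forall>a. E a (\<rho> x) \<longrightarrow> csat E Q u (p n) (Suc n) (\<rho>(n := a)))"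
  by (simp add: cBall_def csat_All csat_Imp csat_Mem)

lemma csat_Bex: "x < n \<Longrightarrow>
    csat E Q u (cBex x p) n \<rho> \<longleftrightarrow> (\<exists>a. E a (\<rho> x) \<and> csat E Q u (p n) (Suc n) (\<rho>(n := a)))"
  by (simp add: cBex_def csat_Ex csat_And csat_Mem)

lemmas csat_simps = csat_Mem csat_Eq csat_Imp csat_Not csat_And csat_Or csat_Iff csat_All csat_Ex
  csat_Ball csat_Bex

text \<open>A block of \<open>k\<close> quantifiers is a single quantifier over assignments
  \<sigma>, of which only the levels from \<open>n\<close> to \<open>n + k - 1\<close> are
  read.\<close>

lemma sat_params:
  "sat E Q ((Univ ^^ k) p) (lenv n \<rho> u) \<longleftrightarrow> (\<forall>\<sigma>. sat E Q p (lenv (n + k) (\<lambda>i. if i < n then \<rho> i else \<sigma> i) u))"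
proof (induction k arbitrary: n \<rho>)
  case 0
  have "lenv n (\<lambda>i. if i < n then \<rho> i else \<sigma> i) u = lenv n \<rho> u" for \<sigma>
    by (auto simp: lenv_def fun_eq_iff)
  then show ?case by simp
next
  case (Suc k)
  have *: "(\<lambda>i. if i < Suc n then (\<rho>(n := a)) i else \<sigma> i) = (\<lambda>i. if i < n then \<rho> i else (\<sigma>(n := a)) i)" for a \<sigma>
    by (auto simp: fun_eq_iff)
  have "(\<forall>a \<sigma>. R (\<sigma>(n := a))) \<longleftrightarrow> (\<forall>\<sigma>. R \<sigma>)" for R :: "(nat \<Rightarrow> 'a) \<Rightarrow> bool"
    by (metis fun_upd_triv)
  from this[of "\<lambda>\<sigma>. sat E Q p (lenv (Suc (n + k)) (\<lambda>i. if i < n then \<rho> i else \<sigma> i) u)"]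
  show ?case by (simp only: funpow.simps comp_apply sat.simps lenv_Suc Suc * add_Suc add_Suc_right)
qed

lemma csat_params: "csat E Q u (params k p) 0 \<rho> \<longleftrightarrow> (\<forall>\<sigma>. csat E Q u p k \<sigma>)"
  using sat_params[of E Q k "p k" 0 \<rho> u] by (simp add: csat_def params_def)

lemma sat_below: "below m p \<Longrightarrow> (\<And>i. i < m \<Longrightarrow> e i = e' i) \<Longrightarrow> sat E Q p e \<longleftrightarrow> sat E Q p e'"
proof (induction p arbitrary: m e e')
  case (Univ p)
  have "sat E Q p (case_nat x e) \<longleftrightarrow> sat E Q p (case_nat x e')" for x
    using Univ.prems by (intro Univ.IH[of "Suc m"]) (auto split: nat.split)
  then show ?case by simp
next
  case (Imp p q)
  have "sat E Q p e \<longleftrightarrow> sat E Q p e'" "sat E Q q e \<longleftrightarrow> sat E Q q e'"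
    using Imp.prems by (auto intro!: Imp.IH[of m])
  then show ?case by simp
qed auto

lemma below_mono: "below m p \<Longrightarrow> m \<le> n \<Longrightarrow> below n p"
  by (induction p arbitrary: m n) fastforce+

lemma below_exists: "\<exists>m. below m p"
proof (induction p)
  case (Mem i j)
  show ?case by (intro exI[of _ "Suc (i + j)"]) simp
next
  case (Eq i j)
  show ?case by (intro exI[of _ "Suc (i + j)"]) simp
next
  case (Imp p q)
  then obtain m n where "below m p" "below n q" by blast
  then have "below (max m n) (Imp p q)" using below_mono by (metis below.simps(4) max.cobounded1 max.cobounded2)
  then show ?case by blast
next
  case (Univ p)
  then obtain m where "below m p" by blast
  then have "below m (Univ p)" using below_mono[of m p "Suc m"] by simp
  then show ?case by blast
qed simp

lemma below_ren: "below m p \<Longrightarrow> (\<And>i. i < m \<Longrightarrow> r i < n) \<Longrightarrow> below n (ren r p)"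
proof (induction p arbitrary: m n r)
  case (Univ p)
  have "below (Suc n) (ren (case_nat 0 (\<lambda>i. Suc (r i))) p)"
    by (rule Univ.IH[of "Suc m"]) (use Univ.prems in \<open>auto split: nat.split\<close>)
  then show ?case by simp
next
  case (Imp p q)
  have "below n (ren r p)" "below n (ren r q)"
    using Imp.prems by (auto intro!: Imp.IH[of m])
  then show ?case by simp
qed auto

text \<open>The bound on the indices of \<open>p\<close> hides everything past the \<open>k\<close>
  parameters, so \<sigma> may be arbitrary there.\<close>

lemma csat_fm_at1:
  assumes "below (k + 1) p" "w < n" "k \<le> n" "\<And>i. i < k \<Longrightarrow> \<rho> i = \<sigma> i"
  shows "csat E Q u (fm_at p (case_nat w (\<lambda>i. i))) n \<rho> \<longleftrightarrow> sat E Q p (case_nat (\<rho> w) \<sigma>)"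
  unfolding csat_def fm_at_def sat_ren
  by (rule sat_below[OF assms(1)]) (use assms(2-4) in \<open>auto simp: lenv_level split: nat.split\<close>)

lemma csat_fm_at2:
  assumes "below (k + 2) p" "v < n" "w < n" "k \<le> n" "\<And>i. i < k \<Longrightarrow> \<rho> i = \<sigma> i"
  shows "csat E Q u (fm_at p (case_nat v (case_nat w (\<lambda>i. i)))) n \<rho> \<longleftrightarrow>
    sat E Q p (case_nat (\<rho> v) (case_nat (\<rho> w) \<sigma>))"
  unfolding csat_def fm_at_def sat_ren
  by (rule sat_below[OF assms(1)]) (use assms(2-5) in \<open>auto simp: lenv_level split: nat.split\<close>)

section \<open>The axioms as statements about a structure\<close>

lemma sat_separation:
  assumes "below (k + 1) p"
  shows "sat E Q (separation k p) u \<longleftrightarrow>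
    (\<forall>\<sigma> x. \<exists>y. \<forall>v. E v y \<longleftrightarrow> E v x \<and> sat E Q p (case_nat v \<sigma>))"
proof -
  have "csat E Q u (fm_at p (case_nat (Suc (Suc k)) (\<lambda>i. i))) (Suc (Suc (Suc k))) (\<sigma>(k := x, Suc k := y, Suc (Suc k) := v))
      \<longleftrightarrow> sat E Q p (case_nat v \<sigma>)" for \<sigma> x y v
    using csat_fm_at1[OF assms, of "Suc (Suc k)" "Suc (Suc (Suc k))" "\<sigma>(k := x, Suc k := y, Suc (Suc k) := v)" \<sigma>] by simp
  then show ?thesis
    unfolding separation_def sat_sentence[where \<rho> = u] csat_params
    by (intro arg_cong[of _ _ All] HOL.ext) (simp add: csat_simps)
qed

lemma sat_replacement:
  assumes "below (k + 2) p"
  shows "sat E Q (replacement k p) u \<longleftrightarrow> (\<forall>\<sigma>.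
    (\<forall>a b c. sat E Q p (case_nat a (case_nat b \<sigma>)) \<and> sat E Q p (case_nat a (case_nat c \<sigma>)) \<longrightarrow> Q b c) \<longrightarrow>
    (\<forall>x. \<exists>y. \<forall>b. E b y \<longleftrightarrow> (\<exists>a. E a x \<and> sat E Q p (case_nat a (case_nat b \<sigma>)))))"
proof -
  note fm = csat_fm_at2[OF assms]
  have 1: "csat E Q u (fm_at p (case_nat k (case_nat (Suc k) (\<lambda>i. i)))) (Suc (Suc (Suc k))) (\<sigma>(k := a, Suc k := b, Suc (Suc k) := c))
      \<longleftrightarrow> sat E Q p (case_nat a (case_nat b \<sigma>))" for \<sigma> a b c
    using fm[of k "Suc (Suc (Suc k))" "Suc k" "\<sigma>(k := a, Suc k := b, Suc (Suc k) := c)" \<sigma>] by simp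
  have 2: "csat E Q u (fm_at p (case_nat k (case_nat (Suc (Suc k)) (\<lambda>i. i)))) (Suc (Suc (Suc k))) (\<sigma>(k := a, Suc k := b, Suc (Suc k) := c))
      \<longleftrightarrow> sat E Q p (case_nat a (case_nat c \<sigma>))" for \<sigma> a b c
    using fm[of k "Suc (Suc (Suc k))" "Suc (Suc k)" "\<sigma>(k := a, Suc k := b, Suc (Suc k) := c)" \<sigma>] by simp
  have 3: "csat E Q u (fm_at p (case_nat (Suc (Suc (Suc k))) (case_nat (Suc (Suc k)) (\<lambda>i. i)))) (Suc (Suc (Suc (Suc k))))
      (\<sigma>(k := x, Suc k := y, Suc (Suc k) := b, Suc (Suc (Suc k)) := a)) \<longleftrightarrow> sat E Q p (case_nat a (case_nat b \<sigma>))" for \<sigma> x y a b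
    using fm[of "Suc (Suc (Suc k))" "Suc (Suc (Suc (Suc k)))" "Suc (Suc k)"
        "\<sigma>(k := x, Suc k := y, Suc (Suc k) := b, Suc (Suc (Suc k)) := a)" \<sigma>] by simp
  show ?thesis
    unfolding replacement_def sat_sentence[where \<rho> = u] csat_params Let_def
    by (intro arg_cong[of _ _ All] HOL.ext) (simp add: csat_simps 1 2 3)
qed

lemma sat_extensionality: "sat E Q extensionality u \<longleftrightarrow> (\<forall>x y. (\<forall>z. E z x \<longleftrightarrow> E z y) \<longrightarrow> Q x y)"
  unfolding extensionality_def sat_sentence[where \<rho> = u] by (simp add: csat_simps)

lemma sat_foundation: "sat E Q foundation u \<longleftrightarrow>
    (\<forall>x. (\<exists>z. E z x) \<longrightarrow> (\<exists>y. E y x \<and> (\<forall>z. E z x \<longrightarrow> \<not> E z y)))"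
  unfolding foundation_def sat_sentence[where \<rho> = u] is_empty_def by (simp add: csat_simps)

lemma sat_pairing: "sat E Q pairing u \<longleftrightarrow> (\<forall>x y. \<exists>p. \<forall>z. E z p \<longleftrightarrow> Q z x \<or> Q z y)"
  unfolding pairing_def sat_sentence[where \<rho> = u] is_upair_def by (simp add: csat_simps)

lemma sat_union: "sat E Q union u \<longleftrightarrow> (\<forall>x. \<exists>y. \<forall>v. E v y \<longleftrightarrow> (\<exists>z. E z x \<and> E v z))"
  unfolding union_def sat_sentence[where \<rho> = u] by (simp add: csat_simps)

lemma sat_power_set: "sat E Q power_set u \<longleftrightarrow> (\<forall>x. \<exists>y. \<forall>v. E v y \<longleftrightarrow> (\<forall>z. E z v \<longrightarrow> E z x))"
  unfolding power_set_def sat_sentence[where \<rho> = u] is_power_def subset_def by (simp add: csat_simps)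

lemma sat_infinity: "sat E Q infinity u \<longleftrightarrow> (\<exists>s. (\<exists>x. E x s \<and> (\<forall>z. \<not> E z x)) \<and>
    (\<forall>x. E x s \<longrightarrow> (\<exists>y. E y s \<and> (\<forall>z. E z y \<longleftrightarrow> E z x \<or> Q z x))))"
  unfolding infinity_def sat_sentence[where \<rho> = u] is_empty_def is_succ_def by (simp add: csat_simps)

text \<open>A structure with finitely many elements up to \<open>Q\<close> would have a universal set.\<close>

lemma ZFC_infinite:
  assumes Q: "equivp Q" and cong: "\<And>x x' y y'. Q x x' \<Longrightarrow> Q y y' \<Longrightarrow> E x y \<Longrightarrow> E x' y'"
    and sat: "\<And>p. p \<in> ZFC \<Longrightarrow> sat E Q p e" and F: "finite F"
  shows "\<exists>x. \<forall>y\<in>F. \<not> Q x y"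
proof (rule ccontr)
  assume "\<not> ?thesis"
  then have rep: "\<exists>y\<in>F. Q x y" for x by blast
  have refl: "Q x x" and sym: "Q x y \<Longrightarrow> Q y x" for x y using Q by (auto dest: equivp_reflp equivp_symp)
  have "pairing \<in> ZFC" "union \<in> ZFC" by (simp_all add: ZFC_def)
  note ax = this[THEN sat, unfolded sat_pairing sat_union]
  have pairing: "\<exists>p. \<forall>z. E z p \<longleftrightarrow> Q z x \<or> Q z y" for x y using ax(1) by blast
  have union: "\<exists>y. \<forall>v. E v y \<longleftrightarrow> (\<exists>z. E z x \<and> E v z)" for x using ax(2) by blast
  \<comment> \<open>Russell's predicate: separation for it excludes a universal set.\<close>
  let ?p = "Imp (Mem 0 0) Falsum"
  have b: "below (0 + 1) ?p" by simp
  then have "separation 0 ?p \<in> ZFC" unfolding ZFC_def by blast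
  from sat[OF this] have russell: "\<exists>y. \<forall>v. E v y \<longleftrightarrow> E v x \<and> \<not> E v v" for x
    unfolding sat_separation[OF b] by simp
  have "\<exists>z. \<forall>s\<in>S. E s z" if "finite S" for S
    using that
  proof (induction S rule: finite_induct)
    case (insert a S)
    then obtain z where z: "\<forall>s\<in>S. E s z" by blast
    obtain a' where a': "\<forall>x. E x a' \<longleftrightarrow> Q x a \<or> Q x a" using pairing by blast
    obtain p where p: "\<forall>x. E x p \<longleftrightarrow> Q x a' \<or> Q x z" using pairing by blast
    obtain y where y: "\<forall>v. E v y \<longleftrightarrow> (\<exists>x. E x p \<and> E v x)" using union by blast
    have "\<forall>s\<in>insert a S. E s y" using z a' p y refl by blast
    then show ?case by blast
  qed simp
  then obtain z where "\<forall>s\<in>F. E s z" using F by blast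
  then have "E x z" for x using rep cong refl sym by metis
  moreover obtain y where "\<forall>v. E v y \<longleftrightarrow> E v z \<and> \<not> E v v" using russell by blast
  ultimately show False by blast
qed

section \<open>Basic notions evaluated in a model\<close>

context zf
begin

abbreviation S where "S \<equiv> csat E (=)"

text \<open>Lets the simplifier see that an assignment updated at the fresh level \<open>n\<close>
  is unchanged at older levels.\<close>

lemma level_neq: "x < n \<Longrightarrow> x \<noteq> n" "x < n \<Longrightarrow> n \<noteq> x" for x n :: nat
  by simp_all

lemma S_Mem: "x < n \<Longrightarrow> y < n \<Longrightarrow> S u (x \<^bold>\<in> y) n \<rho> \<longleftrightarrow> \<rho> x \<in> elts (\<rho> y)"
  by (simp add: csat_Mem elts_def)

lemma S_Ball: "x < n \<Longrightarrow> S u (cBall x p) n \<rho> \<longleftrightarrow> (\<forall>a\<in>elts (\<rho> x). S u (p n) (Suc n) (\<rho>(n := a)))"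
  by (simp add: csat_Ball elts_def)

lemma S_Bex: "x < n \<Longrightarrow> S u (cBex x p) n \<rho> \<longleftrightarrow> (\<exists>a\<in>elts (\<rho> x). S u (p n) (Suc n) (\<rho>(n := a)))"
  by (auto simp: csat_Bex elts_def)

lemmas S0 = S_Mem csat_Eq csat_Imp csat_Not csat_And csat_Or csat_Iff csat_All csat_Ex S_Ball S_Bex
  level_neq less_SucI

lemma S_is_empty: "x < n \<Longrightarrow> S u (is_empty x) n \<rho> \<longleftrightarrow> \<rho> x = vempty"
  unfolding is_empty_def by (simp add: S0)

lemma S_subset: "x < n \<Longrightarrow> y < n \<Longrightarrow> S u (x \<^bold>\<subseteq> y) n \<rho> \<longleftrightarrow> elts (\<rho> x) \<subseteq> elts (\<rho> y)"
  unfolding subset_def by (simp add: S0 subset_eq)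

lemma S_is_upair: "p < n \<Longrightarrow> x < n \<Longrightarrow> y < n \<Longrightarrow> S u (is_upair p x y) n \<rho> \<longleftrightarrow> \<rho> p = upair (\<rho> x) (\<rho> y)"
  unfolding is_upair_def by (simp add: S0 upair_eq set_eq_iff)

lemma S_is_pair: "p < n \<Longrightarrow> x < n \<Longrightarrow> y < n \<Longrightarrow> S u (is_pair p x y) n \<rho> \<longleftrightarrow> \<rho> p = pair (\<rho> x) (\<rho> y)"
  unfolding is_pair_def pair_def by (simp add: S0 S_is_upair)

lemma S_is_power: "y < n \<Longrightarrow> x < n \<Longrightarrow> S u (is_power y x) n \<rho> \<longleftrightarrow> \<rho> y = vpow (\<rho> x)"
  unfolding is_power_def by (simp add: S0 S_subset set_eq_iff elts_inject[symmetric] del: elts_inject)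

lemma S_is_diff: "z < n \<Longrightarrow> x < n \<Longrightarrow> y < n \<Longrightarrow>
    S u (is_diff z x y) n \<rho> \<longleftrightarrow> elts (\<rho> z) = elts (\<rho> x) - elts (\<rho> y)"
  unfolding is_diff_def by (simp add: S0 set_eq_iff)

lemma S_maps: "f < n \<Longrightarrow> x < n \<Longrightarrow> y < n \<Longrightarrow> S u (maps f x y) n \<rho> \<longleftrightarrow> pair (\<rho> x) (\<rho> y) \<in> elts (\<rho> f)"
  unfolding maps_def by (simp add: S0 S_is_pair)

lemma S_fun_on: "f < n \<Longrightarrow> a < n \<Longrightarrow> S u (fun_on f a) n \<rho> \<longleftrightarrow> isfun (\<rho> f) (\<rho> a)"
  unfolding fun_on_def isfun_def by (simp add: S0 S_is_pair S_maps) (metis (no_types, lifting))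

lemma isfun_mem: "isfun f a \<Longrightarrow> pair x y \<in> elts f \<longleftrightarrow> x \<in> elts a \<and> y = app f x"
  by (auto simp: isfun_elts)

lemma S_fun_to: "f < n \<Longrightarrow> a < n \<Longrightarrow> b < n \<Longrightarrow>
    S u (fun_to f a b) n \<rho> \<longleftrightarrow> isfun (\<rho> f) (\<rho> a) \<and> app (\<rho> f) ` elts (\<rho> a) \<subseteq> elts (\<rho> b)"
  unfolding fun_to_def by (auto simp: S0 S_fun_on S_maps isfun_mem)

lemma S_injection: "f < n \<Longrightarrow> a < n \<Longrightarrow> b < n \<Longrightarrow> S u (injection f a b) n \<rho> \<longleftrightarrow>
    isfun (\<rho> f) (\<rho> a) \<and> app (\<rho> f) ` elts (\<rho> a) \<subseteq> elts (\<rho> b) \<and> inj_on (app (\<rho> f)) (elts (\<rho> a))"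
  unfolding injection_def by (auto simp: S0 S_fun_to S_maps isfun_mem inj_on_def)

lemma S_bijection: "f < n \<Longrightarrow> a < n \<Longrightarrow> b < n \<Longrightarrow> S u (bijection f a b) n \<rho> \<longleftrightarrow>
    isfun (\<rho> f) (\<rho> a) \<and> bij_betw (app (\<rho> f)) (elts (\<rho> a)) (elts (\<rho> b))"
  unfolding bijection_def bij_betw_def by (simp add: S0 S_injection S_maps isfun_mem cong: conj_cong) blast

lemma sat_choice: "sat E (=) choice e \<longleftrightarrow>
    (\<forall>x. (\<forall>u\<in>elts x. elts u \<noteq> {}) \<longrightarrow> (\<exists>f. isfun f x \<and> (\<forall>u\<in>elts x. app f u \<in> elts u)))"
proof -
  have "sat E (=) choice e \<longleftrightarrow>
    (\<forall>x. (\<forall>u\<in>elts x. elts u \<noteq> {}) \<longrightarrow> (\<exists>f. isfun f x \<and> (\<forall>u\<in>elts x. \<exists>v\<in>elts u. pair u v \<in> elts f)))"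
    unfolding choice_def sat_sentence[where \<rho> = e] by (simp add: S0 S_fun_on S_maps S_is_empty)
  then show ?thesis by (simp add: isfun_mem cong: conj_cong)
qed

end

section \<open>Models of ZFC are the instances of the locales\<close>

lemma zf_if_sat:
  assumes sat: "\<And>p. p \<in> ZFC \<Longrightarrow> sat E (=) p e"
  shows "zf E"
proof -
  have "extensionality \<in> ZFC" "foundation \<in> ZFC" "pairing \<in> ZFC" "union \<in> ZFC" "power_set \<in> ZFC"
    "infinity \<in> ZFC"
    by (simp_all add: ZFC_def)
  note ax = this[THEN sat, unfolded sat_extensionality sat_foundation sat_pairing sat_union sat_power_set
      sat_infinity]
  show ?thesis
  proof unfold_locales
    show "x = y" if "\<And>u. E u x \<longleftrightarrow> E u y" for x y using ax(1) that by blast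
    show "\<exists>y. E y x \<and> (\<forall>z. E z x \<longrightarrow> \<not> E z y)" if "E u x" for u x using ax(2) that by blast
    show "\<exists>p. \<forall>u. E u p \<longleftrightarrow> u = x \<or> u = y" for x y using ax(3) by blast
    show "\<exists>y. \<forall>u. E u y \<longleftrightarrow> (\<exists>z. E z x \<and> E u z)" for x using ax(4) by blast
    show "\<exists>y. \<forall>u. E u y \<longleftrightarrow> (\<forall>v. E v u \<longrightarrow> E v x)" for x using ax(5) by blast
    show "\<exists>s. (\<exists>x. E x s \<and> (\<forall>u. \<not> E u x)) \<and>
      (\<forall>x. E x s \<longrightarrow> (\<exists>y. E y s \<and> (\<forall>u. E u y \<longleftrightarrow> E u x \<or> u = x)))" using ax(6) by blast
  next
    fix P x assume "mem.D E (\<lambda>e. P (e 0))"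
    then obtain p r c where P: "\<And>e. P (e (0::nat)) = sat E (=) p (\<lambda>i. case r i of None \<Rightarrow> c i | Some j \<Rightarrow> e j)"
      unfolding mem.D_def by blast
    obtain m where m: "below m p" using below_exists by blast
    \<comment> \<open>Every variable that reads the environment becomes index 0, as \<open>P\<close>
      depends only on slot 0; the parameters move to the indices from 1 on. Finitely many of them
      occur in \<open>p\<close>, as required by the schema.\<close>
    define f where "f i = (if r i = None then Suc i else 0)" for i
    have b: "below (m + 1) (ren f p)" by (rule below_ren[OF m]) (simp add: f_def)
    have "P v = sat E (=) (ren f p) (case_nat v c)" for v
      unfolding sat_ren P[of "\<lambda>_. v"]
      by (rule arg_cong[of _ _ "sat E (=) p"]) (auto simp: f_def fun_eq_iff split: option.split)
    moreover have "separation m (ren f p) \<in> ZFC" unfolding ZFC_def using b by blast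
    from sat[OF this] have "\<exists>y. \<forall>v. E v y \<longleftrightarrow> E v x \<and> sat E (=) (ren f p) (case_nat v c)"
      unfolding sat_separation[OF b] by blast
    ultimately show "\<exists>y. \<forall>u. E u y \<longleftrightarrow> E u x \<and> P u" by simp
  next
    fix R x assume "mem.D E (\<lambda>e. R (e 0) (e 1))" and fn: "\<And>u v w. R u v \<Longrightarrow> R u w \<Longrightarrow> v = w"
    then obtain p r c where R: "\<And>e. R (e (0::nat)) (e (1::nat)) = sat E (=) p (\<lambda>i. case r i of None \<Rightarrow> c i | Some j \<Rightarrow> e j)"
      unfolding mem.D_def by blast
    obtain m where m: "below m p" using below_exists by blast
    define f where "f i = (case r i of None \<Rightarrow> Suc (Suc i) | Some j \<Rightarrow> if j = 0 then 0 else 1)" for i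
    have b: "below (m + 2) (ren f p)" by (rule below_ren[OF m]) (simp add: f_def split: option.split)
    have R': "R v w = sat E (=) (ren f p) (case_nat v (case_nat w c))" for v w
      unfolding sat_ren using R[of "\<lambda>i. if i = 0 then v else w"]
      by (simp add: if_distrib f_def cong: option.case_cong if_cong)
        (rule arg_cong[of _ _ "sat E (=) p"], auto simp: fun_eq_iff split: option.split)
    have "replacement m (ren f p) \<in> ZFC" unfolding ZFC_def using b by blast
    from sat[OF this] have "\<exists>y. \<forall>v. E v y \<longleftrightarrow> (\<exists>u. E u x \<and> sat E (=) (ren f p) (case_nat u (case_nat v c)))"
      unfolding sat_replacement[OF b] using fn R' by blast
    then show "\<exists>y. \<forall>v. E v y \<longleftrightarrow> (\<exists>u. E u x \<and> R u v)" by (simp add: R')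
  qed
qed

lemma zfc_if_sat:
  assumes sat: "\<And>p. p \<in> ZFC \<Longrightarrow> sat E (=) p e"
  shows "zfc E"
proof -
  interpret zf E using sat by (rule zf_if_sat)
  have "choice \<in> ZFC" by (simp add: ZFC_def)
  then show ?thesis
    using sat sat_choice by (intro zfc.intro zf_axioms zfc_axioms.intro) blast
qed

lemma (in zfc) sat_ZFC:
  assumes "p \<in> ZFC"
  shows "sat E (=) p e"
proof -
  have D_case: "D (\<lambda>e. sat E (=) p (case_nat (e 0) \<sigma>))" for p \<sigma>
    by (rule D_satI[of _ p "case_nat undefined \<sigma>" "case_nat (Some 0) (\<lambda>_. None)"])
      (rule arg_cong[of _ _ "sat E (=) p"], auto simp: fun_eq_iff split: nat.split)
  have D_case2: "D (\<lambda>e. sat E (=) p (case_nat (e 0) (case_nat (e 1) \<sigma>)))" for p \<sigma>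
    by (rule D_satI[of _ p "case_nat undefined (case_nat undefined \<sigma>)" "case_nat (Some 0) (case_nat (Some 1) (\<lambda>_. None))"])
      (rule arg_cong[of _ _ "sat E (=) p"], auto simp: fun_eq_iff split: nat.split)
  consider "p \<in> {extensionality, foundation, pairing, union, power_set, infinity}" | "p = choice"
    | k q where "p = separation k q" "below (k + 1) q" | k q where "p = replacement k q" "below (k + 2) q"
    using assms unfolding ZFC_def by blast
  then show ?thesis
  proof cases
    case 1
    have "sat E (=) extensionality e" unfolding sat_extensionality using ext by blast
    moreover have "sat E (=) foundation e" unfolding sat_foundation using foundation by blast
    moreover have "sat E (=) pairing e" unfolding sat_pairing using pairing by blast
    moreover have "sat E (=) union e" unfolding sat_union using union by blast
    moreover have "sat E (=) power_set e" unfolding sat_power_set using power by blast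
    moreover have "sat E (=) infinity e" unfolding sat_infinity by (rule infinity)
    ultimately show ?thesis using 1 by auto
  next
    case 2
    then show ?thesis using choice by (simp add: sat_choice)
  next
    case (3 k q)
    then show ?thesis using sep[OF D_case] by (simp add: sat_separation)
  next
    case (4 k q)
    then show ?thesis unfolding 4(1) sat_replacement[OF 4(2)] using repl[OF D_case2] by blast
  qed
qed

section \<open>Ordinals, cardinals and stationary sets evaluated in a model\<close>

context zfc
begin

lemma eqpoll_isfun: "eqpoll a b \<Longrightarrow> \<exists>f. isfun f a \<and> bij_betw (app f) (elts a) (elts b)"
proof -
  assume "eqpoll a b"
  then obtain f where f: "bij_betw (app f) (elts a) (elts b)" unfolding eqpoll_def by blast
  have T: "T (\<lambda>e. app f (e 0))" by (intro D_intros)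
  have "bij_betw (app (lam a (app f))) (elts a) (elts b)"
    using f app_lam[OF T] by (simp cong: bij_betw_cong)
  then show ?thesis using isfun_lam[OF T] by blast
qed

text \<open>Transitivity of membership as an order on a transitive set makes the elements of the set
  transitive. Conversely, least elements of subsets come from \<open>Ord_least\<close>.\<close>

lemma S_ordinal: "x < n \<Longrightarrow> S u (ordinal x) n \<rho> \<longleftrightarrow> Ord (\<rho> x)"
proof -
  assume "x < n"
  then have *: "S u (ordinal x) n \<rho> \<longleftrightarrow> transitive (\<rho> x) \<and> (\<forall>a\<in>elts (\<rho> x). a \<notin> elts a) \<and>
      (\<forall>a\<in>elts (\<rho> x). \<forall>b\<in>elts (\<rho> x). \<forall>c\<in>elts (\<rho> x). a \<in> elts b \<and> b \<in> elts c \<longrightarrow> a \<in> elts c) \<and>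
      (\<forall>a\<in>elts (\<rho> x). \<forall>b\<in>elts (\<rho> x). a \<in> elts b \<or> a = b \<or> b \<in> elts a) \<and>
      (\<forall>s. elts s \<subseteq> elts (\<rho> x) \<and> s \<noteq> vempty \<longrightarrow> (\<exists>a\<in>elts s. \<forall>b\<in>elts s. a = b \<or> a \<in> elts b))"
    unfolding ordinal_def is_transitive_def mem_wellorders_def
    by (simp add: S0 S_subset S_is_empty transitive_def)
  show ?thesis
  proof
    assume "S u (ordinal x) n \<rho>"
    note L = this[unfolded *]
    have tr: "elts y \<subseteq> elts (\<rho> x)" if "y \<in> elts (\<rho> x)" for y
      using L[THEN conjunct1] that unfolding transitive_def by blast
    have "elts z \<subseteq> elts y" if "y \<in> elts (\<rho> x)" "z \<in> elts y" for y z
    proof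
      fix w assume w: "w \<in> elts z"
      have z: "z \<in> elts (\<rho> x)" using tr that by blast
      then have "w \<in> elts (\<rho> x)" using tr w by blast
      then show "w \<in> elts y" using L[THEN conjunct2, THEN conjunct2, THEN conjunct1] that z w by blast
    qed
    then show "Ord (\<rho> x)" using tr unfolding Ord_def transitive_def by simp
  next
    assume O: "Ord (\<rho> x)"
    have "\<exists>a\<in>elts s. \<forall>b\<in>elts s. a = b \<or> a \<in> elts b" if s: "elts s \<subseteq> elts (\<rho> x)" "s \<noteq> vempty" for s
    proof -
      obtain z where "z \<in> elts s" using s(2) by (metis elts_eq_empty ex_in_conv)
      moreover have "Ord z" using Ord_mem[OF O] s(1) \<open>z \<in> elts s\<close> by blast
      moreover have "D (\<lambda>e. e 0 \<in> elts s)" by (intro D_intros)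
      ultimately obtain a where a: "Ord a" "a \<in> elts s" "\<And>b. b \<in> elts a \<Longrightarrow> b \<notin> elts s"
        using Ord_least[of "\<lambda>a. a \<in> elts s" z] by metis
      then have "\<forall>b\<in>elts s. a = b \<or> a \<in> elts b" using Ord_linear[OF a(1)] Ord_mem[OF O] s(1) by blast
      then show ?thesis using a(2) by blast
    qed
    moreover have "transitive (\<rho> x)" using O unfolding Ord_def by blast
    moreover have "a \<in> elts b \<or> a = b \<or> b \<in> elts a" if "a \<in> elts (\<rho> x)" "b \<in> elts (\<rho> x)" for a b
      using Ord_linear Ord_mem[OF O] that by blast
    moreover have "a \<in> elts c" if "c \<in> elts (\<rho> x)" "a \<in> elts b" "b \<in> elts c" for a b c
      using Ord_trans2[OF Ord_mem[OF O that(1)] that(2,3)] .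
    ultimately show "S u (ordinal x) n \<rho>" unfolding * using not_self_elts by blast
  qed
qed

lemma S_limit_ordinal: "x < n \<Longrightarrow> S u (limit_ordinal x) n \<rho> \<longleftrightarrow> limit (\<rho> x)"
  unfolding limit_ordinal_def limit_def by (simp add: S0 S_ordinal S_is_empty)

lemma limit_omega: "limit omega"
  unfolding limit_def using zero_omega succ_omega by (metis Ord_omega elts_vempty elts_vsucc empty_iff insertI1)

lemma not_limit_natural: "n \<in> elts omega \<Longrightarrow> \<not> limit n"
proof -
  assume "n \<in> elts omega"
  then consider "n = vempty" | m where "n = vsucc m" by (auto elim: omega_cases)
  then show ?thesis
  proof cases
    case (2 m)
    have "\<not> (\<exists>z\<in>elts (vsucc m). m \<in> elts z)" using not_cycle2[of _ m] not_self_elts by auto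
    then show ?thesis unfolding limit_def 2 by auto
  qed (simp add: limit_def)
qed

lemma S_is_omega: "x < n \<Longrightarrow> S u (is_omega x) n \<rho> \<longleftrightarrow> \<rho> x = omega"
proof -
  assume "x < n"
  then have *: "S u (is_omega x) n \<rho> \<longleftrightarrow> limit (\<rho> x) \<and> (\<forall>y\<in>elts (\<rho> x). \<not> limit y)"
    unfolding is_omega_def by (simp add: S0 S_limit_ordinal)
  have "\<rho> x = omega" if "limit (\<rho> x)" "\<forall>y\<in>elts (\<rho> x). \<not> limit y"
  proof -
    have "Ord (\<rho> x)" using that(1) unfolding limit_def by blast
    then show ?thesis using Ord_linear[OF _ Ord_omega] that not_limit_natural limit_omega by blast
  qed
  then show ?thesis unfolding * using limit_omega not_limit_natural by metis
qed

definition cardinal_like where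
  "cardinal_like x \<longleftrightarrow> Ord x \<and> (\<forall>y\<in>elts x. \<not> eqpoll y x)"

lemma S_cardinal: "x < n \<Longrightarrow> S u (cardinal x) n \<rho> \<longleftrightarrow> cardinal_like (\<rho> x)"
proof -
  have "(\<exists>f. isfun f a \<and> bij_betw (app f) (elts a) (elts b)) \<longleftrightarrow> eqpoll a b" for a b
    using eqpoll_isfun unfolding eqpoll_def by blast
  then show "x < n \<Longrightarrow> ?thesis"
    unfolding cardinal_def cardinal_like_def by (simp add: S0 S_ordinal S_bijection)
qed

lemma cardinal_hart: "cardinal_like (hart k)"
  unfolding cardinal_like_def
  using hart lepoll_trans[OF eqpoll_lepoll[OF eqpoll_sym]] by blast

text \<open>An ordinal strictly between \<open>\<rho> x\<close> and its Hartogs number has the size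
  of \<open>\<rho> x\<close>, hence is no cardinal; linearity of the ordinals leaves only the
  Hartogs number.\<close>

lemma S_is_cardinal_succ:
  assumes "y < n" "x < n" and k: "Ord (\<rho> x)"
  shows "S u (is_cardinal_succ y x) n \<rho> \<longleftrightarrow> \<rho> y = hart (\<rho> x)"
proof -
  have *: "S u (is_cardinal_succ y x) n \<rho> \<longleftrightarrow> cardinal_like (\<rho> y) \<and> \<rho> x \<in> elts (\<rho> y) \<and>
      (\<forall>z\<in>elts (\<rho> y). \<rho> x \<in> elts z \<longrightarrow> \<not> cardinal_like z)"
    using assms(1,2) unfolding is_cardinal_succ_def by (simp add: S0 S_cardinal)
  have no: "\<not> cardinal_like z" if z: "z \<in> elts (hart (\<rho> x))" "\<rho> x \<in> elts z" for z
  proof -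
    have "Ord z" using Ord_mem[OF hart(1) z(1)] .
    then have "lepoll (\<rho> x) z" by (intro subset_lepoll Ord_trans[OF _ z(2)])
    then have "eqpoll (\<rho> x) z" using hart(3)[OF z(1)] by (rule Schroeder_Bernstein)
    then show ?thesis unfolding cardinal_like_def using z(2) by blast
  qed
  have "\<rho> y = hart (\<rho> x)" if y: "cardinal_like (\<rho> y)" "\<rho> x \<in> elts (\<rho> y)"
    "\<forall>z\<in>elts (\<rho> y). \<rho> x \<in> elts z \<longrightarrow> \<not> cardinal_like z"
  proof -
    have "Ord (\<rho> y)" using y(1) unfolding cardinal_like_def by blast
    then show ?thesis
      using Ord_linear[OF _ hart(1), of "\<rho> y" "\<rho> x"] y no cardinal_hart self_mem_hart[OF k] by blast
  qed
  moreover have "cardinal_like (\<rho> y) \<and> \<rho> x \<in> elts (\<rho> y) \<and>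
      (\<forall>z\<in>elts (\<rho> y). \<rho> x \<in> elts z \<longrightarrow> \<not> cardinal_like z)" if "\<rho> y = hart (\<rho> x)"
    using cardinal_hart self_mem_hart[OF k] no by (simp add: that)
  ultimately show ?thesis unfolding * by blast
qed

lemma S_is_omega1: "x < n \<Longrightarrow> S u (is_omega1 x) n \<rho> \<longleftrightarrow> \<rho> x = w1"
proof -
  assume x: "x < n"
  have "S u (is_omega1 x) n \<rho> \<longleftrightarrow> (\<exists>a. a = omega \<and> S u (is_cardinal_succ x n) (Suc n) (\<rho>(n := a)))"
    unfolding is_omega1_def using x by (simp add: S0 S_is_omega)
  also have "\<dots> \<longleftrightarrow> \<rho> x = w1" using x by (simp add: S_is_cardinal_succ w1_def)
  finally show ?thesis .
qed

lemma S_is_omega2: "x < n \<Longrightarrow> S u (is_omega2 x) n \<rho> \<longleftrightarrow> \<rho> x = w2"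
proof -
  assume x: "x < n"
  have "S u (is_omega2 x) n \<rho> \<longleftrightarrow> (\<exists>a. a = w1 \<and> S u (is_cardinal_succ x n) (Suc n) (\<rho>(n := a)))"
    unfolding is_omega2_def using x by (simp add: S0 S_is_omega1)
  also have "\<dots> \<longleftrightarrow> \<rho> x = w2" using x by (simp add: S_is_cardinal_succ Ord_w1 w2_def)
  finally show ?thesis .
qed

lemma S_countable_empty: "x < n \<Longrightarrow> \<rho> x = vempty \<Longrightarrow> S u (countable_set x) n \<rho>"
  unfolding countable_set_def
  using lepollE[OF subset_lepoll, of vempty omega] by (simp add: S0 S_is_omega S_injection) blast

lemma S_unbounded_in: "c < n \<Longrightarrow> k < n \<Longrightarrow> S u (unbounded_in c k) n \<rho> \<longleftrightarrow>
    (\<forall>x\<in>elts (\<rho> k). \<exists>y\<in>elts (\<rho> c). y \<in> elts (\<rho> k) \<and> x \<in> elts y)"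
  unfolding unbounded_in_def by (simp add: S0)

lemma S_club_in: "c < n \<Longrightarrow> k < n \<Longrightarrow> \<rho> k = w2 \<Longrightarrow> S u (club_in c k) n \<rho> \<longleftrightarrow> club (\<rho> c)"
  unfolding club_in_def club_def by (simp add: S0 S_subset S_unbounded_in S_limit_ordinal) blast

lemma S_stationary_in: "s < n \<Longrightarrow> k < n \<Longrightarrow> \<rho> k = w2 \<Longrightarrow> S u (stationary_in s k) n \<rho> \<longleftrightarrow> stationary (\<rho> s)"
  unfolding stationary_in_def stationary_def by (simp add: S0 S_subset S_club_in)

lemma S_cofinal_map: "f < n \<Longrightarrow> b < n \<Longrightarrow> a < n \<Longrightarrow> S u (cofinal_map f b a) n \<rho> \<longleftrightarrow>
    isfun (\<rho> f) (\<rho> b) \<and> app (\<rho> f) ` elts (\<rho> b) \<subseteq> elts (\<rho> a) \<and>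
    (\<forall>x\<in>elts (\<rho> a). \<exists>y\<in>elts (\<rho> b). x \<in> elts (app (\<rho> f) y) \<or> x = app (\<rho> f) y)"
  unfolding cofinal_map_def ord_le_def by (simp add: S0 S_fun_to S_maps isfun_mem cong: conj_cong)

lemma S_is_cofinality:
  assumes "c < n" "a < n" "\<rho> c = w1" and a: "S21 (\<rho> a)"
  shows "S u (is_cofinality c a) n \<rho>"
proof -
  have *: "S u (is_cofinality c a) n \<rho> \<longleftrightarrow> (\<exists>f. isfun f w1 \<and> app f ` elts w1 \<subseteq> elts (\<rho> a) \<and>
        (\<forall>x\<in>elts (\<rho> a). \<exists>y\<in>elts w1. x \<in> elts (app f y) \<or> x = app f y)) \<and>
      (\<forall>b\<in>elts w1. \<nexists>f. isfun f b \<and> app f ` elts b \<subseteq> elts (\<rho> a) \<and>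
        (\<forall>x\<in>elts (\<rho> a). \<exists>y\<in>elts b. x \<in> elts (app f y) \<or> x = app f y))"
    using assms unfolding is_cofinality_def by (simp add: S0 S_cofinal_map S_ordinal Ord_w1)
  from a have cof: "\<exists>f. isfun f w1 \<and> app f ` elts w1 \<subseteq> elts (\<rho> a) \<and>
      (\<forall>x\<in>elts (\<rho> a). \<exists>y\<in>elts w1. x \<in> elts (app f y))"
    unfolding S21_def by simp
  show ?thesis
    unfolding *
  proof (intro conjI ballI notI)
    show "\<exists>f. isfun f w1 \<and> app f ` elts w1 \<subseteq> elts (\<rho> a) \<and>
        (\<forall>x\<in>elts (\<rho> a). \<exists>y\<in>elts w1. x \<in> elts (app f y) \<or> x = app f y)"
      using cof by meson
    fix b assume "b \<in> elts w1" "\<exists>f. isfun f b \<and> app f ` elts b \<subseteq> elts (\<rho> a) \<and>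
        (\<forall>x\<in>elts (\<rho> a). \<exists>y\<in>elts b. x \<in> elts (app f y) \<or> x = app f y)"
    then obtain f where b: "b \<in> elts w1" "app f ` elts b \<subseteq> elts (\<rho> a)"
      "\<forall>x\<in>elts (\<rho> a). \<exists>y\<in>elts b. x \<in> elts (app f y) \<or> x = app f y" by blast
    have T: "T (\<lambda>e. app f (e 0))" by (intro D_intros)
    \<comment> \<open>The range of a map from a countable ordinal is countable, hence bounded by
      some \<delta> below \<open>\<rho> a\<close>; no value reaches \<delta>, so the map is not
      cofinal.\<close>
    let ?x = "mk (app f ` elts b)"
    have x: "elts ?x = app f ` elts b" by (intro elts_mk isset_image T) auto
    have "lepoll ?x b" by (rule lepoll_image[OF T]) (simp add: x)
    then have "lepoll ?x omega" using w1_countable[OF b(1)] by (rule lepoll_trans)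
    moreover have "elts ?x \<subseteq> elts (\<rho> a)" using b(2) x by simp
    ultimately obtain \<delta> where \<delta>: "\<delta> \<in> elts (\<rho> a)" "elts ?x \<subseteq> elts \<delta>" using S21_bound[OF a, of ?x] by blast
    have "\<delta> \<notin> elts (app f y) \<and> \<delta> \<noteq> app f y" if "y \<in> elts b" for y
    proof -
      have "app f y \<in> elts \<delta>" using \<delta>(2) x that by blast
      then show ?thesis using not_cycle2 not_self_elts by metis
    qed
    then show False using b(3) \<delta>(1) by blast
  qed
qed

lemma S_g_separated:
  assumes "g < n" "x < n" "y < n" and g: "isfun (\<rho> g) w1" and "\<rho> x \<in> elts w1" "\<rho> y \<in> elts w1"
    and sep: "gsep (\<rho> g) (\<rho> x) (\<rho> y)"
  shows "S u (g_separated g x y) n \<rho>"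
proof -
  have "\<exists>m v M. ((m = \<rho> x \<or> m = \<rho> y) \<and> (m \<in> elts (\<rho> x) \<or> m = \<rho> x) \<and> (m \<in> elts (\<rho> y) \<or> m = \<rho> y)) \<and>
      pair m v \<in> elts (\<rho> g) \<and>
      ((M = \<rho> x \<or> M = \<rho> y) \<and> (\<rho> x \<in> elts M \<or> \<rho> x = M) \<and> (\<rho> y \<in> elts M \<or> \<rho> y = M)) \<and> v \<in> elts M"
    using sep unfolding gsep_def
  proof
    assume "\<rho> x \<in> elts (\<rho> y) \<and> app (\<rho> g) (\<rho> x) \<in> elts (\<rho> y)"
    then show ?thesis
      by (intro exI[of _ "\<rho> x"] exI[of _ "app (\<rho> g) (\<rho> x)"] exI[of _ "\<rho> y"])
        (simp add: isfun_mem[OF g] assms(5))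
  next
    assume "\<rho> y \<in> elts (\<rho> x) \<and> app (\<rho> g) (\<rho> y) \<in> elts (\<rho> x)"
    then show ?thesis
      by (intro exI[of _ "\<rho> y"] exI[of _ "app (\<rho> g) (\<rho> y)"] exI[of _ "\<rho> x"])
        (simp add: isfun_mem[OF g] assms(6))
  qed
  then show ?thesis
    using assms(1-3) unfolding g_separated_def is_min_def is_max_def ord_le_def
    by (simp add: S0 S_maps del: ex_simps)
qed

lemma S_closed_under: "b < n \<Longrightarrow> h < n \<Longrightarrow> S u (closed_under b h) n \<rho> \<longleftrightarrow>
    (\<forall>a\<in>elts (\<rho> b). \<exists>v. pair a v \<in> elts (\<rho> h) \<and> v \<in> elts (\<rho> b))"
  unfolding closed_under_def by (simp add: S0 S_maps)

lemma S_conditions: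
  assumes lt: "g < n" "h < n" "b < n" "q < n" "d < n"
    and g: "isfun (\<rho> g) w1" and b: "S21 (\<rho> b)" and h: "\<rho> h = lam w2 vsucc"
    and q: "isfun (\<rho> q) (\<rho> b)" "bij_betw (app (\<rho> q)) (elts (\<rho> b)) (elts w1)" "good (\<rho> g) (\<rho> b) (\<rho> q)"
  shows "S u (cond1 g h b q d) n \<rho>" "S u (cond2 g h b q d) n \<rho>"
proof -
  have T: "T (\<lambda>e. vsucc (e 0))" by (intro D_intros)
  have sub: "a \<in> elts w2" if "a \<in> elts (\<rho> b)" for a
    using Ord_trans2[OF Ord_w2 that] b unfolding S21_def by blast
  have hm: "pair a v \<in> elts (\<rho> h) \<longleftrightarrow> v = vsucc a" if "a \<in> elts (\<rho> b)" for a v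
    using sub[OF that] by (auto simp: h elts_lam[OF T])
  have qm: "pair a v \<in> elts (\<rho> q) \<longleftrightarrow> v = app (\<rho> q) a" "app (\<rho> q) a \<in> elts w1" if "a \<in> elts (\<rho> b)" for a v
    using isfun_mem[OF q(1)] that q(2) unfolding bij_betw_def by blast+
  note succ = S21_succ[OF b]
  show "S u (cond1 g h b q d) n \<rho>"
    unfolding cond1_def
    by (simp add: S0 S_maps lt hm qm succ cong: conj_cong, intro ballI impI, rule S_g_separated)
      (use lt g qm succ q(3) in \<open>simp_all add: good_def\<close>)
  show "S u (cond2 g h b q d) n \<rho>"
    unfolding cond2_def
    by (simp add: S0 S_maps lt hm qm succ cong: conj_cong, intro ballI impI, rule S_g_separated)
      (use lt g qm succ q(3) in \<open>simp_all add: good_def\<close>)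
qed

section \<open>CH and (B) hold in the model\<close>

lemma sat_CH:
  assumes "gch omega"
  shows "sat E (=) CH u"
proof -
  have "lepoll w1 (vpow omega)" using uncountable_w1 cantor by blast
  then have "eqpoll (vpow omega) w1" using assms unfolding gch_def w1_def by (intro Schroeder_Bernstein)
  then obtain f where "isfun f (vpow omega)" "bij_betw (app f) (elts (vpow omega)) (elts w1)"
    using eqpoll_isfun by blast
  then have "\<exists>f. isfun f (vpow omega) \<and> bij_betw (app f) (elts (vpow omega)) (elts w1)" by blast
  then show ?thesis
    unfolding CH_def sat_sentence[where \<rho> = u]
    by (simp add: S0 S_is_omega S_is_omega1 S_is_power S_bijection)
qed

lemma sat_principle_B:
  assumes "gch w1"
  shows "sat E (=) principle_B u"
proof -
  obtain \<pi> where \<pi>: "isfun \<pi> (mk (elts w2 - elts w1))"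
    "\<And>b. b \<in> elts w2 - elts w1 \<Longrightarrow> isfun (app \<pi> b) b \<and> bij_betw (app (app \<pi> b)) (elts b) (elts w1)"
    "\<And>g. isfun g w1 \<Longrightarrow> app g ` elts w1 \<subseteq> elts w1 \<Longrightarrow> \<exists>I. stationary I \<and> (\<forall>b\<in>elts I. S21 b \<and> good g b (app \<pi> b))"
    using principle_B[OF assms] by blast
  let ?X = "mk (elts w2 - elts w1)" and ?h = "lam w2 vsucc"
  have X: "elts ?X = elts w2 - elts w1" by (intro elts_mk isset_sub[OF isset_elts[of w2]] D_intros) blast
  have T: "T (\<lambda>e. vsucc (e 0))" by (intro D_intros)
  have h: "isfun ?h w2" "app ?h ` elts w2 \<subseteq> elts w2" "inj_on (app ?h) (elts w2)"
    using isfun_lam[OF T] w2_succ by (auto simp: app_lam[OF T] inj_on_def)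
  have h_closed: "\<exists>v. pair a v \<in> elts ?h \<and> v \<in> elts b" if "S21 b" "a \<in> elts b" for a b
  proof -
    have "a \<in> elts w2" using Ord_trans2[OF Ord_w2 that(2)] that(1) unfolding S21_def by blast
    then have "pair a (vsucc a) \<in> elts ?h" by (simp add: elts_lam[OF T])
    then show ?thesis using S21_succ[OF that] by blast
  qed
  have \<pi>m: "pair b (app \<pi> b) \<in> elts \<pi>" if "b \<in> elts ?X" for b using isfun_mem[OF \<pi>(1)] that by blast
  have S21_\<pi>: "pair b (app \<pi> b) \<in> elts \<pi>" "isfun (app \<pi> b) b" "bij_betw (app (app \<pi> b)) (elts b) (elts w1)"
    if "S21 b" for b
  proof -
    have "b \<in> elts ?X" using that X S21_not_w1 unfolding S21_def by blast
    then show "pair b (app \<pi> b) \<in> elts \<pi>" "isfun (app \<pi> b) b" "bij_betw (app (app \<pi> b)) (elts b) (elts w1)"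
      using \<pi>m \<pi>(2) X by blast+
  qed
  show ?thesis
    unfolding principle_B_def sat_sentence[where \<rho> = u]
    apply (simp add: S0 S_is_omega1 S_is_omega2 S_is_diff S_fun_on S_maps S_bijection S_fun_to S_injection
        S_stationary_in S_closed_under S_subset)
    apply (rule exI[of _ ?X], rule conjI[OF X], rule exI[of _ \<pi>], intro conjI ballI allI impI \<pi>(1))
    subgoal for b using \<pi>m[of b] \<pi>(2)[of b] X by blast
    subgoal for g
      apply (elim conjE, frule (1) \<pi>(3), elim exE conjE)
      subgoal for I
        \<comment> \<open>The successor operation serves every \<open>g\<close>; only the stationary
          set \<open>I\<close> depends on \<open>g\<close>.\<close>
        apply (rule exI[of _ ?h], intro conjI h, rule exI[of _ I], intro conjI ballI)
           apply assumption
          apply (rule S_is_cofinality; simp)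
         apply (rule h_closed; simp)
        subgoal for b
          apply (rule exI[of _ "app \<pi> b"], rule conjI, simp add: S21_\<pi>)
          apply (rule exI[of _ vempty], intro conjI S_countable_empty S_conditions)
          apply (simp_all add: S21_\<pi>)
          done
        done
      done
    done
qed

end

theorem mainTheorem1:
  shows "consistent ZFC \<longrightarrow> consistent (ZFC \<union> {CH, principle_B})"
proof
  assume con: "consistent ZFC"
  obtain E :: "nat \<Rightarrow> nat \<Rightarrow> bool" and e where "\<And>p. p \<in> ZFC \<Longrightarrow> sat E (=) p e"
  proof (rule model_existence[OF con])
    show "\<exists>x. \<forall>y\<in>F. \<not> Q x y" if "equivp Q" "\<And>x x' y y'. Q x x' \<Longrightarrow> Q y y' \<Longrightarrow> E x y \<Longrightarrow> E x' y'"
      "\<And>p. p \<in> ZFC \<Longrightarrow> sat E Q p e" "finite F" for E Q e F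
      using that by (rule ZFC_infinite)
  qed blast
  then have "zfc E" by (rule zfc_if_sat)
  then obtain E1 :: "nat \<Rightarrow> nat \<Rightarrow> bool" where E1: "zfc E1" "zfc.gch E1 (zf.omega E1)"
    using gch_omega_extension by blast
  then obtain E2 :: "nat \<Rightarrow> nat \<Rightarrow> bool"
    where E2: "zfc E2" "zfc.gch E2 (zf.omega E2)" "zfc.gch E2 (zfc.hart E2 (zf.omega E2))"
    using gch_omega1_extension by blast
  interpret zfc E2 by (rule E2(1))
  \<comment> \<open>\<open>undefined\<close> is an arbitrary assignment; all formulas concerned hold
    under every assignment.\<close>
  have "sat E2 (=) q undefined" if "q \<in> ZFC \<union> {CH, principle_B}" for q
    using that sat_ZFC sat_CH[OF E2(2)] sat_principle_B[unfolded w1_def, OF E2(3)] by blast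
  then show "consistent (ZFC \<union> {CH, principle_B})" by (rule consistent_if_sat)
qed

end
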